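(* Let $\Omega$ be a bounded domain in $\mathbb{C}^n$. Then the Bergman metric of $\Omega$ cannot have positive constant holomorphic sectional curvature. On the other hand, there does exist an unbounded Reinhardt domain (in some $\mathbb{C}^m$) whose Bergman metric is well defined and has positive constant holomorphic sectional curvature.
   Context: A domain is a connected open subset; a Reinhardt domain in $\mathbb{C}^m$ is a domain invariant under all maps $(z_1,\dots,z_m)\mapsto(e^{i\theta_1}z_1,\dots,e^{i\theta_m}z_m)$ with $\theta_j\in\mathbb{R}$. For a domain $D\subset\mathbb{C}^m$, the Bergman space $A^2(D)$ is the Hilbert space of holomorphic functions on $D$ that are square integrable with respect to Lebesgue measure, and $K_D(z,z)=\sum_j|f_j(z)|^2$ for an orthonormal basis $\{f_j\}$ of $A^2(D)$. When $K_D(z,z)>0$ on $D$ and $\omega_D=\sqrt{-1}\,\partial\overline\partial\log K_D(z,z)$ is positive definite on $D$, the Bergman metric is said to be well defined and is given by $\omega_D$ (this always holds for bounded domains). Its metric tensor is $g_{\alpha\overline\beta}=\partial^2\log K_D/\partial z_\alpha\partial\overline z_\beta$, with curvature $R_{i\overline jk\overline l}=-\partial_k\partial_{\overline l}g_{i\overline j}+\sum g^{\alpha\overline\beta}\,\partial_kg_{i\overline\beta}\,\partial_{\overline l}g_{\alpha\overline j}$; the holomorphic sectional curvature in the direction of a nonzero $(1,0)$-vector $X$ is $R(X,\overline X,X,\overline X)/g(X,\overline X)^2$. The metric is not assumed complete. *)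

theory Defs
  imports "HOL-Analysis.Analysis"
begin

text \<open>
  The dimension is quantified inside the statement, so \<open>\<complex>\<^sup>n\<close> is the set of extensional functions
  \<open>{..<n} \<rightarrow>\<^sub>E UNIV\<close>, with the product topology and the product Lebesgue measure. (The type-class
  metric on \<^typ>\<open>nat \<Rightarrow> complex\<close> makes every set bounded and is not used.)
\<close>

definition Cn_top :: "nat \<Rightarrow> (nat \<Rightarrow> complex) topology" where
  "Cn_top n = product_topology (\<lambda>_. euclidean) {..<n}"

definition Cn_lborel :: "nat \<Rightarrow> (nat \<Rightarrow> complex) measure" where
  "Cn_lborel n = Pi\<^sub>M {..<n} (\<lambda>_. lborel)"

definition Cn_domain :: "nat \<Rightarrow> (nat \<Rightarrow> complex) set \<Rightarrow> bool" where
  "Cn_domain n D \<longleftrightarrow> D \<noteq> {} \<and> openin (Cn_top n) D \<and> connectedin (Cn_top n) D"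

definition Cn_bounded :: "nat \<Rightarrow> (nat \<Rightarrow> complex) set \<Rightarrow> bool" where
  "Cn_bounded n D \<longleftrightarrow> (\<exists>B. \<forall>z\<in>D. L2_set (\<lambda>i. cmod (z i)) {..<n} \<le> B)"

definition reinhardt_domain :: "nat \<Rightarrow> (nat \<Rightarrow> complex) set \<Rightarrow> bool" where
  "reinhardt_domain n D \<longleftrightarrow> Cn_domain n D \<and>
     (\<forall>z\<in>D. \<forall>\<theta> :: nat \<Rightarrow> real. (\<lambda>i\<in>{..<n}. cis (\<theta> i) * z i) \<in> D)"

text \<open>Holomorphic in several variables: continuous and holomorphic in each variable separately.\<close>

definition Cn_holomorphic_on ::
  "nat \<Rightarrow> ((nat \<Rightarrow> complex) \<Rightarrow> complex) \<Rightarrow> (nat \<Rightarrow> complex) set \<Rightarrow> bool" where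
  "Cn_holomorphic_on n f D \<longleftrightarrow>
     continuous_map (subtopology (Cn_top n) D) euclidean f \<and>
     (\<forall>z\<in>D. \<forall>i<n. (\<lambda>w. f (z(i := w))) field_differentiable at (z i))"

text \<open>
  Elements of \<open>A\<^sup>2(D)\<close> are total functions whose values outside \<open>D\<close> are irrelevant. Two functions
  that agree on \<open>D\<close> but differ elsewhere cannot both belong to an orthonormal set, since their
  inner product would have to be \<open>0\<close>.
\<close>

definition bergman_space ::
  "nat \<Rightarrow> (nat \<Rightarrow> complex) set \<Rightarrow> ((nat \<Rightarrow> complex) \<Rightarrow> complex) set" where
  "bergman_space n D =
     {f. Cn_holomorphic_on n f D \<and> set_integrable (Cn_lborel n) D (\<lambda>z. (cmod (f z))\<^sup>2)}"

definition bergman_inner ::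
  "nat \<Rightarrow> (nat \<Rightarrow> complex) set \<Rightarrow> ((nat \<Rightarrow> complex) \<Rightarrow> complex) \<Rightarrow> ((nat \<Rightarrow> complex) \<Rightarrow> complex)
    \<Rightarrow> complex" where
  "bergman_inner n D f g = set_lebesgue_integral (Cn_lborel n) D (\<lambda>z. f z * cnj (g z))"

definition bergman_orthonormal_basis ::
  "nat \<Rightarrow> (nat \<Rightarrow> complex) set \<Rightarrow> ((nat \<Rightarrow> complex) \<Rightarrow> complex) set \<Rightarrow> bool" where
  "bergman_orthonormal_basis n D B \<longleftrightarrow>
     B \<subseteq> bergman_space n D \<and>
     (\<forall>f\<in>B. \<forall>g\<in>B. bergman_inner n D f g = (if f = g then 1 else 0)) \<and>
     (\<forall>h\<in>bergman_space n D. (\<forall>f\<in>B. bergman_inner n D h f = 0) \<longrightarrow> (\<forall>z\<in>D. h z = 0))"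

text \<open>The kernel on the diagonal, \<open>K\<^sub>D(z,z)\<close>; its value does not depend on the chosen basis.\<close>

definition bergman_kernel :: "nat \<Rightarrow> (nat \<Rightarrow> complex) set \<Rightarrow> (nat \<Rightarrow> complex) \<Rightarrow> real" where
  "bergman_kernel n D z =
     (\<Sum>\<^sub>\<infinity>f\<in>(SOME B. bergman_orthonormal_basis n D B). (cmod (f z))\<^sup>2)"

text \<open>
  \<open>dir_deriv i v F z\<close> is the real derivative at \<open>z\<close> in the direction \<open>v\<close> of the \<open>i\<close>-th coordinate
  plane: \<open>v = 1\<close> gives \<open>\<partial>/\<partial>x\<^sub>i\<close> and \<open>v = \<i>\<close> gives \<open>\<partial>/\<partial>y\<^sub>i\<close>, from which the Wirtinger
  derivatives \<open>\<partial>/\<partial>z\<^sub>i\<close> and \<open>\<partial>/\<partial>z\<^sub>i-bar\<close> are formed.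
\<close>

definition dir_deriv ::
  "nat \<Rightarrow> complex \<Rightarrow> ((nat \<Rightarrow> complex) \<Rightarrow> complex) \<Rightarrow> (nat \<Rightarrow> complex) \<Rightarrow> complex" where
  "dir_deriv i v F z = vector_derivative (\<lambda>t. F (z(i := z i + of_real t * v))) (at (0::real))"

definition wirtinger ::
  "nat \<Rightarrow> ((nat \<Rightarrow> complex) \<Rightarrow> complex) \<Rightarrow> (nat \<Rightarrow> complex) \<Rightarrow> complex" where
  "wirtinger i F z = (dir_deriv i 1 F z - \<i> * dir_deriv i \<i> F z) / 2"

definition wirtinger_bar ::
  "nat \<Rightarrow> ((nat \<Rightarrow> complex) \<Rightarrow> complex) \<Rightarrow> (nat \<Rightarrow> complex) \<Rightarrow> complex" where
  "wirtinger_bar i F z = (dir_deriv i 1 F z + \<i> * dir_deriv i \<i> F z) / 2"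

text \<open>In \<open>bergman_g n D a b\<close> the second index \<open>b\<close> is the barred one.\<close>

definition bergman_g ::
  "nat \<Rightarrow> (nat \<Rightarrow> complex) set \<Rightarrow> nat \<Rightarrow> nat \<Rightarrow> (nat \<Rightarrow> complex) \<Rightarrow> complex" where
  "bergman_g n D a b =
     wirtinger a (wirtinger_bar b (\<lambda>z. complex_of_real (ln (bergman_kernel n D z))))"

definition bergman_form ::
  "nat \<Rightarrow> (nat \<Rightarrow> complex) set \<Rightarrow> (nat \<Rightarrow> complex) \<Rightarrow> (nat \<Rightarrow> complex) \<Rightarrow> complex" where
  "bergman_form n D z X = (\<Sum>i<n. \<Sum>j<n. bergman_g n D i j z * X i * cnj (X j))"

definition bergman_metric_well_defined :: "nat \<Rightarrow> (nat \<Rightarrow> complex) set \<Rightarrow> bool" where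
  "bergman_metric_well_defined n D \<longleftrightarrow>
     (\<forall>z\<in>D. bergman_kernel n D z > 0) \<and>
     (\<forall>z\<in>D. \<forall>X. (\<exists>i<n. X i \<noteq> 0) \<longrightarrow>
        bergman_form n D z X \<in> \<real> \<and> Re (bergman_form n D z X) > 0)"

text \<open>
  The entries \<open>g\<^sup>a\<^sup>b\<close> (\<open>b\<close> barred), normalised by contracting the barred indices; this is the inverse
  of the transpose of \<open>g\<close>. Only indices below \<open>n\<close> are meaningful, and there the choice is unique
  when \<open>g\<close> is invertible.
\<close>

definition bergman_g_inv ::
  "nat \<Rightarrow> (nat \<Rightarrow> complex) set \<Rightarrow> (nat \<Rightarrow> complex) \<Rightarrow> nat \<Rightarrow> nat \<Rightarrow> complex" where
  "bergman_g_inv n D z = (SOME H. \<forall>a<n. \<forall>c<n.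
     (\<Sum>b<n. H a b * bergman_g n D c b z) = (if a = c then 1 else 0))"

definition bergman_curvature ::
  "nat \<Rightarrow> (nat \<Rightarrow> complex) set \<Rightarrow> nat \<Rightarrow> nat \<Rightarrow> nat \<Rightarrow> nat \<Rightarrow> (nat \<Rightarrow> complex) \<Rightarrow> complex" where
  "bergman_curvature n D i j k l z =
     - wirtinger k (wirtinger_bar l (bergman_g n D i j)) z
     + (\<Sum>a<n. \<Sum>b<n. bergman_g_inv n D z a b *
          wirtinger k (bergman_g n D i b) z * wirtinger_bar l (bergman_g n D a j) z)"

definition holomorphic_sectional_curvature ::
  "nat \<Rightarrow> (nat \<Rightarrow> complex) set \<Rightarrow> (nat \<Rightarrow> complex) \<Rightarrow> (nat \<Rightarrow> complex) \<Rightarrow> complex" where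
  "holomorphic_sectional_curvature n D z X =
     (\<Sum>i<n. \<Sum>j<n. \<Sum>k<n. \<Sum>l<n.
        bergman_curvature n D i j k l z * X i * cnj (X j) * X k * cnj (X l))
     / (bergman_form n D z X)\<^sup>2"

definition bergman_constant_hsc :: "nat \<Rightarrow> (nat \<Rightarrow> complex) set \<Rightarrow> real \<Rightarrow> bool" where
  "bergman_constant_hsc n D c \<longleftrightarrow>
     (\<forall>z\<in>D. \<forall>X. (\<exists>i<n. X i \<noteq> 0) \<longrightarrow>
        holomorphic_sectional_curvature n D z X = complex_of_real c)"

end

theory Submission
  imports Defs "HOL-Complex_Analysis.Complex_Analysis" "Jordan_Normal_Form.Determinant"
    "HOL-Probability.Sinc_Integral"
begin

text \<open>
  Let \<open>K = \<Sum> \<bar>f\<^sub>j\<bar>\<^sup>2\<close> be the kernel for an orthonormal basis \<open>f\<^sub>j\<close> of \<open>A\<^sup>2(D)\<close>, \<open>g = \<partial>\<partial>-bar log K\<close>, and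
  suppose that the holomorphic sectional curvature is a constant \<open>c > 0\<close>. By polarization the
  curvature tensor is \<open>c/2\<close> times the standard one (\<open>curvature_of_constant_hsc\<close>); since the curvature is
  \<open>- \<partial>-bar \<Gamma>\<close> with an index lowered, \<open>\<partial>-bar \<Gamma>\<close> is a combination of entries of \<open>g\<close>, which are themselves
  \<open>\<partial>-bar\<close> of the functions \<open>p\<^sub>i = \<partial>\<^sub>i log K\<close>. Integrating twice gives a Riccati system
  \<open>\<partial>\<^sub>k p\<^sub>i = - c/2 p\<^sub>i p\<^sub>k + \<Sum> A p\<^sub>a + B\<close> with \<^emph>\<open>holomorphic\<close> \<open>A\<close>, \<open>B\<close> (\<open>riccati\<close>). In the model case it
  says that \<open>K\<close> is the power \<open>2/c\<close> of a Hermitian quadratic polynomial.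

  The contradiction comes from the sign of falling factorials of \<open>2/c\<close>. Put \<open>\<psi>\<^sub>a = p\<^sub>a - p\<^sub>a(z0)\<close>. By the
  Riccati system, differentiating \<open>K \<psi>\<^sub>0\<^sup>m\<close> in the direction \<open>0\<close> gives \<open>(1 - m c/2) K \<psi>\<^sub>0\<^sup>m\<^sup>+\<^sup>1\<close> up to
  products with fewer factors (\<open>w_T\<close>). While these factors are positive, \<open>K \<psi>\<^sub>0\<^sup>m\<close> is a positive multiple of \<open>\<partial>\<^sub>0\<^sup>m K\<close> plus derivatives
  of \<open>K\<close> of lower order, with holomorphic coefficients. At the first \<open>m\<close> for which the factor is not
  positive one obtains a differential operator \<open>L = \<partial>\<^sub>0\<^sup>k + lower order\<close>, \<open>k = m + 1\<close>, with
  \<open>L K = e K \<psi>\<^sub>0\<^sup>k\<close> and \<open>e \<le> 0\<close> (\<open>exists_operator_nonpos\<close>). Now \<open>L\<close> acts on the holomorphic factors of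
  \<open>K = \<Sum> f\<^sub>j f\<^sub>j-bar\<close> and \<open>L-bar\<close> on the other ones, so
  \<open>\<Sum> \<bar>L f\<^sub>j\<bar>\<^sup>2 = L-bar L K = e k! K g\<^sub>0\<^sub>0\<^sup>k \<le> 0\<close> at \<open>z0\<close>, where \<open>\<psi>\<^sub>0\<close> vanishes. Hence \<open>L f\<close> vanishes at
  \<open>z0\<close> for every basis element (\<open>exists_annihilating_jet\<close>), and by completeness for every \<open>f\<close> in \<open>A\<^sup>2(D)\<close>
  (\<open>jet_functional_vanishes\<close>). If \<open>D\<close> is bounded then \<open>A\<^sup>2(D)\<close> contains \<open>(z\<^sub>0 - z0\<^sub>0)\<^sup>k\<close>, at which \<open>L\<close>
  has the value \<open>k!\<close>.

  The second half escapes this argument by a domain on which no polynomial of degree two is square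
  integrable. The domain \<open>thin_reinhardt\<close> in \<open>\<complex>\<^sup>2\<close> is a neighbourhood of the cone \<open>\<bar>z\<^sub>0\<bar> = \<bar>z\<^sub>1\<bar>\<close> whose
  fibre over \<open>z\<^sub>0\<close> has area of order \<open>(1 + \<bar>z\<^sub>0\<bar>\<^sup>2)\<^sup>-\<^sup>3\<close>. Affine functions are square integrable there,
  and nothing else is: a square-integrable holomorphic \<open>f\<close> expands as \<open>\<Sum> z\<^sub>1\<^sup>m c\<^sub>m(z\<^sub>0/z\<^sub>1) / m!\<close>
  with \<open>c\<^sub>m\<close> entire, averaging over rotations shows that every monomial \<open>z\<^sub>1\<^sup>m (z\<^sub>0/z\<^sub>1)\<^sup>j\<close> that occurs is
  square integrable, and such a monomial has infinite norm if \<open>m \<ge> 2\<close> (\<open>line_coeff_derivs_zero\<close>). So \<open>K\<close> is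
  a Hermitian quadratic polynomial, and the Bergman metric is a Fubini-Study metric, of constant
  curvature \<open>2\<close> (\<open>constant_hsc_2_of_affine\<close>).
\<close>

section \<open>Polydiscs and square-summable holomorphic families\<close>

definition polydisc :: "nat \<Rightarrow> (nat \<Rightarrow> complex) \<Rightarrow> real \<Rightarrow> (nat \<Rightarrow> complex) set" where
  "polydisc n p r = PiE {..<n} (\<lambda>i. ball (p i) r)"

lemma polydisc_update:
  assumes "z \<in> polydisc n p r" "i < n" "w \<in> ball (p i) r"
  shows "z(i := w) \<in> polydisc n p r"
  using assms unfolding polydisc_def
  by (metis PiE_fun_upd insert_absorb lessThan_iff)

lemma polydisc_mono: "r \<le> s \<Longrightarrow> polydisc n p r \<subseteq> polydisc n p s"
  unfolding polydisc_def by (intro PiE_mono) auto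

lemma polydisc_center: "r > 0 \<Longrightarrow> p \<in> polydisc n q s \<Longrightarrow> p \<in> polydisc n p r"
  unfolding polydisc_def by (auto simp: PiE_iff)

lemma polydisc_half:
  assumes "z \<in> polydisc n p (r/2)" "w \<in> ball (z i) (r/2)" "i < n"
  shows "z(i := w) \<in> polydisc n p r"
proof (rule polydisc_update)
  have z: "dist (p i) (z i) < r/2"
    using assms by (auto simp: polydisc_def PiE_iff)
  have "dist (p i) w \<le> dist (p i) (z i) + dist (z i) w" by (rule dist_triangle)
  with z assms(2) show "w \<in> ball (p i) r" by auto
  have "r > 0"
    using z by (meson assms(2) dist_not_less_zero half_gt_zero_iff less_le_trans linorder_not_le mem_ball)
  then show "z \<in> polydisc n p r" using assms(1) polydisc_mono[of "r/2" r n p] by auto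
qed (use assms in auto)

lemma norm_deriv_le_of_bounded:
  assumes hol: "g holomorphic_on ball c r" and r: "r > 0"
    and M: "\<And>w. w \<in> ball c r \<Longrightarrow> cmod (g w) \<le> M"
  shows "cmod (deriv g c) \<le> 2 * M / r"
proof -
  have sub: "cball c (r/2) \<subseteq> ball c r" using r by auto
  have "cmod ((deriv ^^ 1) g c) \<le> fact 1 * M / (r/2) ^ 1"
  proof (rule Cauchy_inequality)
    show "g holomorphic_on ball c (r/2)" by (rule holomorphic_on_subset[OF hol]) (use r in auto)
    show "continuous_on (cball c (r/2)) g"
      by (rule holomorphic_on_imp_continuous_on[OF holomorphic_on_subset[OF hol sub]])
    show "cmod (g x) \<le> M" if "cmod (c - x) = r/2" for x
      using that r by (intro M) (auto simp: dist_norm)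
  qed (use r in auto)
  then show ?thesis by (simp add: field_simps)
qed

text \<open>A quantitative remainder, with a constant that depends on the bound only: it is what makes difference
  quotients converge uniformly in the other variables and in the index of a family.\<close>

lemma norm_taylor_remainder_le_of_bounded:
  assumes hol: "g holomorphic_on ball c r" and r: "r > 0"
    and M: "\<And>w. w \<in> ball c r \<Longrightarrow> cmod (g w) \<le> M" and h: "cmod h \<le> r / 4"
  shows "cmod (g (c + h) - g c - h * deriv g c) \<le> 8 * M / r\<^sup>2 * (cmod h)\<^sup>2"
proof -
  have der: "((deriv ^^ i) g has_field_derivative (deriv ^^ Suc i) g x) (at x)"
    if "x \<in> ball c r" for x i
    using holomorphic_higher_deriv[OF hol, of i] that
    by (simp add: holomorphic_derivI[OF _ open_ball])
  have B: "cmod ((deriv ^^ Suc 1) g x) \<le> 8 * M / r\<^sup>2" if x: "x \<in> cball c (r/4)" for x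
  proof -
    have sub: "cball x (r/2) \<subseteq> ball c r"
    proof
      fix y assume "y \<in> cball x (r/2)"
      with x r dist_triangle[of c y x] show "y \<in> ball c r" by auto
    qed
    have "cmod ((deriv ^^ 2) g x) \<le> fact 2 * M / (r/2) ^ 2"
    proof (rule Cauchy_inequality)
      show "g holomorphic_on ball x (r/2)"
        by (rule holomorphic_on_subset[OF hol]) (use sub in auto)
      show "continuous_on (cball x (r/2)) g"
        by (rule holomorphic_on_imp_continuous_on[OF holomorphic_on_subset[OF hol sub]])
      show "cmod (g y) \<le> M" if "cmod (x - y) = r/2" for y
        using that sub by (intro M) (auto simp: dist_norm subset_eq)
    qed (use r in auto)
    then show ?thesis by (simp add: field_simps power2_eq_square numeral_2_eq_2)
  qed
  have "cmod ((deriv ^^ 0) g (c + h) - (\<Sum>i\<le>1. (deriv ^^ i) g c * (c + h - c) ^ i / fact i))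
      \<le> 8 * M / r\<^sup>2 * cmod (c + h - c) ^ Suc 1 / fact 1"
  proof (rule field_Taylor[OF convex_cball])
    show "((deriv ^^ i) g has_field_derivative (deriv ^^ Suc i) g x) (at x within cball c (r/4))"
      if "x \<in> cball c (r/4)" for i x
      using that r by (intro has_field_derivative_at_within[OF der]) auto
  qed (use B h r in \<open>auto simp: dist_norm\<close>)
  then show ?thesis by (simp add: algebra_simps power2_eq_square)
qed

text \<open>Duality in \<open>\<ell>\<^sup>2\<close>: it turns estimates for one holomorphic function into estimates for a
  square-summable family, through its linear combinations.\<close>

lemma sum_sq_le_of_dual_bound:
  fixes x :: "'j \<Rightarrow> complex"
  assumes F: "finite F" and C: "C \<ge> 0"
    and dual: "\<And>a. cmod (\<Sum>j\<in>F. a j * x j) \<le> C * sqrt (\<Sum>j\<in>F. (cmod (a j))\<^sup>2)"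
  shows "(\<Sum>j\<in>F. (cmod (x j))\<^sup>2) \<le> C\<^sup>2"
proof -
  define S where "S = (\<Sum>j\<in>F. (cmod (x j))\<^sup>2)"
  have S0: "S \<ge> 0" unfolding S_def by (intro sum_nonneg) auto
  have "(\<Sum>j\<in>F. cnj (x j) * x j) = of_real S"
    unfolding S_def of_real_sum by (intro sum.cong refl) (simp add: complex_norm_square mult.commute flip: of_real_power)
  with dual[of "\<lambda>j. cnj (x j)"] have "S \<le> C * sqrt S"
    using S0 by (simp add: S_def[symmetric])
  then have "sqrt S \<le> C"
  proof (cases "S = 0")
    case False
    then have "sqrt S > 0" using S0 by simp
    moreover have "sqrt S * sqrt S \<le> C * sqrt S" using \<open>S \<le> C * sqrt S\<close> S0 by simp
    ultimately show ?thesis by (rule mult_right_le_imp_le[rotated])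
  qed (use C in simp)
  then have "(sqrt S)\<^sup>2 \<le> C\<^sup>2" using S0 by (intro power_mono) auto
  then show ?thesis using S0 by (simp add: S_def)
qed

lemma norm_sum_mult_le:
  fixes a b :: "'j \<Rightarrow> complex"
  shows "cmod (\<Sum>j\<in>F. a j * b j) \<le> sqrt (\<Sum>j\<in>F. (cmod (a j))\<^sup>2) * sqrt (\<Sum>j\<in>F. (cmod (b j))\<^sup>2)"
proof -
  have "cmod (\<Sum>j\<in>F. a j * b j) \<le> (\<Sum>j\<in>F. \<bar>cmod (a j)\<bar> * \<bar>cmod (b j)\<bar>)"
    by (rule order_trans[OF norm_sum]) (simp add: norm_mult)
  also have "\<dots> \<le> L2_set (\<lambda>j. cmod (a j)) F * L2_set (\<lambda>j. cmod (b j)) F"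
    by (rule L2_set_mult_ineq)
  finally show ?thesis by (simp add: L2_set_def)
qed

lemma
  fixes g :: "'j \<Rightarrow> complex \<Rightarrow> complex"
  assumes F: "finite F" and hol: "\<And>j. j \<in> F \<Longrightarrow> g j holomorphic_on ball c r"
    and r: "r > 0" and M0: "M \<ge> 0"
    and M: "\<And>w. w \<in> ball c r \<Longrightarrow> (\<Sum>j\<in>F. (cmod (g j w))\<^sup>2) \<le> M\<^sup>2"
  shows sum_sq_deriv_le: "(\<Sum>j\<in>F. (cmod (deriv (g j) c))\<^sup>2) \<le> (2 * M / r)\<^sup>2"
    and sum_sq_taylor_remainder_le: "cmod h \<le> r / 4 \<Longrightarrow>
      (\<Sum>j\<in>F. (cmod (g j (c + h) - g j c - h * deriv (g j) c))\<^sup>2) \<le> (8 * M / r\<^sup>2 * (cmod h)\<^sup>2)\<^sup>2"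
proof -
  have U: "(\<lambda>w. \<Sum>j\<in>F. a j * g j w) holomorphic_on ball c r" for a
    by (intro holomorphic_intros hol) auto
  have Ub: "cmod (\<Sum>j\<in>F. a j * g j w) \<le> sqrt (\<Sum>j\<in>F. (cmod (a j))\<^sup>2) * M" if "w \<in> ball c r" for a w
  proof -
    have "sqrt (\<Sum>j\<in>F. (cmod (g j w))\<^sup>2) \<le> M" using M[OF that] M0 by (simp add: real_le_lsqrt)
    then show ?thesis
      using norm_sum_mult_le[of a "\<lambda>j. g j w" F]
      by (meson mult_left_mono order_trans real_sqrt_ge_zero sum_nonneg zero_le_power2)
  qed
  have dU: "deriv (\<lambda>w. \<Sum>j\<in>F. a j * g j w) c = (\<Sum>j\<in>F. a j * deriv (g j) c)" for a
    by (rule DERIV_imp_deriv, intro DERIV_sum DERIV_cmult)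
       (rule holomorphic_derivI[OF hol open_ball], use r in auto)
  show "(\<Sum>j\<in>F. (cmod (deriv (g j) c))\<^sup>2) \<le> (2 * M / r)\<^sup>2"
  proof (rule sum_sq_le_of_dual_bound[OF F])
    fix a :: "'j \<Rightarrow> complex"
    show "cmod (\<Sum>j\<in>F. a j * deriv (g j) c) \<le> 2 * M / r * sqrt (\<Sum>j\<in>F. (cmod (a j))\<^sup>2)"
      using norm_deriv_le_of_bounded[OF U r Ub, of a] by (simp add: dU mult_ac)
  qed (use M0 r in auto)
  assume h: "cmod h \<le> r / 4"
  show "(\<Sum>j\<in>F. (cmod (g j (c + h) - g j c - h * deriv (g j) c))\<^sup>2) \<le> (8 * M / r\<^sup>2 * (cmod h)\<^sup>2)\<^sup>2"
  proof (rule sum_sq_le_of_dual_bound[OF F])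
    fix a :: "'j \<Rightarrow> complex"
    show "cmod (\<Sum>j\<in>F. a j * (g j (c + h) - g j c - h * deriv (g j) c))
        \<le> 8 * M / r\<^sup>2 * (cmod h)\<^sup>2 * sqrt (\<Sum>j\<in>F. (cmod (a j))\<^sup>2)"
      using norm_taylor_remainder_le_of_bounded[OF U r Ub h, of a]
      by (simp add: dU sum_subtractf[symmetric] sum_distrib_left algebra_simps)
  qed (use M0 r in auto)
qed

text \<open>Local boundedness plays the part of joint continuity in Osgood's lemma: with it,
  separate holomorphy passes to partial derivatives.\<close>

definition hol_family ::
  "nat \<Rightarrow> (nat \<Rightarrow> complex) set \<Rightarrow> 'j set \<Rightarrow> ('j \<Rightarrow> (nat \<Rightarrow> complex) \<Rightarrow> complex) \<Rightarrow> bool" where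
  "hol_family n D B u \<longleftrightarrow>
     (\<forall>j\<in>B. \<forall>z\<in>D. \<forall>i<n. (\<lambda>w. u j (z(i := w))) field_differentiable at (z i)) \<and>
     (\<forall>p\<in>D. \<exists>r>0. \<exists>M\<ge>0. p \<in> polydisc n p r \<and> polydisc n p r \<subseteq> D \<and>
        (\<forall>z\<in>polydisc n p r. \<forall>F. finite F \<longrightarrow> F \<subseteq> B \<longrightarrow> (\<Sum>j\<in>F. (cmod (u j z))\<^sup>2) \<le> M\<^sup>2))"

definition cpd :: "nat \<Rightarrow> ((nat \<Rightarrow> complex) \<Rightarrow> complex) \<Rightarrow> (nat \<Rightarrow> complex) \<Rightarrow> complex" where
  "cpd i f z = deriv (\<lambda>w. f (z(i := w))) (z i)"

lemma hol_familyE: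
  assumes "hol_family n D B u" "p \<in> D"
  obtains r M where "r > 0" "M \<ge> 0" "p \<in> polydisc n p r" "polydisc n p r \<subseteq> D"
    "\<And>z F. z \<in> polydisc n p r \<Longrightarrow> finite F \<Longrightarrow> F \<subseteq> B \<Longrightarrow> (\<Sum>j\<in>F. (cmod (u j z))\<^sup>2) \<le> M\<^sup>2"
  using assms unfolding hol_family_def by metis

lemma hol_family_line:
  assumes "hol_family n D B u" "j \<in> B" "i < n" "\<And>w. w \<in> S \<Longrightarrow> z(i := w) \<in> D"
  shows "(\<lambda>w. u j (z(i := w))) holomorphic_on S"
proof -
  have "(\<lambda>w. u j (z(i := w))) field_differentiable at w" if "w \<in> S" for w
  proof -
    have "(\<lambda>w'. u j ((z(i := w))(i := w'))) field_differentiable at ((z(i := w)) i)"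
      using assms that unfolding hol_family_def by blast
    then show ?thesis by simp
  qed
  then show ?thesis
    by (simp add: field_differentiable_at_within holomorphic_on_def)
qed

lemma cpd_has_derivative:
  assumes "hol_family n D B u" "j \<in> B" "i < n" "z \<in> D"
  shows "((\<lambda>w. u j (z(i := w))) has_field_derivative cpd i (u j) z) (at (z i))"
proof -
  have "(\<lambda>w. u j (z(i := w))) field_differentiable at (z i)"
    using assms unfolding hol_family_def by blast
  then show ?thesis unfolding cpd_def by (simp only: field_differentiable_derivI)
qed

lemma cpd_update: "cpd i f (z(i := w)) = deriv (\<lambda>w'. f (z(i := w'))) w"
  by (simp add: cpd_def)

text \<open>The difference quotients in the \<open>i\<close>-th variable are holomorphic in the \<open>k\<close>-th one and converge
  locally uniformly by the remainder estimate. Weierstrass' theorem then gives holomorphy of the limit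
  and convergence of the \<open>k\<close>-th derivatives, that is, the symmetry of the second derivatives.\<close>

lemma
  assumes fam: "hol_family n D B u" and i: "i < n"
  shows hol_family_cpd: "hol_family n D B (\<lambda>j. cpd i (u j))"
    and cpd_commute: "\<And>j k z. j \<in> B \<Longrightarrow> k < n \<Longrightarrow> z \<in> D \<Longrightarrow> cpd k (cpd i (u j)) z = cpd i (cpd k (u j)) z"
proof -
  have key: "(\<lambda>w. cpd i (u j) (z(k := w))) field_differentiable at (z k) \<and>
             cpd k (cpd i (u j)) z = cpd i (cpd k (u j)) z"
    if j: "j \<in> B" and k: "k < n" and z: "z \<in> D" for j k z
  proof -
    obtain r M where r: "r > 0" and M: "M \<ge> 0" and zin: "z \<in> polydisc n z r"
      and sub: "polydisc n z r \<subseteq> D"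
      and bd: "\<And>y F. y \<in> polydisc n z r \<Longrightarrow> finite F \<Longrightarrow> F \<subseteq> B \<Longrightarrow> (\<Sum>j\<in>F. (cmod (u j y))\<^sup>2) \<le> M\<^sup>2"
      using hol_familyE[OF fam z] by metis
    define f where "f = u j"
    have fM: "cmod (f y) \<le> M" if "y \<in> polydisc n z r" for y
    proof -
      have "(cmod (f y))\<^sup>2 \<le> M\<^sup>2" using bd[OF that, of "{j}"] j by (simp add: f_def)
      then show ?thesis using M by (simp add: abs_le_square_iff[symmetric])
    qed
    have line: "(\<lambda>w. f (y(l := w))) holomorphic_on ball (z l) r"
      if "y \<in> polydisc n z r" "l < n" for y l
      unfolding f_def using fam j that(2)
      by (rule hol_family_line) (use that sub polydisc_update in blast)
    show ?thesis
    proof (cases "k = i")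
      case True
      have "(\<lambda>w. cpd i f (z(i := w))) holomorphic_on ball (z i) r"
        unfolding cpd_update using line[OF zin i] by (intro holomorphic_deriv) auto
      then show ?thesis using True r by (auto simp: f_def[symmetric] holomorphic_on_imp_differentiable_at)
    next
      case False
      \<comment> \<open>the difference quotient, and its derivative in the \<open>k\<close>-th variable\<close>
      define q where "q h s = (f (z(k := s, i := z i + h)) - f (z(k := s))) / h" for h s
      define q' where "q' h s = (cpd k f (z(k := s, i := z i + h)) - cpd k f (z(k := s))) / h" for h s
      have zk: "z(k := s) \<in> polydisc n z r" if "s \<in> ball (z k) r" for s
        using polydisc_update[OF zin k that] .
      have zki: "z(k := s, i := z i + h) \<in> polydisc n z r" if "s \<in> ball (z k) r" "cmod h < r" for s h
        using polydisc_update[OF zk[OF that(1)] i, of "z i + h"] that by (simp add: dist_norm)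
      have swap: "z(k := s, i := t) = (z(i := t))(k := s)" for s t
        using False by (simp add: fun_upd_twist)
      have der1: "((\<lambda>s. f (z(k := s, i := z i + h))) has_field_derivative cpd k f (z(k := s, i := z i + h))) (at s)"
        if "s \<in> ball (z k) r" "cmod h < r" for s h
      proof -
        have "(\<lambda>w. f ((z(i := z i + h))(k := w))) holomorphic_on ball (z k) r"
          using k that polydisc_update[OF zin i, of "z i + h"] by (intro line) (auto simp: dist_norm)
        from holomorphic_derivI[OF this open_ball that(1)]
        show ?thesis by (simp add: cpd_def swap)
      qed
      have small: "\<forall>\<^sub>F h in at (0::complex). cmod h < r / 4"
        unfolding eventually_at using r by (intro exI[of _ "r/4"]) (auto simp: dist_norm)
      have small': "\<forall>\<^sub>F h in at (0::complex). cmod h < r / 4 \<and> h \<noteq> 0"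
        using small eventually_neq_at_within[of 0 0 UNIV] by eventually_elim auto
      have "\<forall>\<^sub>F h in at 0. continuous_on (cball (z k) (r/2)) (q h) \<and>
              (\<forall>s\<in>ball (z k) (r/2). (q h has_field_derivative q' h s) (at s))"
        using small'
      proof eventually_elim
        case (elim h)
        have D: "(q h has_field_derivative q' h s) (at s)" if s: "s \<in> ball (z k) r" for s
        proof -
          have "((\<lambda>s. f (z(k := s))) has_field_derivative cpd k f (z(k := s))) (at s)"
            using der1[OF s, of 0] r False by (simp add: fun_upd_idem[of "z(k := _)" i])
          then show ?thesis
            unfolding q_def q'_def using der1[OF s, of h] elim r
            by (auto intro!: derivative_eq_intros)
        qed
        have "continuous_on (cball (z k) (r/2)) (q h)"
          by (rule DERIV_continuous_on, rule has_field_derivative_at_within, rule D) (use r in auto)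
        with D show ?case using r by auto
      qed
      moreover have "uniform_limit (cball (z k) (r/2)) q (\<lambda>s. cpd i f (z(k := s))) (at 0)"
      proof (rule uniform_limitI)
        fix e :: real assume e: "e > 0"
        define d where "d = min (r/4) (e / (8 * M / r\<^sup>2 + 1))"
        have c0: "8 * M / r\<^sup>2 \<ge> 0" using M by simp
        have d: "d > 0" unfolding d_def using r e c0 by simp
        have "\<forall>\<^sub>F h in at (0::complex). cmod h < d \<and> h \<noteq> 0"
          unfolding eventually_at using d by (intro exI[of _ d]) (auto simp: dist_norm)
        then show "\<forall>\<^sub>F h in at 0. \<forall>s\<in>cball (z k) (r/2). dist (q h s) (cpd i f (z(k := s))) < e"
        proof (eventually_elim, intro ballI)
          fix h s assume h: "cmod h < d \<and> h \<noteq> 0" and s: "s \<in> cball (z k) (r/2)"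
          have s': "s \<in> ball (z k) r" using s r by auto
          have "cmod (f (z(k := s, i := z i + h)) - f (z(k := s, i := z i)) - h * deriv (\<lambda>w. f (z(k := s, i := w))) (z i))
              \<le> 8 * M / r\<^sup>2 * (cmod h)\<^sup>2"
            by (rule norm_taylor_remainder_le_of_bounded[OF line[OF zk[OF s'] i] r])
               (use h fM polydisc_update[OF zk[OF s'] i] in \<open>auto simp: d_def\<close>)
          moreover have "deriv (\<lambda>w. f (z(k := s, i := w))) (z i) = cpd i f (z(k := s))"
            using False by (simp add: cpd_def)
          moreover have "z(k := s, i := z i) = z(k := s)"
            using False by (simp add: fun_upd_idem)
          moreover have "h * (q h s - cpd i f (z(k := s)))
              = f (z(k := s, i := z i + h)) - f (z(k := s)) - h * cpd i f (z(k := s))"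
            using h by (simp add: q_def field_simps)
          ultimately have "cmod (h * (q h s - cpd i f (z(k := s)))) \<le> 8 * M / r\<^sup>2 * (cmod h)\<^sup>2"
            by simp
          then have "cmod h * dist (q h s) (cpd i f (z(k := s))) \<le> cmod h * (8 * M / r\<^sup>2 * cmod h)"
            by (simp add: norm_mult dist_norm power2_eq_square mult_ac)
          then have "dist (q h s) (cpd i f (z(k := s))) \<le> 8 * M / r\<^sup>2 * cmod h"
            by (rule mult_left_le_imp_le) (use h in simp)
          also have "\<dots> \<le> (8 * M / r\<^sup>2 + 1) * cmod h" by (intro mult_right_mono) auto
          also have "\<dots> < (8 * M / r\<^sup>2 + 1) * (e / (8 * M / r\<^sup>2 + 1))"
            using h c0 by (intro mult_strict_left_mono) (auto simp: d_def)
          also have "\<dots> = e" using c0 by simp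
          finally show "dist (q h s) (cpd i f (z(k := s))) < e" .
        qed
      qed
      ultimately obtain g' where g': "\<And>w. w \<in> ball (z k) (r/2) \<Longrightarrow>
          ((\<lambda>s. cpd i f (z(k := s))) has_field_derivative g' w) (at w) \<and> ((\<lambda>h. q' h w) \<longlongrightarrow> g' w) (at 0)"
        by (rule has_complex_derivative_uniform_limit) (use r in auto)
      have zk0: "z k \<in> ball (z k) (r/2)" using r by simp
      have 1: "((\<lambda>s. cpd i f (z(k := s))) has_field_derivative g' (z k)) (at (z k))"
        using g'[OF zk0] by blast
      have "((\<lambda>h. (cpd k f (z(i := z i + h)) - cpd k f (z(i := z i))) / h) \<longlongrightarrow> g' (z k)) (at 0)"
        using g'[OF zk0] by (simp add: q'_def)
      then have "((\<lambda>s. cpd k f (z(i := s))) has_field_derivative g' (z k)) (at (z i))"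
        by (simp add: DERIV_def)
      then have "cpd i (cpd k f) z = g' (z k)" unfolding cpd_def[of i "cpd k f"] by (rule DERIV_imp_deriv)
      moreover have "cpd k (cpd i f) z = g' (z k)"
        unfolding cpd_def[of k "cpd i f"] using 1 by (rule DERIV_imp_deriv)
      ultimately show ?thesis using 1 by (auto simp: f_def[symmetric] field_differentiable_def)
    qed
  qed
  show "hol_family n D B (\<lambda>j. cpd i (u j))"
    unfolding hol_family_def
  proof (intro conjI ballI allI impI)
    fix p assume p: "p \<in> D"
    obtain r M where r: "r > 0" and M: "M \<ge> 0" and pin: "p \<in> polydisc n p r"
      and sub: "polydisc n p r \<subseteq> D"
      and bd: "\<And>y F. y \<in> polydisc n p r \<Longrightarrow> finite F \<Longrightarrow> F \<subseteq> B \<Longrightarrow> (\<Sum>j\<in>F. (cmod (u j y))\<^sup>2) \<le> M\<^sup>2"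
      using hol_familyE[OF fam p] by metis
    have "(\<Sum>j\<in>F. (cmod (cpd i (u j) z))\<^sup>2) \<le> (2 * M / (r/2))\<^sup>2"
      if z: "z \<in> polydisc n p (r/2)" and F: "finite F" "F \<subseteq> B" for z F
      unfolding cpd_def
    proof (rule sum_sq_deriv_le[OF F(1)])
      have in': "z(i := w) \<in> polydisc n p r" if "w \<in> ball (z i) (r/2)" for w
        using polydisc_half[OF z that i] .
      then show "(\<lambda>w. u j (z(i := w))) holomorphic_on ball (z i) (r / 2)" if "j \<in> F" for j
        using that F sub by (intro hol_family_line[OF fam _ i]) auto
      show "(\<Sum>j\<in>F. (cmod (u j (z(i := w))))\<^sup>2) \<le> M\<^sup>2" if "w \<in> ball (z i) (r/2)" for w
        using bd[OF in'[OF that] F] .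
    qed (use r M in auto)
    moreover have "p \<in> polydisc n p (r/2)" using pin polydisc_center[of "r/2"] r by auto
    moreover have "polydisc n p (r/2) \<subseteq> D" using sub polydisc_mono[of "r/2" r n p] r by auto
    moreover have "2 * M / (r/2) \<ge> 0" using r M by simp
    ultimately show "\<exists>r>0. \<exists>M\<ge>0. p \<in> polydisc n p r \<and> polydisc n p r \<subseteq> D \<and>
        (\<forall>z\<in>polydisc n p r. \<forall>F. finite F \<longrightarrow> F \<subseteq> B \<longrightarrow> (\<Sum>j\<in>F. (cmod (cpd i (u j) z))\<^sup>2) \<le> M\<^sup>2)"
      using r by (intro exI[of _ "r/2"] exI[of _ "2 * M / (r/2)"]) auto
  qed (use key in blast)
  show "\<And>j k z. j \<in> B \<Longrightarrow> k < n \<Longrightarrow> z \<in> D \<Longrightarrow> cpd k (cpd i (u j)) z = cpd i (cpd k (u j)) z"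
    using key by blast
qed

section \<open>Wirtinger calculus for kernels\<close>

text \<open>Existence of the two partial derivatives along the real and imaginary axes is too weak for a
  chain rule; differentiability in the \<open>i\<close>-th coordinate plane is the usable notion.\<close>

definition has_wirtinger ::
  "nat \<Rightarrow> ((nat \<Rightarrow> complex) \<Rightarrow> complex) \<Rightarrow> (nat \<Rightarrow> complex) \<Rightarrow> complex \<Rightarrow> complex \<Rightarrow> bool" where
  "has_wirtinger i F z a b \<longleftrightarrow>
     ((\<lambda>s. F (z(i := s))) has_derivative (\<lambda>h. a * h + b * cnj h)) (at (z i))"

lemma has_wirtinger_dir_deriv:
  assumes "has_wirtinger i F z a b"
  shows "dir_deriv i v F z = a * v + b * cnj v"
proof -
  have 1: "((\<lambda>t. z i + of_real t * v) has_derivative (\<lambda>t. of_real t * v)) (at (0::real))"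
    by (auto intro!: derivative_eq_intros)
  have "((\<lambda>s. F (z(i := s))) has_derivative (\<lambda>h. a * h + b * cnj h)) (at (z i + of_real 0 * v))"
    using assms by (simp add: has_wirtinger_def)
  from has_derivative_compose[OF 1 this]
  have "((\<lambda>t. F (z(i := z i + of_real t * v))) has_derivative
          (\<lambda>t. a * (of_real t * v) + b * cnj (of_real t * v))) (at (0::real))" by simp
  then have "((\<lambda>t. F (z(i := z i + of_real t * v))) has_vector_derivative (a * v + b * cnj v)) (at (0::real))"
    unfolding has_vector_derivative_def
    by (rule has_derivative_eq_rhs) (auto simp: scaleR_conv_of_real algebra_simps)
  then show ?thesis unfolding dir_deriv_def by (rule vector_derivative_at)
qed

lemma
  assumes "has_wirtinger i F z a b"
  shows has_wirtinger_wirtinger: "wirtinger i F z = a"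
    and has_wirtinger_wirtinger_bar: "wirtinger_bar i F z = b"
  unfolding wirtinger_def wirtinger_bar_def has_wirtinger_dir_deriv[OF assms]
  by (simp_all add: algebra_simps)

lemma has_wirtinger_const: "has_wirtinger i (\<lambda>_. c) z 0 0"
  unfolding has_wirtinger_def by (auto intro!: derivative_eq_intros)

lemma has_wirtinger_add:
  assumes "has_wirtinger i F z a b" "has_wirtinger i G z a' b'"
  shows "has_wirtinger i (\<lambda>z. F z + G z) z (a + a') (b + b')"
  unfolding has_wirtinger_def
  by (rule has_derivative_eq_rhs[OF has_derivative_add[OF assms[unfolded has_wirtinger_def]]])
     (auto simp: algebra_simps)

lemma has_wirtinger_mult:
  assumes "has_wirtinger i F z a b" "has_wirtinger i G z a' b'"
  shows "has_wirtinger i (\<lambda>z. F z * G z) z (a * G z + F z * a') (b * G z + F z * b')"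
  unfolding has_wirtinger_def
  by (rule has_derivative_eq_rhs[OF has_derivative_mult[OF assms[unfolded has_wirtinger_def]]])
     (auto simp: algebra_simps)

lemma has_wirtinger_inverse:
  assumes "has_wirtinger i F z a b" "F z \<noteq> 0"
  shows "has_wirtinger i (\<lambda>z. inverse (F z)) z
           (- a * inverse (F z) * inverse (F z)) (- b * inverse (F z) * inverse (F z))"
  unfolding has_wirtinger_def
  by (rule has_derivative_eq_rhs[OF Deriv.has_derivative_inverse[OF _ assms(1)[unfolded has_wirtinger_def]]])
     (use assms(2) in \<open>auto simp: algebra_simps\<close>)

definition cn_open :: "nat \<Rightarrow> (nat \<Rightarrow> complex) set \<Rightarrow> bool" where
  "cn_open n D \<longleftrightarrow> (\<forall>p\<in>D. \<exists>r>0. p \<in> polydisc n p r \<and> polydisc n p r \<subseteq> D)"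

lemma cn_open_line:
  assumes "cn_open n D" "z \<in> D" "i < n"
  shows "\<forall>\<^sub>F s in nhds (z i). z(i := s) \<in> D"
proof -
  obtain r where r: "r > 0" "z \<in> polydisc n z r" "polydisc n z r \<subseteq> D"
    using assms unfolding cn_open_def by blast
  have "\<forall>\<^sub>F s in nhds (z i). s \<in> ball (z i) r" using r(1) by (intro eventually_nhds_in_open) auto
  then show ?thesis by eventually_elim (use r polydisc_update assms(3) in blast)
qed

lemma has_wirtinger_cong:
  assumes "cn_open n D" "z \<in> D" "i < n" "\<And>y. y \<in> D \<Longrightarrow> G y = F y" "has_wirtinger i F z a b"
  shows "has_wirtinger i G z a b"
  unfolding has_wirtinger_def
proof (rule has_derivative_transform_eventually)
  show "((\<lambda>s. F (z(i := s))) has_derivative (\<lambda>h. a * h + b * cnj h)) (at (z i))"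
    using assms(5) by (simp add: has_wirtinger_def)
  have "\<forall>\<^sub>F s in nhds (z i). F (z(i := s)) = G (z(i := s))"
    using cn_open_line[OF assms(1-3)] by eventually_elim (simp add: assms(4))
  then show "\<forall>\<^sub>F s in at (z i). F (z(i := s)) = G (z(i := s))"
    by (rule eventually_at_filter[THEN iffD2, OF eventually_mono]) simp
qed (use assms(2,4) in auto)

lemma
  assumes "cn_open n D" "z \<in> D" "i < n" "\<And>y. y \<in> D \<Longrightarrow> G y = F y"
  shows wirtinger_cong: "wirtinger i G z = wirtinger i F z"
    and wirtinger_bar_cong: "wirtinger_bar i G z = wirtinger_bar i F z"
proof -
  have "dir_deriv i v G z = dir_deriv i v F z" for v
    unfolding dir_deriv_def
  proof (rule vector_derivative_cong_eq)
    have "((\<lambda>t. z i + of_real t * v) \<longlongrightarrow> z i + of_real 0 * v) (nhds (0::real))"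
      by (intro tendsto_intros) (simp add: filterlim_ident)
    then have "\<forall>\<^sub>F t in nhds (0::real). z(i := z i + of_real t * v) \<in> D"
      using cn_open_line[OF assms(1-3)] by (auto simp: filterlim_iff)
    then show "\<forall>\<^sub>F t in nhds (0::real). t \<in> UNIV \<longrightarrow> G (z(i := z i + of_real t * v)) = F (z(i := z i + of_real t * v))"
      by eventually_elim (simp add: assms(4))
  qed auto
  then show "wirtinger i G z = wirtinger i F z" "wirtinger_bar i G z = wirtinger_bar i F z"
    by (simp_all add: wirtinger_def wirtinger_bar_def)
qed

text \<open>Along a coordinate plane \<open>F\<close> is real, so its Wirtinger derivatives are conjugate to each other and
  the chain rule for the real logarithm applies to the real part.\<close>

lemma has_wirtinger_ln:
  assumes D: "cn_open n D" "z \<in> D" "i < n" and F: "\<And>y. y \<in> D \<Longrightarrow> F y = of_real (k y)"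
    and k: "k z > 0" and W: "has_wirtinger i F z a b"
  shows "has_wirtinger i (\<lambda>y. of_real (ln (k y))) z (a / F z) (b / F z)"
proof -
  have W': "has_wirtinger i (\<lambda>y. of_real (k y)) z a b"
    by (rule has_wirtinger_cong[OF D _ W]) (simp add: F)
  then have dk: "((\<lambda>s. of_real (k (z(i := s)))) has_derivative (\<lambda>h. a * h + b * cnj h)) (at (z i))"
    by (simp add: has_wirtinger_def)
  then have dRe: "((\<lambda>s. k (z(i := s))) has_derivative (\<lambda>h. Re (a * h + b * cnj h))) (at (z i))"
    using bounded_linear.has_derivative[OF bounded_linear_Re dk] by simp
  have "((\<lambda>s. of_real (k (z(i := s))) :: complex) has_derivative (\<lambda>h. of_real (Re (a * h + b * cnj h)))) (at (z i))"
    by (rule bounded_linear.has_derivative[OF bounded_linear_of_real dRe])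
  from has_derivative_unique[OF this dk]
  have re: "of_real (Re (a * h + b * cnj h)) = a * h + b * cnj h" for h by meson
  have "((\<lambda>s. of_real (ln (k (z(i := s)))) :: complex) has_derivative
      (\<lambda>h. of_real (Re (a * h + b * cnj h) * inverse (k (z(i := z i)))))) (at (z i))"
    by (rule bounded_linear.has_derivative[OF bounded_linear_of_real], rule has_derivative_ln[OF _ dRe, THEN has_derivative_eq_rhs])
       (use k in \<open>auto simp: mult.commute\<close>)
  moreover have "of_real (Re (a * h + b * cnj h) * inverse (k (z(i := z i)))) = a / F z * h + b / F z * cnj h" for h
    unfolding of_real_mult re using F[OF D(2)] by (simp add: divide_inverse algebra_simps)
  ultimately show ?thesis unfolding has_wirtinger_def by (simp only:)
qed

text \<open>\<open>M\<close> bounds the \<open>\<ell>\<^sup>2\<close> norm. Bounding the finite partial sums lets estimates pass from finite families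
  to arbitrary ones without separate summability arguments.\<close>

definition l2b :: "'j set \<Rightarrow> ('j \<Rightarrow> complex) \<Rightarrow> real \<Rightarrow> bool" where
  "l2b B x M \<longleftrightarrow> M \<ge> 0 \<and> (\<forall>F. finite F \<longrightarrow> F \<subseteq> B \<longrightarrow> (\<Sum>j\<in>F. (cmod (x j))\<^sup>2) \<le> M\<^sup>2)"

definition l2pair :: "'j set \<Rightarrow> ('j \<Rightarrow> complex) \<Rightarrow> ('j \<Rightarrow> complex) \<Rightarrow> complex" where
  "l2pair B x y = (\<Sum>\<^sub>\<infinity>j\<in>B. x j * cnj (y j))"

lemma has_sum_diff:
  fixes f g :: "'a \<Rightarrow> complex"
  assumes "(f has_sum a) A" "(g has_sum b) A"
  shows "((\<lambda>x. f x - g x) has_sum (a - b)) A"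
  using has_sum_add[OF assms(1), of "\<lambda>x. - g x" "- b"] assms(2) by (simp add: has_sum_uminus)

lemma l2b_summable:
  assumes "l2b B x M" "l2b B y N"
  shows "(\<lambda>j. cmod (x j * cnj (y j))) summable_on B"
    and "((\<lambda>j. x j * cnj (y j)) has_sum l2pair B x y) B"
    and "cmod (l2pair B x y) \<le> M * N"
proof -
  have fin: "(\<Sum>j\<in>F. cmod (x j * cnj (y j))) \<le> M * N" if "finite F" "F \<subseteq> B" for F
  proof -
    have "(\<Sum>j\<in>F. cmod (x j * cnj (y j))) = (\<Sum>j\<in>F. \<bar>cmod (x j)\<bar> * \<bar>cmod (y j)\<bar>)"
      by (simp add: norm_mult)
    also have "\<dots> \<le> L2_set (\<lambda>j. cmod (x j)) F * L2_set (\<lambda>j. cmod (y j)) F"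
      by (rule L2_set_mult_ineq)
    also have "\<dots> \<le> M * N"
      using assms that unfolding l2b_def L2_set_def
      by (intro mult_mono real_le_lsqrt) (auto intro!: sum_nonneg)
    finally show ?thesis .
  qed
  show abs: "(\<lambda>j. cmod (x j * cnj (y j))) summable_on B"
    by (rule nonneg_bdd_above_summable_on) (auto intro!: bdd_aboveI[of _ "M * N"] fin)
  show "((\<lambda>j. x j * cnj (y j)) has_sum l2pair B x y) B"
    unfolding l2pair_def by (rule has_sum_infsum[OF abs_summable_summable[OF abs]])
  have "cmod (l2pair B x y) \<le> (\<Sum>\<^sub>\<infinity>j\<in>B. cmod (x j * cnj (y j)))"
    unfolding l2pair_def by (rule norm_infsum_bound[OF abs])
  also have "\<dots> \<le> M * N"
    by (rule infsum_le_finite_sums[OF abs]) (use fin in auto)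
  finally show "cmod (l2pair B x y) \<le> M * N" .
qed

definition pairing ::
  "'j set \<Rightarrow> ('j \<Rightarrow> (nat \<Rightarrow> complex) \<Rightarrow> complex) \<Rightarrow> ('j \<Rightarrow> (nat \<Rightarrow> complex) \<Rightarrow> complex)
    \<Rightarrow> (nat \<Rightarrow> complex) \<Rightarrow> complex" where
  "pairing B u v z = l2pair B (\<lambda>j. u j z) (\<lambda>j. v j z)"

lemma has_derivative_of_quadratic_remainder:
  fixes f :: "complex \<Rightarrow> complex"
  assumes L: "bounded_linear L" and e: "e > 0"
    and bd: "\<And>h. cmod h < e \<Longrightarrow> cmod (f (x + h) - f x - L h) \<le> C * (cmod h)\<^sup>2"
  shows "(f has_derivative L) (at x)"
proof (rule has_derivativeI_sandwich[OF e L, where H = "\<lambda>y. C * cmod (y - x)"])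
  show "cmod (f y - f x - L (y - x)) / cmod (y - x) \<le> C * cmod (y - x)"
    if "y \<noteq> x" "dist y x < e" for y
    using bd[of "y - x"] that by (simp add: dist_norm field_simps power2_eq_square)
  have "((\<lambda>y. C * cmod (y - x)) \<longlongrightarrow> C * cmod (x - x)) (at x)" by (intro tendsto_intros)
  then show "((\<lambda>y. C * cmod (y - x)) \<longlongrightarrow> 0) (at x)" by simp
qed

text \<open>Differentiation under the summation sign. For every index the Taylor remainders of \<open>u\<close> and \<open>v\<close> are
  quadratic in the increment, with \<open>\<ell>\<^sup>2\<close> norms controlled by the local bounds of the families, so by
  Cauchy-Schwarz the remainder of the sum is quadratic as well.\<close>

lemma has_wirtinger_pairing:
  assumes u: "hol_family n D B u" and v: "hol_family n D B v" and z: "z \<in> D" and i: "i < n"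
  shows "has_wirtinger i (pairing B u v) z
           (pairing B (\<lambda>j. cpd i (u j)) v z) (pairing B u (\<lambda>j. cpd i (v j)) z)"
proof -
  obtain r1 M where 1: "r1 > 0" "M \<ge> 0" "z \<in> polydisc n z r1" "polydisc n z r1 \<subseteq> D"
    "\<And>y F. y \<in> polydisc n z r1 \<Longrightarrow> finite F \<Longrightarrow> F \<subseteq> B \<Longrightarrow> (\<Sum>j\<in>F. (cmod (u j y))\<^sup>2) \<le> M\<^sup>2"
    using hol_familyE[OF u z] by metis
  obtain r2 N where 2: "r2 > 0" "N \<ge> 0" "z \<in> polydisc n z r2" "polydisc n z r2 \<subseteq> D"
    "\<And>y F. y \<in> polydisc n z r2 \<Longrightarrow> finite F \<Longrightarrow> F \<subseteq> B \<Longrightarrow> (\<Sum>j\<in>F. (cmod (v j y))\<^sup>2) \<le> N\<^sup>2"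
    using hol_familyE[OF v z] by metis
  define r where "r = min r1 r2"
  have r: "r > 0" using 1 2 by (simp add: r_def)
  have in1: "z(i := w) \<in> polydisc n z r1" and in2: "z(i := w) \<in> polydisc n z r2" if "w \<in> ball (z i) r" for w
    using polydisc_update[OF 1(3) i, of w] polydisc_update[OF 2(3) i, of w] that by (auto simp: r_def)
  define u0 u1 where "u0 j = u j z" and "u1 j = cpd i (u j) z" for j
  define v0 v1 where "v0 j = v j z" and "v1 j = cpd i (v j) z" for j
  define \<rho>u where "\<rho>u h j = u j (z(i := z i + h)) - u0 j - h * u1 j" for h j
  define \<rho>v where "\<rho>v h j = v j (z(i := z i + h)) - v0 j - h * v1 j" for h j
  define vh where "vh h j = v j (z(i := z i + h))" for h j
  have lu0: "l2b B u0 M" and lv0: "l2b B v0 N"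
    using 1 2 by (auto simp: l2b_def u0_def v0_def)
  have lvh: "l2b B (vh h) N" if "cmod h < r" for h
    using 2(2) 2(5)[OF in2[of "z i + h"]] that by (auto simp: l2b_def vh_def dist_norm)
  have holu: "(\<lambda>w. u j (z(i := w))) holomorphic_on ball (z i) r" if "j \<in> B" for j
    using in1 1(4) by (intro hol_family_line[OF u that i]) auto
  have holv: "(\<lambda>w. v j (z(i := w))) holomorphic_on ball (z i) r" if "j \<in> B" for j
    using in2 2(4) by (intro hol_family_line[OF v that i]) auto
  have lu1: "l2b B u1 (2 * M / r)"
    unfolding l2b_def u1_def cpd_def using r 1(2) in1 1(5) holu
    by (auto intro!: sum_sq_deriv_le)
  have lv1: "l2b B v1 (2 * N / r)"
    unfolding l2b_def v1_def cpd_def using r 2(2) in2 2(5) holv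
    by (auto intro!: sum_sq_deriv_le)
  have lru: "l2b B (\<rho>u h) (8 * M / r\<^sup>2 * (cmod h)\<^sup>2)" if "cmod h \<le> r / 4" for h
    unfolding l2b_def
  proof (intro conjI allI impI)
    fix F assume F: "finite F" "F \<subseteq> B"
    show "(\<Sum>j\<in>F. (cmod (\<rho>u h j))\<^sup>2) \<le> (8 * M / r\<^sup>2 * (cmod h)\<^sup>2)\<^sup>2"
      using sum_sq_taylor_remainder_le[OF F(1), of "\<lambda>j w. u j (z(i := w))" "z i" r M h]
        holu F in1 1(5) r 1(2) that by (auto simp: \<rho>u_def u0_def u1_def cpd_def)
  qed (use 1(2) in auto)
  have lrv: "l2b B (\<rho>v h) (8 * N / r\<^sup>2 * (cmod h)\<^sup>2)" if "cmod h \<le> r / 4" for h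
    unfolding l2b_def
  proof (intro conjI allI impI)
    fix F assume F: "finite F" "F \<subseteq> B"
    show "(\<Sum>j\<in>F. (cmod (\<rho>v h j))\<^sup>2) \<le> (8 * N / r\<^sup>2 * (cmod h)\<^sup>2)\<^sup>2"
      using sum_sq_taylor_remainder_le[OF F(1), of "\<lambda>j w. v j (z(i := w))" "z i" r N h]
        holv F in2 2(5) r 2(2) that by (auto simp: \<rho>v_def v0_def v1_def cpd_def)
  qed (use 2(2) in auto)
  define L where "L h = l2pair B u1 v0 * h + l2pair B u0 v1 * cnj h" for h
  define C where "C = 8 * M / r\<^sup>2 * N + M * (8 * N / r\<^sup>2) + (r/4) * ((2 * M / r) * (8 * N / r\<^sup>2)) + (2 * M / r) * (2 * N / r)"
  have "((\<lambda>s. pairing B u v (z(i := s))) has_derivative L) (at (z i))"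
  proof (rule has_derivative_of_quadratic_remainder)
    show "bounded_linear L" unfolding L_def
      by (intro bounded_linear_add bounded_linear_const_mult bounded_linear_ident
          bounded_linear_mult_right[THEN bounded_linear_compose] bounded_linear_cnj)
    show "r / 4 > 0" using r by simp
    fix h assume h4: "cmod h < r / 4"
    then have h: "cmod h < r" "cmod h \<le> r / 4" using r by auto
    define uh where "uh j = u j (z(i := z i + h))" for j
    have luh: "l2b B uh M"
      using 1(2) 1(5)[OF in1[of "z i + h"]] h by (auto simp: l2b_def uh_def dist_norm)
    have E: "((\<lambda>j. uh j * cnj (vh h j) - u0 j * cnj (v0 j) - (h * (u1 j * cnj (v0 j)) + cnj h * (u0 j * cnj (v1 j))))
        has_sum (l2pair B uh (vh h) - l2pair B u0 v0 - (h * l2pair B u1 v0 + cnj h * l2pair B u0 v1))) B"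
      by (intro has_sum_diff has_sum_add has_sum_cmult_right l2b_summable(2)[OF luh lvh[OF h(1)]]
          l2b_summable(2)[OF lu0 lv0] l2b_summable(2)[OF lu1 lv0] l2b_summable(2)[OF lu0 lv1])
    have E': "((\<lambda>j. \<rho>u h j * cnj (vh h j) + u0 j * cnj (\<rho>v h j) + h * (u1 j * cnj (\<rho>v h j)) + (h * cnj h) * (u1 j * cnj (v1 j)))
        has_sum (l2pair B (\<rho>u h) (vh h) + l2pair B u0 (\<rho>v h) + h * l2pair B u1 (\<rho>v h) + (h * cnj h) * l2pair B u1 v1)) B"
      by (intro has_sum_diff has_sum_add has_sum_cmult_right l2b_summable(2)[OF lru[OF h(2)] lvh[OF h(1)]]
          l2b_summable(2)[OF lu0 lrv[OF h(2)]] l2b_summable(2)[OF lu1 lrv[OF h(2)]] l2b_summable(2)[OF lu1 lv1])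
    have pw: "uh j * cnj (vh h j) - u0 j * cnj (v0 j) - (h * (u1 j * cnj (v0 j)) + cnj h * (u0 j * cnj (v1 j)))
       = \<rho>u h j * cnj (vh h j) + u0 j * cnj (\<rho>v h j) + h * (u1 j * cnj (\<rho>v h j)) + (h * cnj h) * (u1 j * cnj (v1 j))" for j
      by (simp add: \<rho>u_def \<rho>v_def uh_def vh_def algebra_simps)
    have "l2pair B uh (vh h) - l2pair B u0 v0 - L h
       = l2pair B (\<rho>u h) (vh h) + l2pair B u0 (\<rho>v h) + h * l2pair B u1 (\<rho>v h) + (h * cnj h) * l2pair B u1 v1"
      using has_sum_unique[OF E E'[folded pw]] by (simp add: L_def mult.commute)
    moreover have "cmod (l2pair B (\<rho>u h) (vh h)) \<le> 8 * M / r\<^sup>2 * (cmod h)\<^sup>2 * N"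
      by (rule l2b_summable(3)[OF lru[OF h(2)] lvh[OF h(1)]])
    moreover have "cmod (l2pair B u0 (\<rho>v h)) \<le> M * (8 * N / r\<^sup>2 * (cmod h)\<^sup>2)"
      by (rule l2b_summable(3)[OF lu0 lrv[OF h(2)]])
    moreover have "cmod (h * l2pair B u1 (\<rho>v h)) \<le> (r/4) * ((2 * M / r) * (8 * N / r\<^sup>2 * (cmod h)\<^sup>2))"
      unfolding norm_mult using r
      by (intro mult_mono h(2) l2b_summable(3)[OF lu1 lrv[OF h(2)]]) auto
    moreover have "cmod ((h * cnj h) * l2pair B u1 v1) \<le> (cmod h)\<^sup>2 * ((2 * M / r) * (2 * N / r))"
      unfolding norm_mult
      by (intro mult_mono l2b_summable(3)[OF lu1 lv1]) (auto simp: power2_eq_square)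
    ultimately have "cmod (l2pair B uh (vh h) - l2pair B u0 v0 - L h)
       \<le> 8 * M / r\<^sup>2 * (cmod h)\<^sup>2 * N + M * (8 * N / r\<^sup>2 * (cmod h)\<^sup>2)
         + (r/4) * ((2 * M / r) * (8 * N / r\<^sup>2 * (cmod h)\<^sup>2)) + (cmod h)\<^sup>2 * ((2 * M / r) * (2 * N / r))"
      by (smt (verit, best) norm_triangle_ineq)
    also have "\<dots> = C * (cmod h)\<^sup>2" by (simp add: C_def algebra_simps)
    finally show "cmod (pairing B u v (z(i := z i + h)) - pairing B u v (z(i := z i)) - L h) \<le> C * (cmod h)\<^sup>2"
      by (simp add: pairing_def uh_def[abs_def] vh_def[abs_def] u0_def[abs_def] v0_def[abs_def])
  qed
  then show ?thesis
    by (simp add: has_wirtinger_def pairing_def L_def[abs_def] u0_def[abs_def] v0_def[abs_def] u1_def[abs_def] v1_def[abs_def])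
qed

section \<open>The differential algebra generated by pairings\<close>

definition dop :: "nat \<times> bool \<Rightarrow> ((nat \<Rightarrow> complex) \<Rightarrow> complex) \<Rightarrow> (nat \<Rightarrow> complex) \<Rightarrow> complex" where
  "dop d = (if snd d then wirtinger_bar (fst d) else wirtinger (fst d))"

lemma dop_simps [simp]: "dop (i, True) = wirtinger_bar i" "dop (i, False) = wirtinger i"
  by (simp_all add: dop_def)

text \<open>All Wirtinger derivatives of a member exist, belong to the class and commute; this is inherited from
  the generators by the rules of calculus.\<close>

inductive kalg ::
  "nat \<Rightarrow> (nat \<Rightarrow> complex) set \<Rightarrow> 'j set \<Rightarrow> ((nat \<Rightarrow> complex) \<Rightarrow> complex) \<Rightarrow> bool"
  for n D and B :: "'j set" where
  kalg_pairing: "hol_family n D B u \<Longrightarrow> hol_family n D B v \<Longrightarrow> kalg n D B (pairing B u v)"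
| kalg_const: "kalg n D B (\<lambda>_. c)"
| kalg_add: "kalg n D B F \<Longrightarrow> kalg n D B G \<Longrightarrow> kalg n D B (\<lambda>z. F z + G z)"
| kalg_mult: "kalg n D B F \<Longrightarrow> kalg n D B G \<Longrightarrow> kalg n D B (\<lambda>z. F z * G z)"
| kalg_inverse: "kalg n D B F \<Longrightarrow> (\<And>z. z \<in> D \<Longrightarrow> F z \<noteq> 0) \<Longrightarrow> kalg n D B (\<lambda>z. inverse (F z))"
| kalg_cong: "kalg n D B F \<Longrightarrow> (\<And>z. z \<in> D \<Longrightarrow> G z = F z) \<Longrightarrow> kalg n D B G"

locale cn_kernel =
  fixes n :: nat and D :: "(nat \<Rightarrow> complex) set" and B :: "'j set"
  assumes cn_open: "cn_open n D"
begin

abbreviation "smooth \<equiv> kalg n D B"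
abbreviation "fam \<equiv> hol_family n D B"

lemma dop_cong:
  assumes "fst d < n" "z \<in> D" "\<And>y. y \<in> D \<Longrightarrow> G y = F y"
  shows "dop d G z = dop d F z"
  using wirtinger_cong[OF cn_open assms(2,1), of G F] wirtinger_bar_cong[OF cn_open assms(2,1), of G F] assms(3)
  by (simp add: dop_def)

lemma smooth_diff: "smooth F \<Longrightarrow> smooth G \<Longrightarrow> smooth (\<lambda>z. F z - G z)"
  using kalg_add[of n D B F "\<lambda>z. (-1) * G z"] kalg_mult[OF kalg_const[of n D B "-1"], of G] by simp

lemma smooth_uminus: "smooth G \<Longrightarrow> smooth (\<lambda>z. - G z)"
  using kalg_mult[OF kalg_const[of n D B "-1"], of G] by simp

lemma smooth_sum: "(\<And>a. a \<in> A \<Longrightarrow> smooth (F a)) \<Longrightarrow> smooth (\<lambda>z. \<Sum>a\<in>A. F a z)"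
  by (induction A rule: infinite_finite_induct) (auto intro!: kalg_const kalg_add)

lemma smooth_prod: "(\<And>a. a \<in> A \<Longrightarrow> smooth (F a)) \<Longrightarrow> smooth (\<lambda>z. \<Prod>a\<in>A. F a z)"
  by (induction A rule: infinite_finite_induct) (auto intro!: kalg_const kalg_mult)

lemma smooth_divide: "smooth F \<Longrightarrow> smooth G \<Longrightarrow> (\<And>z. z \<in> D \<Longrightarrow> G z \<noteq> 0) \<Longrightarrow> smooth (\<lambda>z. F z / G z)"
  unfolding divide_inverse by (intro kalg_mult kalg_inverse) auto

definition wdiff where
  "wdiff i F \<longleftrightarrow> smooth (wirtinger i F) \<and> smooth (wirtinger_bar i F) \<and>
     (\<forall>z\<in>D. has_wirtinger i F z (wirtinger i F z) (wirtinger_bar i F z))"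

lemma wdiffI:
  assumes "i < n" "\<And>z. z \<in> D \<Longrightarrow> has_wirtinger i F z (P z) (Q z)" "smooth P" "smooth Q"
  shows "wdiff i F"
  unfolding wdiff_def
proof (intro conjI ballI)
  show "smooth (wirtinger i F)" by (rule kalg_cong[OF assms(3)]) (metis assms(2) has_wirtinger_wirtinger)
  show "smooth (wirtinger_bar i F)" by (rule kalg_cong[OF assms(4)]) (metis assms(2) has_wirtinger_wirtinger_bar)
  show "has_wirtinger i F z (wirtinger i F z) (wirtinger_bar i F z)" if "z \<in> D" for z
    using assms(2)[OF that] has_wirtinger_wirtinger has_wirtinger_wirtinger_bar by metis
qed

lemma smooth_wdiff:
  assumes "smooth F" "i < n"
  shows "wdiff i F"
  using assms(1)
proof induction
  case (kalg_pairing u v)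
  show ?case
    by (rule wdiffI[OF assms(2) has_wirtinger_pairing[OF kalg_pairing]])
       (auto intro!: kalg.kalg_pairing hol_family_cpd kalg_pairing assms(2))
next
  case (kalg_const c)
  show ?case by (rule wdiffI[OF assms(2) has_wirtinger_const]) (auto intro!: kalg.kalg_const)
next
  case (kalg_add F G)
  then show ?case
    by (intro wdiffI[OF assms(2) has_wirtinger_add]) (auto simp: wdiff_def intro!: kalg.kalg_add)
next
  case (kalg_mult F G)
  then show ?case
    by (intro wdiffI[OF assms(2) has_wirtinger_mult]) (auto simp: wdiff_def intro!: kalg.kalg_add kalg.kalg_mult)
next
  case (kalg_inverse F)
  then show ?case
    by (intro wdiffI[OF assms(2) has_wirtinger_inverse])
       (auto simp: wdiff_def intro!: kalg.kalg_mult kalg.kalg_inverse smooth_uminus)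
next
  case (kalg_cong F G)
  show ?case
  proof (rule wdiffI[OF assms(2)])
    show "has_wirtinger i G z (wirtinger i F z) (wirtinger_bar i F z)" if "z \<in> D" for z
      using kalg_cong that by (intro has_wirtinger_cong[OF cn_open that assms(2), of G F]) (auto simp: wdiff_def)
  qed (use kalg_cong in \<open>auto simp: wdiff_def\<close>)
qed

lemma smooth_has_wirtinger:
  "smooth F \<Longrightarrow> i < n \<Longrightarrow> z \<in> D \<Longrightarrow> has_wirtinger i F z (wirtinger i F z) (wirtinger_bar i F z)"
  using smooth_wdiff unfolding wdiff_def by blast

lemma smooth_dop: "smooth F \<Longrightarrow> fst d < n \<Longrightarrow> smooth (dop d F)"
  using smooth_wdiff unfolding wdiff_def dop_def by auto

lemma dop_eqI:
  "has_wirtinger (fst d) F z a b \<Longrightarrow> dop d F z = (if snd d then b else a)"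
  by (simp add: dop_def has_wirtinger_wirtinger has_wirtinger_wirtinger_bar)

lemma dop_const: "dop d (\<lambda>_. c) z = 0"
  by (simp add: dop_eqI[OF has_wirtinger_const])

lemma dop_add:
  assumes "smooth F" "smooth G" "fst d < n" "z \<in> D"
  shows "dop d (\<lambda>z. F z + G z) z = dop d F z + dop d G z"
  using dop_eqI[OF has_wirtinger_add[OF smooth_has_wirtinger[OF assms(1,3,4)] smooth_has_wirtinger[OF assms(2,3,4)]]]
  by (simp add: dop_def)

lemma dop_mult:
  assumes "smooth F" "smooth G" "fst d < n" "z \<in> D"
  shows "dop d (\<lambda>z. F z * G z) z = dop d F z * G z + F z * dop d G z"
  using dop_eqI[OF has_wirtinger_mult[OF smooth_has_wirtinger[OF assms(1,3,4)] smooth_has_wirtinger[OF assms(2,3,4)]]]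
  by (simp add: dop_def)

lemma dop_inverse:
  assumes "smooth F" "fst d < n" "z \<in> D" "F z \<noteq> 0"
  shows "dop d (\<lambda>z. inverse (F z)) z = - dop d F z * (inverse (F z) * inverse (F z))"
  using dop_eqI[OF has_wirtinger_inverse[OF smooth_has_wirtinger[OF assms(1-3)] assms(4)]]
  by (simp add: dop_def)

lemma dop_cmult:
  assumes "smooth G" "fst d < n" "z \<in> D"
  shows "dop d (\<lambda>z. c * G z) z = c * dop d G z"
  using dop_mult[OF kalg_const assms] by (simp add: dop_const)

lemma dop_diff:
  assumes "smooth F" "smooth G" "fst d < n" "z \<in> D"
  shows "dop d (\<lambda>z. F z - G z) z = dop d F z - dop d G z"
  using dop_add[OF assms(1) kalg_mult[OF kalg_const assms(2)] assms(3,4), of "-1"] dop_cmult[OF assms(2-4), of "-1"]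
  by simp

lemma dop_sum:
  assumes "\<And>a. a \<in> A \<Longrightarrow> smooth (F a)" "fst d < n" "z \<in> D"
  shows "dop d (\<lambda>z. \<Sum>a\<in>A. F a z) z = (\<Sum>a\<in>A. dop d (F a) z)"
  using assms(1)
  by (induction A rule: infinite_finite_induct)
     (simp_all add: dop_const dop_add smooth_sum assms(2,3))

lemma dop_divide:
  assumes "smooth F" "smooth G" "fst d < n" "z \<in> D" "\<And>z. z \<in> D \<Longrightarrow> G z \<noteq> 0"
  shows "dop d (\<lambda>z. F z / G z) z = dop d F z / G z - F z * dop d G z / (G z)\<^sup>2"
  unfolding divide_inverse
  using assms by (subst dop_mult) (auto intro!: kalg_inverse simp: dop_inverse power2_eq_square)

lemma dop_pairing:
  assumes "fam u" "fam v" "fst d < n" "z \<in> D"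
  shows "dop d (pairing B u v) z =
    (if snd d then pairing B u (\<lambda>j. cpd (fst d) (v j)) z else pairing B (\<lambda>j. cpd (fst d) (u j)) v z)"
  by (rule dop_eqI[OF has_wirtinger_pairing[OF assms(1,2,4,3)]])

lemma pairing_cong:
  "(\<And>j. j \<in> B \<Longrightarrow> u j z = u' j z) \<Longrightarrow> (\<And>j. j \<in> B \<Longrightarrow> v j z = v' j z) \<Longrightarrow> pairing B u v z = pairing B u' v' z"
  unfolding pairing_def l2pair_def by (rule infsum_cong) simp

text \<open>On a pairing, derivatives of different type act on different factors, and derivatives of the same type
  commute by \<open>cpd_commute\<close>; the product and quotient rules carry this to the whole algebra.\<close>

lemma dop_commute:
  assumes "smooth F" and d: "fst d < n" and e: "fst e < n" and "z \<in> D"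
  shows "dop d (dop e F) z = dop e (dop d F) z"
  using assms(1,4)
proof (induction arbitrary: z)
  case (kalg_pairing u v)
  note uv = kalg_pairing(1,2)
  have "dop d (dop e (pairing B u v)) z = dop e (dop d (pairing B u v)) z"
    if d: "fst d < n" and e: "fst e < n" for d e
    using dop_cong[OF d kalg_pairing(3), OF dop_pairing[OF uv e]]
      dop_cong[OF e kalg_pairing(3), OF dop_pairing[OF uv d]]
    by (cases "snd d"; cases "snd e")
       (auto simp: dop_pairing kalg_pairing hol_family_cpd d e
          cpd_commute[OF uv(1)] cpd_commute[OF uv(2)] intro!: pairing_cong)
  with d e show ?case by blast
next
  case (kalg_const c)
  have [simp]: "dop d' (\<lambda>_. c) = (\<lambda>_. 0)" for d' and c :: complex by (rule ext) (simp add: dop_const)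
  show ?case by simp
next
  case (kalg_add F G)
  note s = kalg_add(1,2)
  show ?case
    using dop_cong[OF d kalg_add(5), OF dop_add[OF s e]] dop_cong[OF e kalg_add(5), OF dop_add[OF s d]]
    by (simp add: dop_add smooth_dop s d e kalg_add)
next
  case (kalg_mult F G)
  note s = kalg_mult(1,2)
  show ?case
    using dop_cong[OF d kalg_mult(5), OF dop_mult[OF s e]] dop_cong[OF e kalg_mult(5), OF dop_mult[OF s d]]
    by (simp add: dop_add dop_mult smooth_dop s d e kalg.kalg_mult kalg_mult.prems kalg_mult.IH algebra_simps)
next
  case (kalg_inverse F)
  note s = kalg_inverse(1)
  have inv: "smooth (\<lambda>z. inverse (F z))" using kalg_inverse(1,2) by (rule kalg.kalg_inverse)
  have sd: "smooth (\<lambda>z. - dop d' F z)" if "fst d' < n" for d'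
    by (intro smooth_uminus smooth_dop s that)
  have sq: "smooth (\<lambda>z. inverse (F z) * inverse (F z))" by (intro kalg.kalg_mult inv)
  have neg: "dop d' (\<lambda>z. - G z) z = - dop d' G z" if "smooth G" "fst d' < n" for d' G
    using dop_cmult[OF that kalg_inverse.prems, of "-1"] by simp
  have D1: "dop d' (dop e' (\<lambda>z. inverse (F z))) z
     = dop d' (\<lambda>z. - dop e' F z * (inverse (F z) * inverse (F z))) z"
    if "fst d' < n" "fst e' < n" for d' e'
    by (rule dop_cong[OF that(1) kalg_inverse.prems]) (rule dop_inverse[OF s that(2)], use kalg_inverse in auto)
  have "dop d' (dop e' (\<lambda>z. inverse (F z))) z
     = - dop d' (dop e' F) z * (inverse (F z) * inverse (F z))
       + 2 * dop e' F z * dop d' F z * (inverse (F z) * inverse (F z) * inverse (F z))"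
    if d': "fst d' < n" and e': "fst e' < n" for d' e'
    unfolding D1[OF d' e']
    using kalg_inverse.prems kalg_inverse(2)
    by (subst dop_mult[OF sd[OF e'] sq d' kalg_inverse.prems])
       (simp add: dop_mult inv neg smooth_dop s e' d' dop_inverse algebra_simps)
  then show ?case using d e kalg_inverse.IH[OF kalg_inverse.prems] by simp
next
  case (kalg_cong F G)
  have "dop d (dop e G) z = dop d (dop e F) z"
    by (rule dop_cong[OF d kalg_cong.prems]) (rule dop_cong[OF e], use kalg_cong in auto)
  moreover have "dop e (dop d G) z = dop e (dop d F) z"
    by (rule dop_cong[OF e kalg_cong.prems]) (rule dop_cong[OF d], use kalg_cong in auto)
  ultimately show ?case using kalg_cong.IH[OF kalg_cong.prems] by simp
qed

end

section \<open>Curvature of the kernel metric\<close>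

definition quartic ::
  "nat \<Rightarrow> (nat \<Rightarrow> nat \<Rightarrow> nat \<Rightarrow> nat \<Rightarrow> complex) \<Rightarrow> (nat \<Rightarrow> complex) \<Rightarrow> (nat \<Rightarrow> complex) \<Rightarrow> (nat \<Rightarrow> complex)
    \<Rightarrow> (nat \<Rightarrow> complex) \<Rightarrow> complex" where
  "quartic n S X Y Z W = (\<Sum>i<n. \<Sum>j<n. \<Sum>k<n. \<Sum>l<n. S i j k l * X i * cnj (Y j) * Z k * cnj (W l))"

lemma quartic_add:
  "quartic n S (\<lambda>i. X i + X' i) Y Z W = quartic n S X Y Z W + quartic n S X' Y Z W"
  "quartic n S X (\<lambda>i. Y i + Y' i) Z W = quartic n S X Y Z W + quartic n S X Y' Z W"
  "quartic n S X Y (\<lambda>i. Z i + Z' i) W = quartic n S X Y Z W + quartic n S X Y Z' W"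
  "quartic n S X Y Z (\<lambda>i. W i + W' i) = quartic n S X Y Z W + quartic n S X Y Z W'"
  unfolding quartic_def by (simp_all add: sum.distrib algebra_simps)

lemma quartic_scale:
  "quartic n S (\<lambda>i. t * X i) Y Z W = t * quartic n S X Y Z W"
  "quartic n S X (\<lambda>i. t * Y i) Z W = cnj t * quartic n S X Y Z W"
  "quartic n S X Y (\<lambda>i. t * Z i) W = t * quartic n S X Y Z W"
  "quartic n S X Y Z (\<lambda>i. t * W i) = cnj t * quartic n S X Y Z W"
  unfolding quartic_def by (simp_all add: sum_distrib_left algebra_simps)

text \<open>A Hermitian quartic form vanishing on the diagonal vanishes identically: evaluating at
  \<open>X + t Z\<close> for the fourth roots of unity \<open>t\<close> isolates the terms in \<open>t\<^sup>2\<close> and \<open>(cnj t)\<^sup>2\<close>, and a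
  further rotation of \<open>Z\<close> by an eighth root of unity separates these two.\<close>

lemma quartic_polarization:
  assumes sym1: "\<And>i j k l. i < n \<Longrightarrow> j < n \<Longrightarrow> k < n \<Longrightarrow> l < n \<Longrightarrow> S i j k l = S k j i l"
    and sym2: "\<And>i j k l. i < n \<Longrightarrow> j < n \<Longrightarrow> k < n \<Longrightarrow> l < n \<Longrightarrow> S i j k l = S i l k j"
    and diag: "\<And>X. quartic n S X X X X = 0"
    and ijkl: "i < n" "j < n" "k < n" "l < n"
  shows "S i j k l = 0"
proof -
  let ?Q = "quartic n S"
  have s1: "?Q X Y Z W = ?Q Z Y X W" for X Y Z W
  proof -
    have "?Q X Y Z W = (\<Sum>i<n. \<Sum>k<n. \<Sum>j<n. \<Sum>l<n. S i j k l * X i * cnj (Y j) * Z k * cnj (W l))"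
      unfolding quartic_def by (intro sum.cong refl sum.swap)
    also have "\<dots> = (\<Sum>k<n. \<Sum>i<n. \<Sum>j<n. \<Sum>l<n. S i j k l * X i * cnj (Y j) * Z k * cnj (W l))"
      by (rule sum.swap)
    also have "\<dots> = (\<Sum>k<n. \<Sum>j<n. \<Sum>i<n. \<Sum>l<n. S i j k l * X i * cnj (Y j) * Z k * cnj (W l))"
      by (intro sum.cong refl sum.swap)
    also have "\<dots> = ?Q Z Y X W"
      unfolding quartic_def by (intro sum.cong refl) (simp add: sym1 mult_ac)
    finally show ?thesis .
  qed
  have s2: "?Q X Y Z W = ?Q X W Z Y" for X Y Z W
  proof -
    have "?Q X Y Z W = (\<Sum>i<n. \<Sum>k<n. \<Sum>j<n. \<Sum>l<n. S i j k l * X i * cnj (Y j) * Z k * cnj (W l))"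
      unfolding quartic_def by (intro sum.cong refl sum.swap)
    also have "\<dots> = (\<Sum>i<n. \<Sum>k<n. \<Sum>l<n. \<Sum>j<n. S i j k l * X i * cnj (Y j) * Z k * cnj (W l))"
      by (intro sum.cong refl sum.swap)
    also have "\<dots> = (\<Sum>i<n. \<Sum>l<n. \<Sum>k<n. \<Sum>j<n. S i j k l * X i * cnj (Y j) * Z k * cnj (W l))"
      by (intro sum.cong refl sum.swap)
    also have "\<dots> = ?Q X W Z Y"
      unfolding quartic_def by (intro sum.cong refl) (simp add: sym2 mult_ac)
    finally show ?thesis .
  qed
  have pair: "?Q X Z X Z + ?Q Z X Z X = 0" for X Z
  proof -
    \<comment> \<open>the quartic form at \<open>X + t Z\<close>, with equal terms collected by symmetry\<close>
    define P where "P t = ?Q X X X X + t * cnj t * (4 * ?Q X X Z Z) + t^2 * ?Q Z X Z X + (cnj t)^2 * ?Q X Z X Z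
        + t^2 * (cnj t)^2 * ?Q Z Z Z Z + 2 * t * ?Q X X Z X + 2 * cnj t * ?Q X X X Z
        + 2 * t^2 * cnj t * ?Q Z X Z Z + 2 * t * (cnj t)^2 * ?Q X Z Z Z" for t
    have P: "P t = 0" for t
    proof -
      have "?Q (\<lambda>i. X i + t * Z i) (\<lambda>i. X i + t * Z i) (\<lambda>i. X i + t * Z i) (\<lambda>i. X i + t * Z i) = 0"
        by (rule diag)
      then show ?thesis
        unfolding quartic_add quartic_scale P_def
        using s1[of Z X X X] s2[of X Z X X] s1[of Z X X Z] s2[of X Z Z X] s1[of Z Z X X]
          s1[of Z Z X Z] s2[of Z Z Z X]
        by (simp add: algebra_simps power2_eq_square)
    qed
    have "4 * (?Q X Z X Z + ?Q Z X Z X) = P 1 + P (-1) - P \<i> - P (-\<i>)"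
      unfolding P_def by (simp add: algebra_simps)
    also have "\<dots> = 0" by (simp add: P)
    finally show ?thesis by (metis mult_eq_0_iff zero_neq_numeral)
  qed
  have zero: "?Q X Z X Z = 0" for X Z
  proof -
    define w where "w = cis (pi/4)"
    have w2: "w * w = \<i>" unfolding w_def by (simp add: cis_mult)
    have w2': "cnj w * cnj w = - \<i>" using arg_cong[OF w2, of cnj] by simp
    have "?Q X (\<lambda>i. w * Z i) X (\<lambda>i. w * Z i) + ?Q (\<lambda>i. w * Z i) X (\<lambda>i. w * Z i) X = 0" by (rule pair)
    then have "(cnj w * cnj w) * ?Q X Z X Z + (w * w) * ?Q Z X Z X = 0"
      unfolding quartic_scale by (simp add: mult_ac)
    then have "\<i> * (?Q Z X Z X - ?Q X Z X Z) = 0" unfolding w2 w2' by (simp add: algebra_simps)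
    with pair[of X Z] show ?thesis by (simp add: complex_eq_iff)
  qed
  have zero1: "?Q X Z X' Z = 0" for X X' Z
    using zero[of "\<lambda>i. X i + X' i" Z] zero[of X Z] zero[of X' Z] s1[of X' Z X Z] by (simp add: quartic_add)
  have zero2: "?Q X Z X' Z' = 0" for X X' Z Z'
    using zero1[of X "\<lambda>i. Z i + Z' i" X'] zero1[of X Z X'] zero1[of X Z' X'] s2[of X Z' X' Z]
    by (simp add: quartic_add)
  define e where "e a b = (if a = b then 1 else 0 :: complex)" for a b :: nat
  have "?Q (e i) (e j) (e k) (e l) = S i j k l"
    unfolding quartic_def e_def using ijkl
    by (simp add: if_distrib[of cnj] if_distrib[of "\<lambda>x. _ * x"] if_distrib[of "\<lambda>x. x * _"] cong: if_cong)
  with zero2 show ?thesis by simp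
qed

context cn_kernel
begin

lemma smooth_det:
  assumes "\<And>i j. i < m \<Longrightarrow> j < m \<Longrightarrow> smooth (\<lambda>z. A z i j)"
  shows "smooth (\<lambda>z. Determinant.det (Matrix.mat m m (\<lambda>(i, j). A z i j)))"
proof -
  have pl: "p i < m" if "p permutes {0..<m}" "i < m" for p :: "nat \<Rightarrow> nat" and i
    using permutes_in_image[OF that(1), of i] that(2) by simp
  have "smooth (\<lambda>z. \<Sum>p\<in>{p. p permutes {0..<m}}. signof p * (\<Prod>i = 0..<m. A z i (p i)))"
    by (intro smooth_sum kalg_mult kalg_const smooth_prod assms) (auto simp: pl)
  moreover have "Determinant.det (Matrix.mat m m (\<lambda>(i, j). A z i j))
      = (\<Sum>p\<in>{p. p permutes {0..<m}}. signof p * (\<Prod>i = 0..<m. A z i (p i)))" for z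
    by (subst det_def') (auto intro!: sum.cong prod.cong simp: pl)
  ultimately show ?thesis by simp
qed

text \<open>Cramer's rule keeps the inverse of a matrix of members inside the algebra.\<close>

lemma smooth_inverse_matrix:
  assumes g: "\<And>i j. i < n \<Longrightarrow> j < n \<Longrightarrow> smooth (g i j)"
    and nondeg: "\<And>z v. z \<in> D \<Longrightarrow> (\<And>b. b < n \<Longrightarrow> (\<Sum>c<n. g c b z * v c) = 0) \<Longrightarrow> (\<And>c. c < n \<Longrightarrow> v c = 0)"
  obtains H where "\<And>a b. a < n \<Longrightarrow> b < n \<Longrightarrow> smooth (H a b)"
    "\<And>z a c. z \<in> D \<Longrightarrow> a < n \<Longrightarrow> c < n \<Longrightarrow> (\<Sum>b<n. H a b z * g c b z) = (if a = c then 1 else 0)"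
    "\<And>z b d. z \<in> D \<Longrightarrow> b < n \<Longrightarrow> d < n \<Longrightarrow> (\<Sum>a<n. g a b z * H a d z) = (if b = d then 1 else 0)"
proof -
  define A where "A z = Matrix.mat n n (\<lambda>(b, c). g c b z)" for z
  have A: "A z \<in> carrier_mat n n" for z by (simp add: A_def)
  have det: "Determinant.det (A z) \<noteq> 0" if z: "z \<in> D" for z
  proof
    assume "Determinant.det (A z) = 0"
    then obtain v where v: "v \<in> carrier_vec n" "v \<noteq> 0\<^sub>v n" "A z *\<^sub>v v = 0\<^sub>v n"
      using det_0_iff_vec_prod_zero[OF A] by blast
    have "v $ c = 0" if c: "c < n" for c
    proof (rule nondeg[OF z _ c])
      fix b assume b: "b < n"
      have "(A z *\<^sub>v v) $ b = 0" using v(3) b by simp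
      then show "(\<Sum>c<n. g c b z * v $ c) = 0"
        using b v(1) by (simp add: A_def scalar_prod_def atLeast0LessThan)
    qed
    with v show False by (auto simp: vec_eq_iff)
  qed
  define H where "H a b z = adj_mat (A z) $$ (a, b) / Determinant.det (A z)" for a b z
  have adj: "adj_mat (A z) \<in> carrier_mat n n" for z using adj_mat(1)[OF A] .
  have sdet: "smooth (\<lambda>z. Determinant.det (A z))"
    unfolding A_def by (rule smooth_det) (auto intro: g)
  have "smooth (H a b)" if "a < n" "b < n" for a b
    unfolding H_def
  proof (rule smooth_divide[OF _ sdet det])
    have "smooth (\<lambda>z. (-1) ^ (b + a) * Determinant.det (Matrix.mat (n - 1) (n - 1)
        (\<lambda>(i', j'). g (if j' < a then j' else Suc j') (if i' < b then i' else Suc i') z)))"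
      by (intro kalg_mult kalg_const smooth_det g) (use that in auto)
    moreover have "adj_mat (A z) $$ (a, b) = (-1) ^ (b + a) * Determinant.det (Matrix.mat (n - 1) (n - 1)
        (\<lambda>(i', j'). g (if j' < a then j' else Suc j') (if i' < b then i' else Suc i') z))" for z
    proof -
      have "mat_delete (A z) b a = Matrix.mat (n - 1) (n - 1)
        (\<lambda>(i', j'). g (if j' < a then j' else Suc j') (if i' < b then i' else Suc i') z)"
        using that by (intro eq_matI) (auto simp: mat_delete_def A_def)
      then show ?thesis using that A[of z] by (simp add: adj_mat_def cofactor_def)
    qed
    ultimately show "smooth (\<lambda>z. adj_mat (A z) $$ (a, b))" by simp
  qed
  moreover have "(\<Sum>b<n. H a b z * g c b z) = (if a = c then 1 else 0)" if "z \<in> D" "a < n" "c < n" for z a c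
  proof -
    have "(adj_mat (A z) * A z) $$ (a, c) = (Determinant.det (A z) \<cdot>\<^sub>m 1\<^sub>m n) $$ (a, c)"
      using adj_mat(3)[OF A] by simp
    then have "(\<Sum>b<n. adj_mat (A z) $$ (a, b) * g c b z) = (if a = c then Determinant.det (A z) else 0)"
      using that adj[of z] A[of z] by (simp add: scalar_prod_def A_def[of z] atLeast0LessThan)
    then show ?thesis using det[OF that(1)] by (simp add: H_def sum_divide_distrib[symmetric])
  qed
  moreover have "(\<Sum>a<n. g a b z * H a d z) = (if b = d then 1 else 0)" if "z \<in> D" "b < n" "d < n" for z b d
  proof -
    have "(A z * adj_mat (A z)) $$ (b, d) = (Determinant.det (A z) \<cdot>\<^sub>m 1\<^sub>m n) $$ (b, d)"
      using adj_mat(2)[OF A] by simp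
    then have "(\<Sum>a<n. g a b z * adj_mat (A z) $$ (a, d)) = (if b = d then Determinant.det (A z) else 0)"
      using that adj[of z] A[of z] by (simp add: scalar_prod_def A_def[of z] atLeast0LessThan)
    then show ?thesis using det[OF that(1)] by (simp add: H_def sum_divide_distrib[symmetric])
  qed
  ultimately show ?thesis by (rule that)
qed

end

text \<open>The kernel as a pairing of a holomorphic family with itself; for the Bergman kernel the family is an
  orthonormal basis. The functions \<open>p i\<close> are the first derivatives of \<open>log K\<close>, and \<open>G i k\<close> the second
  ones of type \<open>(2,0)\<close>.\<close>

locale kernel_potential = cn_kernel n D B for n D and B :: "'j set" +
  fixes f :: "'j \<Rightarrow> (nat \<Rightarrow> complex) \<Rightarrow> complex"
  assumes fam: "hol_family n D B f"
    and kernel: "\<And>z. z \<in> D \<Longrightarrow> of_real (bergman_kernel n D z) = pairing B f f z"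
    and K_pos: "\<And>z. z \<in> D \<Longrightarrow> bergman_kernel n D z > 0"
begin

abbreviation "w \<equiv> wirtinger"
abbreviation "wb \<equiv> wirtinger_bar"
abbreviation "g \<equiv> bergman_g n D"

definition "K = pairing B f f"
definition "p i z = w i K z / K z"
definition "G i k = w k (p i)"

lemma smooth_K: "smooth K"
  unfolding K_def by (rule kalg_pairing[OF fam fam])

lemma K_nonzero: "z \<in> D \<Longrightarrow> K z \<noteq> 0"
  using K_pos[of z] kernel[of z] unfolding K_def by (metis less_irrefl of_real_eq_0_iff)

lemma smooth_w: "smooth F \<Longrightarrow> i < n \<Longrightarrow> smooth (w i F)"
  and smooth_wb: "smooth F \<Longrightarrow> i < n \<Longrightarrow> smooth (wb i F)"
  using smooth_dop[of F "(i, False)"] smooth_dop[of F "(i, True)"] by auto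

lemma commute:
  assumes "smooth F" "i < n" "j < n" "z \<in> D"
  shows "w i (w j F) z = w j (w i F) z" "wb i (wb j F) z = wb j (wb i F) z" "w i (wb j F) z = wb j (w i F) z"
  using dop_commute[of F "(i, False)" "(j, False)" z] dop_commute[of F "(i, True)" "(j, True)" z]
    dop_commute[of F "(i, False)" "(j, True)" z] assms by auto

lemmas w_rules = dop_add[where d = "(_, False)", simplified] dop_mult[where d = "(_, False)", simplified]
  dop_diff[where d = "(_, False)", simplified] dop_sum[where d = "(_, False)", simplified]
  dop_const[where d = "(_, False)", simplified] dop_cmult[where d = "(_, False)", simplified]
lemmas wb_rules = dop_add[where d = "(_, True)", simplified] dop_mult[where d = "(_, True)", simplified]
  dop_diff[where d = "(_, True)", simplified] dop_sum[where d = "(_, True)", simplified]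
  dop_const[where d = "(_, True)", simplified] dop_cmult[where d = "(_, True)", simplified]
lemmas w_cong = dop_cong[where d = "(_, False)", simplified]
lemmas wb_cong = dop_cong[where d = "(_, True)", simplified]

lemma smooth_p: "i < n \<Longrightarrow> smooth (p i)"
  unfolding p_def[abs_def] by (intro smooth_divide smooth_w smooth_K K_nonzero)

lemma smooth_G: "i < n \<Longrightarrow> k < n \<Longrightarrow> smooth (G i k)"
  unfolding G_def by (intro smooth_w smooth_p)

lemma G_sym: "i < n \<Longrightarrow> k < n \<Longrightarrow> z \<in> D \<Longrightarrow> G i k z = G k i z"
  unfolding G_def p_def[abs_def]
  using dop_divide[of "w i K" K "(k, False)" z] dop_divide[of "w k K" K "(i, False)" z]
  by (simp add: smooth_w smooth_K K_nonzero commute)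

lemma g_eq:
  assumes "i < n" "j < n" "z \<in> D"
  shows "g i j z = wb j (p i) z"
proof -
  have "g i j z = w i (\<lambda>z. wb j K z / K z) z"
    unfolding bergman_g_def
  proof (rule w_cong[OF assms(1,3)])
    fix y assume y: "y \<in> D"
    have "has_wirtinger j (\<lambda>z. of_real (ln (bergman_kernel n D z))) y (w j K y / K y) (wb j K y / K y)"
      using has_wirtinger_ln[where F = K and k = "bergman_kernel n D", OF cn_open y assms(2) _ K_pos[OF y]
          smooth_has_wirtinger[OF smooth_K assms(2) y]]
      by (simp add: K_def kernel)
    then show "wb j (\<lambda>z. of_real (ln (bergman_kernel n D z))) y = wb j K y / K y"
      by (rule has_wirtinger_wirtinger_bar)
  qed
  also have "\<dots> = wb j (p i) z"
    unfolding p_def[abs_def] using assms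
      dop_divide[of "wb j K" K "(i, False)" z] dop_divide[of "w i K" K "(j, True)" z]
    by (simp add: smooth_w smooth_wb smooth_K K_nonzero commute)
  finally show ?thesis .
qed

lemma smooth_g: "i < n \<Longrightarrow> j < n \<Longrightarrow> smooth (g i j)"
  by (rule kalg_cong[OF smooth_wb[OF smooth_p]]) (auto simp: g_eq)

end

locale kernel_metric = kernel_potential n D B f
  for n D and B :: "'j set" and f :: "'j \<Rightarrow> (nat \<Rightarrow> complex) \<Rightarrow> complex" +
  assumes well_defined: "bergman_metric_well_defined n D"
begin

lemma g_nondegenerate:
  assumes z: "z \<in> D" and v: "\<And>b. b < n \<Longrightarrow> (\<Sum>c<n. g c b z * v c) = 0" and c: "c < n"
  shows "v c = 0"
proof (rule ccontr)
  assume "v c \<noteq> 0"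
  then have "Re (bergman_form n D z v) > 0"
    using well_defined z c unfolding bergman_metric_well_defined_def by blast
  moreover have "bergman_form n D z v = (\<Sum>j<n. (\<Sum>i<n. g i j z * v i) * cnj (v j))"
    unfolding bergman_form_def by (subst sum.swap) (simp add: sum_distrib_right)
  ultimately show False by (simp add: v)
qed

definition "H = (SOME H. (\<forall>a<n. \<forall>b<n. smooth (H a b)) \<and>
    (\<forall>z\<in>D. \<forall>a<n. \<forall>c<n. (\<Sum>b<n. H a b z * g c b z) = (if a = c then 1 else 0)) \<and>
    (\<forall>z\<in>D. \<forall>b<n. \<forall>d<n. (\<Sum>a<n. g a b z * H a d z) = (if b = d then 1 else 0)))"

lemma
  shows smooth_H: "a < n \<Longrightarrow> b < n \<Longrightarrow> smooth (H a b)"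
    and H_g: "z \<in> D \<Longrightarrow> a < n \<Longrightarrow> c < n \<Longrightarrow> (\<Sum>b<n. H a b z * g c b z) = (if a = c then 1 else 0)"
    and g_H: "z \<in> D \<Longrightarrow> b < n \<Longrightarrow> d < n \<Longrightarrow> (\<Sum>a<n. g a b z * H a d z) = (if b = d then 1 else 0)"
proof -
  have "\<exists>H. (\<forall>a<n. \<forall>b<n. smooth (H a b)) \<and>
    (\<forall>z\<in>D. \<forall>a<n. \<forall>c<n. (\<Sum>b<n. H a b z * g c b z) = (if a = c then 1 else 0)) \<and>
    (\<forall>z\<in>D. \<forall>b<n. \<forall>d<n. (\<Sum>a<n. g a b z * H a d z) = (if b = d then 1 else 0))"
  proof (rule smooth_inverse_matrix[of g])
    show "smooth (g i j)" if "i < n" "j < n" for i j using smooth_g that .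
    show "v c = 0" if "z \<in> D" "\<And>b. b < n \<Longrightarrow> (\<Sum>c<n. g c b z * v c) = 0" "c < n" for z v c
      by (rule g_nondegenerate[OF that(1) _ that(3)]) (rule that(2))
  qed blast
  from someI_ex[OF this, folded H_def]
  show "a < n \<Longrightarrow> b < n \<Longrightarrow> smooth (H a b)"
    "z \<in> D \<Longrightarrow> a < n \<Longrightarrow> c < n \<Longrightarrow> (\<Sum>b<n. H a b z * g c b z) = (if a = c then 1 else 0)"
    "z \<in> D \<Longrightarrow> b < n \<Longrightarrow> d < n \<Longrightarrow> (\<Sum>a<n. g a b z * H a d z) = (if b = d then 1 else 0)" by blast+
qed

lemma contract_H:
  assumes "z \<in> D" "d < n" "\<And>j. j < n \<Longrightarrow> (\<Sum>a<n. x a * g a j z) = (\<Sum>a<n. y a * g a j z)"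
  shows "x d = y d"
proof -
  have *: "(\<Sum>j<n. H d j z * (\<Sum>a<n. x a * g a j z)) = x d" for x :: "nat \<Rightarrow> complex"
  proof -
    have "(\<Sum>j<n. H d j z * (\<Sum>a<n. x a * g a j z)) = (\<Sum>j<n. \<Sum>a<n. x a * (H d j z * g a j z))"
      by (simp add: sum_distrib_left mult_ac)
    also have "\<dots> = (\<Sum>a<n. x a * (\<Sum>j<n. H d j z * g a j z))"
      by (subst sum.swap) (simp add: sum_distrib_left)
    also have "\<dots> = (\<Sum>a<n. x a * (if d = a then 1 else 0))"
      using assms by (intro sum.cong refl) (simp add: H_g)
    also have "\<dots> = x d" using assms by (simp add: if_distrib[of "\<lambda>x. _ * x"] cong: if_cong)
    finally show ?thesis .
  qed
  have "x d = (\<Sum>j<n. H d j z * (\<Sum>a<n. x a * g a j z))" by (rule *[symmetric])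
  also have "\<dots> = (\<Sum>j<n. H d j z * (\<Sum>a<n. y a * g a j z))"
    by (intro sum.cong refl) (simp add: assms(3))
  also have "\<dots> = y d" by (rule *)
  finally show ?thesis .
qed

text \<open>The entries of an inverse matrix are determined by one of the two defining identities, so the matrix
  chosen by \<open>bergman_g_inv\<close> is \<open>H\<close>, which is smooth.\<close>

lemma bergman_g_inv_eq:
  assumes "z \<in> D" "a < n" "b < n"
  shows "bergman_g_inv n D z a b = H a b z"
proof -
  define H' where "H' = bergman_g_inv n D z"
  have "\<forall>a<n. \<forall>c<n. (\<Sum>b<n. H' a b * g c b z) = (if a = c then 1 else 0)"
    unfolding H'_def bergman_g_inv_def
    by (rule someI[of _ "\<lambda>a b. H a b z"]) (use H_g[OF assms(1)] in blast)
  then have H': "(\<Sum>b<n. H' a b * g c b z) = (if a = c then 1 else 0)" if "c < n" for c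
    using that assms(2) by blast
  have *: "(\<Sum>c<n. (\<Sum>d<n. x d * g c d z) * H c b z) = x b" for x :: "nat \<Rightarrow> complex"
  proof -
    have "(\<Sum>c<n. (\<Sum>d<n. x d * g c d z) * H c b z) = (\<Sum>d<n. x d * (\<Sum>c<n. g c d z * H c b z))"
      by (simp add: sum_distrib_left sum_distrib_right mult_ac, subst sum.swap, simp)
    also have "\<dots> = x b" using assms by (simp add: g_H if_distrib[of "\<lambda>x. _ * x"] cong: if_cong)
    finally show ?thesis .
  qed
  have "H' a b = (\<Sum>c<n. (\<Sum>d<n. H' a d * g c d z) * H c b z)" by (rule *[symmetric])
  also have "\<dots> = (\<Sum>c<n. (\<Sum>d<n. H a d z * g c d z) * H c b z)"
    using assms by (intro sum.cong refl) (simp add: H' H_g)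
  also have "\<dots> = H a b z" by (rule *)
  finally show ?thesis by (simp add: H'_def)
qed

text \<open>The Christoffel symbols: \<open>wb b (G i k)\<close> is \<open>\<partial>\<^sub>k g\<^sub>i\<^sub>b\<close>, the metric being a potential.\<close>

definition "\<Gamma> a i k z = (\<Sum>b<n. H a b z * wb b (G i k) z)"

lemma smooth_\<Gamma>: "a < n \<Longrightarrow> i < n \<Longrightarrow> k < n \<Longrightarrow> smooth (\<Gamma> a i k)"
  unfolding \<Gamma>_def[abs_def] by (intro smooth_sum kalg_mult smooth_H smooth_wb smooth_G) auto

lemma \<Gamma>_g:
  assumes "i < n" "k < n" "j < n" "z \<in> D"
  shows "(\<Sum>a<n. \<Gamma> a i k z * g a j z) = wb j (G i k) z"
proof -
  have "(\<Sum>a<n. \<Gamma> a i k z * g a j z) = (\<Sum>b<n. wb b (G i k) z * (\<Sum>a<n. g a j z * H a b z))"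
    unfolding \<Gamma>_def by (simp add: sum_distrib_left sum_distrib_right mult_ac, subst sum.swap, simp)
  then show ?thesis using assms by (simp add: g_H if_distrib[of "\<lambda>x. _ * x"] cong: if_cong)
qed

lemma curvature_formula:
  assumes "i < n" "j < n" "k < n" "l < n" "z \<in> D"
  shows "bergman_curvature n D i j k l z
    = - wb l (wb j (G i k)) z + (\<Sum>a<n. \<Gamma> a i k z * wb l (wb j (p a)) z)"
proof -
  have 1: "w k (g i b) y = wb b (G i k) y" if "b < n" "y \<in> D" for b y
    using w_cong[OF assms(3) that(2), of "g i b" "wb b (p i)"] that assms
    by (simp add: g_eq commute smooth_p G_def)
  have "w k (wb l (g i j)) z = w k (wb l (wb j (p i))) z"
    by (rule w_cong[OF assms(3,5)], rule wb_cong[OF assms(4)]) (use assms in \<open>auto simp: g_eq\<close>)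
  also have "\<dots> = wb l (w k (wb j (p i))) z"
    using assms by (simp add: commute smooth_p smooth_wb)
  also have "\<dots> = wb l (wb j (G i k)) z"
    unfolding G_def by (rule wb_cong[OF assms(4,5)]) (use assms in \<open>auto simp: commute smooth_p\<close>)
  finally have 2: "w k (wb l (g i j)) z = wb l (wb j (G i k)) z" .
  have 3: "wb l (g a j) z = wb l (wb j (p a)) z" if "a < n" for a
    by (rule wb_cong[OF assms(4,5)]) (use assms that in \<open>auto simp: g_eq\<close>)
  show ?thesis
    unfolding bergman_curvature_def 2 \<Gamma>_def
    using assms by (simp add: 1 3 bergman_g_inv_eq sum_distrib_right)
qed

text \<open>The classical \<open>R = - \<partial>-bar \<Gamma>\<close> with the upper index lowered.\<close>

lemma curvature_eq:
  assumes "i < n" "j < n" "k < n" "l < n" "z \<in> D"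
  shows "bergman_curvature n D i j k l z = - (\<Sum>a<n. wb l (\<Gamma> a i k) z * g a j z)"
proof -
  have "wb l (wb j (G i k)) z = wb l (\<lambda>z. \<Sum>a<n. \<Gamma> a i k z * g a j z) z"
    by (rule wb_cong[OF assms(4,5)]) (use assms in \<open>auto simp: \<Gamma>_g\<close>)
  also have "\<dots> = (\<Sum>a<n. wb l (\<Gamma> a i k) z * g a j z + \<Gamma> a i k z * wb l (g a j) z)"
    using assms by (subst wb_rules(4)) (auto intro!: kalg_mult sum.cong simp: wb_rules smooth_\<Gamma> smooth_g)
  also have "\<dots> = (\<Sum>a<n. wb l (\<Gamma> a i k) z * g a j z) + (\<Sum>a<n. \<Gamma> a i k z * wb l (wb j (p a)) z)"
    unfolding sum.distrib
    by (intro arg_cong2[where f = "(+)"] sum.cong refl arg_cong2[where f = "(*)"], rule wb_cong[OF assms(4,5)])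
       (use assms in \<open>auto simp: g_eq\<close>)
  finally show ?thesis using curvature_formula[OF assms] by simp
qed

lemma curvature_sym:
  assumes "i < n" "j < n" "k < n" "l < n" "z \<in> D"
  shows "bergman_curvature n D i j k l z = bergman_curvature n D k j i l z"
    and "bergman_curvature n D i j k l z = bergman_curvature n D i l k j z"
proof -
  have "\<Gamma> a i k y = \<Gamma> a k i y" if "y \<in> D" for a y
    unfolding \<Gamma>_def
    by (intro sum.cong refl arg_cong2[where f = "(*)"], rule wb_cong) (use that assms G_sym in auto)
  then have "wb l (\<Gamma> a i k) z = wb l (\<Gamma> a k i) z" for a
    by (intro wb_cong[OF assms(4,5)])
  then show "bergman_curvature n D i j k l z = bergman_curvature n D k j i l z"
    using assms by (simp add: curvature_eq)
  show "bergman_curvature n D i j k l z = bergman_curvature n D i l k j z"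
    using assms by (simp add: curvature_formula commute(2) smooth_G smooth_p)
qed

lemma form_power2:
  "(bergman_form n D z X)\<^sup>2 = quartic n (\<lambda>i j k l. g i j z * g k l z) X X X X"
proof -
  define F where "F = bergman_form n D z X"
  have F: "F = (\<Sum>k<n. \<Sum>l<n. g k l z * X k * cnj (X l))" by (simp add: F_def bergman_form_def)
  have "F * F = (\<Sum>i<n. \<Sum>j<n. g i j z * X i * cnj (X j) * F)"
    by (subst (1) F) (simp add: sum_distrib_right)
  also have "\<dots> = quartic n (\<lambda>i j k l. g i j z * g k l z) X X X X"
    unfolding quartic_def by (subst F) (simp add: sum_distrib_left mult_ac)
  finally show ?thesis by (simp add: F_def power2_eq_square)
qed

lemma quartic_swap:
  "quartic n (\<lambda>i j k l. g i l z * g k j z) X X X X = quartic n (\<lambda>i j k l. g i j z * g k l z) X X X X"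
proof -
  have "quartic n (\<lambda>i j k l. g i l z * g k j z) X X X X
     = (\<Sum>i<n. \<Sum>k<n. \<Sum>j<n. \<Sum>l<n. g i l z * g k j z * X i * cnj (X j) * X k * cnj (X l))"
    unfolding quartic_def by (intro sum.cong refl sum.swap)
  also have "\<dots> = (\<Sum>i<n. \<Sum>k<n. \<Sum>l<n. \<Sum>j<n. g i l z * g k j z * X i * cnj (X j) * X k * cnj (X l))"
    by (intro sum.cong refl sum.swap)
  also have "\<dots> = (\<Sum>i<n. \<Sum>l<n. \<Sum>k<n. \<Sum>j<n. g i l z * g k j z * X i * cnj (X j) * X k * cnj (X l))"
    by (intro sum.cong refl sum.swap)
  also have "\<dots> = quartic n (\<lambda>i j k l. g i j z * g k l z) X X X X"
    unfolding quartic_def by (intro sum.cong refl) (simp add: mult_ac)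
  finally show ?thesis .
qed

lemma quartic_lincomb:
  "quartic n (\<lambda>i j k l. S i j k l - c * (T i j k l + U i j k l)) X Y Z W
    = quartic n S X Y Z W - c * (quartic n T X Y Z W + quartic n U X Y Z W)"
  unfolding quartic_def by (simp add: sum_subtractf sum.distrib sum_distrib_left algebra_simps)

text \<open>The difference of the two sides is a quartic form with the symmetries of a curvature tensor of a Kaehler
  metric, and it vanishes on the diagonal by hypothesis, hence \<open>quartic_polarization\<close> applies.\<close>

lemma curvature_of_constant_hsc:
  assumes hsc: "bergman_constant_hsc n D c" and ijkl: "i < n" "j < n" "k < n" "l < n" and z: "z \<in> D"
  shows "bergman_curvature n D i j k l z = c / 2 * (g i j z * g k l z + g i l z * g k j z)"
proof -
  let ?S = "\<lambda>i j k l. bergman_curvature n D i j k l z - c / 2 * (g i j z * g k l z + g i l z * g k j z)"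
  have "?S i j k l = 0"
  proof (rule quartic_polarization[where n = n and S = ?S])
    fix X :: "nat \<Rightarrow> complex"
    show "quartic n ?S X X X X = 0"
    proof (cases "\<exists>i<n. X i \<noteq> 0")
      case True
      then have "Re (bergman_form n D z X) > 0"
        using well_defined z unfolding bergman_metric_well_defined_def by blast
      then have nz: "bergman_form n D z X \<noteq> 0" by auto
      have "holomorphic_sectional_curvature n D z X = c"
        using hsc True z unfolding bergman_constant_hsc_def by blast
      then have "quartic n (\<lambda>i j k l. bergman_curvature n D i j k l z) X X X X = c * (bergman_form n D z X)\<^sup>2"
        using nz unfolding holomorphic_sectional_curvature_def quartic_def by (simp add: divide_eq_eq)
      then show ?thesis unfolding quartic_lincomb quartic_swap form_power2 by simp
    next
      case False
      then show ?thesis unfolding quartic_def by simp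
    qed
  qed (use ijkl z in \<open>auto simp: curvature_sym add.commute mult.commute curvature_sym(2)\<close>)
  then show ?thesis by simp
qed

lemma constant_hsc_of_curvature:
  assumes curv: "\<And>i j k l z. i < n \<Longrightarrow> j < n \<Longrightarrow> k < n \<Longrightarrow> l < n \<Longrightarrow> z \<in> D \<Longrightarrow>
      bergman_curvature n D i j k l z = g i j z * g k l z + g i l z * g k j z"
  shows "bergman_constant_hsc n D 2"
  unfolding bergman_constant_hsc_def
proof (intro ballI allI impI)
  fix z X assume z: "z \<in> D" and X: "\<exists>i<n. X i \<noteq> (0::complex)"
  then have "Re (bergman_form n D z X) > 0"
    using well_defined z unfolding bergman_metric_well_defined_def by blast
  then have nz: "bergman_form n D z X \<noteq> 0" by auto
  have "quartic n (\<lambda>i j k l. bergman_curvature n D i j k l z) X X X X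
     = quartic n (\<lambda>i j k l. 0 - (-1) * (g i j z * g k l z + g i l z * g k j z)) X X X X"
    unfolding quartic_def by (intro sum.cong refl) (simp add: curv z)
  also have "\<dots> = 2 * (bergman_form n D z X)\<^sup>2"
    unfolding quartic_lincomb quartic_swap form_power2 by (simp add: quartic_def)
  finally show "holomorphic_sectional_curvature n D z X = complex_of_real 2"
    using nz unfolding holomorphic_sectional_curvature_def quartic_def by simp
qed

text \<open>When the second derivatives of the members of the family vanish, \<open>K\<close> is a Hermitian
  quadratic polynomial and the metric is a Fubini-Study metric.\<close>

lemma constant_hsc_2_of_affine:
  assumes aff: "\<And>j i k z. j \<in> B \<Longrightarrow> i < n \<Longrightarrow> k < n \<Longrightarrow> z \<in> D \<Longrightarrow> cpd k (cpd i (f j)) z = 0"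
  shows "bergman_constant_hsc n D 2"
proof (rule constant_hsc_of_curvature)
  fix i j k l z
  assume ijkl: "i < n" "j < n" "k < n" "l < n" and z: "z \<in> D"
  \<comment> \<open>the equation \<open>\<partial>\<^sub>k \<partial>\<^sub>i K = 0\<close>, divided by \<open>K\<close>\<close>
  have G: "G i k y = - p i y * p k y" if y: "y \<in> D" for y
  proof -
    have "w k (w i K) y = w k (pairing B (\<lambda>j. cpd i (f j)) f) y"
      unfolding K_def by (rule w_cong[OF ijkl(3) y]) (use dop_pairing[OF fam fam, of "(i, False)"] ijkl in auto)
    also have "\<dots> = pairing B (\<lambda>j. cpd k (cpd i (f j))) f y"
      using dop_pairing[OF hol_family_cpd[OF fam ijkl(1)] fam, of "(k, False)"] ijkl y by auto
    also have "\<dots> = pairing B (\<lambda>j z. 0) f y" by (rule pairing_cong) (auto simp: aff ijkl y)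
    also have "\<dots> = 0" by (simp add: pairing_def l2pair_def)
    finally show ?thesis
      unfolding G_def p_def[abs_def] using dop_divide[of "w i K" K "(k, False)" y] ijkl y
      by (simp add: smooth_w smooth_K K_nonzero power2_eq_square)
  qed
  have \<Gamma>: "\<Gamma> a i k y = - (if a = i then 1 else 0) * p k y - (if a = k then 1 else 0) * p i y"
    if y: "y \<in> D" and a: "a < n" for a y
  proof -
    have "\<Gamma> a i k y = (\<Sum>b<n. H a b y * - (g i b y * p k y + p i y * g k b y))"
      unfolding \<Gamma>_def
    proof (intro sum.cong refl arg_cong2[where f = "(*)"])
      fix b assume b: "b \<in> {..<n}"
      have "wb b (G i k) y = wb b (\<lambda>z. (-1) * (p i z * p k z)) y"
        by (rule wb_cong) (use b y G in auto)
      then show "wb b (G i k) y = - (g i b y * p k y + p i y * g k b y)"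
        using b y ijkl wb_rules(6)[of "\<lambda>z. p i z * p k z" b y "-1"]
        by (simp add: wb_rules smooth_p kalg_mult g_eq algebra_simps)
    qed
    also have "\<dots> = - p k y * (\<Sum>b<n. H a b y * g i b y) - p i y * (\<Sum>b<n. H a b y * g k b y)"
      by (simp add: sum_distrib_left sum.distrib sum_negf sum_subtractf algebra_simps)
    finally show ?thesis using ijkl y a by (simp add: H_g)
  qed
  have "wb l (\<Gamma> a i k) z = - (if a = i then 1 else 0) * g k l z - (if a = k then 1 else 0) * g i l z"
    if a: "a < n" for a
  proof -
    have "wb l (\<Gamma> a i k) z = wb l (\<lambda>y. - (if a = i then 1 else 0) * p k y - (if a = k then 1 else 0) * p i y) z"
      by (rule wb_cong[OF ijkl(4) z]) (use \<Gamma> a in auto)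
    also have "\<dots> = - (if a = i then 1 else 0) * g k l z - (if a = k then 1 else 0) * g i l z"
      by (subst wb_rules(3), (intro kalg_mult kalg_const smooth_p ijkl z)+)
         (simp only: wb_rules(6)[OF smooth_p[OF ijkl(3)] ijkl(4) z] wb_rules(6)[OF smooth_p[OF ijkl(1)] ijkl(4) z]
            g_eq ijkl z)
    finally show ?thesis .
  qed
  then have "bergman_curvature n D i j k l z
      = - (\<Sum>a<n. (- (if a = i then 1 else 0) * g k l z - (if a = k then 1 else 0) * g i l z) * g a j z)"
    unfolding curvature_eq[OF ijkl z] by simp
  also have "\<dots> = (\<Sum>a<n. (if a = i then g k l z * g a j z else 0)) + (\<Sum>a<n. (if a = k then g i l z * g a j z else 0))"
    unfolding sum.distrib[symmetric] sum_negf[symmetric] by (intro sum.cong refl) auto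
  also have "\<dots> = g i j z * g k l z + g i l z * g k j z" using ijkl by simp
  finally show "bergman_curvature n D i j k l z = g i j z * g k l z + g i l z * g k j z" .
qed

end

section \<open>The linear system carried by a metric of constant positive curvature\<close>

definition cpds :: "nat list \<Rightarrow> ((nat \<Rightarrow> complex) \<Rightarrow> complex) \<Rightarrow> (nat \<Rightarrow> complex) \<Rightarrow> complex" where
  "cpds xs = fold cpd xs"

definition wbs :: "nat list \<Rightarrow> ((nat \<Rightarrow> complex) \<Rightarrow> complex) \<Rightarrow> (nat \<Rightarrow> complex) \<Rightarrow> complex" where
  "wbs ys = fold wirtinger_bar ys"

lemma cpds_simps [simp]: "cpds [] u = u" "cpds (x # xs) u = cpds xs (cpd x u)"
  "cpds (xs @ [x]) u = cpd x (cpds xs u)"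
  by (simp_all add: cpds_def)

lemma wbs_simps [simp]: "wbs [] u = u" "wbs (x # xs) u = wbs xs (wirtinger_bar x u)"
  by (simp_all add: wbs_def)

lemma hol_family_cpds:
  "hol_family n D B u \<Longrightarrow> set xs \<subseteq> {..<n} \<Longrightarrow> hol_family n D B (\<lambda>j. cpds xs (u j))"
  by (induction xs arbitrary: u) (auto intro: hol_family_cpd)

lemma l2b_add: "l2b B x M \<Longrightarrow> l2b B y N \<Longrightarrow> l2b B (\<lambda>j. x j + y j) (M + N)"
  unfolding l2b_def
proof (intro conjI allI impI; (elim conjE)?)
  fix F assume a: "finite F" "F \<subseteq> B" "0 \<le> M" "0 \<le> N"
    "\<forall>F. finite F \<longrightarrow> F \<subseteq> B \<longrightarrow> (\<Sum>j\<in>F. (cmod (x j))\<^sup>2) \<le> M\<^sup>2"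
    "\<forall>F. finite F \<longrightarrow> F \<subseteq> B \<longrightarrow> (\<Sum>j\<in>F. (cmod (y j))\<^sup>2) \<le> N\<^sup>2"
  have "L2_set (\<lambda>j. cmod (x j + y j)) F \<le> L2_set (\<lambda>j. cmod (x j) + cmod (y j)) F"
    by (rule L2_set_mono) (auto intro: norm_triangle_ineq)
  also have "\<dots> \<le> L2_set (\<lambda>j. cmod (x j)) F + L2_set (\<lambda>j. cmod (y j)) F" by (rule L2_set_triangle_ineq)
  also have "\<dots> \<le> M + N"
    unfolding L2_set_def using a by (intro add_mono real_le_lsqrt) (auto intro!: sum_nonneg)
  finally have "(L2_set (\<lambda>j. cmod (x j + y j)) F)\<^sup>2 \<le> (M + N)\<^sup>2"
    by (intro power_mono) auto
  then show "(\<Sum>j\<in>F. (cmod (x j + y j))\<^sup>2) \<le> (M + N)\<^sup>2"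
    by (simp add: L2_set_def sum_nonneg)
qed auto

lemma l2b_cmult: "l2b B x M \<Longrightarrow> l2b B (\<lambda>j. a * x j) (cmod a * M)"
  unfolding l2b_def
  by (auto simp: norm_mult power_mult_distrib sum_distrib_left[symmetric] intro!: mult_left_mono)

lemma l2b_const0: "l2b B (\<lambda>j. 0) 0"
  unfolding l2b_def by simp

lemma l2pair_cnj: "l2pair B x y = cnj (l2pair B y x)"
  unfolding l2pair_def infsum_cnj[symmetric] by (simp add: mult.commute)

lemma l2pair_lincomb:
  assumes x: "\<And>a xs. (a, xs) \<in> set L \<Longrightarrow> \<exists>M. l2b B (x xs) M" and y: "l2b B y N"
  shows "\<exists>M. l2b B (\<lambda>j. \<Sum>(a, xs)\<leftarrow>L. a * x xs j) M"
    and "l2pair B (\<lambda>j. \<Sum>(a, xs)\<leftarrow>L. a * x xs j) y = (\<Sum>(a, xs)\<leftarrow>L. a * l2pair B (x xs) y)"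
proof -
  have "(\<exists>M. l2b B (\<lambda>j. \<Sum>(a, xs)\<leftarrow>L. a * x xs j) M) \<and>
    l2pair B (\<lambda>j. \<Sum>(a, xs)\<leftarrow>L. a * x xs j) y = (\<Sum>(a, xs)\<leftarrow>L. a * l2pair B (x xs) y)"
    using x
  proof (induction L)
    case Nil
    show ?case using l2b_const0[of B] by (auto simp: l2pair_def)
  next
    case (Cons p L)
    obtain a xs where p: "p = (a, xs)" by (cases p)
    obtain M where M: "l2b B (x xs) M" using Cons.prems[of a xs] p by auto
    obtain M' where M': "l2b B (\<lambda>j. \<Sum>(a, xs)\<leftarrow>L. a * x xs j) M'" using Cons by auto
    have "((\<lambda>j. (a * x xs j) * cnj (y j) + (\<Sum>(a, xs)\<leftarrow>L. a * x xs j) * cnj (y j)) has_sum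
       (a * l2pair B (x xs) y + l2pair B (\<lambda>j. \<Sum>(a, xs)\<leftarrow>L. a * x xs j) y)) B"
      using has_sum_add[OF has_sum_cmult_right[OF l2b_summable(2)[OF M y], of a] l2b_summable(2)[OF M' y]]
      by (simp add: mult_ac)
    then have "l2pair B (\<lambda>j. \<Sum>(a, xs)\<leftarrow>p # L. a * x xs j) y
      = a * l2pair B (x xs) y + l2pair B (\<lambda>j. \<Sum>(a, xs)\<leftarrow>L. a * x xs j) y"
      unfolding l2pair_def[of B "\<lambda>j. \<Sum>(a, xs)\<leftarrow>p # L. a * x xs j"]
      by (intro infsumI) (simp add: p algebra_simps)
    moreover have "l2b B (\<lambda>j. a * x xs j + (\<Sum>(a, xs)\<leftarrow>L. a * x xs j)) (cmod a * M + M')"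
      by (intro l2b_add l2b_cmult M M')
    ultimately show ?case using Cons by (auto simp: p)
  qed
  then show "\<exists>M. l2b B (\<lambda>j. \<Sum>(a, xs)\<leftarrow>L. a * x xs j) M"
    and "l2pair B (\<lambda>j. \<Sum>(a, xs)\<leftarrow>L. a * x xs j) y = (\<Sum>(a, xs)\<leftarrow>L. a * l2pair B (x xs) y)" by auto
qed

lemma l2b_self_zero:
  assumes x: "l2b B x M" and neg: "l2pair B x x = of_real s" "s \<le> 0" and j: "j \<in> B"
  shows "x j = 0"
proof -
  have "((\<lambda>j. x j * cnj (x j)) has_sum of_real s) B" using l2b_summable(2)[OF x x] neg by simp
  then have "((\<lambda>j. complex_of_real ((cmod (x j))\<^sup>2)) has_sum of_real s) B"
    by (simp only: complex_norm_square)
  then have hs: "((\<lambda>j. (cmod (x j))\<^sup>2) has_sum s) B" by (simp only: has_sum_of_real_iff)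
  have "(\<Sum>j\<in>{j}. (cmod (x j))\<^sup>2) \<le> s"
    by (rule finite_sum_le_has_sum[OF hs]) (use j in auto)
  then have "(cmod (x j))\<^sup>2 \<le> s" by simp
  with neg(2) have "(cmod (x j))\<^sup>2 \<le> 0" by linarith
  then show ?thesis by simp
qed

context kernel_metric
begin

text \<open>Holomorphic members of the algebra generated by pairings.\<close>

definition "hol h \<longleftrightarrow> smooth h \<and> (\<forall>l<n. \<forall>z\<in>D. wb l h z = 0)"

lemma hol_const: "hol (\<lambda>_. a)"
  unfolding hol_def by (auto intro: kalg_const simp: wb_rules)

lemma hol_add: "hol h \<Longrightarrow> hol h' \<Longrightarrow> hol (\<lambda>z. h z + h' z)"
  unfolding hol_def by (auto intro: kalg_add simp: wb_rules)

lemma hol_mult: "hol h \<Longrightarrow> hol h' \<Longrightarrow> hol (\<lambda>z. h z * h' z)"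
  unfolding hol_def by (auto intro: kalg_mult simp: wb_rules)

lemma hol_diff: "hol h \<Longrightarrow> hol h' \<Longrightarrow> hol (\<lambda>z. h z - h' z)"
  unfolding hol_def by (auto intro: smooth_diff simp: wb_rules)

lemma hol_sum: "(\<And>a. a \<in> A \<Longrightarrow> hol (h a)) \<Longrightarrow> hol (\<lambda>z. \<Sum>a\<in>A. h a z)"
  unfolding hol_def by (auto intro: smooth_sum simp: wb_rules)

lemma hol_w:
  assumes "hol h" "i < n"
  shows "hol (w i h)"
  unfolding hol_def
proof (intro conjI allI impI ballI)
  show "smooth (w i h)" using assms unfolding hol_def by (auto intro: smooth_w)
  fix l z assume l: "l < n" and z: "z \<in> D"
  have "wb l (w i h) z = w i (wb l h) z" using assms l z unfolding hol_def by (auto simp: commute)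
  also have "\<dots> = w i (\<lambda>_. 0) z" by (rule w_cong) (use assms l z in \<open>auto simp: hol_def\<close>)
  also have "\<dots> = 0" by (simp add: w_rules)
  finally show "wb l (w i h) z = 0" .
qed

lemma hol_smooth: "hol h \<Longrightarrow> smooth h"
  unfolding hol_def by blast

lemma wbs_cong:
  "set ys \<subseteq> {..<n} \<Longrightarrow> z \<in> D \<Longrightarrow> (\<And>y. y \<in> D \<Longrightarrow> F y = F' y) \<Longrightarrow> wbs ys F z = wbs ys F' z"
proof (induction ys arbitrary: F F')
  case (Cons l ys)
  show ?case unfolding wbs_simps
    by (rule Cons.IH) (use Cons.prems in \<open>auto intro!: wb_cong\<close>)
qed simp

lemma wbs_pairing:
  assumes "hol_family n D B u" "hol_family n D B v" "set ys \<subseteq> {..<n}" "z \<in> D"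
  shows "wbs ys (pairing B u v) z = pairing B u (\<lambda>j. cpds ys (v j)) z"
  using assms(2,3)
proof (induction ys arbitrary: v)
  case (Cons l ys)
  have "wbs ys (wb l (pairing B u v)) z = wbs ys (pairing B u (\<lambda>j. cpd l (v j))) z"
    by (rule wbs_cong) (use Cons.prems assms dop_pairing[OF assms(1) Cons.prems(1), of "(l, True)"] in auto)
  then show ?case using Cons.IH[OF hol_family_cpd[OF Cons.prems(1), of l]] Cons.prems by simp
qed simp

lemma wbs_add:
  assumes "smooth F" "smooth F'" "set ys \<subseteq> {..<n}" "z \<in> D"
  shows "wbs ys (\<lambda>z. F z + F' z) z = wbs ys F z + wbs ys F' z"
  using assms(1-3)
proof (induction ys arbitrary: F F')
  case (Cons l ys)
  have "wbs ys (wb l (\<lambda>z. F z + F' z)) z = wbs ys (\<lambda>z. wb l F z + wb l F' z) z"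
    by (rule wbs_cong) (use Cons.prems assms in \<open>auto simp: wb_rules\<close>)
  then show ?case using Cons by (simp add: smooth_wb)
qed simp

text \<open>Holomorphic factors are constants for the barred derivatives.\<close>

lemma wbs_hol_mult:
  assumes "smooth F" "hol h" "set ys \<subseteq> {..<n}" "z \<in> D"
  shows "wbs ys (\<lambda>z. h z * F z) z = h z * wbs ys F z"
  using assms(1,3)
proof (induction ys arbitrary: F)
  case (Cons l ys)
  have "wbs ys (wb l (\<lambda>z. h z * F z)) z = wbs ys (\<lambda>z. h z * wb l F z) z"
    by (rule wbs_cong) (use Cons.prems assms in \<open>auto simp: wb_rules hol_smooth hol_def\<close>)
  then show ?case using Cons by (simp add: smooth_wb)
qed simp

text \<open>The derivative \<open>\<partial>\<^sub>x\<^sub>s K\<close>, which falls on the holomorphic factor of the pairing only.\<close>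

definition "dk xs = pairing B (\<lambda>j. cpds xs (f j)) f"

lemma smooth_dk: "set xs \<subseteq> {..<n} \<Longrightarrow> smooth (dk xs)"
  unfolding dk_def by (intro kalg_pairing hol_family_cpds fam)

lemma w_dk:
  assumes "set xs \<subseteq> {..<n}" "i < n" "z \<in> D"
  shows "w i (dk xs) z = dk (xs @ [i]) z"
  unfolding dk_def using dop_pairing[OF hol_family_cpds[OF fam assms(1)] fam, of "(i, False)"] assms by simp

text \<open>Results of applying to \<open>K\<close> a differential operator in the \<open>\<partial>\<^sub>i\<close>, of order less than \<open>m\<close>,
  whose coefficients are holomorphic. Holomorphic coefficients let such operators pass through all
  \<open>\<partial>\<^sub>l\<close>-bar.\<close>

inductive Op :: "nat \<Rightarrow> ((nat \<Rightarrow> complex) \<Rightarrow> complex) \<Rightarrow> bool" where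
  Op_base: "hol h \<Longrightarrow> length xs < m \<Longrightarrow> set xs \<subseteq> {..<n} \<Longrightarrow> Op m (\<lambda>z. h z * dk xs z)"
| Op_zero: "Op m (\<lambda>_. 0)"
| Op_add: "Op m F \<Longrightarrow> Op m F' \<Longrightarrow> Op m (\<lambda>z. F z + F' z)"
| Op_cong: "Op m F \<Longrightarrow> (\<And>z. z \<in> D \<Longrightarrow> F' z = F z) \<Longrightarrow> Op m F'"

lemma Op_smooth: "Op m F \<Longrightarrow> smooth F"
  by (induction rule: Op.induct) (auto intro: kalg_mult kalg_const kalg_add kalg_cong hol_smooth smooth_dk)

lemma Op_mono: "Op m F \<Longrightarrow> m \<le> m' \<Longrightarrow> Op m' F"
  by (induction rule: Op.induct) (auto intro: Op.intros)

lemma Op_hol_mult: "Op m F \<Longrightarrow> hol h \<Longrightarrow> Op m (\<lambda>z. h z * F z)"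
proof (induction rule: Op.induct)
  case (Op_base h' xs m)
  then have "Op m (\<lambda>z. (h z * h' z) * dk xs z)" by (intro Op.Op_base hol_mult)
  then show ?case by (simp add: mult.assoc)
next
  case (Op_zero m)
  then show ?case by (simp add: Op.Op_zero)
next
  case (Op_add m F F')
  then have "Op m (\<lambda>z. h z * F z + h z * F' z)" by (intro Op.Op_add)
  then show ?case by (simp add: algebra_simps)
next
  case (Op_cong m F F')
  show ?case by (rule Op.Op_cong[OF Op_cong.IH[OF Op_cong.prems]]) (simp add: Op_cong.hyps)
qed

lemma Op_w: "Op m F \<Longrightarrow> i < n \<Longrightarrow> Op (Suc m) (w i F)"
proof (induction rule: Op.induct)
  case (Op_base h xs m)
  have "Op (Suc m) (\<lambda>z. w i h z * dk xs z + h z * dk (xs @ [i]) z)"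
    using Op_base by (intro Op.Op_add Op.Op_base hol_w) auto
  then show ?case
    by (rule Op.Op_cong) (use Op_base in \<open>simp add: w_rules hol_smooth smooth_dk w_dk\<close>)
next
  case (Op_zero m)
  show ?case by (rule Op.Op_cong[OF Op.Op_zero]) (simp add: w_rules)
next
  case (Op_add m F F')
  show ?case
    by (rule Op.Op_cong[OF Op.Op_add[OF Op_add.IH]]) (use Op_add in \<open>auto simp: w_rules Op_smooth\<close>)
next
  case (Op_cong m F F')
  show ?case by (rule Op.Op_cong[OF Op_cong.IH]) (use Op_cong in \<open>auto intro: w_cong\<close>)
qed

text \<open>An operator with holomorphic coefficients acts on \<open>K = \<Sum> f\<^sub>j f\<^sub>j-bar\<close> through the first factors, barred
  derivatives act through the second ones. At a fixed point the operator thus becomes a list \<open>L\<close> of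
  coefficients and derivatives, which does not depend on the barred derivatives taken afterwards.\<close>

lemma Op_jet:
  assumes "Op m F" and z: "z \<in> D"
  shows "\<exists>L. (\<forall>(a, xs)\<in>set L. length xs < m \<and> set xs \<subseteq> {..<n}) \<and>
    (\<forall>ys. set ys \<subseteq> {..<n} \<longrightarrow>
       wbs ys F z = (\<Sum>(a, xs)\<leftarrow>L. a * l2pair B (\<lambda>j. cpds xs (f j) z) (\<lambda>j. cpds ys (f j) z)))"
  using assms(1)
proof (induction rule: Op.induct)
  case (Op_base h xs m)
  have "wbs ys (\<lambda>z. h z * dk xs z) z = h z * l2pair B (\<lambda>j. cpds xs (f j) z) (\<lambda>j. cpds ys (f j) z)"
    if "set ys \<subseteq> {..<n}" for ys
    using wbs_hol_mult[OF smooth_dk Op_base(1) that z] Op_base that z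
      wbs_pairing[OF hol_family_cpds[OF fam] fam that z]
    by (simp add: dk_def pairing_def[abs_def])
  then show ?case using Op_base by (intro exI[of _ "[(h z, xs)]"]) auto
next
  case (Op_zero m)
  have "wbs ys (\<lambda>_. 0) z = 0" if "set ys \<subseteq> {..<n}" for ys
    using wbs_hol_mult[OF kalg_const hol_const that z, of 0] by simp
  then show ?case by (intro exI[of _ "[]"]) auto
next
  case (Op_add m F F')
  then obtain L L' where L: "\<forall>(a, xs)\<in>set L. length xs < m \<and> set xs \<subseteq> {..<n}"
      "\<forall>ys. set ys \<subseteq> {..<n} \<longrightarrow>
       wbs ys F z = (\<Sum>(a, xs)\<leftarrow>L. a * l2pair B (\<lambda>j. cpds xs (f j) z) (\<lambda>j. cpds ys (f j) z))"
    and L': "\<forall>(a, xs)\<in>set L'. length xs < m \<and> set xs \<subseteq> {..<n}"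
      "\<forall>ys. set ys \<subseteq> {..<n} \<longrightarrow>
       wbs ys F' z = (\<Sum>(a, xs)\<leftarrow>L'. a * l2pair B (\<lambda>j. cpds xs (f j) z) (\<lambda>j. cpds ys (f j) z))"
    by blast
  show ?case
    using L L' wbs_add[OF Op_smooth[OF Op_add(1)] Op_smooth[OF Op_add(2)] _ z]
    by (intro exI[of _ "L @ L'"]) auto
next
  case (Op_cong m F F')
  have "wbs ys F' z = wbs ys F z" if "set ys \<subseteq> {..<n}" for ys
    by (rule wbs_cong) (use Op_cong that z in auto)
  then show ?case using Op_cong by auto
qed

end

locale positive_curvature = kernel_metric n D B f
  for n D and B :: "'j set" and f :: "'j \<Rightarrow> (nat \<Rightarrow> complex) \<Rightarrow> complex" +
  fixes c :: real and z0 :: "nat \<Rightarrow> complex"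
  assumes c_pos: "c > 0" and hsc: "bergman_constant_hsc n D c" and z0: "z0 \<in> D" and dim: "n > 0"
begin

definition "c' = c / 2"
definition "\<psi> a z = p a z - p a z0"

lemma smooth_\<psi>: "a < n \<Longrightarrow> smooth (\<psi> a)"
  unfolding \<psi>_def[abs_def] by (intro smooth_diff smooth_p kalg_const)

lemma wb_\<psi>: "a < n \<Longrightarrow> l < n \<Longrightarrow> z \<in> D \<Longrightarrow> wb l (\<psi> a) z = g a l z"
  unfolding \<psi>_def[abs_def] by (simp add: wb_rules smooth_p kalg_const g_eq)

lemma w_\<psi>: "a < n \<Longrightarrow> l < n \<Longrightarrow> z \<in> D \<Longrightarrow> w l (\<psi> a) z = G a l z"
  unfolding \<psi>_def[abs_def] by (simp add: w_rules smooth_p kalg_const G_def)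

text \<open>The equation for constant curvature, freed of the contraction with \<open>g\<close>.\<close>

lemma wb_\<Gamma>:
  assumes "a < n" "i < n" "k < n" "l < n" "z \<in> D"
  shows "wb l (\<Gamma> a i k) z = - of_real c' * ((if a = i then 1 else 0) * g k l z + (if a = k then 1 else 0) * g i l z)"
proof (rule contract_H[OF assms(5,1), where x = "\<lambda>a. wb l (\<Gamma> a i k) z"])
  fix j assume j: "j < n"
  have "(\<Sum>a<n. wb l (\<Gamma> a i k) z * g a j z) = - bergman_curvature n D i j k l z"
    using curvature_eq[of i j k l z] assms j by simp
  also have "\<dots> = - of_real c' * (g i j z * g k l z + g i l z * g k j z)"
    using curvature_of_constant_hsc[OF hsc, of i j k l z] assms j by (simp add: c'_def)
  also have "\<dots> = (\<Sum>a<n. (if a = i then - of_real c' * (g k l z * g a j z) else 0)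
      + (if a = k then - of_real c' * (g i l z * g a j z) else 0))"
    using assms unfolding sum.distrib by (simp add: algebra_simps)
  also have "\<dots> = (\<Sum>a<n. - of_real c' * ((if a = i then 1 else 0) * g k l z
      + (if a = k then 1 else 0) * g i l z) * g a j z)"
    by (intro sum.cong refl) (auto simp: algebra_simps)
  finally show "(\<Sum>a<n. wb l (\<Gamma> a i k) z * g a j z)
      = (\<Sum>a<n. - of_real c' * ((if a = i then 1 else 0) * g k l z + (if a = k then 1 else 0) * g i l z) * g a j z)" .
qed

text \<open>As \<open>wb l (p k) = g k l\<close>, adding terms in \<open>p\<close> to \<open>\<Gamma>\<close> cancels \<open>wb l (\<Gamma> a i k)\<close>, and \<open>A\<close> is holomorphic. Then
  \<open>wb l (G i k)\<close> is, up to derivatives of products of two \<open>p\<close>, the derivative of \<open>\<Sum> A p\<close>, so the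
  remainder \<open>B0\<close> is holomorphic, too.\<close>

definition "A a i k z = \<Gamma> a i k z + of_real c' * ((if a = i then 1 else 0) * p k z + (if a = k then 1 else 0) * p i z)"
definition "B0 i k z = G i k z + of_real c' * (p i z * p k z) - (\<Sum>a<n. A a i k z * p a z)"

lemma hol_A:
  assumes "a < n" "i < n" "k < n"
  shows "hol (A a i k)"
proof -
  have s: "smooth (\<lambda>z. (if a = i then 1 else 0) * p k z)" "smooth (\<lambda>z. (if a = k then 1 else 0) * p i z)"
    using assms by (auto intro!: kalg_mult kalg_const smooth_p)
  show ?thesis
    unfolding hol_def
  proof (intro conjI allI impI ballI)
    show "smooth (A a i k)"
      unfolding A_def[abs_def] by (intro kalg_add kalg_mult[OF kalg_const] smooth_\<Gamma> s assms)
    fix l z assume l: "l < n" and z: "z \<in> D"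
    show "wb l (A a i k) z = 0"
      unfolding A_def[abs_def]
      using assms l z s by (simp add: wb_rules(1,6) kalg_add kalg_mult kalg_const smooth_\<Gamma> smooth_p wb_\<Gamma> g_eq del: mult_cancel_left1)
  qed
qed

lemma hol_B0:
  assumes "i < n" "k < n"
  shows "hol (B0 i k)"
  unfolding hol_def
proof (intro conjI allI impI ballI)
  have s1: "smooth (\<lambda>z. \<Sum>a<n. A a i k z * p a z)"
    by (intro smooth_sum kalg_mult) (auto intro: hol_smooth hol_A smooth_p assms)
  have s2: "smooth (\<lambda>z. of_real c' * (p i z * p k z))" by (intro kalg_mult kalg_const smooth_p assms)
  show "smooth (B0 i k)"
    unfolding B0_def[abs_def] by (intro smooth_diff kalg_add smooth_G s1 s2 assms)
  fix l z assume l: "l < n" and z: "z \<in> D"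
  have "wb l (\<lambda>z. A a i k z * p a z) z = A a i k z * g a l z" if "a < n" for a
    using hol_A[OF that assms] that l z by (simp add: wb_rules(2) hol_smooth smooth_p hol_def g_eq)
  then have "wb l (\<lambda>z. \<Sum>a<n. A a i k z * p a z) z = (\<Sum>a<n. A a i k z * g a l z)"
    using l z by (subst wb_rules(4)) (auto intro!: kalg_mult hol_smooth[OF hol_A] smooth_p assms)
  also have "\<dots> = (\<Sum>a<n. \<Gamma> a i k z * g a l z) + (\<Sum>a<n. (if a = i then of_real c' * (p k z * g a l z) else 0)
      + (if a = k then of_real c' * (p i z * g a l z) else 0))"
    unfolding A_def sum.distrib[symmetric] by (intro sum.cong refl) (auto simp: algebra_simps)
  also have "\<dots> = wb l (G i k) z + of_real c' * (g i l z * p k z + p i z * g k l z)"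
    unfolding sum.distrib \<Gamma>_g[OF assms l z] using assms by (simp add: algebra_simps)
  finally have e: "wb l (\<lambda>z. \<Sum>a<n. A a i k z * p a z) z
      = wb l (G i k) z + of_real c' * (g i l z * p k z + p i z * g k l z)" .
  have "wb l (B0 i k) z = wb l (G i k) z + of_real c' * (g i l z * p k z + p i z * g k l z)
      - wb l (\<lambda>z. \<Sum>a<n. A a i k z * p a z) z"
    unfolding B0_def[abs_def]
    using assms l z s1 s2
    by (simp add: wb_rules(3) wb_rules(1) wb_rules(6) wb_rules(2) kalg_add kalg_mult smooth_G smooth_p g_eq)
  then show "wb l (B0 i k) z = 0" by (simp add: e)
qed

text \<open>With \<open>E = K powr c'\<close> one has \<open>\<partial>\<^sub>i E / E = c' p\<^sub>i\<close>, and the identity below says that \<open>E\<close>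
  satisfies a linear system \<open>\<partial>\<^sub>k \<partial>\<^sub>i E = \<Sum> A \<partial>\<^sub>a E + B E\<close> with holomorphic coefficients: \<open>E\<close> looks
  like a Hermitian quadratic polynomial. Recentring \<open>p\<close> at \<open>z0\<close> only changes the coefficients.\<close>

lemma riccati:
  obtains A' B' where "\<And>a i k. a < n \<Longrightarrow> i < n \<Longrightarrow> k < n \<Longrightarrow> hol (A' a i k)"
    "\<And>i k. i < n \<Longrightarrow> k < n \<Longrightarrow> hol (B' i k)"
    "\<And>i k z. i < n \<Longrightarrow> k < n \<Longrightarrow> z \<in> D \<Longrightarrow>
       w k (\<psi> i) z = - of_real c' * (\<psi> i z * \<psi> k z) + (\<Sum>a<n. A' a i k z * \<psi> a z) + B' i k z"
proof -
  define \<alpha> where "\<alpha> a = p a z0" for a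
  define A' where "A' a i k z = A a i k z - of_real c' * ((if a = k then 1 else 0) * \<alpha> i + (if a = i then 1 else 0) * \<alpha> k)" for a i k z
  define B' where "B' i k z = B0 i k z - of_real c' * (\<alpha> i * \<alpha> k) + (\<Sum>a<n. A a i k z * \<alpha> a)" for i k z
  have 1: "hol (A' a i k)" if "a < n" "i < n" "k < n" for a i k
    unfolding A'_def[abs_def] by (intro hol_diff hol_A hol_const that)
  have 2: "hol (B' i k)" if "i < n" "k < n" for i k
    unfolding B'_def[abs_def] by (intro hol_add hol_diff hol_B0 hol_const hol_sum hol_mult hol_A that) auto
  have 3: "w k (\<psi> i) z = - of_real c' * (\<psi> i z * \<psi> k z) + (\<Sum>a<n. A' a i k z * \<psi> a z) + B' i k z"
    if "i < n" "k < n" "z \<in> D" for i k z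
  proof -
    have p: "p a z = \<psi> a z + \<alpha> a" for a by (simp add: \<psi>_def \<alpha>_def)
    have "(\<Sum>a<n. A' a i k z * \<psi> a z) = (\<Sum>a<n. A a i k z * \<psi> a z)
        - (\<Sum>a<n. (if a = k then of_real c' * (\<alpha> i * \<psi> a z) else 0) + (if a = i then of_real c' * (\<alpha> k * \<psi> a z) else 0))"
      unfolding A'_def sum_subtractf[symmetric] by (intro sum.cong refl) (auto simp: algebra_simps)
    also have "\<dots> = (\<Sum>a<n. A a i k z * \<psi> a z) - of_real c' * (\<alpha> i * \<psi> k z + \<alpha> k * \<psi> i z)"
      unfolding sum.distrib using that by (simp add: algebra_simps)
    finally have e1: "(\<Sum>a<n. A' a i k z * \<psi> a z) = (\<Sum>a<n. A a i k z * \<psi> a z) - of_real c' * (\<alpha> i * \<psi> k z + \<alpha> k * \<psi> i z)" .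
    have e2: "(\<Sum>a<n. A a i k z * p a z) = (\<Sum>a<n. A a i k z * \<psi> a z) + (\<Sum>a<n. A a i k z * \<alpha> a)"
      unfolding p by (simp add: algebra_simps sum.distrib)
    have e3: "G i k z = B0 i k z - of_real c' * (p i z * p k z) + (\<Sum>a<n. A a i k z * p a z)"
      by (simp add: B0_def)
    show ?thesis
      unfolding w_\<psi>[OF that] B'_def e1 e3 e2 p[of i] p[of k] by (simp add: algebra_simps)
  qed
  show ?thesis by (rule that[of A' B', OF 1 2 3])
qed

text \<open>The recentred logarithmic derivatives \<open>\<psi>\<close> vanish at \<open>z0\<close>, so \<open>T xs\<close> vanishes there to the order
  \<open>length xs\<close> in the barred directions. \<open>Sp m\<close> is the span of the products with at most \<open>m\<close> factors over
  the holomorphic functions; it collects error terms.\<close>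

definition "T xs z = K z * (\<Prod>a\<leftarrow>xs. \<psi> a z)"

lemma T_Nil: "T [] z = K z" and T_Cons: "T (a # xs) z = \<psi> a z * T xs z"
  by (simp_all add: T_def)

lemma smooth_T: "set xs \<subseteq> {..<n} \<Longrightarrow> smooth (T xs)"
proof (induction xs)
  case Nil
  show ?case by (rule kalg_cong[OF smooth_K]) (simp add: T_Nil)
next
  case (Cons a xs)
  then have "smooth (\<lambda>z. \<psi> a z * T xs z)" by (intro kalg_mult smooth_\<psi>) auto
  then show ?case by (rule kalg_cong) (simp add: T_Cons)
qed

inductive Sp :: "nat \<Rightarrow> ((nat \<Rightarrow> complex) \<Rightarrow> complex) \<Rightarrow> bool" where
  Sp_base: "hol h \<Longrightarrow> length xs \<le> m \<Longrightarrow> set xs \<subseteq> {..<n} \<Longrightarrow> Sp m (\<lambda>z. h z * T xs z)"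
| Sp_zero: "Sp m (\<lambda>_. 0)"
| Sp_add: "Sp m F \<Longrightarrow> Sp m F' \<Longrightarrow> Sp m (\<lambda>z. F z + F' z)"
| Sp_cong: "Sp m F \<Longrightarrow> (\<And>z. z \<in> D \<Longrightarrow> F' z = F z) \<Longrightarrow> Sp m F'"

lemma Sp_sum: "finite I \<Longrightarrow> (\<And>a. a \<in> I \<Longrightarrow> Sp m (F a)) \<Longrightarrow> Sp m (\<lambda>z. \<Sum>a\<in>I. F a z)"
  by (induction I rule: finite_induct) (auto intro: Sp_zero Sp_add)

lemma Sp_\<psi>: "Sp m F \<Longrightarrow> a < n \<Longrightarrow> Sp (Suc m) (\<lambda>z. \<psi> a z * F z)"
proof (induction rule: Sp.induct)
  case (Sp_base h xs m)
  have "Sp (Suc m) (\<lambda>z. h z * T (a # xs) z)" using Sp_base by (intro Sp.Sp_base) auto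
  then show ?case by (simp add: T_Cons mult_ac)
next
  case (Sp_zero m)
  then show ?case by (simp add: Sp.Sp_zero)
next
  case (Sp_add m F F')
  then have "Sp (Suc m) (\<lambda>z. \<psi> a z * F z + \<psi> a z * F' z)" by (intro Sp.Sp_add)
  then show ?case by (simp add: algebra_simps)
next
  case (Sp_cong m F F')
  show ?case by (rule Sp.Sp_cong[OF Sp_cong.IH[OF Sp_cong.prems]]) (simp add: Sp_cong.hyps)
qed

text \<open>The derivative of \<open>K\<close> contributes one more factor \<open>\<psi> b\<close> with coefficient \<open>1\<close>, and by the Riccati equation
  the derivative of each of the factors \<open>\<psi>\<close> contributes it with coefficient \<open>- c'\<close>.\<close>

lemma w_T:
  assumes b: "b < n" and xs: "set xs \<subseteq> {..<n}"
  shows "\<exists>s. Sp (length xs) s \<and>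
    (\<forall>z\<in>D. w b (T xs) z = of_real (1 - c' * real (length xs)) * T (b # xs) z + s z)"
  using xs
proof (induction xs)
  case Nil
  have "w b (T []) z = of_real (1 - c' * real (length [])) * T [b] z + p b z0 * T [] z" if z: "z \<in> D" for z
  proof -
    have "w b (T []) z = w b K z" by (rule w_cong[OF b z]) (simp add: T_Nil)
    also have "\<dots> = p b z * K z" using K_nonzero[OF z] by (simp add: p_def)
    finally show ?thesis by (simp add: T_Nil T_Cons \<psi>_def algebra_simps)
  qed
  moreover have "Sp (length []) (\<lambda>z. p b z0 * T [] z)" by (rule Sp_base[OF hol_const]) auto
  ultimately show ?case by blast
next
  case (Cons a xs)
  then have a: "a < n" and xs: "set xs \<subseteq> {..<n}" by auto
  obtain s where s: "Sp (length xs) s"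
    "\<And>z. z \<in> D \<Longrightarrow> w b (T xs) z = of_real (1 - c' * real (length xs)) * T (b # xs) z + s z"
    using Cons.IH[OF xs] by blast
  obtain A' B' where A': "\<And>a i k. a < n \<Longrightarrow> i < n \<Longrightarrow> k < n \<Longrightarrow> hol (A' a i k)"
    and B': "\<And>i k. i < n \<Longrightarrow> k < n \<Longrightarrow> hol (B' i k)"
    and ric: "\<And>i k z. i < n \<Longrightarrow> k < n \<Longrightarrow> z \<in> D \<Longrightarrow>
       w k (\<psi> i) z = - of_real c' * (\<psi> i z * \<psi> k z) + (\<Sum>a<n. A' a i k z * \<psi> a z) + B' i k z"
    by (rule riccati) (rule that)
  define s' where "s' z = \<psi> a z * s z + (\<Sum>d<n. A' d a b z * T (d # xs) z) + B' a b z * T xs z" for z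
  have "Sp (length (a # xs)) s'"
    unfolding s'_def[abs_def] using Sp_\<psi>[OF s(1) a] a b xs
    by (intro Sp_add Sp_sum Sp_base A' B') auto
  moreover have "w b (T (a # xs)) z = of_real (1 - c' * real (length (a # xs))) * T (b # a # xs) z + s' z"
    if z: "z \<in> D" for z
  proof -
    have e: "(- of_real c' * (\<psi> a z * \<psi> b z) + (\<Sum>d<n. A' d a b z * \<psi> d z) + B' a b z) * T xs z
       = - of_real c' * T (b # a # xs) z + (\<Sum>d<n. A' d a b z * T (d # xs) z) + B' a b z * T xs z"
      by (simp add: T_Cons algebra_simps sum_distrib_left)
    have "w b (T (a # xs)) z = w b (\<lambda>z. \<psi> a z * T xs z) z" by (rule w_cong[OF b z]) (simp add: T_Cons)
    also have "\<dots> = w b (\<psi> a) z * T xs z + \<psi> a z * w b (T xs) z"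
      using a b z xs by (simp add: w_rules(2) smooth_\<psi> smooth_T)
    also have "\<dots> = - of_real c' * T (b # a # xs) z + (\<Sum>d<n. A' d a b z * T (d # xs) z) + B' a b z * T xs z
       + \<psi> a z * (of_real (1 - c' * real (length xs)) * T (b # xs) z + s z)"
      by (simp only: ric[OF a b z] s(2)[OF z] e)
    also have "\<dots> = of_real (1 - c' * real (length (a # xs))) * T (b # a # xs) z + s' z"
      by (simp add: s'_def T_Cons algebra_simps)
    finally show ?thesis .
  qed
  ultimately show ?case by blast
qed

lemma Sp_Op:
  assumes "Sp m F" "\<And>xs. length xs \<le> m \<Longrightarrow> set xs \<subseteq> {..<n} \<Longrightarrow> Op (Suc m) (T xs)"
  shows "Op (Suc m) F"
  using assms by (induction rule: Sp.induct) (auto intro: Op_hol_mult Op_zero Op_add Op_cong)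

lemma Op_uminus: "Op m F \<Longrightarrow> Op m (\<lambda>z. - F z)"
  using Op_hol_mult[OF _ hol_const, of m F "-1"] by simp

lemma Op_diff: "Op m F \<Longrightarrow> Op m F' \<Longrightarrow> Op m (\<lambda>z. F z - F' z)"
  using Op_add[OF _ Op_uminus, of m F F'] by simp

text \<open>As long as the factors \<open>1 - c' j\<close> do not vanish, the relation \<open>w_T\<close> can be solved for the
  product with one more factor.\<close>

lemma Op_T:
  assumes "set xs \<subseteq> {..<n}" "\<And>j. j < length xs \<Longrightarrow> c' * real j \<noteq> 1"
  shows "Op (Suc (length xs)) (T xs)"
  using assms
proof (induction "length xs" arbitrary: xs rule: less_induct)
  case less
  show ?case
  proof (cases xs)
    case Nil
    have "Op (Suc 0) (\<lambda>z. 1 * dk [] z)" by (rule Op_base[OF hol_const]) auto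
    then show ?thesis unfolding Nil
      by (simp, elim Op_cong) (simp add: T_Nil dk_def K_def)
  next
    case (Cons b ys)
    have b: "b < n" and ys: "set ys \<subseteq> {..<n}" using less.prems Cons by auto
    obtain s where s: "Sp (length ys) s"
      "\<And>z. z \<in> D \<Longrightarrow> w b (T ys) z = of_real (1 - c' * real (length ys)) * T (b # ys) z + s z"
      using w_T[OF b ys] by blast
    define e where "e = complex_of_real (1 - c' * real (length ys))"
    have s2: "w b (T ys) z = e * T (b # ys) z + s z" if "z \<in> D" for z
      using s(2)[OF that] unfolding e_def .
    have e: "e \<noteq> 0" using less.prems(2)[of "length ys"] Cons unfolding e_def of_real_eq_0_iff by auto
    have IH: "Op (Suc (length zs)) (T zs)" if "length zs \<le> length ys" "set zs \<subseteq> {..<n}" for zs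
      by (rule less.hyps) (use that Cons less.prems in auto)
    have "Op (Suc (length ys)) s"
      by (rule Sp_Op[OF s(1)]) (use IH Op_mono in fastforce)
    then have "Op (Suc (Suc (length ys))) s" by (rule Op_mono) simp
    then have "Op (Suc (Suc (length ys))) (\<lambda>z. inverse e * (w b (T ys) z - s z))"
      by (intro Op_hol_mult hol_const Op_diff Op_w b IH ys) auto
    then have "Op (Suc (Suc (length ys))) (T (b # ys))"
      by (rule Op_cong) (use e in \<open>simp add: s2\<close>)
    then show ?thesis by (simp add: Cons)
  qed
qed

lemma solve_linear:
  fixes T k r :: complex
  assumes "of_real e * T = of_real d * k + r" "e \<noteq> 0"
  shows "T = of_real (d / e) * k + inverse (of_real e) * r"
  using assms by (simp add: field_simps)

text \<open>In the direction \<open>0\<close> only, keeping track of the leading coefficient \<open>d\<close>: it is the inverse of the product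
  of the factors \<open>1 - c' j\<close>, hence positive.\<close>

lemma T_leading_term:
  assumes "\<And>j. j < m \<Longrightarrow> c' * real j < 1"
  shows "\<exists>d F. d > 0 \<and> Op m F \<and>
    (\<forall>z\<in>D. T (replicate m 0) z = of_real d * dk (replicate m 0) z + F z)"
  using assms
proof (induction m)
  case 0
  show ?case by (intro exI[of _ 1] exI[of _ "\<lambda>_. 0"]) (auto simp: T_Nil dk_def K_def Op_zero)
next
  case (Suc m)
  obtain d F where d: "d > 0" and F: "Op m F"
    and TF: "\<And>z. z \<in> D \<Longrightarrow> T (replicate m 0) z = of_real d * dk (replicate m 0) z + F z"
    using Suc by force
  have r: "set (replicate m 0) \<subseteq> {..<n}" using dim by auto
  obtain s where s: "Sp m s"
    "\<And>z. z \<in> D \<Longrightarrow> w 0 (T (replicate m 0)) z = of_real (1 - c' * real m) * T (replicate (Suc m) 0) z + s z"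
    using w_T[OF dim r] by auto
  have so: "Op (Suc m) s"
  proof (rule Sp_Op[OF s(1)])
    fix xs :: "nat list" assume xs: "length xs \<le> m" "set xs \<subseteq> {..<n}"
    then have "Op (Suc (length xs)) (T xs)"
      using Suc.prems by (intro Op_T) (auto simp: less_le)
    then show "Op (Suc m) (T xs)" by (rule Op_mono) (use xs in simp)
  qed
  define e where "e = 1 - c' * real m"
  have e: "e > 0" using Suc.prems[of m] by (simp add: e_def)
  have "T (replicate (Suc m) 0) z = of_real (d / e) * dk (replicate (Suc m) 0) z + inverse (of_real e) * (w 0 F z - s z)"
    if z: "z \<in> D" for z
  proof -
    have "w 0 (T (replicate m 0)) z = w 0 (\<lambda>z. of_real d * dk (replicate m 0) z + F z) z"
      by (rule w_cong[OF dim z]) (use TF in auto)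
    also have "\<dots> = of_real d * dk (replicate m 0 @ [0]) z + w 0 F z"
      using dim z r by (simp add: w_rules(1,6) kalg_mult kalg_const smooth_dk Op_smooth[OF F] w_dk)
    finally have "of_real e * T (replicate (Suc m) 0) z = of_real d * dk (replicate (Suc m) 0) z + (w 0 F z - s z)"
      using s(2)[OF z] by (simp add: e_def replicate_append_same algebra_simps)
    then show ?thesis by (rule solve_linear) (use e in simp)
  qed
  moreover have "Op (Suc m) (\<lambda>z. inverse (of_real e) * (w 0 F z - s z))"
    by (intro Op_hol_mult hol_const Op_diff Op_w F so dim)
  moreover have "d / e > 0" using d e by simp
  ultimately show ?case by blast
qed

text \<open>The first \<open>m\<close> with \<open>c' m \<ge> 1\<close> exists because \<open>c'\<close> is positive. There \<open>w_T\<close> still expresses \<open>\<partial>\<^sub>0\<^sup>m\<^sup>+\<^sup>1 K\<close>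
  through \<open>T\<close>, but with a coefficient \<open>1 - c' m \<le> 0\<close>.\<close>

lemma exists_operator_nonpos:
  obtains k e F where "e \<le> 0" "Op k F"
    "\<And>z. z \<in> D \<Longrightarrow> dk (replicate k 0) z + F z = of_real e * T (replicate k 0) z"
proof -
  have c': "c' > 0" using c_pos by (simp add: c'_def)
  define m where "m = (LEAST m. c' * real m \<ge> 1)"
  have "\<exists>m. c' * real m \<ge> 1"
    using reals_Archimedean3[OF c'] by (metis less_imp_le mult.commute)
  then have m: "c' * real m \<ge> 1" unfolding m_def by (rule LeastI_ex)
  have less: "c' * real j < 1" if "j < m" for j
    using not_less_Least[of j "\<lambda>m. c' * real m \<ge> 1"] that unfolding m_def by linarith
  obtain d F where d: "d > 0" and F: "Op m F"
    and TF: "\<And>z. z \<in> D \<Longrightarrow> T (replicate m 0) z = of_real d * dk (replicate m 0) z + F z"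
    using T_leading_term[OF less] by blast
  have r: "set (replicate m 0) \<subseteq> {..<n}" using dim by auto
  obtain s where s: "Sp m s"
    "\<And>z. z \<in> D \<Longrightarrow> w 0 (T (replicate m 0)) z = of_real (1 - c' * real m) * T (replicate (Suc m) 0) z + s z"
    using w_T[OF dim r] by auto
  have so: "Op (Suc m) s"
  proof (rule Sp_Op[OF s(1)])
    fix xs :: "nat list" assume xs: "length xs \<le> m" "set xs \<subseteq> {..<n}"
    then have "Op (Suc (length xs)) (T xs)"
      using less by (intro Op_T) (auto simp: less_le)
    then show "Op (Suc m) (T xs)" by (rule Op_mono) (use xs in simp)
  qed
  have "dk (replicate (Suc m) 0) z + inverse (of_real d) * (w 0 F z - s z)
      = of_real ((1 - c' * real m) / d) * T (replicate (Suc m) 0) z" if z: "z \<in> D" for z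
  proof -
    have "w 0 (T (replicate m 0)) z = w 0 (\<lambda>z. of_real d * dk (replicate m 0) z + F z) z"
      by (rule w_cong[OF dim z]) (use TF in auto)
    also have "\<dots> = of_real d * dk (replicate m 0 @ [0]) z + w 0 F z"
      using dim z r by (simp add: w_rules(1,6) kalg_mult kalg_const smooth_dk Op_smooth[OF F] w_dk)
    finally have "of_real d * dk (replicate (Suc m) 0) z + (w 0 F z - s z) = of_real (1 - c' * real m) * T (replicate (Suc m) 0) z"
      using s(2)[OF z] by (simp add: replicate_append_same algebra_simps)
    then have "of_real d * dk (replicate (Suc m) 0) z
        = of_real (1 - c' * real m) * T (replicate (Suc m) 0) z + - (w 0 F z - s z)"
      by (simp add: algebra_simps)
    from solve_linear[OF this] show ?thesis using d by (simp add: algebra_simps)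
  qed
  moreover have "Op (Suc m) (\<lambda>z. inverse (of_real d) * (w 0 F z - s z))"
    by (intro Op_hol_mult hol_const Op_diff Op_w F so dim)
  moreover have "(1 - c' * real m) / d \<le> 0" using m d by (simp add: divide_le_0_iff)
  ultimately show ?thesis by (intro that[of "(1 - c' * real m) / d" "Suc m"]) auto
qed

lemma \<psi>_z0: "\<psi> a z0 = 0" by (simp add: \<psi>_def)

lemma smooth_power: "smooth F \<Longrightarrow> smooth (\<lambda>z. F z ^ k)"
  by (induction k) (auto intro: kalg_const kalg_mult)

lemma wb_mult_\<psi>_power:
  assumes F: "smooth F" and l: "l < n" and z: "z \<in> D"
  shows "wb l (\<lambda>z. F z * \<psi> 0 z ^ Suc k) z = (wb l F z * \<psi> 0 z + of_nat (Suc k) * F z * g 0 l z) * \<psi> 0 z ^ k"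
proof -
  have "wb l (\<lambda>z. \<psi> 0 z ^ Suc k) z = of_nat (Suc k) * g 0 l z * \<psi> 0 z ^ k" for k
  proof (induction k)
    case 0
    show ?case by (simp add: wb_\<psi> dim l z)
  next
    case (Suc k)
    have "wb l (\<lambda>z. \<psi> 0 z ^ Suc (Suc k)) z = wb l (\<lambda>z. \<psi> 0 z * \<psi> 0 z ^ Suc k) z" by simp
    also have "\<dots> = g 0 l z * \<psi> 0 z ^ Suc k + \<psi> 0 z * wb l (\<lambda>z. \<psi> 0 z ^ Suc k) z"
      by (simp only: wb_rules(2)[OF smooth_\<psi>[OF dim] smooth_power[OF smooth_\<psi>[OF dim]] l z] wb_\<psi>[OF dim l z])
    also have "\<dots> = of_nat (Suc (Suc k)) * g 0 l z * \<psi> 0 z ^ Suc k"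
      unfolding Suc.IH by (simp add: algebra_simps)
    finally show ?case .
  qed
  then show ?thesis
    by (simp only: wb_rules(2)[OF F smooth_power[OF smooth_\<psi>[OF dim]] l z]) (simp add: algebra_simps)
qed

lemma smooth_wb_mult_\<psi>_power:
  assumes "smooth F" "l < n"
  shows "smooth (\<lambda>z. wb l F z * \<psi> 0 z + of_nat (Suc k) * F z * g 0 l z)"
  by (intro kalg_add kalg_mult kalg_const smooth_wb smooth_\<psi> smooth_g dim assms)

text \<open>Barred derivatives of \<open>F \<psi>\<^sub>0\<^sup>k\<close> at the zero \<open>z0\<close> of \<open>\<psi>\<^sub>0\<close>: none survives below order \<open>k\<close>, and at order
  \<open>k\<close> each derivative must hit a factor \<open>\<psi>\<^sub>0\<close>, producing \<open>g\<^sub>0\<^sub>0\<close>.\<close>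

lemma wbs_\<psi>_power_low:
  "smooth F \<Longrightarrow> set ys \<subseteq> {..<n} \<Longrightarrow> length ys < k \<Longrightarrow> wbs ys (\<lambda>z. F z * \<psi> 0 z ^ k) z0 = 0"
proof (induction ys arbitrary: F k)
  case (Cons l ys)
  then obtain k' where k: "k = Suc k'" by (cases k) auto
  have "wbs (l # ys) (\<lambda>z. F z * \<psi> 0 z ^ k) z0
      = wbs ys (\<lambda>z. (wb l F z * \<psi> 0 z + of_nat (Suc k') * F z * g 0 l z) * \<psi> 0 z ^ k') z0"
    unfolding wbs_simps k by (rule wbs_cong) (use Cons.prems z0 wb_mult_\<psi>_power in auto)
  also have "\<dots> = 0"
    by (rule Cons.IH[OF smooth_wb_mult_\<psi>_power]) (use Cons.prems k in auto)
  finally show ?case .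
qed (simp add: \<psi>_z0)

lemma wbs_\<psi>_power_top:
  "smooth F \<Longrightarrow> wbs (replicate k 0) (\<lambda>z. F z * \<psi> 0 z ^ k) z0 = fact k * F z0 * g 0 0 z0 ^ k"
proof (induction k arbitrary: F)
  case (Suc k)
  have "wbs (replicate (Suc k) 0) (\<lambda>z. F z * \<psi> 0 z ^ Suc k) z0
      = wbs (replicate k 0) (\<lambda>z. (wb 0 F z * \<psi> 0 z + of_nat (Suc k) * F z * g 0 0 z) * \<psi> 0 z ^ k) z0"
    unfolding replicate_Suc wbs_simps
    by (rule wbs_cong) (use Suc.prems z0 dim wb_mult_\<psi>_power in auto)
  also have "\<dots> = fact k * (of_nat (Suc k) * F z0 * g 0 0 z0) * g 0 0 z0 ^ k"
    using Suc.IH[OF smooth_wb_mult_\<psi>_power[OF Suc.prems dim]] by (simp add: \<psi>_z0)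
  finally show ?case by (simp add: algebra_simps)
qed simp

lemma g00: "g 0 0 z0 = of_real (Re (g 0 0 z0))" "Re (g 0 0 z0) > 0"
proof -
  define X where "X i = (if i = 0 then 1 else 0 :: complex)" for i :: nat
  have "bergman_form n D z0 X = (\<Sum>i<n. if i = 0 then (\<Sum>j<n. if j = 0 then g i j z0 else 0) else 0)"
    unfolding bergman_form_def
  proof (intro sum.cong refl)
    fix i
    show "(\<Sum>j<n. g i j z0 * X i * cnj (X j)) = (if i = 0 then (\<Sum>j<n. if j = 0 then g i j z0 else 0) else 0)"
      by (cases "i = 0") (simp_all add: X_def if_distrib[of cnj] if_distrib[of "\<lambda>x. _ * x"] cong: if_cong)
  qed
  then have "bergman_form n D z0 X = g 0 0 z0" using dim by simp
  moreover have "bergman_form n D z0 X \<in> \<real> \<and> Re (bergman_form n D z0 X) > 0"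
    using well_defined z0 dim unfolding bergman_metric_well_defined_def by (force simp: X_def)
  ultimately show "g 0 0 z0 = of_real (Re (g 0 0 z0))" "Re (g 0 0 z0) > 0" by auto
qed

text \<open>The operator \<open>L\<close> of \<open>exists_operator_nonpos\<close> satisfies
  \<open>\<Sum> \<bar>L f\<^sub>j\<bar>\<^sup>2 = L-bar L K = e k! K g\<^sub>0\<^sub>0\<^sup>k \<le> 0\<close> at \<open>z0\<close>, so it kills the whole family there.\<close>

theorem exists_annihilating_jet:
  obtains k L where "\<forall>(a, xs)\<in>set L. length xs < k \<and> set xs \<subseteq> {..<n}"
    "\<And>j. j \<in> B \<Longrightarrow> cpds (replicate k 0) (f j) z0 + (\<Sum>(a, xs)\<leftarrow>L. a * cpds xs (f j) z0) = 0"
proof -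
  obtain k e F where e: "e \<le> 0" and F: "Op k F"
    and TF: "\<And>z. z \<in> D \<Longrightarrow> dk (replicate k 0) z + F z = of_real e * T (replicate k 0) z"
    by (rule exists_operator_nonpos) (rule that)
  have r: "set (replicate k 0) \<subseteq> {..<n}" using dim by auto
  obtain L where L: "\<forall>(a, xs)\<in>set L. length xs < k \<and> set xs \<subseteq> {..<n}"
    and FL: "\<And>ys. set ys \<subseteq> {..<n} \<Longrightarrow>
       wbs ys F z0 = (\<Sum>(a, xs)\<leftarrow>L. a * l2pair B (\<lambda>j. cpds xs (f j) z0) (\<lambda>j. cpds ys (f j) z0))"
    using Op_jet[OF F z0] by blast
  \<comment> \<open>\<open>v j\<close> is the value at \<open>z0\<close> of the operator \<open>\<partial>\<^sub>0\<^sup>k + F\<close> on \<open>f j\<close>\<close>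
  define L' where "L' = (1, replicate k 0) # L"
  define x where "x xs j = cpds xs (f j) z0" for xs j
  define v where "v j = (\<Sum>(a, xs)\<leftarrow>L'. a * x xs j)" for j
  have L'in: "set xs \<subseteq> {..<n}" if "(a, xs) \<in> set L'" for a xs
    using that L r unfolding L'_def by auto
  have bd: "\<exists>M. l2b B (x xs) M" if xs: "set xs \<subseteq> {..<n}" for xs
  proof -
    obtain r M where "r > 0" "M \<ge> 0" "z0 \<in> polydisc n z0 r"
      "\<And>z F. z \<in> polydisc n z0 r \<Longrightarrow> finite F \<Longrightarrow> F \<subseteq> B \<Longrightarrow> (\<Sum>j\<in>F. (cmod (cpds xs (f j) z))\<^sup>2) \<le> M\<^sup>2"
      using hol_familyE[OF hol_family_cpds[OF fam xs] z0] by metis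
    then show ?thesis unfolding l2b_def x_def by blast
  qed
  have bd': "\<exists>M. l2b B (x xs) M" if "(a, xs) \<in> set L'" for a xs
    by (rule bd[OF L'in[OF that]])
  obtain M where M: "l2b B v M"
    using l2pair_lincomb(1)[of L' B x, OF _ l2b_const0] bd' unfolding v_def by blast
  have W: "l2pair B v (x ys) = of_real e * wbs ys (T (replicate k 0)) z0" if ys: "set ys \<subseteq> {..<n}" for ys
  proof -
    obtain N where N: "l2b B (x ys) N" using bd[OF ys] by blast
    have "l2pair B v (x ys) = (\<Sum>(a, xs)\<leftarrow>L'. a * l2pair B (x xs) (x ys))"
      unfolding v_def by (rule l2pair_lincomb(2)[OF bd' N])
    also have "\<dots> = wbs ys (dk (replicate k 0)) z0 + wbs ys F z0"
      unfolding L'_def using FL[OF ys] wbs_pairing[OF hol_family_cpds[OF fam r] fam ys z0]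
      by (simp add: x_def[abs_def] dk_def pairing_def[abs_def])
    also have "\<dots> = wbs ys (\<lambda>z. dk (replicate k 0) z + F z) z0"
      by (rule wbs_add[symmetric]) (use smooth_dk[OF r] Op_smooth[OF F] ys z0 in auto)
    also have "\<dots> = wbs ys (\<lambda>z. of_real e * T (replicate k 0) z) z0"
      by (rule wbs_cong) (use ys z0 TF in auto)
    also have "\<dots> = of_real e * wbs ys (T (replicate k 0)) z0"
      by (rule wbs_hol_mult) (use smooth_T[OF r] hol_const ys z0 in auto)
    finally show ?thesis .
  qed
  have TK: "T (replicate k 0) = (\<lambda>z. K z * \<psi> 0 z ^ k)"
    by (rule ext) (simp add: T_def)
  have v': "(\<lambda>j. \<Sum>(a, xs)\<leftarrow>L'. a * x xs j) = v" by (rule ext) (simp add: v_def)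
  \<comment> \<open>expanding the second factor, only the term of order \<open>k\<close> survives\<close>
  have "l2pair B (\<lambda>j. \<Sum>(a, xs)\<leftarrow>L'. a * x xs j) v = (\<Sum>(a, xs)\<leftarrow>L'. a * l2pair B (x xs) v)"
    by (rule l2pair_lincomb(2)[OF bd' M])
  then have "l2pair B v v = (\<Sum>(a, xs)\<leftarrow>L'. a * l2pair B (x xs) v)" by (simp only: v')
  also have "\<dots> = (\<Sum>(a, xs)\<leftarrow>L'. a * cnj (of_real e * wbs xs (T (replicate k 0)) z0))"
    by (intro arg_cong[where f = sum_list] map_cong refl)
       (auto simp: l2pair_cnj[of B "x _" v] W[OF L'in])
  also have "\<dots> = cnj (of_real e * wbs (replicate k 0) (T (replicate k 0)) z0)
      + (\<Sum>(a, xs)\<leftarrow>L. a * cnj (of_real e * wbs xs (T (replicate k 0)) z0))"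
    by (simp add: L'_def)
  also have "(\<Sum>(a, xs)\<leftarrow>L. a * cnj (of_real e * wbs xs (T (replicate k 0)) z0)) = (\<Sum>(a, xs)\<leftarrow>L. 0)"
    by (intro arg_cong[where f = sum_list] map_cong refl)
       (use L in \<open>auto simp: TK wbs_\<psi>_power_low[OF smooth_K]\<close>)
  also have "cnj (of_real e * wbs (replicate k 0) (T (replicate k 0)) z0)
      = of_real (e * (fact k * bergman_kernel n D z0 * Re (g 0 0 z0) ^ k))"
    unfolding TK wbs_\<psi>_power_top[OF smooth_K]
    by (subst g00(1)) (simp add: K_def kernel[OF z0, symmetric])
  finally have "l2pair B v v = of_real (e * (fact k * bergman_kernel n D z0 * Re (g 0 0 z0) ^ k))"
    by (simp add: case_prod_unfold)
  moreover have "e * (fact k * bergman_kernel n D z0 * Re (g 0 0 z0) ^ k) \<le> 0"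
    using e g00(2) K_pos[OF z0] by (intro mult_nonpos_nonneg) auto
  ultimately have "v j = 0" if "j \<in> B" for j
    using l2b_self_zero[OF M _ _ that] by blast
  then show ?thesis
    by (intro that[OF L]) (simp add: v_def L'_def x_def)
qed

end

section \<open>Rotations and averages\<close>

text \<open>The two measures agree on boxes, and boxes determine the Lebesgue measure.\<close>

lemma lborel_complex_eq_distr:
  "(lborel :: complex measure) = distr (lborel \<Otimes>\<^sub>M lborel) borel (\<lambda>(x, y). Complex x y)"
proof (rule lborel_eqI)
  have m: "(\<lambda>(x, y). Complex x y) \<in> borel_measurable (lborel \<Otimes>\<^sub>M lborel)"
    by (simp add: Complex_eq case_prod_unfold)
  fix l u :: complex
  assume lu: "\<And>b. b \<in> Basis \<Longrightarrow> l \<bullet> b \<le> u \<bullet> b"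
  then have le: "Re l \<le> Re u" "Im l \<le> Im u"
    using lu[of 1] lu[of \<i>] by (auto simp: Basis_complex_def inner_complex_def)
  have "(\<lambda>(x, y). Complex x y) -` box l u \<inter> space (lborel \<Otimes>\<^sub>M lborel) = {Re l<..<Re u} \<times> {Im l<..<Im u}"
    by (auto simp: box_def Basis_complex_def inner_complex_def space_pair_measure)
  then show "emeasure (distr (lborel \<Otimes>\<^sub>M lborel) borel (\<lambda>(x, y). Complex x y)) (box l u)
      = ennreal (\<Prod>b\<in>Basis. (u - l) \<bullet> b)"
    using le m by (simp add: emeasure_distr lborel.emeasure_pair_measure_Times Basis_complex_def
        inner_complex_def ennreal_mult)
qed simp

lemma nn_integral_complex:
  assumes [measurable]: "F \<in> borel_measurable borel"
  shows "(\<integral>\<^sup>+z. F z \<partial>lborel) = (\<integral>\<^sup>+x. \<integral>\<^sup>+y. F (Complex x y) \<partial>lborel \<partial>lborel)"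
    and "(\<integral>\<^sup>+z. F z \<partial>lborel) = (\<integral>\<^sup>+y. \<integral>\<^sup>+x. F (Complex x y) \<partial>lborel \<partial>lborel)"
proof -
  have m[measurable]: "(\<lambda>(x, y). Complex x y) \<in> borel_measurable (lborel \<Otimes>\<^sub>M lborel)"
    by (simp add: Complex_eq case_prod_unfold)
  have "(\<integral>\<^sup>+z. F z \<partial>lborel) = (\<integral>\<^sup>+q. F (case q of (x, y) \<Rightarrow> Complex x y) \<partial>(lborel \<Otimes>\<^sub>M lborel))"
    by (subst lborel_complex_eq_distr) (simp add: nn_integral_distr)
  then have e: "(\<integral>\<^sup>+z. F z \<partial>lborel) = (\<integral>\<^sup>+q. (\<lambda>(x, y). F (Complex x y)) q \<partial>(lborel \<Otimes>\<^sub>M lborel))"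
    by (simp add: case_prod_unfold)
  have m2: "(\<lambda>(x, y). F (Complex x y)) \<in> borel_measurable (lborel \<Otimes>\<^sub>M lborel)"
    using measurable_compose[OF m, of F] by (simp add: case_prod_unfold)
  show "(\<integral>\<^sup>+z. F z \<partial>lborel) = (\<integral>\<^sup>+x. \<integral>\<^sup>+y. F (Complex x y) \<partial>lborel \<partial>lborel)"
    unfolding e by (subst lborel.nn_integral_fst[OF m2, symmetric]) simp
  show "(\<integral>\<^sup>+z. F z \<partial>lborel) = (\<integral>\<^sup>+y. \<integral>\<^sup>+x. F (Complex x y) \<partial>lborel \<partial>lborel)"
    unfolding e using lborel_pair.nn_integral_snd[OF m2] by simp
qed

lemma Complex_measurable [measurable]:
  "f \<in> borel_measurable M \<Longrightarrow> g \<in> borel_measurable M \<Longrightarrow> (\<lambda>x. Complex (f x) (g x)) \<in> borel_measurable M"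
  by (simp add: Complex_eq)

lemma nn_integral_shear:
  assumes [measurable]: "F \<in> borel_measurable borel"
  shows "(\<integral>\<^sup>+z. F (Complex (Re z + a * Im z) (Im z)) \<partial>lborel) = (\<integral>\<^sup>+z. F z \<partial>lborel)"
    and "(\<integral>\<^sup>+z. F (Complex (Re z) (Im z + a * Re z)) \<partial>lborel) = (\<integral>\<^sup>+z. F z \<partial>lborel)"
proof -
  have t: "(\<integral>\<^sup>+x. h (x + b) \<partial>lborel) = (\<integral>\<^sup>+x. h x \<partial>lborel)"
    if "h \<in> borel_measurable borel" for h :: "real \<Rightarrow> ennreal" and b
    using nn_integral_real_affine[OF that, of 1 b] by (simp add: add.commute)
  show "(\<integral>\<^sup>+z. F (Complex (Re z + a * Im z) (Im z)) \<partial>lborel) = (\<integral>\<^sup>+z. F z \<partial>lborel)"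
    by (subst (1 2) nn_integral_complex(2)) (auto intro!: nn_integral_cong t)
  show "(\<integral>\<^sup>+z. F (Complex (Re z) (Im z + a * Re z)) \<partial>lborel) = (\<integral>\<^sup>+z. F z \<partial>lborel)"
    by (subst (1 2) nn_integral_complex(1)) (auto intro!: nn_integral_cong t)
qed

text \<open>A rotation other than \<open>-1\<close> is a product of three shears, each of which is a translation on
  lines.\<close>

lemma nn_integral_rotate:
  assumes [measurable]: "F \<in> borel_measurable borel" and \<omega>: "cmod \<omega> = 1"
  shows "(\<integral>\<^sup>+z. F (\<omega> * z) \<partial>lborel) = (\<integral>\<^sup>+z. F z \<partial>lborel)"
proof -
  have main: "(\<integral>\<^sup>+z. F (\<omega> * z) \<partial>lborel) = (\<integral>\<^sup>+z. F z \<partial>lborel)"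
    if [measurable]: "F \<in> borel_measurable borel" and \<omega>: "cmod \<omega> = 1" "Re \<omega> \<noteq> -1" for F :: "complex \<Rightarrow> ennreal" and \<omega>
  proof -
    define c s where "c = Re \<omega>" and "s = Im \<omega>"
    have cs: "c * c + s * s = 1" "1 + c \<noteq> 0"
      using \<omega> by (auto simp: c_def s_def cmod_def power2_eq_square)
    \<comment> \<open>\<open>a\<close> is minus the tangent of half the angle\<close>
    define a where "a = - s / (1 + c)"
    have a1: "1 + a * s = c"
      using cs by (simp add: a_def field_simps)
    have a2: "a * (1 + c) = - s" using cs by (simp add: a_def)
    define F1 where "F1 z = F (Complex (Re z + a * Im z) (Im z))" for z
    define F2 where "F2 z = F1 (Complex (Re z) (Im z + s * Re z))" for z
    have [measurable]: "F1 \<in> borel_measurable borel" "F2 \<in> borel_measurable borel"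
      unfolding F1_def[abs_def] F2_def[abs_def] by measurable
    have "F (\<omega> * z) = F2 (Complex (Re z + a * Im z) (Im z))" for z
    proof -
      define x y where "x = Re z" and "y = Im z"
      have 1: "y + s * (x + a * y) = s * x + c * y"
        unfolding a1[symmetric] by (simp add: algebra_simps)
      have "x + a * y + a * (s * x + c * y) = (1 + a * s) * x + a * (1 + c) * y"
        by (simp add: algebra_simps)
      then have 2: "x + a * y + a * (s * x + c * y) = c * x - s * y" by (simp add: a1 a2)
      have "\<omega> * z = Complex (c * x - s * y) (s * x + c * y)"
        by (simp add: complex_eq_iff c_def s_def x_def y_def)
      then show ?thesis by (simp add: F2_def F1_def x_def[symmetric] y_def[symmetric] 1 2)
    qed
    then have "(\<integral>\<^sup>+z. F (\<omega> * z) \<partial>lborel) = (\<integral>\<^sup>+z. F2 (Complex (Re z + a * Im z) (Im z)) \<partial>lborel)" by simp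
    also have "\<dots> = (\<integral>\<^sup>+z. F2 z \<partial>lborel)" by (rule nn_integral_shear(1)) measurable
    also have "\<dots> = (\<integral>\<^sup>+z. F1 z \<partial>lborel)" unfolding F2_def by (rule nn_integral_shear(2)) measurable
    also have "\<dots> = (\<integral>\<^sup>+z. F z \<partial>lborel)" unfolding F1_def by (rule nn_integral_shear(1)) measurable
    finally show ?thesis .
  qed
  show ?thesis
  proof (cases "Re \<omega> = -1")
    case False
    then show ?thesis using main assms by blast
  next
    case True
    have "Im \<omega> = 0" using \<omega> True by (simp add: cmod_def power2_eq_square)
    \<comment> \<open>the half-turn is the square of the quarter-turn\<close>
    then have w: "\<omega> * z = \<i> * (\<i> * z)" for z using True by (simp add: complex_eq_iff)
    have "(\<integral>\<^sup>+z. F (\<i> * (\<i> * z)) \<partial>lborel) = (\<integral>\<^sup>+z. F (\<i> * z) \<partial>lborel)"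
      by (rule main[of "\<lambda>z. F (\<i> * z)" \<i>]) auto
    also have "\<dots> = (\<integral>\<^sup>+z. F z \<partial>lborel)" by (rule main) auto
    finally show ?thesis by (simp add: w)
  qed
qed

definition root1 :: "nat \<Rightarrow> nat \<Rightarrow> complex" where
  "root1 N k = cis (2 * pi * real k / real N)"

lemma norm_root1 [simp]: "cmod (root1 N k) = 1"
  by (simp add: root1_def)

lemma cis_eq_1_iff: "cis t = 1 \<longleftrightarrow> (\<exists>q::int. t = 2 * pi * of_int q)"
  by (simp add: cis_conv_exp exp_eq_1 mult_ac)

lemma root1_sum:
  assumes "j < N" "m < N"
  shows "(\<Sum>k<N. cnj (root1 N k ^ m) * root1 N k ^ j) = (if j = m then of_nat N else 0)"
proof -
  have N: "N > 0" using assms by simp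
  define x where "x = cis (2 * pi * (real j - real m) / real N)"
  have e: "cnj (root1 N k ^ m) * root1 N k ^ j = x ^ k" for k
    by (simp add: root1_def x_def Complex.DeMoivre cis_cnj cis_mult diff_divide_distrib algebra_simps)
  show ?thesis
  proof (cases "j = m")
    case True
    then show ?thesis unfolding e by (simp add: x_def)
  next
    case False
    have x1: "x \<noteq> 1"
    proof
      assume "x = 1"
      then obtain q :: int where "2 * pi * (real j - real m) / real N = 2 * pi * real_of_int q"
        unfolding x_def cis_eq_1_iff by (auto simp: mult_ac)
      then have "2 * pi * ((real j - real m) / real N) = 2 * pi * real_of_int q" by simp
      then have "(real j - real m) / real N = real_of_int q"
        by (rule mult_left_cancel[THEN iffD1, rotated]) simp
      then have "real j - real m = real_of_int (q * int N)" using N by (simp add: field_simps)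
      then have q: "int j - int m = q * int N" by linarith
      then have "\<bar>q * int N\<bar> < int N" using assms by linarith
      then have "q = 0" using N by (simp add: abs_mult) 
      with q False show False by simp
    qed
    have "x ^ N = cis (2 * pi * (real j - real m))"
      using N by (simp add: x_def Complex.DeMoivre)
    also have "\<dots> = 1" unfolding cis_eq_1_iff by (intro exI[of _ "int j - int m"]) auto
    finally have "x ^ N = 1" .
    then show ?thesis unfolding e using x1 False by (simp add: geometric_sum)
  qed
qed

text \<open>On Taylor polynomials of degree below \<open>N\<close> the averages are exact, by orthogonality of the roots of
  unity; the tail of the series, which converges absolutely on the unit circle, bounds the error.\<close>

lemma dft_tendsto_taylor_coeff:
  assumes hol: "g holomorphic_on ball 0 R" and R: "R > 1"
  shows "(\<lambda>N. (\<Sum>k<N. cnj (root1 N k ^ m) * g (root1 N k)) / of_nat N) \<longlonglongrightarrow> (deriv ^^ m) g 0 / fact m"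
proof -
  define a where "a j = (deriv ^^ j) g 0 / fact j" for j
  have ser: "(\<lambda>j. a j * z ^ j) sums g z" if "z \<in> ball 0 R" for z
    using holomorphic_power_series[OF hol that] by (simp add: a_def)
  have abs: "summable (\<lambda>j. cmod (a j))"
  proof -
    have R': "of_real ((1 + R) / 2) \<in> ball (0 :: complex) R" using R by (auto simp: abs_if simp del: of_real_divide of_real_add)
    have "summable (\<lambda>j. cmod (a j * 1 ^ j))"
      by (rule powser_insidea[OF sums_summable[OF ser[OF R']]])
         (use R in \<open>auto simp: abs_if simp del: of_real_divide of_real_add\<close>)
    then show ?thesis by simp
  qed
  define \<tau> where "\<tau> N = (\<Sum>j. cmod (a (j + N)))" for N
  have \<tau>0: "\<tau> \<longlonglongrightarrow> 0" unfolding \<tau>_def using suminf_exist_split2[OF abs] by simp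
  have tail: "cmod (g w - (\<Sum>j<N. a j * w ^ j)) \<le> \<tau> N" if w: "cmod w = 1" for w N
  proof -
    have s: "(\<lambda>j. a j * w ^ j) sums g w" by (rule ser) (use w R in auto)
    have "g w - (\<Sum>j<N. a j * w ^ j) = (\<Sum>j. a (j + N) * w ^ (j + N))"
      using suminf_minus_initial_segment[OF sums_summable[OF s], of N] sums_unique[OF s] by simp
    also have "cmod \<dots> \<le> (\<Sum>j. cmod (a (j + N) * w ^ (j + N)))"
      by (rule summable_norm) (use summable_ignore_initial_segment[OF abs, of N] in \<open>simp add: norm_mult norm_power w\<close>)
    finally show ?thesis by (simp add: \<tau>_def norm_mult norm_power w)
  qed
  have "\<forall>\<^sub>F N in sequentially. cmod ((\<Sum>k<N. cnj (root1 N k ^ m) * g (root1 N k)) / of_nat N - a m) \<le> \<tau> N"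
    using eventually_gt_at_top[of m]
  proof eventually_elim
    case (elim N)
    have "(\<Sum>k<N. cnj (root1 N k ^ m) * (\<Sum>j<N. a j * root1 N k ^ j))
        = (\<Sum>j<N. a j * (\<Sum>k<N. cnj (root1 N k ^ m) * root1 N k ^ j))"
      unfolding sum_distrib_left by (subst sum.swap) (simp add: mult_ac)
    also have "\<dots> = (\<Sum>j<N. if j = m then a j * of_nat N else 0)"
      using elim by (intro sum.cong refl) (simp add: root1_sum del: complex_cnj_power)
    also have "\<dots> = a m * of_nat N" using elim by simp
    finally have "(\<Sum>k<N. cnj (root1 N k ^ m) * g (root1 N k)) / of_nat N - a m
        = (\<Sum>k<N. cnj (root1 N k ^ m) * (g (root1 N k) - (\<Sum>j<N. a j * root1 N k ^ j))) / of_nat N"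
      using elim by (simp add: right_diff_distrib sum_subtractf field_simps)
    also have "cmod \<dots> \<le> (\<Sum>k<N. \<tau> N) / real N"
      unfolding norm_divide norm_of_nat
      by (intro divide_right_mono sum_norm_le) (auto simp: norm_mult norm_power tail)
    also have "\<dots> = \<tau> N" using elim by simp
    finally show ?case .
  qed
  then have "(\<lambda>N. (\<Sum>k<N. cnj (root1 N k ^ m) * g (root1 N k)) / of_nat N - a m) \<longlonglongrightarrow> 0"
    by (rule Lim_null_comparison[OF _ \<tau>0])
  then show ?thesis unfolding a_def by (rule LIM_zero_cancel)
qed

text \<open>Averages of \<open>L\<^sup>2\<close> functions over measure-preserving maps do not increase the norm, and by
  Fatou's lemma neither do their pointwise limits.\<close>

lemma nn_integral_average_limit_le:
  fixes h :: "'a \<Rightarrow> complex" and H :: "'a \<Rightarrow> complex"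
  assumes h[measurable]: "h \<in> borel_measurable M"
    and \<tau>[measurable]: "\<And>N k. \<tau> N k \<in> measurable M M"
    and pres: "\<And>N k. (\<integral>\<^sup>+x. ennreal ((cmod (h (\<tau> N k x)))\<^sup>2) \<partial>M) = (\<integral>\<^sup>+x. ennreal ((cmod (h x))\<^sup>2) \<partial>M)"
    and \<lambda>: "\<And>N k. cmod (wt N k) \<le> 1"
    and lim: "AE x in M. (\<lambda>N. (\<Sum>k<N. wt N k * h (\<tau> N k x)) / of_nat N) \<longlonglongrightarrow> H x"
  shows "(\<integral>\<^sup>+x. ennreal ((cmod (H x))\<^sup>2) \<partial>M) \<le> (\<integral>\<^sup>+x. ennreal ((cmod (h x))\<^sup>2) \<partial>M)"
proof -
  define A where "A N x = (\<Sum>k<N. wt N k * h (\<tau> N k x)) / of_nat N" for N x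
  have [measurable]: "A N \<in> borel_measurable M" for N unfolding A_def[abs_def] by measurable
  let ?I = "\<integral>\<^sup>+x. ennreal ((cmod (h x))\<^sup>2) \<partial>M"
  have pw: "(cmod (A N x))\<^sup>2 \<le> (\<Sum>k<N. (cmod (h (\<tau> N k x)))\<^sup>2) / real N" if N: "N > 0" for N x
  proof -
    have "cmod (\<Sum>k<N. wt N k * h (\<tau> N k x)) \<le> sqrt (\<Sum>k<N. (cmod (wt N k))\<^sup>2) * sqrt (\<Sum>k<N. (cmod (h (\<tau> N k x)))\<^sup>2)"
      by (rule norm_sum_mult_le)
    also have "\<dots> \<le> sqrt (real N) * sqrt (\<Sum>k<N. (cmod (h (\<tau> N k x)))\<^sup>2)"
    proof (intro mult_right_mono)
      have "(\<Sum>k<N. (cmod (wt N k))\<^sup>2) \<le> (\<Sum>k<N. 1)" by (intro sum_mono) (simp add: \<lambda> power_le_one)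
      then show "sqrt (\<Sum>k<N. (cmod (wt N k))\<^sup>2) \<le> sqrt (real N)" by simp
    qed (simp add: sum_nonneg)
    finally have "(cmod (\<Sum>k<N. wt N k * h (\<tau> N k x)))\<^sup>2 \<le> (sqrt (real N) * sqrt (\<Sum>k<N. (cmod (h (\<tau> N k x)))\<^sup>2))\<^sup>2"
      by (rule power_mono) simp
    then have "(cmod (\<Sum>k<N. wt N k * h (\<tau> N k x)))\<^sup>2 \<le> real N * (\<Sum>k<N. (cmod (h (\<tau> N k x)))\<^sup>2)"
      by (simp add: power_mult_distrib sum_nonneg)
    then show ?thesis
      using N by (simp add: A_def norm_divide power_divide power2_eq_square[of "real N"] divide_simps mult_ac)
  qed
  have IA: "(\<integral>\<^sup>+x. ennreal ((cmod (A N x))\<^sup>2) \<partial>M) \<le> ?I" if N: "N > 0" for N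
  proof -
    have "(\<integral>\<^sup>+x. ennreal ((cmod (A N x))\<^sup>2) \<partial>M)
        \<le> (\<integral>\<^sup>+x. ennreal (1 / real N) * (\<Sum>k<N. ennreal ((cmod (h (\<tau> N k x)))\<^sup>2)) \<partial>M)"
    proof (rule nn_integral_mono)
      fix x
      have "ennreal ((cmod (A N x))\<^sup>2) \<le> ennreal (1 / real N * (\<Sum>k<N. (cmod (h (\<tau> N k x)))\<^sup>2))"
        using pw[OF N, of x] by (intro ennreal_leI) simp
      also have "\<dots> = ennreal (1 / real N) * (\<Sum>k<N. ennreal ((cmod (h (\<tau> N k x)))\<^sup>2))"
        by (subst ennreal_mult) (auto simp: sum_nonneg sum_ennreal)
      finally show "ennreal ((cmod (A N x))\<^sup>2) \<le> ennreal (1 / real N) * (\<Sum>k<N. ennreal ((cmod (h (\<tau> N k x)))\<^sup>2))" .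
    qed
    also have "\<dots> = ennreal (1 / real N) * (\<Sum>k<N. \<integral>\<^sup>+x. ennreal ((cmod (h (\<tau> N k x)))\<^sup>2) \<partial>M)"
      by (subst nn_integral_cmult, measurable, subst nn_integral_sum) auto
    also have "\<dots> = ennreal (1 / real N) * (of_nat N * ?I)" by (simp add: pres)
    also have "\<dots> = ?I"
    proof -
      have "ennreal (1 / real N) * ennreal (real N) = 1"
        using N by (subst ennreal_mult[symmetric]) auto
      then show ?thesis by (simp add: mult.assoc[symmetric] ennreal_of_nat_eq_real_of_nat)
    qed
    finally show ?thesis .
  qed
  have "(\<integral>\<^sup>+x. ennreal ((cmod (H x))\<^sup>2) \<partial>M) \<le> (\<integral>\<^sup>+x. liminf (\<lambda>N. ennreal ((cmod (A N x))\<^sup>2)) \<partial>M)"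
  proof (rule nn_integral_mono_AE)
    show "AE x in M. ennreal ((cmod (H x))\<^sup>2) \<le> liminf (\<lambda>N. ennreal ((cmod (A N x))\<^sup>2))"
      using lim
    proof eventually_elim
      case (elim x)
      then have "(\<lambda>N. ennreal ((cmod (A N x))\<^sup>2)) \<longlonglongrightarrow> ennreal ((cmod (H x))\<^sup>2)"
        unfolding A_def by (intro tendsto_ennrealI tendsto_power tendsto_norm)
      then show ?case using lim_imp_Liminf[OF sequentially_bot] by (metis order_refl)
    qed
  qed
  also have "\<dots> \<le> liminf (\<lambda>N. \<integral>\<^sup>+x. ennreal ((cmod (A N x))\<^sup>2) \<partial>M)"
    by (rule nn_integral_liminf) measurable
  also have "\<dots> \<le> ?I"
  proof (rule Liminf_le)
    show "\<forall>\<^sub>F N in sequentially. (\<integral>\<^sup>+x. ennreal ((cmod (A N x))\<^sup>2) \<partial>M) \<le> ?I"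
      using eventually_gt_at_top[of 0] by eventually_elim (rule IA)
  qed simp
  finally show ?thesis .
qed

section \<open>The mean value inequality\<close>

lemma nn_integral_translate:
  assumes "F \<in> borel_measurable borel"
  shows "(\<integral>\<^sup>+w. F (c + w) \<partial>lborel) = (\<integral>\<^sup>+w. F (w :: complex) \<partial>lborel)"
proof -
  have "(\<integral>\<^sup>+w. F w \<partial>lborel) = (\<integral>\<^sup>+w. F w \<partial>distr lborel borel ((+) c))"
    by (simp add: lborel_distr_plus)
  also have "\<dots> = (\<integral>\<^sup>+w. F (c + w) \<partial>lborel)" using assms by (simp add: nn_integral_distr)
  finally show ?thesis by simp
qed

text \<open>The mean value inequality in integrated form: the averages of \<open>g\<close> over the rotations of the disc by the
  \<open>N\<close>-th roots of unity tend to the constant \<open>g c\<close>, and averaging does not increase the norm.\<close>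

lemma mean_value_disc:
  assumes hol: "g holomorphic_on ball c r"
    and m: "(\<lambda>w. indicator (ball c r) w * g w) \<in> borel_measurable borel"
  shows "ennreal ((cmod (g c))\<^sup>2) * emeasure lborel (ball c r)
      \<le> (\<integral>\<^sup>+w. ennreal ((cmod (indicator (ball c r) w * g w))\<^sup>2) \<partial>lborel)"
proof -
  define h where "h w = indicator (ball c r) (c + w) * g (c + w)" for w
  have hm[measurable]: "h \<in> borel_measurable lborel"
    using measurable_compose[OF _ m, of "\<lambda>w. c + w" lborel] unfolding h_def[abs_def] by simp
  define H where "H w = indicator (ball 0 r) w * g c" for w :: complex
  have "(\<integral>\<^sup>+w. ennreal ((cmod (H w))\<^sup>2) \<partial>lborel) \<le> (\<integral>\<^sup>+w. ennreal ((cmod (h w))\<^sup>2) \<partial>lborel)"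
  proof (rule nn_integral_average_limit_le[where \<tau> = "\<lambda>N k w. root1 N k * w" and wt = "\<lambda>N k. 1"])
    show "(\<integral>\<^sup>+w. ennreal ((cmod (h (root1 N k * w)))\<^sup>2) \<partial>lborel) = (\<integral>\<^sup>+w. ennreal ((cmod (h w))\<^sup>2) \<partial>lborel)" for N k
      by (rule nn_integral_rotate[where F = "\<lambda>w. ennreal ((cmod (h w))\<^sup>2)"]) (use hm in auto)
    have "(\<lambda>N. (\<Sum>k<N. 1 * h (root1 N k * w)) / of_nat N) \<longlonglongrightarrow> H w" for w
    proof (cases "w \<in> ball 0 r")
      case True
      then have w: "cmod w < r" by simp
      define R where "R = (if w = 0 then 2 else r / cmod w)"
      have R: "R > 1" using w by (simp add: R_def)
      have in': "c + t * w \<in> ball c r" if "t \<in> ball 0 R" for t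
        using that w by (auto simp: R_def dist_norm norm_mult divide_simps split: if_splits)
      have "(\<lambda>t. g (c + t * w)) holomorphic_on ball 0 R"
      proof (rule holomorphic_on_compose_gen[of "\<lambda>t. c + t * w" "ball 0 R" g "ball c r", unfolded o_def])
        show "(\<lambda>t. c + t * w) ` ball 0 R \<subseteq> ball c r" using in' by blast
      qed (auto intro!: holomorphic_intros hol)
      from dft_tendsto_taylor_coeff[OF this R, of 0]
      have "(\<lambda>N. (\<Sum>k<N. g (c + root1 N k * w)) / of_nat N) \<longlonglongrightarrow> g c" by simp
      moreover have "h (root1 N k * w) = g (c + root1 N k * w)" for N k
        using w by (simp add: h_def dist_norm norm_mult)
      ultimately show ?thesis using True by (simp add: H_def)
    next
      case False
      then have "h (root1 N k * w) = 0" for N k by (simp add: h_def dist_norm norm_mult)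
      then show ?thesis using False by (simp add: H_def)
    qed
    then show "AE w in lborel. (\<lambda>N. (\<Sum>k<N. 1 * h (root1 N k * w)) / of_nat N) \<longlonglongrightarrow> H w" by simp
  qed auto
  also have "(\<integral>\<^sup>+w. ennreal ((cmod (h w))\<^sup>2) \<partial>lborel) = (\<integral>\<^sup>+w. ennreal ((cmod (indicator (ball c r) w * g w))\<^sup>2) \<partial>lborel)"
    unfolding h_def by (rule nn_integral_translate[where F = "\<lambda>w. ennreal ((cmod (indicator (ball c r) w * g w))\<^sup>2)"])
       (use m in measurable)
  also have "(\<integral>\<^sup>+w. ennreal ((cmod (H w))\<^sup>2) \<partial>lborel) = (\<integral>\<^sup>+w. ennreal ((cmod (g c))\<^sup>2) * indicator (ball (0::complex) r) w \<partial>lborel)"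
    by (intro nn_integral_cong) (auto simp: H_def indicator_def)
  also have "\<dots> = ennreal ((cmod (g c))\<^sup>2) * emeasure lborel (ball (0::complex) r)"
    by (subst nn_integral_cmult_indicator) auto
  also have "emeasure lborel (ball (0::complex) r) = emeasure lborel (ball c r)"
  proof -
    have "emeasure lborel (ball c r) = (\<integral>\<^sup>+w. indicator (ball c r) w \<partial>lborel)" by simp
    also have "\<dots> = (\<integral>\<^sup>+w. indicator (ball c r) (c + w) \<partial>lborel)"
      by (rule nn_integral_translate[symmetric]) (simp add: borel_measurable_indicator)
    also have "\<dots> = (\<integral>\<^sup>+w. indicator (ball (0::complex) r) w \<partial>lborel)"
      by (intro nn_integral_cong) (auto simp: indicator_def dist_norm)
    finally show ?thesis by simp
  qed
  finally show ?thesis .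
qed

interpretation lborel_product: product_sigma_finite "\<lambda>_::nat. lborel :: complex measure"
  by (simp add: product_sigma_finite_def sigma_finite_lborel)

text \<open>By Fubini, one variable at a time. The index set is arbitrary to make the induction possible.\<close>

lemma mean_value_polydisc_aux:
  fixes f :: "(nat \<Rightarrow> complex) \<Rightarrow> complex"
  assumes "finite I"
    and "f \<in> borel_measurable (Pi\<^sub>M I (\<lambda>_. lborel))"
    and "\<And>z i. z \<in> PiE I (\<lambda>i. ball (p i) r) \<Longrightarrow> i \<in> I \<Longrightarrow> (\<lambda>w. f (z(i := w))) holomorphic_on ball (p i) r"
  shows "ennreal ((cmod (f (restrict p I)))\<^sup>2) * (\<Prod>i\<in>I. emeasure lborel (ball (p i) r))
    \<le> (\<integral>\<^sup>+z. ennreal ((cmod (f z))\<^sup>2) * indicator (PiE I (\<lambda>i. ball (p i) r)) z \<partial>Pi\<^sub>M I (\<lambda>_. lborel))"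
  using assms
proof (induction I arbitrary: f rule: finite_induct)
  case empty
  then show ?case by (simp add: lborel_product.nn_integral_empty PiM_empty nn_integral_count_space_finite restrict_def)
next
  case (insert i I)
  have fm[measurable]: "f \<in> borel_measurable (Pi\<^sub>M (insert i I) (\<lambda>_. lborel))" by (rule insert.prems)
  have Pm[measurable]: "PiE (insert i I) (\<lambda>i. ball (p i) r) \<in> sets (Pi\<^sub>M (insert i I) (\<lambda>_. lborel))"
    using insert by (intro sets_PiM_I_finite) auto
  have Pm'[measurable]: "PiE I (\<lambda>i. ball (p i) r) \<in> sets (Pi\<^sub>M I (\<lambda>_. lborel))"
    using insert by (intro sets_PiM_I_finite) auto
  show ?case
  proof (cases "r > 0")
    case False
    then have "ball (p i) r = {}" by simp
    then show ?thesis using insert.hyps by (simp del: ball_eq_empty)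
  next
    case r: True
  define f' where "f' x = f (x(i := p i))" for x
  have upd: "(\<lambda>x. x(i := w)) \<in> measurable (Pi\<^sub>M I (\<lambda>_. lborel)) (Pi\<^sub>M (insert i I) (\<lambda>_. lborel))" for w :: complex
    by (rule measurable_fun_upd[where J = I]) auto
  have f'm: "f' \<in> borel_measurable (Pi\<^sub>M I (\<lambda>_. lborel))"
    unfolding f'_def[abs_def] using measurable_compose[OF upd fm] .
  have IH: "ennreal ((cmod (f' (restrict p I)))\<^sup>2) * (\<Prod>i\<in>I. emeasure lborel (ball (p i) r))
    \<le> (\<integral>\<^sup>+z. ennreal ((cmod (f' z))\<^sup>2) * indicator (PiE I (\<lambda>i. ball (p i) r)) z \<partial>Pi\<^sub>M I (\<lambda>_. lborel))"
  proof (rule insert.IH[OF f'm])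
    fix z k assume z: "z \<in> PiE I (\<lambda>i. ball (p i) r)" and k: "k \<in> I"
    have "z(i := p i) \<in> PiE (insert i I) (\<lambda>i. ball (p i) r)"
      using z r by (intro PiE_fun_upd) auto
    from insert.prems(2)[OF this insertI2[OF k]] have "(\<lambda>w. f (z(i := p i, k := w))) holomorphic_on ball (p k) r" .
    moreover have "k \<noteq> i" using k insert.hyps by auto
    ultimately show "(\<lambda>w. f' (z(k := w))) holomorphic_on ball (p k) r"
      unfolding f'_def by (simp add: fun_upd_twist[of k i z])
  qed
  have slice: "ennreal ((cmod (f' x))\<^sup>2) * indicator (PiE I (\<lambda>i. ball (p i) r)) x * emeasure lborel (ball (p i) r)
    \<le> (\<integral>\<^sup>+y. ennreal ((cmod (f (x(i := y))))\<^sup>2) * indicator (PiE (insert i I) (\<lambda>i. ball (p i) r)) (x(i := y)) \<partial>lborel)"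
    if xs: "x \<in> space (Pi\<^sub>M I (\<lambda>_. lborel))" for x
  proof (cases "x \<in> PiE I (\<lambda>i. ball (p i) r)")
    case True
    have h: "(\<lambda>w. f (x(i := w))) holomorphic_on ball (p i) r"
    proof -
      have "x(i := p i) \<in> PiE (insert i I) (\<lambda>i. ball (p i) r)"
        using True r by (intro PiE_fun_upd) auto
      from insert.prems(2)[OF this insertI1] show ?thesis by (simp only: fun_upd_upd)
    qed
    have "(\<lambda>y. f (x(i := y))) \<in> borel_measurable lborel"
      by (rule measurable_compose[OF measurable_component_update[OF xs insert.hyps(2)] fm])
    then have m: "(\<lambda>y. indicator (ball (p i) r) y * f (x(i := y))) \<in> borel_measurable borel"
      by (intro borel_measurable_times borel_measurable_indicator) auto
    have "ennreal ((cmod (f (x(i := p i))))\<^sup>2) * emeasure lborel (ball (p i) r)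
      \<le> (\<integral>\<^sup>+y. ennreal ((cmod (indicator (ball (p i) r) y * f (x(i := y))))\<^sup>2) \<partial>lborel)"
      by (rule mean_value_disc[OF h m])
    also have "\<dots> = (\<integral>\<^sup>+y. ennreal ((cmod (f (x(i := y))))\<^sup>2) * indicator (PiE (insert i I) (\<lambda>i. ball (p i) r)) (x(i := y)) \<partial>lborel)"
    proof (intro nn_integral_cong)
      fix y
      have "x(i := y) \<in> PiE (insert i I) (\<lambda>i. ball (p i) r) \<longleftrightarrow> y \<in> ball (p i) r"
        using True insert.hyps(2) by (auto simp: PiE_iff extensional_def)
      then show "ennreal ((cmod (indicator (ball (p i) r) y * f (x(i := y))))\<^sup>2)
          = ennreal ((cmod (f (x(i := y))))\<^sup>2) * indicator (PiE (insert i I) (\<lambda>i. ball (p i) r)) (x(i := y))"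
        by (auto simp: indicator_def)
    qed
    finally show ?thesis using True by (simp add: f'_def)
  qed simp
  have "ennreal ((cmod (f (restrict p (insert i I))))\<^sup>2) * (\<Prod>i\<in>insert i I. emeasure lborel (ball (p i) r))
    = (ennreal ((cmod (f' (restrict p I)))\<^sup>2) * (\<Prod>i\<in>I. emeasure lborel (ball (p i) r))) * emeasure lborel (ball (p i) r)"
  proof -
    have "(restrict p I)(i := p i) = restrict p (insert i I)" by (auto simp: restrict_def fun_eq_iff)
    then show ?thesis using insert.hyps by (simp add: f'_def mult_ac)
  qed
  also have "\<dots> \<le> (\<integral>\<^sup>+z. ennreal ((cmod (f' z))\<^sup>2) * indicator (PiE I (\<lambda>i. ball (p i) r)) z \<partial>Pi\<^sub>M I (\<lambda>_. lborel))
      * emeasure lborel (ball (p i) r)"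
    by (intro mult_right_mono IH) simp
  also have "\<dots> = (\<integral>\<^sup>+x. ennreal ((cmod (f' x))\<^sup>2) * indicator (PiE I (\<lambda>i. ball (p i) r)) x * emeasure lborel (ball (p i) r) \<partial>Pi\<^sub>M I (\<lambda>_. lborel))"
    by (rule nn_integral_multc[symmetric]) (use f'm in measurable)
  also have "\<dots> \<le> (\<integral>\<^sup>+x. (\<integral>\<^sup>+y. ennreal ((cmod (f (x(i := y))))\<^sup>2) * indicator (PiE (insert i I) (\<lambda>i. ball (p i) r)) (x(i := y)) \<partial>lborel) \<partial>Pi\<^sub>M I (\<lambda>_. lborel))"
    by (intro nn_integral_mono slice)
  also have "\<dots> = (\<integral>\<^sup>+z. ennreal ((cmod (f z))\<^sup>2) * indicator (PiE (insert i I) (\<lambda>i. ball (p i) r)) z \<partial>Pi\<^sub>M (insert i I) (\<lambda>_. lborel))"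
    by (rule lborel_product.product_nn_integral_insert[symmetric, OF insert.hyps]) measurable
  finally show ?thesis .
  qed
qed

section \<open>Topology and measurability in coordinates\<close>

lemma openin_Cn_box:
  assumes "openin (Cn_top n) D" "p \<in> D"
  obtains U where "\<And>i. i < n \<Longrightarrow> open (U i)" "p \<in> PiE {..<n} U" "PiE {..<n} U \<subseteq> D"
proof -
  have "\<exists>U. finite {i \<in> {..<n}. U i \<noteq> topspace (euclidean :: complex topology)} \<and>
      (\<forall>i\<in>{..<n}. openin euclidean (U i)) \<and> p \<in> PiE {..<n} U \<and> PiE {..<n} U \<subseteq> D"
    by (rule bspec[OF assms(1)[unfolded Cn_top_def openin_product_topology_alt] assms(2)])
  then show ?thesis by (elim exE conjE) (rule that, simp_all)
qed

lemma openin_Cn_imp_cn_open: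
  assumes "openin (Cn_top n) D"
  shows "cn_open n D"
  unfolding cn_open_def
proof
  fix p assume p: "p \<in> D"
  obtain U where U: "\<And>i. i < n \<Longrightarrow> open (U i)" "p \<in> PiE {..<n} U" "PiE {..<n} U \<subseteq> D"
    by (rule openin_Cn_box[OF assms p]) (rule that)
  have "\<forall>i\<in>{..<n}. \<exists>r>0. ball (p i) r \<subseteq> U i"
    using U by (auto simp: open_contains_ball PiE_iff)
  then obtain \<rho> where \<rho>: "\<And>i. i < n \<Longrightarrow> \<rho> i > 0 \<and> ball (p i) (\<rho> i) \<subseteq> U i"
    by (metis lessThan_iff)
  define r where "r = Min (insert 1 (\<rho> ` {..<n}))"
  have r: "r > 0" unfolding r_def using \<rho> by (subst Min_gr_iff) auto
  have le: "r \<le> \<rho> i" if "i < n" for i unfolding r_def using that by (intro Min_le) auto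
  have "polydisc n p r \<subseteq> PiE {..<n} U"
    unfolding polydisc_def
  proof (rule PiE_mono)
    fix i assume i: "i \<in> {..<n}"
    have "ball (p i) r \<subseteq> ball (p i) (\<rho> i)" by (rule subset_ball) (use le i in auto)
    then show "ball (p i) r \<subseteq> U i" using \<rho> i by blast
  qed
  moreover have "p \<in> polydisc n p r" using U(2) r by (auto simp: polydisc_def PiE_iff)
  ultimately show "\<exists>r>0. p \<in> polydisc n p r \<and> polydisc n p r \<subseteq> D" using r U(3) by blast
qed

lemma openin_polydisc: "openin (Cn_top n) (polydisc n p r)"
  unfolding Cn_top_def polydisc_def by (subst openin_PiE) auto

lemma openin_Cn_iff: "openin (Cn_top n) D \<longleftrightarrow> cn_open n D"
proof
  assume "cn_open n D"
  then have "\<forall>p\<in>D. \<exists>T. openin (Cn_top n) T \<and> p \<in> T \<and> T \<subseteq> D"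
    unfolding cn_open_def using openin_polydisc by meson
  then show "openin (Cn_top n) D" by (rule openin_subopen[THEN iffD2])
qed (rule openin_Cn_imp_cn_open)

text \<open>A countable basis of the plane yields a countable cover by measurable boxes.\<close>

lemma openin_Cn_measurable:
  assumes "openin (Cn_top n) D"
  shows "D \<in> sets (Cn_lborel n)"
proof -
  obtain \<B> :: "complex set set" where c: "countable \<B>" and b: "topological_basis \<B>"
    using ex_countable_basis by blast
  have \<B>: "countable \<B>" "\<And>X. X \<in> \<B> \<Longrightarrow> open X"
    "\<And>X x. open X \<Longrightarrow> x \<in> X \<Longrightarrow> \<exists>Y\<in>\<B>. x \<in> Y \<and> Y \<subseteq> X"
    using c topological_basis_open[OF b] topological_basisE[OF b] by metis+
  define \<C> where "\<C> = {b \<in> PiE {..<n} (\<lambda>_. \<B>). PiE {..<n} b \<subseteq> D}"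
  have "countable \<C>"
    unfolding \<C>_def by (rule countable_subset[of _ "PiE {..<n} (\<lambda>_. \<B>)"]) (auto intro!: countable_PiE \<B>)
  moreover have "PiE {..<n} b \<in> sets (Cn_lborel n)" if "b \<in> \<C>" for b
    unfolding Cn_lborel_def using that \<B>(2)
    by (intro sets_PiM_I_finite) (auto simp: \<C>_def PiE_iff)
  moreover have "D = (\<Union>b\<in>\<C>. PiE {..<n} b)"
  proof (intro equalityI subsetI)
    fix z assume z: "z \<in> D"
    obtain U where U: "\<And>i. i < n \<Longrightarrow> open (U i)" "z \<in> PiE {..<n} U" "PiE {..<n} U \<subseteq> D"
      by (rule openin_Cn_box[OF assms z]) (rule that)
    have "\<forall>i\<in>{..<n}. \<exists>Y\<in>\<B>. z i \<in> Y \<and> Y \<subseteq> U i"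
      using U \<B>(3) by (auto simp: PiE_iff)
    then obtain b where b: "\<And>i. i < n \<Longrightarrow> b i \<in> \<B> \<and> z i \<in> b i \<and> b i \<subseteq> U i"
      by (metis lessThan_iff)
    have "PiE {..<n} (restrict b {..<n}) \<subseteq> PiE {..<n} U" using b by (intro PiE_mono) auto
    then have "restrict b {..<n} \<in> \<C>" using b U(3) by (auto simp: \<C>_def)
    moreover have "z \<in> PiE {..<n} (restrict b {..<n})" using b U(2) by (auto simp: PiE_iff)
    ultimately show "z \<in> (\<Union>b\<in>\<C>. PiE {..<n} b)" by blast
  qed (auto simp: \<C>_def)
  ultimately show ?thesis using sets.countable_UN''[of \<C> "PiE {..<n}" "Cn_lborel n"] by simp
qed

lemma cnj_measurable: "cnj \<in> borel_measurable borel"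
  by (intro borel_measurable_continuous_onI continuous_on_cnj continuous_on_id)

lemma continuous_map_mult_complex:
  fixes f g :: "'a \<Rightarrow> complex"
  assumes "continuous_map X euclidean f" "continuous_map X euclidean g"
  shows "continuous_map X euclidean (\<lambda>x. f x * g x)"
proof -
  have "continuous_map X euclidean (\<lambda>x. (f x, g x))"
    using continuous_map_pairedI[OF assms] by simp
  moreover have "continuous_map euclidean euclidean (\<lambda>(a, b). a * b :: complex)"
    by (auto simp: case_prod_unfold intro!: continuous_intros)
  ultimately show ?thesis
    using continuous_map_compose[of X euclidean "\<lambda>x. (f x, g x)" euclidean "\<lambda>(a, b). a * b"] by (simp add: o_def)
qed

lemma continuous_map_Cn_measurable:
  fixes f :: "(nat \<Rightarrow> complex) \<Rightarrow> complex"
  assumes D: "openin (Cn_top n) D" and f: "continuous_map (subtopology (Cn_top n) D) euclidean f"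
  shows "(\<lambda>z. indicator D z * f z) \<in> borel_measurable (Cn_lborel n)"
proof (rule borel_measurableI)
  fix S :: "complex set" assume S: "open S"
  have sub: "D \<subseteq> topspace (Cn_top n)" using D openin_subset by blast
  have "openin (subtopology (Cn_top n) D) {z \<in> topspace (subtopology (Cn_top n) D). f z \<in> S}"
    using f S by (intro openin_continuous_map_preimage[of _ euclidean]) auto
  then have "openin (Cn_top n) {z \<in> D. f z \<in> S}"
    using D sub by (simp add: openin_open_subtopology inf_absorb2)
  then have 1: "{z \<in> D. f z \<in> S} \<in> sets (Cn_lborel n)" by (rule openin_Cn_measurable)
  have 2: "space (Cn_lborel n) - D \<in> sets (Cn_lborel n)" using openin_Cn_measurable[OF D] by blast
  have sp: "D \<subseteq> space (Cn_lborel n)" using openin_Cn_measurable[OF D] sets.sets_into_space by blast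
  have "(\<lambda>z. indicator D z * f z) -` S \<inter> space (Cn_lborel n)
      = {z \<in> D. f z \<in> S} \<union> (if 0 \<in> S then space (Cn_lborel n) - D else {})"
  proof (rule Set.set_eqI)
    fix z
    show "z \<in> (\<lambda>z. indicator D z * f z) -` S \<inter> space (Cn_lborel n)
        \<longleftrightarrow> z \<in> {z \<in> D. f z \<in> S} \<union> (if 0 \<in> S then space (Cn_lborel n) - D else {})"
      using sp by (cases "z \<in> D") auto
  qed
  also have "\<dots> \<in> sets (Cn_lborel n)" using 1 2 by auto
  finally show "(\<lambda>z. indicator D z * f z) -` S \<inter> space (Cn_lborel n) \<in> sets (Cn_lborel n)" .
qed

text \<open>Osgood's lemma: by Cauchy's estimate a bounded separately holomorphic function is Lipschitz in each
  variable on a smaller polydisc, with the same constant.\<close>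

lemma hol_family_continuous:
  assumes fam: "hol_family n D B u" and j: "j \<in> B" and D: "openin (Cn_top n) D"
  shows "continuous_map (subtopology (Cn_top n) D) euclidean (u j)"
  unfolding continuous_map_def
proof (intro conjI allI impI)
  fix S :: "complex set" assume "openin euclidean S"
  then have S: "open S" by simp
  have sub: "D \<subseteq> topspace (Cn_top n)" using D openin_subset by blast
  have "cn_open n {z \<in> D. u j z \<in> S}"
    unfolding cn_open_def
  proof
    fix p assume p: "p \<in> {z \<in> D. u j z \<in> S}"
    then have pD: "p \<in> D" by simp
    obtain r M where r: "r > 0" and M: "M \<ge> 0" and pin: "p \<in> polydisc n p r"
      and sub: "polydisc n p r \<subseteq> D"
      and bd: "\<And>y F. y \<in> polydisc n p r \<Longrightarrow> finite F \<Longrightarrow> F \<subseteq> B \<Longrightarrow> (\<Sum>j\<in>F. (cmod (u j y))\<^sup>2) \<le> M\<^sup>2"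
      using hol_familyE[OF fam pD] by metis
    have uM: "cmod (u j y) \<le> M" if "y \<in> polydisc n p r" for y
    proof -
      have "(cmod (u j y))\<^sup>2 \<le> M\<^sup>2" using bd[OF that, of "{j}"] j by simp
      then show ?thesis using M by (simp add: abs_le_square_iff[symmetric])
    qed
    define L where "L = 2 * M / (r/2)"
    have L0: "L \<ge> 0" unfolding L_def using M r by simp
    have lip: "cmod (u j (y(i := w)) - u j (y(i := p i))) \<le> L * cmod (w - p i)"
      if y: "y \<in> polydisc n p r" and i: "i < n" and w: "w \<in> ball (p i) (r/2)" for y i w
    proof (rule field_differentiable_bound[of "ball (p i) (r/2)" _ "\<lambda>x. deriv (\<lambda>w. u j (y(i := w))) x"])
      have hol: "(\<lambda>w. u j (y(i := w))) holomorphic_on ball (p i) r"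
        by (rule hol_family_line[OF fam j i]) (use polydisc_update[OF y i] sub in blast)
      show "((\<lambda>w. u j (y(i := w))) has_field_derivative deriv (\<lambda>w. u j (y(i := w))) x) (at x within ball (p i) (r/2))"
        if "x \<in> ball (p i) (r/2)" for x
        by (rule has_field_derivative_at_within, rule holomorphic_derivI[OF hol open_ball]) (use that r in auto)
      show "cmod (deriv (\<lambda>w. u j (y(i := w))) x) \<le> L" if x: "x \<in> ball (p i) (r/2)" for x
        unfolding L_def
      proof (rule norm_deriv_le_of_bounded)
        have sb: "ball x (r/2) \<subseteq> ball (p i) r"
        proof
          fix t assume "t \<in> ball x (r/2)"
          then show "t \<in> ball (p i) r" using x dist_triangle[of "p i" t x] by auto
        qed
        show "(\<lambda>w. u j (y(i := w))) holomorphic_on ball x (r/2)"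
          by (rule holomorphic_on_subset[OF hol sb])
        show "cmod (u j (y(i := t))) \<le> M" if "t \<in> ball x (r/2)" for t
          by (rule uM[OF polydisc_update[OF y i]]) (use that sb in blast)
      qed (use r in simp)
    qed (use w r in auto)
    have tele: "cmod (u j (\<lambda>i. if i < k then z i else p i) - u j p) \<le> L * (\<Sum>i<k. cmod (z i - p i))"
      if z: "z \<in> polydisc n p (r/2)" and k: "k \<le> n" for z k
      using k
    proof (induction k)
      case (Suc k)
      define y where "y = (\<lambda>i. if i < k then z i else p i)"
      have k: "k < n" using Suc.prems by simp
      have z': "z \<in> polydisc n p r" using z polydisc_mono[of "r/2" r n p] r by auto
      have y: "y \<in> polydisc n p r"
        using z' pin Suc.prems by (auto simp: y_def polydisc_def PiE_iff extensional_def)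
      have e1: "(\<lambda>i. if i < Suc k then z i else p i) = y(k := z k)" by (auto simp: y_def fun_eq_iff less_Suc_eq)
      have e2: "y(k := p k) = y" by (auto simp: y_def fun_eq_iff)
      have "z k \<in> ball (p k) (r/2)" using z k by (auto simp: polydisc_def PiE_iff)
      from lip[OF y k this] have "cmod (u j (y(k := z k)) - u j y) \<le> L * cmod (z k - p k)" by (simp only: e2)
      moreover have "cmod (u j y - u j p) \<le> L * (\<Sum>i<k. cmod (z i - p i))"
        using Suc by (simp add: y_def)
      ultimately show ?case unfolding e1
        using norm_triangle_ineq[of "u j (y(k := z k)) - u j y" "u j y - u j p"] by (simp add: distrib_left)
    qed simp
    obtain e where e: "e > 0" "ball (u j p) e \<subseteq> S" using S p by (auto simp: open_contains_ball)
    define d where "d = min (r/2) (e / (L * real n + 1))"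
    have pos: "L * real n + 1 > 0" using L0 by (simp add: add_nonneg_pos)
    have d: "d > 0" using r e(1) pos by (simp add: d_def)
    have sub2: "polydisc n p d \<subseteq> {z \<in> D. u j z \<in> S}"
    proof
      fix z assume z: "z \<in> polydisc n p d"
      have "d \<le> r/2" unfolding d_def by (rule min.cobounded1)
      then have z2: "z \<in> polydisc n p (r/2)" using z polydisc_mono[of d "r/2" n p] by blast
      have zz: "(\<lambda>i. if i < n then z i else p i) = z"
        using z pin by (auto simp: polydisc_def PiE_iff extensional_def fun_eq_iff)
      have "cmod (u j z - u j p) \<le> L * (\<Sum>i<n. cmod (z i - p i))" using tele[OF z2, of n] zz by simp
      also have "\<dots> \<le> L * (\<Sum>i<n. d)"
        using z L0 by (intro mult_left_mono sum_mono) (auto simp: polydisc_def PiE_iff dist_norm norm_minus_commute less_imp_le)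
      also have "\<dots> = (L * real n) * d" by simp
      also have "\<dots> < (L * real n + 1) * d" using d by (intro mult_strict_right_mono) auto
      also have "\<dots> \<le> (L * real n + 1) * (e / (L * real n + 1))"
        using pos by (intro mult_left_mono) (auto simp: d_def)
      also have "\<dots> = e" using pos by simp
      finally have "u j z \<in> ball (u j p) e" by (simp add: dist_norm norm_minus_commute)
      moreover have "z \<in> D" using z2 polydisc_mono[of "r/2" r n p] r sub by auto
      ultimately show "z \<in> {z \<in> D. u j z \<in> S}" using e(2) by blast
    qed
    have "p \<in> polydisc n p d" using pin d polydisc_center by blast
    then show "\<exists>r>0. p \<in> polydisc n p r \<and> polydisc n p r \<subseteq> {z \<in> D. u j z \<in> S}"
      using d sub2 by blast
  qed
  then have "openin (Cn_top n) {z \<in> D. u j z \<in> S}" by (simp add: openin_Cn_iff)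
  then show "openin (subtopology (Cn_top n) D) {z \<in> topspace (subtopology (Cn_top n) D). u j z \<in> S}"
    using sub D by (simp add: openin_open_subtopology inf_absorb2)
qed simp

section \<open>The Bergman space\<close>

locale bergman =
  fixes n :: nat and D :: "(nat \<Rightarrow> complex) set"
  assumes openD: "openin (Cn_top n) D"
begin

abbreviation "A2 \<equiv> bergman_space n D"
abbreviation "ip \<equiv> bergman_inner n D"
abbreviation "hol \<equiv> Cn_holomorphic_on n"
abbreviation "\<mu> \<equiv> Cn_lborel n"

lemma cn_openD: "cn_open n D"
  using openD by (simp add: openin_Cn_iff)

lemma D_sets [measurable]: "D \<in> sets \<mu>"
  by (rule openin_Cn_measurable[OF openD])

lemma hol_add: "hol f D \<Longrightarrow> hol g D \<Longrightarrow> hol (\<lambda>z. f z + g z) D"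
  unfolding Cn_holomorphic_on_def by (auto intro!: continuous_map_add field_differentiable_add)

lemma hol_const: "hol (\<lambda>_. c) D"
  unfolding Cn_holomorphic_on_def by auto

lemma hol_mult: "hol f D \<Longrightarrow> hol g D \<Longrightarrow> hol (\<lambda>z. f z * g z) D"
  unfolding Cn_holomorphic_on_def by (auto intro!: continuous_map_mult_complex field_differentiable_mult)

lemma hol_meas: "hol f D \<Longrightarrow> (\<lambda>z. indicator D z * f z) \<in> borel_measurable \<mu>"
  unfolding Cn_holomorphic_on_def using continuous_map_Cn_measurable[OF openD] by blast

lemma A2_hol: "f \<in> A2 \<Longrightarrow> hol f D"
  unfolding bergman_space_def by blast

definition "I f = (\<integral>\<^sup>+z. ennreal ((cmod (f z))\<^sup>2) * indicator D z \<partial>\<mu>)"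

lemma I_eq: "I f = (\<integral>\<^sup>+z. ennreal ((cmod (indicator D z * f z))\<^sup>2) \<partial>\<mu>)"
  unfolding I_def by (intro nn_integral_cong) (auto simp: indicator_def)

lemma A2_iff: "f \<in> A2 \<longleftrightarrow> hol f D \<and> I f < \<infinity>"
proof (cases "hol f D")
  case True
  have m: "(\<lambda>z. indicator D z *\<^sub>R (cmod (f z))\<^sup>2) \<in> borel_measurable \<mu>"
  proof -
    have "(\<lambda>z. (cmod (indicator D z * f z))\<^sup>2) \<in> borel_measurable \<mu>" using hol_meas[OF True] by measurable
    moreover have "(cmod (indicator D z * f z))\<^sup>2 = indicator D z *\<^sub>R (cmod (f z))\<^sup>2" for z
      by (auto simp: indicator_def)
    ultimately show ?thesis by simp
  qed
  have "(\<integral>\<^sup>+z. ennreal (norm (indicator D z *\<^sub>R (cmod (f z))\<^sup>2)) \<partial>\<mu>) = I f"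
    unfolding I_def by (rule nn_integral_cong) (simp split: split_indicator)
  then have "set_integrable \<mu> D (\<lambda>z. (cmod (f z))\<^sup>2) \<longleftrightarrow> I f < \<infinity>"
    unfolding set_integrable_def integrable_iff_bounded using m by simp
  then show ?thesis using True unfolding bergman_space_def by blast
qed (auto simp: bergman_space_def)

lemma ip_integrable:
  assumes f: "f \<in> A2" and g: "g \<in> A2"
  shows "integrable \<mu> (\<lambda>z. indicator D z *\<^sub>R (f z * cnj (g z)))"
proof (rule Bochner_Integration.integrable_bound)
  show "integrable \<mu> (\<lambda>z. indicator D z *\<^sub>R (cmod (f z))\<^sup>2 + indicator D z *\<^sub>R (cmod (g z))\<^sup>2)"
    using f g unfolding bergman_space_def set_integrable_def by auto
  have "(\<lambda>z. (indicator D z * f z) * cnj (indicator D z * g z)) \<in> borel_measurable \<mu>"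
    by (rule borel_measurable_times[OF hol_meas[OF A2_hol[OF f]] measurable_compose[OF hol_meas[OF A2_hol[OF g]] cnj_measurable]])
  moreover have "(indicator D z * f z) * cnj (indicator D z * g z) = indicator D z *\<^sub>R (f z * cnj (g z))" for z
    by (auto simp: indicator_def)
  ultimately show "(\<lambda>z. indicator D z *\<^sub>R (f z * cnj (g z))) \<in> borel_measurable \<mu>" by simp
  have "cmod (f z * cnj (g z)) \<le> (cmod (f z))\<^sup>2 + (cmod (g z))\<^sup>2" for z
  proof -
    have "2 * (cmod (f z) * cmod (g z)) \<le> (cmod (f z))\<^sup>2 + (cmod (g z))\<^sup>2"
      using sum_squares_bound[of "cmod (f z)" "cmod (g z)"] by (simp add: mult.assoc)
    moreover have "0 \<le> cmod (f z) * cmod (g z)" by simp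
    ultimately show ?thesis unfolding norm_mult complex_mod_cnj by linarith
  qed
  then show "AE z in \<mu>. norm (indicator D z *\<^sub>R (f z * cnj (g z)))
      \<le> norm (indicator D z *\<^sub>R (cmod (f z))\<^sup>2 + indicator D z *\<^sub>R (cmod (g z))\<^sup>2)"
    by (intro AE_I2) (auto simp: indicator_def)
qed

lemma A2_add:
  assumes f: "f \<in> A2" and g: "g \<in> A2"
  shows "(\<lambda>z. f z + g z) \<in> A2"
proof -
  have h: "hol (\<lambda>z. f z + g z) D" using hol_add A2_hol f g by blast
  have "I (\<lambda>z. f z + g z) \<le> (\<integral>\<^sup>+z. 2 * ennreal ((cmod (indicator D z * f z))\<^sup>2) + 2 * ennreal ((cmod (indicator D z * g z))\<^sup>2) \<partial>\<mu>)"
    unfolding I_eq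
  proof (rule nn_integral_mono)
    fix z
    have "(cmod (a + b))\<^sup>2 \<le> 2 * (cmod a)\<^sup>2 + 2 * (cmod b)\<^sup>2" for a b
    proof -
      have "(cmod (a + b))\<^sup>2 \<le> (cmod a + cmod b)\<^sup>2" by (intro power_mono norm_triangle_ineq) auto
      also have "\<dots> \<le> 2 * (cmod a)\<^sup>2 + 2 * (cmod b)\<^sup>2"
        using sum_squares_bound[of "cmod a" "cmod b"] by (simp add: power2_sum)
      finally show ?thesis .
    qed
    from this[of "indicator D z * f z" "indicator D z * g z"]
    have "ennreal ((cmod (indicator D z * (f z + g z)))\<^sup>2)
        \<le> ennreal (2 * (cmod (indicator D z * f z))\<^sup>2 + 2 * (cmod (indicator D z * g z))\<^sup>2)"
      by (intro ennreal_leI) (simp add: distrib_left)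
    also have "\<dots> = 2 * ennreal ((cmod (indicator D z * f z))\<^sup>2) + 2 * ennreal ((cmod (indicator D z * g z))\<^sup>2)"
      by (simp add: ennreal_plus ennreal_mult ennreal_numeral)
    finally show "ennreal ((cmod (indicator D z * (f z + g z)))\<^sup>2)
        \<le> 2 * ennreal ((cmod (indicator D z * f z))\<^sup>2) + 2 * ennreal ((cmod (indicator D z * g z))\<^sup>2)" .
  qed
  also have "\<dots> = 2 * I f + 2 * I g"
    unfolding I_eq using hol_meas[OF A2_hol[OF f]] hol_meas[OF A2_hol[OF g]]
    by (subst nn_integral_add) (auto simp: nn_integral_cmult)
  also have "\<dots> < \<infinity>" using f g by (auto simp: A2_iff ennreal_mult_less_top)
  finally show ?thesis using h by (simp add: A2_iff)
qed

lemma A2_cmult: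
  assumes f: "f \<in> A2"
  shows "(\<lambda>z. c * f z) \<in> A2"
proof -
  have "I (\<lambda>z. c * f z) = (\<integral>\<^sup>+z. ennreal ((cmod c)\<^sup>2) * ennreal ((cmod (indicator D z * f z))\<^sup>2) \<partial>\<mu>)"
    unfolding I_eq by (intro nn_integral_cong) (auto simp: norm_mult power_mult_distrib ennreal_mult indicator_def)
  also have "\<dots> = ennreal ((cmod c)\<^sup>2) * I f"
    unfolding I_eq using hol_meas[OF A2_hol[OF f]] by (subst nn_integral_cmult) auto
  also have "\<dots> < \<infinity>" using f by (auto simp: A2_iff ennreal_mult_less_top)
  finally show ?thesis using f hol_mult[OF hol_const A2_hol[OF f]] by (simp add: A2_iff)
qed

lemma A2_zero: "(\<lambda>_. 0) \<in> A2"
  by (simp add: A2_iff hol_const I_def)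

lemma A2_sum: "(\<And>j. j \<in> F \<Longrightarrow> u j \<in> A2) \<Longrightarrow> (\<lambda>z. \<Sum>j\<in>F. u j z) \<in> A2"
  by (induction F rule: infinite_finite_induct) (auto intro: A2_zero A2_add)

lemma A2_diff: "f \<in> A2 \<Longrightarrow> g \<in> A2 \<Longrightarrow> (\<lambda>z. f z - g z) \<in> A2"
  using A2_add[OF _ A2_cmult, of f g "-1"] by simp

lemma ip_add: "f \<in> A2 \<Longrightarrow> g \<in> A2 \<Longrightarrow> h \<in> A2 \<Longrightarrow> ip (\<lambda>z. f z + g z) h = ip f h + ip g h"
  unfolding bergman_inner_def set_lebesgue_integral_def
  using ip_integrable[of f h] ip_integrable[of g h]
  by (simp add: algebra_simps)

lemma ip_cmult: "f \<in> A2 \<Longrightarrow> h \<in> A2 \<Longrightarrow> ip (\<lambda>z. c * f z) h = c * ip f h"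
  unfolding bergman_inner_def set_lebesgue_integral_def
  using Bochner_Integration.integral_mult_right[of c \<mu> "\<lambda>z. indicator D z *\<^sub>R (f z * cnj (h z))"] ip_integrable[of f h]
  by (simp add: mult_ac)

lemma ip_cnj: "ip g f = cnj (ip f g)"
  unfolding bergman_inner_def set_lebesgue_integral_def
  by (subst Bochner_Integration.integral_cnj[symmetric]) (simp add: mult.commute)

lemma ip_diff: "f \<in> A2 \<Longrightarrow> g \<in> A2 \<Longrightarrow> h \<in> A2 \<Longrightarrow> ip (\<lambda>z. f z - g z) h = ip f h - ip g h"
  using ip_add[of f "\<lambda>z. (-1) * g z" h] ip_cmult[of g h "-1"] A2_cmult[of g "-1"] by simp

lemma ip_zero: "ip (\<lambda>_. 0) h = 0"
  unfolding bergman_inner_def set_lebesgue_integral_def by simp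

lemma ip_sum:
  "(\<And>j. j \<in> F \<Longrightarrow> u j \<in> A2) \<Longrightarrow> h \<in> A2 \<Longrightarrow> ip (\<lambda>z. \<Sum>j\<in>F. a j * u j z) h = (\<Sum>j\<in>F. a j * ip (u j) h)"
proof (induction F rule: infinite_finite_induct)
  case (insert x F)
  have "ip (\<lambda>z. a x * u x z + (\<Sum>j\<in>F. a j * u j z)) h = ip (\<lambda>z. a x * u x z) h + ip (\<lambda>z. \<Sum>j\<in>F. a j * u j z) h"
    using insert.prems by (intro ip_add A2_cmult A2_sum) auto
  then show ?case using insert by (simp add: ip_cmult)
qed (auto simp: ip_zero)

definition "Nrm f = enn2real (I f)"

lemma ip_self:
  assumes "f \<in> A2"
  shows "ip f f = of_real (Nrm f)" and "I f = ennreal (Nrm f)" and "Nrm f \<ge> 0"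
proof -
  show I: "I f = ennreal (Nrm f)" and N0: "Nrm f \<ge> 0" using assms by (auto simp: Nrm_def A2_iff)
  have "ip f f = (\<integral>z. complex_of_real (indicator D z *\<^sub>R (cmod (f z))\<^sup>2) \<partial>\<mu>)"
    unfolding bergman_inner_def set_lebesgue_integral_def
    by (intro Bochner_Integration.integral_cong) (auto simp: complex_norm_square[symmetric] indicator_def simp del: of_real_power)
  also have "\<dots> = of_real (\<integral>z. indicator D z *\<^sub>R (cmod (f z))\<^sup>2 \<partial>\<mu>)"
    by (rule integral_complex_of_real)
  also have "(\<integral>z. indicator D z *\<^sub>R (cmod (f z))\<^sup>2 \<partial>\<mu>) = Nrm f"
  proof -
    have "(\<integral>\<^sup>+z. ennreal (indicator D z *\<^sub>R (cmod (f z))\<^sup>2) \<partial>\<mu>) = I f"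
      unfolding I_def by (intro nn_integral_cong) (auto simp: indicator_def)
    then show ?thesis
      using assms N0 unfolding I bergman_space_def set_integrable_def
      by (intro integral_eq_nn_integral[THEN trans]) (auto simp: integral_eq_nn_integral Nrm_def[symmetric])
  qed
  finally show "ip f f = of_real (Nrm f)" .
qed

text \<open>Point evaluations are bounded, locally uniformly, by the mean value inequality on polydiscs of fixed
  radius about nearby points.\<close>

lemma point_evaluation:
  assumes p: "p \<in> D"
  obtains r C where "r > 0" "C \<ge> 0" "p \<in> polydisc n p r" "polydisc n p r \<subseteq> D"
    "\<And>z f. z \<in> polydisc n p r \<Longrightarrow> f \<in> A2 \<Longrightarrow> (cmod (f z))\<^sup>2 \<le> C\<^sup>2 * Nrm f"
proof -
  obtain R where R: "R > 0" "p \<in> polydisc n p R" "polydisc n p R \<subseteq> D"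
    using cn_openD p unfolding cn_open_def by blast
  define r where "r = R / 2"
  have r: "r > 0" using R by (simp add: r_def)
  define V where "V = (unit_ball_vol (DIM(complex)) * r ^ DIM(complex)) ^ n"
  have V: "V > 0" using r by (simp add: V_def)
  have vol: "(\<Prod>i<n. emeasure lborel (ball (z i) r)) = ennreal V" for z :: "nat \<Rightarrow> complex"
    using r by (simp add: emeasure_ball V_def prod_ennreal ennreal_power)
  have bd: "(cmod (f z))\<^sup>2 \<le> (1 / sqrt V)\<^sup>2 * Nrm f" if z: "z \<in> polydisc n p r" and f: "f \<in> A2" for z f
  proof -
    have sub: "polydisc n z r \<subseteq> polydisc n p R"
    proof
      fix y assume y: "y \<in> polydisc n z r"
      show "y \<in> polydisc n p R"
        unfolding polydisc_def
      proof (rule PiE_I)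
        fix i assume i: "i \<in> {..<n}"
        have "dist (z i) (y i) < r" "dist (p i) (z i) < r"
          using y z i by (auto simp: polydisc_def PiE_iff)
        then show "y i \<in> ball (p i) R" using dist_triangle[of "p i" "y i" "z i"] by (simp add: r_def)
      qed (use y in \<open>auto simp: polydisc_def PiE_iff extensional_def\<close>)
    qed
    then have subD: "polydisc n z r \<subseteq> D" using R by blast
    have zr: "restrict z {..<n} = z" using z by (auto simp: polydisc_def PiE_iff extensional_restrict)
    have fm: "(\<lambda>z. indicator D z * f z) \<in> borel_measurable (Pi\<^sub>M {..<n} (\<lambda>_. lborel))"
      using hol_meas[OF A2_hol[OF f]] by (simp add: Cn_lborel_def)
    have "ennreal ((cmod (indicator D (restrict z {..<n}) * f (restrict z {..<n})))\<^sup>2) * (\<Prod>i<n. emeasure lborel (ball (z i) r))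
      \<le> (\<integral>\<^sup>+y. ennreal ((cmod (indicator D y * f y))\<^sup>2) * indicator (PiE {..<n} (\<lambda>i. ball (z i) r)) y \<partial>Pi\<^sub>M {..<n} (\<lambda>_. lborel))"
    proof (rule mean_value_polydisc_aux[OF _ fm])
      fix y i assume y: "y \<in> PiE {..<n} (\<lambda>i. ball (z i) r)" and i: "i \<in> {..<n}"
      have in': "y(i := w) \<in> D" if "w \<in> ball (z i) r" for w
        using polydisc_update[of y n z r i w] y i that subD by (auto simp: polydisc_def)
      have "(\<lambda>w. f (y(i := w))) holomorphic_on ball (z i) r"
      proof -
        have "(\<lambda>w. f (y(i := w))) field_differentiable at w" if w: "w \<in> ball (z i) r" for w
        proof -
          have "(\<lambda>w'. f ((y(i := w))(i := w'))) field_differentiable at ((y(i := w)) i)"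
            using A2_hol[OF f] in'[OF w] i unfolding Cn_holomorphic_on_def by blast
          then show ?thesis by simp
        qed
        then show ?thesis by (simp add: field_differentiable_at_within holomorphic_on_def)
      qed
      then show "(\<lambda>w. indicator D (y(i := w)) * f (y(i := w))) holomorphic_on ball (z i) r"
        by (rule holomorphic_transform) (use in' in auto)
    qed simp
    also have "\<dots> \<le> I f"
      unfolding I_eq Cn_lborel_def by (intro nn_integral_mono) (auto simp: indicator_def)
    also have "I f = ennreal (Nrm f)" using ip_self[OF f] by blast
    finally have "ennreal ((cmod (f z))\<^sup>2) * ennreal V \<le> ennreal (Nrm f)"
      using zr subD polydisc_center[OF r z] unfolding vol by (auto simp: indicator_def)
    then have "(cmod (f z))\<^sup>2 * V \<le> Nrm f"
      using V ip_self(3)[OF f] by (simp add: ennreal_mult[symmetric] ennreal_le_iff)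
    then show ?thesis using V by (simp add: field_simps power_divide)
  qed
  show ?thesis
  proof (rule that[OF r _ _ _ bd])
    show "p \<in> polydisc n p r" using R r polydisc_center by blast
    show "polydisc n p r \<subseteq> D" using R polydisc_mono[of r R n p] r by (auto simp: r_def)
  qed (use V in auto)
qed

lemma Nrm_zero: "f \<in> A2 \<Longrightarrow> Nrm f = 0 \<Longrightarrow> z \<in> D \<Longrightarrow> f z = 0"
proof -
  assume f: "f \<in> A2" "Nrm f = 0" and z: "z \<in> D"
  obtain r C where "z \<in> polydisc n z r" "\<And>y f. y \<in> polydisc n z r \<Longrightarrow> f \<in> A2 \<Longrightarrow> (cmod (f y))\<^sup>2 \<le> C\<^sup>2 * Nrm f"
    using point_evaluation[OF z] by metis
  then have "(cmod (f z))\<^sup>2 \<le> 0" using f by fastforce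
  then show "f z = 0" by simp
qed

text \<open>A maximal orthonormal set, from Zorn's lemma. A function orthogonal to it that is not zero on \<open>D\<close> has
  positive norm, since point evaluations are bounded, and could be normalized and added.\<close>

lemma bergman_orthonormal_basis_exists: "\<exists>B. bergman_orthonormal_basis n D B"
proof -
  define \<O> where "\<O> = {B. B \<subseteq> A2 \<and> (\<forall>f\<in>B. \<forall>g\<in>B. ip f g = (if f = g then 1 else 0))}"
  have "\<exists>M\<in>\<O>. \<forall>X\<in>\<O>. M \<subseteq> X \<longrightarrow> X = M"
  proof (rule subset_Zorn')
    fix C assume C: "subset.chain \<O> C"
    have "ip f g = (if f = g then 1 else 0)" if "X \<in> C" "f \<in> X" "Y \<in> C" "g \<in> Y" for f g X Y
    proof -
      have "X \<subseteq> Y \<or> Y \<subseteq> X" using C that unfolding subset_chain_def by blast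
      moreover have "X \<in> \<O>" "Y \<in> \<O>" using C that unfolding subset_chain_def by blast+
      ultimately show ?thesis using that unfolding \<O>_def by blast
    qed
    moreover have "\<Union>C \<subseteq> A2" using C unfolding subset_chain_def \<O>_def by blast
    ultimately show "\<Union>C \<in> \<O>" unfolding \<O>_def by blast
  qed
  then obtain B where B: "B \<in> \<O>" and max: "\<And>X. X \<in> \<O> \<Longrightarrow> B \<subseteq> X \<Longrightarrow> X = B" by blast
  have BA: "B \<subseteq> A2" and Bo: "\<And>f g. f \<in> B \<Longrightarrow> g \<in> B \<Longrightarrow> ip f g = (if f = g then 1 else 0)"
    using B unfolding \<O>_def by auto
  have "h z = 0" if h: "h \<in> A2" "\<forall>f\<in>B. ip h f = 0" and z: "z \<in> D" for h z
  proof (rule ccontr)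
    assume "h z \<noteq> 0"
    then have N: "Nrm h > 0" using Nrm_zero[OF h(1) _ z] ip_self(3)[OF h(1)] by fastforce
    define a where "a = complex_of_real (1 / sqrt (Nrm h))"
    define h0 where "h0 = (\<lambda>z. a * h z)"
    have h0A: "h0 \<in> A2" unfolding h0_def by (rule A2_cmult[OF h(1)])
    have o1: "ip h0 f = 0" if "f \<in> B" for f
      unfolding h0_def using ip_cmult[OF h(1), of f a] h(2) that BA by auto
    then have o2: "ip f h0 = 0" if "f \<in> B" for f using that ip_cnj[of f h0] by simp
    have "ip h0 h0 = a * ip h h0" unfolding h0_def by (rule ip_cmult[OF h(1) h0A[unfolded h0_def]])
    also have "ip h h0 = cnj (a * ip h h)"
      using ip_cnj[of h h0] ip_cmult[OF h(1) h(1), of a] by (simp add: h0_def)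
    also have "a * cnj (a * ip h h) = of_real ((1 / sqrt (Nrm h)) * (1 / sqrt (Nrm h)) * Nrm h)"
      unfolding ip_self(1)[OF h(1)] a_def
      by (simp only: complex_cnj_mult complex_cnj_complex_of_real of_real_mult mult.assoc)
    also have "\<dots> = 1"
    proof -
      have "(1 / sqrt (Nrm h)) * (1 / sqrt (Nrm h)) * Nrm h = 1" using N by (simp add: field_simps)
      then show ?thesis by (simp only: of_real_1)
    qed
    finally have o3: "ip h0 h0 = 1" .
    have h0B: "h0 \<notin> B" using o1[of h0] o3 by auto
    have "ip f g = (if f = g then 1 else 0)" if "f \<in> insert h0 B" "g \<in> insert h0 B" for f g
      using that o1 o2 o3 h0B Bo by (cases "f = h0"; cases "g = h0") auto
    then have "insert h0 B \<in> \<O>" unfolding \<O>_def using h0A BA by blast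
    from max[OF this] show False using h0B by blast
  qed
  then have "bergman_orthonormal_basis n D B"
    unfolding bergman_orthonormal_basis_def by (intro conjI ballI impI BA Bo)
  then show ?thesis by (rule exI)
qed

end

locale bergman_onb = bergman n D for n D +
  fixes B :: "((nat \<Rightarrow> complex) \<Rightarrow> complex) set"
  assumes onb: "bergman_orthonormal_basis n D B"
begin

lemma BA: "f \<in> B \<Longrightarrow> f \<in> A2" and Bo: "f \<in> B \<Longrightarrow> g \<in> B \<Longrightarrow> ip f g = (if f = g then 1 else 0)"
  and Bc: "h \<in> A2 \<Longrightarrow> (\<And>f. f \<in> B \<Longrightarrow> ip h f = 0) \<Longrightarrow> z \<in> D \<Longrightarrow> h z = 0"
  using onb unfolding bergman_orthonormal_basis_def by blast+

lemma A2_comb: "F \<subseteq> B \<Longrightarrow> (\<lambda>z. \<Sum>f\<in>F. a f * f z) \<in> A2"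
  by (intro A2_sum A2_cmult BA) auto

lemma ip_comb:
  assumes F: "finite F" "F \<subseteq> B" and g: "g \<in> B"
  shows "ip (\<lambda>z. \<Sum>f\<in>F. a f * f z) g = (if g \<in> F then a g else 0)"
proof -
  have "ip (\<lambda>z. \<Sum>f\<in>F. a f * f z) g = (\<Sum>f\<in>F. a f * ip f g)"
    by (rule ip_sum[where u = "\<lambda>f. f"]) (use F g BA in auto)
  also have "\<dots> = (\<Sum>f\<in>F. if f = g then a f else 0)"
    using F g by (intro sum.cong refl) (auto simp: Bo)
  finally show ?thesis using F(1) by simp
qed

lemma Nrm_comb:
  assumes F: "finite F" "F \<subseteq> B"
  shows "Nrm (\<lambda>z. \<Sum>f\<in>F. a f * f z) = (\<Sum>f\<in>F. (cmod (a f))\<^sup>2)"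
proof -
  let ?S = "\<lambda>z. \<Sum>f\<in>F. a f * f z"
  have "ip ?S ?S = (\<Sum>f\<in>F. a f * ip f ?S)"
    by (rule ip_sum[where u = "\<lambda>f. f"]) (use F BA A2_comb in auto)
  also have "\<dots> = (\<Sum>f\<in>F. a f * cnj (a f))"
  proof (intro sum.cong refl)
    fix f assume f: "f \<in> F"
    have "ip f ?S = cnj (ip ?S f)" by (rule ip_cnj)
    also have "ip ?S f = a f" using ip_comb[OF F, of f a] f F by auto
    finally show "a f * ip f ?S = a f * cnj (a f)" by simp
  qed
  also have "\<dots> = of_real (\<Sum>f\<in>F. (cmod (a f))\<^sup>2)"
    by (simp add: complex_norm_square[symmetric] del: of_real_power)
  finally have "complex_of_real (Nrm ?S) = of_real (\<Sum>f\<in>F. (cmod (a f))\<^sup>2)"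
    using ip_self(1)[OF A2_comb[OF F(2), of a]] by simp
  then show ?thesis by (simp only: of_real_eq_iff)
qed

lemma bessel:
  assumes F: "finite F" "F \<subseteq> B" and h: "h \<in> A2"
  shows "(\<Sum>f\<in>F. (cmod (ip h f))\<^sup>2) \<le> Nrm h"
proof -
  let ?S = "\<lambda>z. \<Sum>f\<in>F. ip h f * f z"
  have S: "?S \<in> A2" by (rule A2_comb[OF F(2)])
  define d where "d = (\<lambda>z. h z - ?S z)"
  have d: "d \<in> A2" unfolding d_def by (rule A2_diff[OF h S])
  have df: "ip d f = 0" if "f \<in> F" for f
    unfolding d_def using ip_diff[OF h S BA, of f] ip_comb[OF F, of f "ip h"] that F by auto
  have Sd: "ip ?S d = 0"
  proof -
    have "ip ?S d = (\<Sum>f\<in>F. ip h f * ip f d)"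
      by (rule ip_sum[where u = "\<lambda>f. f"]) (use F BA d in auto)
    also have "\<dots> = 0" using df ip_cnj[of _ d] by (intro sum.neutral) (metis complex_cnj_zero mult_zero_right)
    finally show ?thesis .
  qed
  have hS: "ip h ?S = ip d ?S + ip ?S ?S"
    unfolding d_def using ip_diff[OF h S S] by simp
  have "ip d d = ip h d - ip ?S d" by (subst (1) d_def) (rule ip_diff[OF h S d])
  also have "ip h d = cnj (ip d h)" by (rule ip_cnj)
  also have "ip d h = ip h h - ip ?S h" by (subst (1) d_def) (rule ip_diff[OF h S h])
  also have "ip ?S h = cnj (ip h ?S)" by (rule ip_cnj)
  also have "ip h ?S = ip ?S ?S" using hS Sd ip_cnj[of d ?S] by simp
  finally have "ip d d = cnj (ip h h) - ip ?S ?S" using Sd by simp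
  then have "complex_of_real (Nrm d) = of_real (Nrm h - Nrm ?S)"
    unfolding ip_self(1)[OF d] ip_self(1)[OF h] ip_self(1)[OF S] by simp
  then have "Nrm d = Nrm h - Nrm ?S" by (simp only: of_real_eq_iff)
  then show ?thesis using ip_self(3)[OF d] Nrm_comb[OF F, of "ip h"] by simp
qed

text \<open>The dual form of the boundedness of point evaluations, tested on the finite combinations of basis
  elements. It says that the kernel is locally bounded.\<close>

lemma onb_local_bound:
  assumes p: "p \<in> D"
  obtains r C where "r > 0" "C \<ge> 0" "p \<in> polydisc n p r" "polydisc n p r \<subseteq> D"
    "\<And>z F. z \<in> polydisc n p r \<Longrightarrow> finite F \<Longrightarrow> F \<subseteq> B \<Longrightarrow> (\<Sum>f\<in>F. (cmod (f z))\<^sup>2) \<le> C\<^sup>2"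
proof -
  obtain r C where r: "r > 0" "C \<ge> 0" "p \<in> polydisc n p r" "polydisc n p r \<subseteq> D"
    and ev: "\<And>z f. z \<in> polydisc n p r \<Longrightarrow> f \<in> A2 \<Longrightarrow> (cmod (f z))\<^sup>2 \<le> C\<^sup>2 * Nrm f"
    by (rule point_evaluation[OF p]) (rule that)
  have "(\<Sum>f\<in>F. (cmod (f z))\<^sup>2) \<le> C\<^sup>2" if z: "z \<in> polydisc n p r" and F: "finite F" "F \<subseteq> B" for z F
  proof (rule sum_sq_le_of_dual_bound[OF F(1) r(2)])
    fix a :: "((nat \<Rightarrow> complex) \<Rightarrow> complex) \<Rightarrow> complex"
    have "(cmod (\<Sum>f\<in>F. a f * f z))\<^sup>2 \<le> C\<^sup>2 * (\<Sum>f\<in>F. (cmod (a f))\<^sup>2)"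
      using ev[OF z A2_comb[OF F(2)], of a] by (simp add: Nrm_comb[OF F])
    then have "sqrt ((cmod (\<Sum>f\<in>F. a f * f z))\<^sup>2) \<le> sqrt (C\<^sup>2 * (\<Sum>f\<in>F. (cmod (a f))\<^sup>2))"
      by (rule real_sqrt_le_mono)
    then show "cmod (\<Sum>f\<in>F. a f * f z) \<le> C * sqrt (\<Sum>f\<in>F. (cmod (a f))\<^sup>2)"
      using r(2) by (simp add: real_sqrt_mult)
  qed
  then show ?thesis by (rule that[OF r]) 
qed

lemma hol_family_onb: "hol_family n D B (\<lambda>f. f)"
  unfolding hol_family_def
proof (intro conjI ballI allI impI)
  show "(\<lambda>w. f (z(i := w))) field_differentiable at (z i)" if "f \<in> B" "z \<in> D" "i < n" for f z i
    using A2_hol[OF BA[OF that(1)]] that unfolding Cn_holomorphic_on_def by blast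
  show "\<exists>r>0. \<exists>M\<ge>0. p \<in> polydisc n p r \<and> polydisc n p r \<subseteq> D \<and>
      (\<forall>z\<in>polydisc n p r. \<forall>F. finite F \<longrightarrow> F \<subseteq> B \<longrightarrow> (\<Sum>j\<in>F. (cmod (j z))\<^sup>2) \<le> M\<^sup>2)" if "p \<in> D" for p
    by (rule onb_local_bound[OF that]) blast
qed

lemma hol_family_const:
  assumes "l2b B a M"
  shows "hol_family n D B (\<lambda>f _. a f)"
  unfolding hol_family_def
proof (intro conjI ballI allI impI)
  fix p assume "p \<in> D"
  then obtain r where "r > 0" "p \<in> polydisc n p r" "polydisc n p r \<subseteq> D"
    using cn_openD unfolding cn_open_def by blast
  then show "\<exists>r>0. \<exists>M\<ge>0. p \<in> polydisc n p r \<and> polydisc n p r \<subseteq> D \<and>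
      (\<forall>z\<in>polydisc n p r. \<forall>F. finite F \<longrightarrow> F \<subseteq> B \<longrightarrow> (\<Sum>j\<in>F. (cmod (a j))\<^sup>2) \<le> M\<^sup>2)"
    using assms unfolding l2b_def by blast
qed auto

end

section \<open>Completeness and positivity\<close>

lemma cpd_cong:
  assumes "cn_open n D" "z \<in> D" "i < n" "\<And>y. y \<in> D \<Longrightarrow> f y = g y"
  shows "cpd i f z = cpd i g z"
  unfolding cpd_def
proof (rule deriv_cong_ev)
  show "\<forall>\<^sub>F w in nhds (z i). f (z(i := w)) = g (z(i := w))"
    using cn_open_line[OF assms(1-3)] by eventually_elim (simp add: assms(4))
qed simp

lemma cpds_cong:
  "cn_open n D \<Longrightarrow> z \<in> D \<Longrightarrow> set xs \<subseteq> {..<n} \<Longrightarrow> (\<And>y. y \<in> D \<Longrightarrow> f y = g y) \<Longrightarrow> cpds xs f z = cpds xs g z"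
proof (induction xs arbitrary: f g)
  case (Cons x xs)
  show ?case unfolding cpds_simps
    by (rule Cons.IH) (use Cons.prems in \<open>auto intro!: cpd_cong[of n D]\<close>)
qed simp

lemma cpd_const: "cpd i (\<lambda>_. c) z = 0"
  by (simp add: cpd_def)

lemma pairing_zero_right: "pairing B u (\<lambda>j z. 0) z = 0"
  by (simp add: pairing_def l2pair_def)

lemma pairing_const_has_field_derivative:
  assumes u: "hol_family n D B u" and c: "hol_family n D B (\<lambda>j _. c j)" and z: "z \<in> D" and i: "i < n"
  shows "((\<lambda>w. pairing B u (\<lambda>j _. c j) (z(i := w))) has_field_derivative
      pairing B (\<lambda>j. cpd i (u j)) (\<lambda>j _. c j) z) (at (z i))"
proof -
  have "cpd i (\<lambda>_. c j) = (\<lambda>_. 0)" for j by (rule ext) (rule cpd_const)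
  then have "has_wirtinger i (pairing B u (\<lambda>j _. c j)) z (pairing B (\<lambda>j. cpd i (u j)) (\<lambda>j _. c j) z) 0"
    using has_wirtinger_pairing[OF u c z i] by (simp add: pairing_zero_right)
  then show ?thesis
    unfolding has_wirtinger_def has_field_derivative_def by simp
qed

lemma cpds_pairing_const:
  assumes D: "cn_open n D" and c: "hol_family n D B (\<lambda>j _. c j)" and z: "z \<in> D"
    and u: "hol_family n D B u" and xs: "set xs \<subseteq> {..<n}"
  shows "cpds xs (pairing B u (\<lambda>j _. c j)) z = pairing B (\<lambda>j. cpds xs (u j)) (\<lambda>j _. c j) z"
  using u xs
proof (induction xs arbitrary: u)
  case (Cons x xs)
  have "cpds xs (cpd x (pairing B u (\<lambda>j _. c j))) z = cpds xs (pairing B (\<lambda>j. cpd x (u j)) (\<lambda>j _. c j)) z"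
  proof (rule cpds_cong[OF D z])
    fix y assume y: "y \<in> D"
    have "x < n" using Cons.prems by simp
    from pairing_const_has_field_derivative[OF Cons.prems(1) c y this]
    show "cpd x (pairing B u (\<lambda>j _. c j)) y = pairing B (\<lambda>j. cpd x (u j)) (\<lambda>j _. c j) y"
      unfolding cpd_def[of x "pairing B u (\<lambda>j _. c j)"] by (rule DERIV_imp_deriv)
  qed (use Cons.prems in auto)
  also have "\<dots> = pairing B (\<lambda>j. cpds xs (cpd x (u j))) (\<lambda>j _. c j) z"
    by (rule Cons.IH) (use Cons.prems in \<open>auto intro: hol_family_cpd\<close>)
  finally show ?case by simp
qed simp

context bergman_onb
begin

lemma l2b_coeff:
  assumes h: "h \<in> A2"
  shows "l2b B (ip h) (sqrt (Nrm h))"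
proof -
  have "(sqrt (Nrm h))\<^sup>2 = Nrm h" using ip_self(3)[OF h] by simp
  then show ?thesis unfolding l2b_def using bessel[OF _ _ h] ip_self(3)[OF h] by simp
qed

lemma l2b_cnj_coeff: "h \<in> A2 \<Longrightarrow> l2b B (\<lambda>f. cnj (ip h f)) (sqrt (Nrm h))"
  unfolding l2b_def complex_mod_cnj by (rule l2b_coeff[unfolded l2b_def])

lemma coeff_tail:
  assumes h: "h \<in> A2" and e: "e > 0"
  shows "\<exists>F. finite F \<and> F \<subseteq> B \<and> (\<forall>F'. finite F' \<longrightarrow> F' \<subseteq> B - F \<longrightarrow> (\<Sum>f\<in>F'. (cmod (ip h f))\<^sup>2) \<le> e)"
proof -
  have sm: "(\<lambda>f. (cmod (ip h f))\<^sup>2) summable_on B"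
    by (rule nonneg_bdd_above_summable_on) (auto intro!: bdd_aboveI[of _ "Nrm h"] bessel h)
  define S where "S = infsum (\<lambda>f. (cmod (ip h f))\<^sup>2) B"
  have hs: "((\<lambda>f. (cmod (ip h f))\<^sup>2) has_sum S) B" unfolding S_def by (rule has_sum_infsum[OF sm])
  obtain F where F: "finite F" "F \<subseteq> B" "dist (\<Sum>f\<in>F. (cmod (ip h f))\<^sup>2) S \<le> e"
    using has_sum_finite_approximation[OF hs e] by blast
  have "(\<Sum>f\<in>F'. (cmod (ip h f))\<^sup>2) \<le> e" if F': "finite F'" "F' \<subseteq> B - F" for F'
  proof -
    have "(\<Sum>f\<in>F \<union> F'. (cmod (ip h f))\<^sup>2) \<le> S"
      by (rule finite_sum_le_has_sum[OF hs]) (use F F' in auto)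
    moreover have "(\<Sum>f\<in>F \<union> F'. (cmod (ip h f))\<^sup>2) = (\<Sum>f\<in>F. (cmod (ip h f))\<^sup>2) + (\<Sum>f\<in>F'. (cmod (ip h f))\<^sup>2)"
      by (rule sum.union_disjoint) (use F F' in auto)
    ultimately show ?thesis using F(3) by (auto simp: dist_real_def abs_le_iff)
  qed
  then show ?thesis using F by blast
qed

text \<open>Completeness of \<open>A\<^sup>2(D)\<close>: the Fourier series of \<open>h\<close> converges locally uniformly to some \<open>h'\<close>, and
  by Fatou's lemma also in \<open>L\<^sup>2\<close>. Hence \<open>h - h'\<close> is orthogonal to the basis and vanishes on \<open>D\<close>.\<close>

theorem fourier_expansion:
  assumes h: "h \<in> A2" and z: "z \<in> D"
  shows "h z = pairing B (\<lambda>f. f) (\<lambda>f _. cnj (ip h f)) z"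
proof -
  define a where "a = ip h"
  define s where "s = sqrt (Nrm h)"
  have la: "l2b B (\<lambda>f. cnj (a f)) s" unfolding a_def s_def by (rule l2b_cnj_coeff[OF h])
  have famc: "hol_family n D B (\<lambda>f _. cnj (a f))" by (rule hol_family_const[OF la])
  define h' where "h' = pairing B (\<lambda>f. f) (\<lambda>f _. cnj (a f))"
  have l2z: "\<exists>C. l2b B (\<lambda>f. f z) C" if "z \<in> D" for z
    by (rule onb_local_bound[OF that]) (auto simp: l2b_def)
  have fam': "hol_family n D {()} (\<lambda>_. h')"
    unfolding hol_family_def
  proof (intro conjI ballI allI impI)
    show "(\<lambda>w. h' (z(i := w))) field_differentiable at (z i)" if "z \<in> D" "i < n" for z i
      unfolding h'_def field_differentiable_def
      using pairing_const_has_field_derivative[OF hol_family_onb famc that] by blast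
    fix p assume p: "p \<in> D"
    obtain r C where r: "r > 0" "C \<ge> 0" "p \<in> polydisc n p r" "polydisc n p r \<subseteq> D"
      and bd: "\<And>z F. z \<in> polydisc n p r \<Longrightarrow> finite F \<Longrightarrow> F \<subseteq> B \<Longrightarrow> (\<Sum>f\<in>F. (cmod (f z))\<^sup>2) \<le> C\<^sup>2"
      by (rule onb_local_bound[OF p]) (rule that)
    have "(\<Sum>j\<in>F. (cmod (h' z))\<^sup>2) \<le> (C * s)\<^sup>2" if z: "z \<in> polydisc n p r" and F: "finite F" "F \<subseteq> {()}" for z F
    proof -
      have "l2b B (\<lambda>f. f z) C" using bd[OF z] r(2) by (simp add: l2b_def)
      from l2b_summable(3)[OF this la] have "cmod (h' z) \<le> C * s" by (simp add: h'_def pairing_def)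
      then have "(cmod (h' z))\<^sup>2 \<le> (C * s)\<^sup>2" by (rule power_mono) simp
      moreover have "F = {} \<or> F = {()}" using F by blast
      ultimately show ?thesis by auto
    qed
    moreover have "C * s \<ge> 0" using r(2) la by (simp add: l2b_def)
    ultimately show "\<exists>r>0. \<exists>M\<ge>0. p \<in> polydisc n p r \<and> polydisc n p r \<subseteq> D \<and>
      (\<forall>z\<in>polydisc n p r. \<forall>F. finite F \<longrightarrow> F \<subseteq> {()} \<longrightarrow> (\<Sum>j\<in>F. (cmod (h' z))\<^sup>2) \<le> M\<^sup>2)"
      using r by blast
  qed
  have hol': "hol h' D"
    unfolding Cn_holomorphic_on_def
    using hol_family_continuous[OF fam' _ openD] fam' by (auto simp: hol_family_def)
  \<comment> \<open>\<open>F m\<close> is chosen so that the coefficients outside of it have norm at most \<open>1 / (m + 1)\<close>\<close>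
  define c where "c m = (1 / real (Suc m))\<^sup>2" for m
  have c0: "c m > 0" for m by (simp add: c_def)
  have clim: "c \<longlonglongrightarrow> 0"
  proof -
    have "(\<lambda>m. (1 / real (Suc m))\<^sup>2) \<longlonglongrightarrow> 0\<^sup>2" by (intro tendsto_power LIMSEQ_Suc[OF lim_1_over_n])
    then show ?thesis by (simp add: c_def[abs_def])
  qed
  have "\<forall>m. \<exists>F. finite F \<and> F \<subseteq> B \<and> (\<forall>F'. finite F' \<longrightarrow> F' \<subseteq> B - F \<longrightarrow> (\<Sum>f\<in>F'. (cmod (a f))\<^sup>2) \<le> c m)"
    unfolding a_def using coeff_tail[OF h c0] by blast
  then obtain F where F: "\<And>m. finite (F m)" "\<And>m. F m \<subseteq> B"
    and tail: "\<And>m F'. finite F' \<Longrightarrow> F' \<subseteq> B - F m \<Longrightarrow> (\<Sum>f\<in>F'. (cmod (a f))\<^sup>2) \<le> c m"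
    by metis
  define S where "S m = (\<lambda>z. \<Sum>f\<in>F m. a f * f z)" for m
  have SA: "S m \<in> A2" for m unfolding S_def by (rule A2_comb[OF F(2)])
  have pw: "(\<lambda>m. S m z) \<longlonglongrightarrow> h' z" if z: "z \<in> D" for z
  proof -
    obtain C where C: "l2b B (\<lambda>f. f z) C" using l2z[OF z] by blast
    have bound: "cmod (S m z - h' z) \<le> C * (1 / real (Suc m))" for m
    proof -
      have x: "l2b (B - F m) (\<lambda>f. f z) C" using C by (auto simp: l2b_def)
      have y: "l2b (B - F m) (\<lambda>f. cnj (a f)) (1 / real (Suc m))"
        using tail[of _ m] by (auto simp: l2b_def c_def)
      let ?g = "\<lambda>f. f z * cnj (cnj (a f))"
      have "(?g has_sum (sum ?g (F m) + l2pair (B - F m) (\<lambda>f. f z) (\<lambda>f. cnj (a f)))) (F m \<union> (B - F m))"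
        by (rule has_sum_Un_disjoint[OF has_sum_finite[OF F(1)] l2b_summable(2)[OF x y]]) auto
      moreover have "F m \<union> (B - F m) = B" using F(2) by blast
      ultimately have "(?g has_sum (sum ?g (F m) + l2pair (B - F m) (\<lambda>f. f z) (\<lambda>f. cnj (a f)))) B" by simp
      from has_sum_unique[OF l2b_summable(2)[OF C la] this]
      have "h' z = S m z + l2pair (B - F m) (\<lambda>f. f z) (\<lambda>f. cnj (a f))"
        by (simp add: h'_def pairing_def S_def mult.commute)
      then have "cmod (S m z - h' z) = cmod (l2pair (B - F m) (\<lambda>f. f z) (\<lambda>f. cnj (a f)))" by simp
      also have "\<dots> \<le> C * (1 / real (Suc m))" by (rule l2b_summable(3)[OF x y])
      finally show ?thesis .
    qed
    have "(\<lambda>m. C * (1 / real (Suc m))) \<longlonglongrightarrow> C * 0"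
      by (intro tendsto_mult tendsto_const LIMSEQ_Suc[OF lim_1_over_n])
    then have lim0: "(\<lambda>m. C * (1 / real (Suc m))) \<longlonglongrightarrow> 0" by (simp only: mult_zero_right)
    have "\<forall>\<^sub>F m in sequentially. cmod (S m z - h' z) \<le> C * (1 / real (Suc m))"
      by (rule always_eventually, rule allI, rule bound)
    from Lim_null_comparison[OF this lim0] show ?thesis by (rule LIM_zero_cancel)
  qed
  have Ndiff: "Nrm (\<lambda>z. S l z - S m z) \<le> c m + c l" for l m
  proof -
    define b where "b f = (if f \<in> F l then a f else 0) - (if f \<in> F m then a f else 0)" for f
    let ?U = "F l \<union> F m"
    have U: "finite ?U" "?U \<subseteq> B" using F by auto
    have "S l z - S m z = (\<Sum>f\<in>?U. b f * f z)" for z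
    proof -
      have "S l z = (\<Sum>f\<in>?U. (if f \<in> F l then a f else 0) * f z)" for l' and z
        unfolding S_def by (rule sum.mono_neutral_cong_left) (use F in auto)
      moreover have "S m z = (\<Sum>f\<in>?U. (if f \<in> F m then a f else 0) * f z)" for z
        unfolding S_def by (rule sum.mono_neutral_cong_left) (use F in auto)
      ultimately show ?thesis by (simp add: b_def left_diff_distrib sum_subtractf)
    qed
    then have "Nrm (\<lambda>z. S l z - S m z) = (\<Sum>f\<in>?U. (cmod (b f))\<^sup>2)"
      using Nrm_comb[OF U, of b] by simp
    also have "\<dots> = (\<Sum>f\<in>(F l - F m) \<union> (F m - F l). (cmod (a f))\<^sup>2)"
      by (rule sum.mono_neutral_cong_right) (use F in \<open>auto simp: b_def\<close>)
    also have "\<dots> = (\<Sum>f\<in>F l - F m. (cmod (a f))\<^sup>2) + (\<Sum>f\<in>F m - F l. (cmod (a f))\<^sup>2)"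
      by (rule sum.union_disjoint) (use F in auto)
    also have "\<dots> \<le> c m + c l"
      by (intro add_mono tail) (use F in auto)
    finally show ?thesis .
  qed
  have Ilim: "I (\<lambda>z. h' z - S m z) \<le> ennreal (c m)" for m
  proof -
    have "I (\<lambda>z. h' z - S m z) \<le> (\<integral>\<^sup>+z. liminf (\<lambda>l. ennreal ((cmod (indicator D z * (S l z - S m z)))\<^sup>2)) \<partial>\<mu>)"
      unfolding I_eq
    proof (rule nn_integral_mono)
      fix z
      have "(\<lambda>l. indicator D z * (S l z - S m z)) \<longlonglongrightarrow> indicator D z * (h' z - S m z)"
        by (cases "z \<in> D") (auto intro!: tendsto_intros pw)
      then have "(\<lambda>l. ennreal ((cmod (indicator D z * (S l z - S m z)))\<^sup>2)) \<longlonglongrightarrow> ennreal ((cmod (indicator D z * (h' z - S m z)))\<^sup>2)"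
        by (intro tendsto_ennrealI tendsto_power tendsto_norm)
      then show "ennreal ((cmod (indicator D z * (h' z - S m z)))\<^sup>2)
          \<le> liminf (\<lambda>l. ennreal ((cmod (indicator D z * (S l z - S m z)))\<^sup>2))"
        using lim_imp_Liminf[OF sequentially_bot] by (metis order_refl)
    qed
    also have "\<dots> \<le> liminf (\<lambda>l. I (\<lambda>z. S l z - S m z))"
      unfolding I_eq
    proof (rule nn_integral_liminf)
      fix l
      have "(\<lambda>z. ennreal ((cmod (q z))\<^sup>2)) \<in> borel_measurable \<mu>"
        if [measurable]: "q \<in> borel_measurable \<mu>" for q :: "(nat \<Rightarrow> complex) \<Rightarrow> complex"
        by measurable
      from this[OF hol_meas[OF A2_hol[OF A2_diff[OF SA SA]]]]
      show "(\<lambda>z. ennreal ((cmod (indicator D z * (S l z - S m z)))\<^sup>2)) \<in> borel_measurable \<mu>" .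
    qed
    also have "\<dots> \<le> liminf (\<lambda>l. ennreal (c m + c l))"
    proof (rule Liminf_mono, rule always_eventually, rule allI)
      fix l
      show "I (\<lambda>z. S l z - S m z) \<le> ennreal (c m + c l)"
        using Ndiff[of l m] ip_self(2)[OF A2_diff[OF SA SA], of l m] by (simp add: ennreal_leI)
    qed
    also have "\<dots> = ennreal (c m)"
    proof (rule lim_imp_Liminf[OF sequentially_bot])
      have "(\<lambda>l. c m + c l) \<longlonglongrightarrow> c m + 0" by (intro tendsto_intros clim)
      then show "(\<lambda>l. ennreal (c m + c l)) \<longlonglongrightarrow> ennreal (c m)" by (intro tendsto_ennrealI) simp
    qed
    finally show ?thesis .
  qed
  have dA: "(\<lambda>z. h' z - S m z) \<in> A2" for m
  proof -
    have "(\<lambda>z. (-1) * S m z) \<in> A2" by (rule A2_cmult[OF SA])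
    then have "hol (\<lambda>z. h' z + (-1) * S m z) D" by (intro hol_add hol' A2_hol)
    moreover have "I (\<lambda>z. h' z - S m z) < \<infinity>" using Ilim[of m] by (simp add: order.strict_trans1)
    ultimately show ?thesis by (simp add: A2_iff)
  qed
  have h'A: "h' \<in> A2" using A2_add[OF dA[of 0] SA[of 0]] by simp
  have coeff: "ip h' g = a g" if g: "g \<in> B" for g
  proof -
    have "cmod (ip h' g - a g) \<le> 2 * (1 / real (Suc m))" for m
    proof -
      have "ip (\<lambda>z. h' z - S m z) g = ip h' g - ip (S m) g" by (rule ip_diff[OF h'A SA BA[OF g]])
      then have e: "ip h' g - a g = ip (\<lambda>z. h' z - S m z) g + (ip (S m) g - a g)" by simp
      have N: "Nrm (\<lambda>z. h' z - S m z) \<le> c m"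
        using Ilim[of m] c0[of m] unfolding ip_self(2)[OF dA] by (simp add: ennreal_le_iff less_imp_le)
      have "(\<Sum>f\<in>{g}. (cmod (ip (\<lambda>z. h' z - S m z) f))\<^sup>2) \<le> Nrm (\<lambda>z. h' z - S m z)"
        by (rule bessel) (use g dA in auto)
      then have "(cmod (ip (\<lambda>z. h' z - S m z) g))\<^sup>2 \<le> Nrm (\<lambda>z. h' z - S m z)" by simp
      from order_trans[OF this N] have "(cmod (ip (\<lambda>z. h' z - S m z) g))\<^sup>2 \<le> (1 / real (Suc m))\<^sup>2"
        by (simp only: c_def)
      then have 1: "cmod (ip (\<lambda>z. h' z - S m z) g) \<le> 1 / real (Suc m)"
        by (rule power2_le_imp_le) simp
      have 2: "cmod (ip (S m) g - a g) \<le> 1 / real (Suc m)"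
      proof (cases "g \<in> F m")
        case True
        then show ?thesis using ip_comb[OF F(1)[of m] F(2)[of m] g, of a] by (simp add: S_def)
      next
        case False
        then have "(\<Sum>f\<in>{g}. (cmod (a f))\<^sup>2) \<le> c m" using g by (intro tail) auto
        then have "cmod (a g) \<le> 1 / real (Suc m)"
          unfolding c_def by (intro power2_le_imp_le[of "cmod (a g)"]) auto
        then show ?thesis using ip_comb[OF F(1)[of m] F(2)[of m] g, of a] False by (simp add: S_def)
      qed
      show ?thesis unfolding e using norm_triangle_ineq[of "ip (\<lambda>z. h' z - S m z) g" "ip (S m) g - a g"] 1 2 by linarith
    qed
    moreover have "(\<lambda>m. 2 * (1 / real (Suc m))) \<longlonglongrightarrow> 2 * 0"
      by (intro tendsto_mult tendsto_const LIMSEQ_Suc[OF lim_1_over_n])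
    ultimately have "cmod (ip h' g - a g) \<le> 0"
      by (intro LIMSEQ_le_const[of "\<lambda>m. 2 * (1 / real (Suc m))"]) auto
    then show ?thesis by simp
  qed
  have "h z - h' z = 0"
    by (rule Bc[OF A2_diff[OF h h'A] _ z]) (use ip_diff[OF h h'A BA] coeff in \<open>auto simp: a_def\<close>)
  then show ?thesis by (simp add: h'_def a_def)
qed

text \<open>A finite combination of derivatives at a point commutes with the Fourier expansion.\<close>

lemma jet_functional_vanishes:
  assumes L: "\<forall>(b, xs)\<in>set L. set xs \<subseteq> {..<n}" and z: "z \<in> D"
    and van: "\<And>f. f \<in> B \<Longrightarrow> (\<Sum>(b, xs)\<leftarrow>L. b * cpds xs f z) = 0" and h: "h \<in> A2"
  shows "(\<Sum>(b, xs)\<leftarrow>L. b * cpds xs h z) = 0"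
proof -
  have famc: "hol_family n D B (\<lambda>f _. cnj (ip h f))" by (rule hol_family_const[OF l2b_cnj_coeff[OF h]])
  have e: "cpds xs h z = l2pair B (\<lambda>f. cpds xs f z) (\<lambda>f. cnj (ip h f))" if "set xs \<subseteq> {..<n}" for xs
  proof -
    have "cpds xs h z = cpds xs (pairing B (\<lambda>f. f) (\<lambda>f _. cnj (ip h f))) z"
      by (rule cpds_cong[OF cn_openD z that]) (rule fourier_expansion[OF h])
    then show ?thesis
      using cpds_pairing_const[OF cn_openD famc z hol_family_onb that] by (simp add: pairing_def)
  qed
  have bd: "\<exists>M. l2b B (\<lambda>f. cpds xs f z) M" if bxs: "(b, xs) \<in> set L" for b xs
  proof -
    have "set xs \<subseteq> {..<n}" using L bxs by auto
    then obtain r M where "r > 0" "M \<ge> 0" "z \<in> polydisc n z r"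
      "\<And>y F. y \<in> polydisc n z r \<Longrightarrow> finite F \<Longrightarrow> F \<subseteq> B \<Longrightarrow> (\<Sum>j\<in>F. (cmod (cpds xs j y))\<^sup>2) \<le> M\<^sup>2"
      using hol_familyE[OF hol_family_cpds[OF hol_family_onb] z] by metis
    then show ?thesis unfolding l2b_def by blast
  qed
  have "(\<Sum>(b, xs)\<leftarrow>L. b * cpds xs h z) = (\<Sum>(b, xs)\<leftarrow>L. b * l2pair B (\<lambda>f. cpds xs f z) (\<lambda>f. cnj (ip h f)))"
    by (intro arg_cong[where f = sum_list] map_cong refl) (use L e in auto)
  also have "\<dots> = l2pair B (\<lambda>f. \<Sum>(b, xs)\<leftarrow>L. b * cpds xs f z) (\<lambda>f. cnj (ip h f))"
    by (rule l2pair_lincomb(2)[where x = "\<lambda>xs f. cpds xs f z", symmetric, OF bd l2b_cnj_coeff[OF h]])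
  also have "\<dots> = l2pair B (\<lambda>f. 0) (\<lambda>f. cnj (ip h f))"
    unfolding l2pair_def by (rule infsum_cong) (simp add: van)
  finally show ?thesis by (simp add: l2pair_def)
qed

end

lemma l2pair_self:
  assumes "l2b B x M"
  shows "l2pair B x x = of_real (\<Sum>\<^sub>\<infinity>j\<in>B. (cmod (x j))\<^sup>2)"
proof -
  have "(\<lambda>j. (cmod (x j))\<^sup>2) summable_on B"
    using assms by (intro nonneg_bdd_above_summable_on) (auto simp: l2b_def intro!: bdd_aboveI[of _ "M\<^sup>2"])
  then have "((\<lambda>j. complex_of_real ((cmod (x j))\<^sup>2)) has_sum of_real (\<Sum>\<^sub>\<infinity>j\<in>B. (cmod (x j))\<^sup>2)) B"
    by (simp only: has_sum_of_real_iff has_sum_infsum)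
  then show ?thesis
    unfolding l2pair_def complex_norm_square by (rule infsumI)
qed

text \<open>The form is the Gram determinant of \<open>x = \<Sum> X\<^sub>i \<partial>\<^sub>i f\<close> and \<open>y = f\<close> over \<open>K\<^sup>2\<close>, that is, \<open>1/K\<close> times the square of
  the distance of \<open>x\<close> from the line through \<open>y\<close>; \<open>t y\<close> is the projection of \<open>x\<close>.\<close>

lemma (in kernel_potential) form_eq:
  fixes X :: "nat \<Rightarrow> complex"
  assumes z: "z \<in> D"
  defines "x \<equiv> \<lambda>j. \<Sum>i<n. X i * cpd i (f j) z" and "y \<equiv> \<lambda>j. f j z"
  obtains t M where "l2b B (\<lambda>j. x j - t * y j) M"
    "bergman_form n D z X = l2pair B (\<lambda>j. x j - t * y j) (\<lambda>j. x j - t * y j) / of_real (bergman_kernel n D z)"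
proof -
  define k where "k = bergman_kernel n D z"
  have k: "k > 0" using K_pos[OF z] by (simp add: k_def)
  have bd: "\<exists>M. l2b B (\<lambda>j. cpds xs (f j) z) M" if xs: "set xs \<subseteq> {..<n}" for xs
  proof -
    obtain r M where "r > 0" "M \<ge> 0" "z \<in> polydisc n z r"
      "\<And>y F. y \<in> polydisc n z r \<Longrightarrow> finite F \<Longrightarrow> F \<subseteq> B \<Longrightarrow> (\<Sum>j\<in>F. (cmod (cpds xs (f j) y))\<^sup>2) \<le> M\<^sup>2"
      using hol_familyE[OF hol_family_cpds[OF fam xs] z] by metis
    then show ?thesis unfolding l2b_def by blast
  qed
  define d where "d i j = cpd i (f j) z" for i j
  have bd1: "\<exists>M. l2b B (d i) M" if "i < n" for i
    using bd[of "[i]"] that by (simp add: d_def[abs_def])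
  obtain My where My: "l2b B y My" using bd[of "[]"] by (auto simp: y_def)
  have lsum: "\<exists>M. l2b B (\<lambda>j. \<Sum>i\<in>S. X i * d i j) M" if "finite S" "S \<subseteq> {..<n}" for S
    using that
  proof (induction S rule: finite_induct)
    case (insert i S)
    then obtain M M' where "l2b B (\<lambda>j. \<Sum>i\<in>S. X i * d i j) M" "l2b B (d i) M'" using bd1 by blast
    then have "l2b B (\<lambda>j. X i * d i j + (\<Sum>i\<in>S. X i * d i j)) (cmod (X i) * M' + M)"
      by (intro l2b_add l2b_cmult)
    then show ?case using insert by auto
  qed (use l2b_const0 in auto)
  obtain Mx where Mx: "l2b B x Mx" using lsum[of "{..<n}"] by (auto simp: x_def d_def)
  have add: "l2pair B (\<lambda>j. u j + v j) w = l2pair B u w + l2pair B v w"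
    if "l2b B u M1" "l2b B v M2" "l2b B w M3" for u v w M1 M2 M3
    using has_sum_add[OF l2b_summable(2)[OF that(1,3)] l2b_summable(2)[OF that(2,3)]]
    unfolding l2pair_def[of B "\<lambda>j. u j + v j"] by (intro infsumI) (simp add: algebra_simps)
  have cm: "l2pair B (\<lambda>j. c * u j) w = c * l2pair B u w" for c u w
    unfolding l2pair_def by (simp add: mult.assoc infsum_cmult_right')
  have suml: "l2pair B (\<lambda>j. \<Sum>i\<in>S. X i * d i j) w = (\<Sum>i\<in>S. X i * l2pair B (d i) w)"
    if "finite S" "S \<subseteq> {..<n}" "l2b B w M" for S w M
    using that(1,2)
  proof (induction S rule: finite_induct)
    case empty
    show ?case by (simp add: l2pair_def)
  next
    case (insert i S)
    then obtain M1 M2 where M12: "l2b B (\<lambda>j. \<Sum>i\<in>S. X i * d i j) M1" "l2b B (d i) M2"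
      using bd1 lsum[of S] by blast
    have "l2pair B (\<lambda>j. X i * d i j + (\<Sum>i\<in>S. X i * d i j)) w = X i * l2pair B (d i) w + (\<Sum>i\<in>S. X i * l2pair B (d i) w)"
      using add[OF l2b_cmult[OF M12(2)] M12(1) that(3)] insert by (simp add: cm)
    then show ?case using insert by simp
  qed
  have x_left: "l2pair B x w = (\<Sum>i<n. X i * l2pair B (d i) w)" if "l2b B w M" for w M
    using suml[OF _ _ that, of "{..<n}"] by (simp add: x_def d_def[symmetric])
  have x_right: "l2pair B w x = (\<Sum>i<n. cnj (X i) * l2pair B w (d i))" if "l2b B w M" for w M
    unfolding l2pair_cnj[of B w x] x_left[OF that] by (simp add: l2pair_cnj[of B "d _" w])
  have yy: "l2pair B y y = of_real k"
    using kernel[OF z] by (simp add: k_def pairing_def y_def)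
  have gij: "g i j z = l2pair B (d i) (d j) / of_real k - l2pair B (d i) y * l2pair B y (d j) / (of_real k)\<^sup>2"
    if i: "i < n" and j: "j < n" for i j
  proof -
    have wK: "w i K u = pairing B (\<lambda>j. cpd i (f j)) f u" if "u \<in> D" for u
      unfolding K_def using dop_pairing[OF fam fam, of "(i, False)" u] that i by simp
    have "wb j (w i K) z = wb j (pairing B (\<lambda>j. cpd i (f j)) f) z"
      by (rule wb_cong[OF j z]) (rule wK)
    also have "\<dots> = l2pair B (d i) (d j)"
      using dop_pairing[OF hol_family_cpd[OF fam i] fam, of "(j, True)" z] z j
      by (simp add: pairing_def d_def[abs_def])
    finally have 1: "wb j (w i K) z = l2pair B (d i) (d j)" .
    have 2: "wb j K z = l2pair B y (d j)"
      unfolding K_def using dop_pairing[OF fam fam, of "(j, True)" z] z j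
      by (simp add: pairing_def d_def[abs_def] y_def)
    have 3: "w i K z = l2pair B (d i) y" using wK[OF z] by (simp add: pairing_def d_def[abs_def] y_def)
    have 4: "K z = of_real k" using kernel[OF z] by (simp add: K_def k_def)
    show ?thesis
      unfolding g_eq[OF i j z] p_def[abs_def]
      using dop_divide[of "w i K" K "(j, True)" z] i j z
      by (simp add: smooth_w smooth_K K_nonzero 1 2 3 4)
  qed
  have "bergman_form n D z X = (\<Sum>i<n. \<Sum>j<n. (l2pair B (d i) (d j) / of_real k - l2pair B (d i) y * l2pair B y (d j) / (of_real k)\<^sup>2) * X i * cnj (X j))"
    unfolding bergman_form_def by (intro sum.cong refl) (simp add: gij)
  also have "\<dots> = (\<Sum>i<n. \<Sum>j<n. X i * (cnj (X j) * l2pair B (d i) (d j))) / of_real k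
      - (\<Sum>i<n. \<Sum>j<n. (X i * l2pair B (d i) y) * (cnj (X j) * l2pair B y (d j))) / (of_real k)\<^sup>2"
    by (simp add: sum_subtractf sum_divide_distrib algebra_simps)
  also have "(\<Sum>i<n. \<Sum>j<n. X i * (cnj (X j) * l2pair B (d i) (d j))) = l2pair B x x"
  proof -
    have "l2pair B x x = (\<Sum>i<n. X i * l2pair B (d i) x)" by (rule x_left[OF Mx])
    also have "\<dots> = (\<Sum>i<n. \<Sum>j<n. X i * (cnj (X j) * l2pair B (d i) (d j)))"
    proof (intro sum.cong refl)
      fix i assume "i \<in> {..<n}"
      then obtain M where "l2b B (d i) M" using bd1 by auto
      from x_right[OF this] show "X i * l2pair B (d i) x = (\<Sum>j<n. X i * (cnj (X j) * l2pair B (d i) (d j)))"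
        by (simp add: sum_distrib_left)
    qed
    finally show ?thesis by simp
  qed
  also have "(\<Sum>i<n. \<Sum>j<n. (X i * l2pair B (d i) y) * (cnj (X j) * l2pair B y (d j))) = l2pair B x y * l2pair B y x"
    unfolding x_left[OF My] x_right[OF My] by (simp add: sum_product)
  finally have form: "bergman_form n D z X = l2pair B x x / of_real k - l2pair B x y * l2pair B y x / (of_real k)\<^sup>2" .
  define t where "t = l2pair B x y / of_real k"
  have tc: "cnj t = l2pair B y x / of_real k" by (simp add: t_def l2pair_cnj[of B x y])
  define v where "v = (\<lambda>j. x j + (-t) * y j)"
  have vM: "l2b B v (Mx + cmod (-t) * My)" unfolding v_def by (intro l2b_add l2b_cmult Mx My)
  have vl: "l2pair B v u = l2pair B x u - t * l2pair B y u" if "l2b B u M" for u M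
    unfolding v_def using add[OF Mx l2b_cmult[OF My] that, of "-t"] cm[of "-t" y u] by simp
  have "l2pair B v v = l2pair B x v - t * l2pair B y v" by (rule vl[OF vM])
  also have "l2pair B x v = l2pair B x x - cnj t * l2pair B x y"
    by (metis complex_cnj_diff complex_cnj_mult l2pair_cnj vl[OF Mx])
  also have "l2pair B y v = l2pair B y x - cnj t * l2pair B y y"
    by (metis complex_cnj_diff complex_cnj_mult l2pair_cnj vl[OF My])
  finally have vv: "l2pair B v v = l2pair B x x - l2pair B x y * l2pair B y x / of_real k"
    unfolding tc t_def yy using k by (simp add: field_simps)
  have "bergman_form n D z X = l2pair B v v / of_real k"
    unfolding form vv using k by (simp add: field_simps power2_eq_square)
  then show ?thesis
    using that[of t "Mx + cmod (-t) * My"] vM unfolding v_def k_def by simp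
qed

context bergman
begin

definition "B0 = (SOME B. bergman_orthonormal_basis n D B)"

lemma B0: "bergman_onb n D B0"
  unfolding bergman_onb_def bergman_onb_axioms_def B0_def
  using bergman_axioms bergman_orthonormal_basis_exists by (auto intro: someI_ex)

text \<open>Were \<open>K\<close> or the form degenerate at \<open>z\<close>, then by \<open>form_eq\<close> a combination of the value and of first
  derivatives at \<open>z\<close> would vanish on all basis elements, hence on the constants and the coordinates,
  which separate such functionals.\<close>

theorem kernel_metric_B0:
  assumes one: "(\<lambda>_. 1) \<in> A2" and coord: "\<And>i. i < n \<Longrightarrow> (\<lambda>z. z i) \<in> A2"
  shows "kernel_metric n D B0 (\<lambda>f. f)"
proof -
  interpret bergman_onb n D B0 by (rule B0)
  have l2z: "\<exists>C. l2b B0 (\<lambda>f. f z) C" if "z \<in> D" for z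
    by (rule onb_local_bound[OF that]) (auto simp: l2b_def)
  have ker: "of_real (bergman_kernel n D z) = pairing B0 (\<lambda>f. f) (\<lambda>f. f) z" if z: "z \<in> D" for z
  proof -
    obtain C where "l2b B0 (\<lambda>f. f z) C" using l2z[OF z] by blast
    from l2pair_self[OF this] show ?thesis by (simp add: bergman_kernel_def B0_def[symmetric] pairing_def)
  qed
  have pos: "bergman_kernel n D z > 0" if z: "z \<in> D" for z
  proof (rule ccontr)
    assume "\<not> bergman_kernel n D z > 0"
    then have le: "bergman_kernel n D z \<le> 0" by simp
    obtain C where C: "l2b B0 (\<lambda>f. f z) C" using l2z[OF z] by blast
    have "f z = 0" if "f \<in> B0" for f
      using l2b_self_zero[OF C _ le that] ker[OF z] by (simp add: pairing_def)
    then have "(\<Sum>(b, xs)\<leftarrow>[(1, [])]. b * cpds xs (\<lambda>_. 1) z) = 0"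
      by (intro jet_functional_vanishes[OF _ z _ one]) auto
    then show False by simp
  qed
  interpret kp: kernel_potential n D B0 "\<lambda>f. f"
    by unfold_locales (use cn_openD hol_family_onb ker pos in auto)
  have "bergman_form n D z X \<in> \<real> \<and> Re (bergman_form n D z X) > 0"
    if z: "z \<in> D" and X: "\<exists>i<n. X i \<noteq> 0" for z X
  proof -
    define v where "v t f = (\<Sum>i<n. X i * cpd i f z) - t * f z" for t f
    obtain t M where M: "l2b B0 (v t) M"
      and form: "bergman_form n D z X = l2pair B0 (v t) (v t) / of_real (bergman_kernel n D z)"
      using kp.form_eq[OF z, of X] unfolding v_def by blast
    define s where "s = (\<Sum>\<^sub>\<infinity>f\<in>B0. (cmod (v t f))\<^sup>2)"
    have vs: "l2pair B0 (v t) (v t) = of_real s" unfolding s_def by (rule l2pair_self[OF M])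
    have "s > 0"
    proof (rule ccontr)
      assume "\<not> s > 0"
      then have v0: "v t f = 0" if "f \<in> B0" for f using l2b_self_zero[OF M vs _ that] by simp
      define L where "L = (- t, []) # map (\<lambda>i. (X i, [i])) [0..<n]"
      have Lsum: "(\<Sum>(b, xs)\<leftarrow>L. b * cpds xs f z) = v t f" for f
        by (simp add: L_def v_def o_def interv_sum_list_conv_sum_set_nat atLeast0LessThan)
      have Lin: "\<forall>(b, xs)\<in>set L. set xs \<subseteq> {..<n}" by (auto simp: L_def)
      have van: "v t h = 0" if "h \<in> A2" for h
        using jet_functional_vanishes[OF Lin z _ that] v0 by (simp add: Lsum)
      have "t = 0" using van[OF one] by (simp add: v_def cpd_const)
      have "X k = 0" if k: "k < n" for k
      proof -
        have "cpd i (\<lambda>z. z k) z = (if i = k then 1 else 0)" for i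
          by (auto simp: cpd_def)
        then have "v t (\<lambda>z. z k) = (\<Sum>i<n. X i * (if i = k then 1 else 0))"
          using \<open>t = 0\<close> by (simp add: v_def)
        also have "\<dots> = X k" using k by (simp add: if_distrib[of "\<lambda>x. _ * x"] cong: if_cong)
        finally show ?thesis using van[OF coord[OF k]] by simp
      qed
      with X show False by blast
    qed
    then show ?thesis using pos[OF z] unfolding form vs by (simp flip: of_real_divide)
  qed
  then have wd: "bergman_metric_well_defined n D"
    unfolding bergman_metric_well_defined_def using pos by blast
  show ?thesis by unfold_locales (rule wd)
qed

lemma cpd_power:
  "cpd i (\<lambda>z. c * (z 0 - q) ^ Suc k) = (if i = 0 then (\<lambda>z. (c * of_nat (Suc k)) * (z 0 - q) ^ k) else (\<lambda>_. 0))"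
proof (rule ext)
  fix z :: "nat \<Rightarrow> complex"
  have "((\<lambda>w. c * (w - q) ^ Suc k) has_field_derivative
      c * (of_nat (Suc k) * ((1 - 0) * (z 0 - q) ^ (Suc k - Suc 0)))) (at (z 0))"
    by (intro DERIV_cmult DERIV_power DERIV_diff DERIV_ident DERIV_const)
  then show "cpd i (\<lambda>z. c * (z 0 - q) ^ Suc k) z
      = (if i = 0 then (\<lambda>z. (c * of_nat (Suc k)) * (z 0 - q) ^ k) else (\<lambda>_. 0)) z"
    by (cases "i = 0") (simp_all add: cpd_def DERIV_imp_deriv mult_ac del: power_Suc of_nat_Suc)
qed

lemma cpds_power_low:
  "length xs < k \<Longrightarrow> z 0 = q \<Longrightarrow> cpds xs (\<lambda>z. c * (z 0 - q) ^ k) z = 0"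
proof (induction xs arbitrary: c k)
  case (Cons x xs)
  then obtain k' where k: "k = Suc k'" by (cases k) auto
  have const0: "cpds ys (\<lambda>_. 0) z = 0" for ys z
  proof (induction ys)
    case (Cons y ys)
    have "cpd y (\<lambda>_. 0) = (\<lambda>_. 0)" by (rule ext) (rule cpd_const)
    then show ?case using Cons by simp
  qed simp
  show ?case
    using Cons.IH[of k' "c * of_nat (Suc k')"] Cons.prems
    unfolding cpds_simps k cpd_power by (auto simp: const0)
qed simp

lemma cpds_power_top: "cpds (replicate k 0) (\<lambda>z. c * (z 0 - q) ^ k) z = c * fact k"
proof (induction k arbitrary: c)
  case (Suc k)
  show ?case unfolding replicate_Suc cpds_simps cpd_power
    using Suc[of "c * of_nat (Suc k)"] by (simp add: mult_ac)
qed simp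

text \<open>The annihilating jet of order \<open>k\<close> is nonzero on \<open>(z\<^sub>0 - z0\<^sub>0)\<^sup>k\<close>.\<close>

theorem no_positive_constant_hsc:
  assumes one: "(\<lambda>_. 1) \<in> A2" and coord: "\<And>i. i < n \<Longrightarrow> (\<lambda>z. z i) \<in> A2"
    and pow: "\<And>q k. (\<lambda>z. (z 0 - q) ^ k) \<in> A2"
    and n: "n > 0" and z0: "z0 \<in> D" and c: "c > 0"
  shows "\<not> bergman_constant_hsc n D c"
proof
  assume hsc: "bergman_constant_hsc n D c"
  interpret bergman_onb n D B0 by (rule B0)
  interpret km: kernel_metric n D B0 "\<lambda>f. f" by (rule kernel_metric_B0[OF one coord])
  interpret pc: positive_curvature n D B0 "\<lambda>f. f" c z0
    by unfold_locales (use c hsc z0 n in auto)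
  obtain k L where L: "\<forall>(a, xs)\<in>set L. length xs < k \<and> set xs \<subseteq> {..<n}"
    and ann: "\<And>f. f \<in> B0 \<Longrightarrow> cpds (replicate k 0) f z0 + (\<Sum>(a, xs)\<leftarrow>L. a * cpds xs f z0) = 0"
    by (rule pc.exists_annihilating_jet) (rule that)
  define h where "h = (\<lambda>z::nat \<Rightarrow> complex. 1 * (z 0 - z0 0) ^ k)"
  have h: "h \<in> A2" using pow[of "z0 0" k] by (simp add: h_def)
  have "(\<Sum>(a, xs)\<leftarrow>(1, replicate k 0) # L. a * cpds xs h z0) = 0"
  proof (rule jet_functional_vanishes[OF _ z0 _ h])
    show "\<forall>(b, xs)\<in>set ((1, replicate k 0) # L). set xs \<subseteq> {..<n}" using L n by auto
  qed (use ann in auto)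
  moreover have low: "cpds xs h z0 = 0" if "length xs < k" for xs
    using cpds_power_low[OF that, of z0 "z0 0" 1] by (simp add: h_def)
  have "(\<Sum>(a, xs)\<leftarrow>L. a * cpds xs h z0) = (\<Sum>(a, xs)\<leftarrow>L. 0)"
    by (intro arg_cong[where f = sum_list] map_cong refl) (use L low in auto)
  moreover have "cpds (replicate k 0) h z0 = fact k" unfolding h_def cpds_power_top by simp
  ultimately show False by (simp add: case_prod_unfold)
qed

end

section \<open>Bounded domains\<close>

lemma Cn_bounded_component:
  assumes "Cn_bounded n D"
  obtains b where "b > 0" "\<And>z i. z \<in> D \<Longrightarrow> i < n \<Longrightarrow> cmod (z i) < b"
proof -
  obtain b where b: "\<And>z. z \<in> D \<Longrightarrow> L2_set (\<lambda>i. cmod (z i)) {..<n} \<le> b"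
    using assms unfolding Cn_bounded_def by blast
  have "cmod (z i) < \<bar>b\<bar> + 1" if "z \<in> D" "i < n" for z i
    using member_le_L2_set[of "{..<n}" i "\<lambda>i. cmod (z i)"] b[OF that(1)] that(2) by auto
  then show ?thesis by (intro that[of "\<bar>b\<bar> + 1"]) auto
qed

lemma (in bergman) hol_coord: "i < n \<Longrightarrow> hol (\<lambda>z. z i) D"
  unfolding Cn_holomorphic_on_def
proof (intro conjI ballI allI impI)
  assume i: "i < n"
  show "continuous_map (subtopology (Cn_top n) D) euclidean (\<lambda>z. z i)"
    unfolding Cn_top_def by (rule continuous_map_from_subtopology, rule continuous_map_product_projection) (use i in auto)
  fix z j assume "z \<in> D" "j < n"
  show "(\<lambda>w. (z(j := w)) i) field_differentiable at (z j)" by (cases "i = j") auto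
qed

lemma (in bergman) bounded_hol_in_A2:
  assumes bdd: "Cn_bounded n D" and f: "hol f D" and M: "\<And>z. z \<in> D \<Longrightarrow> cmod (f z) \<le> M"
  shows "f \<in> A2"
proof -
  obtain b where b: "b > 0" "\<And>z i. z \<in> D \<Longrightarrow> i < n \<Longrightarrow> cmod (z i) < b"
    using Cn_bounded_component[OF bdd] by metis
  define P where "P = PiE {..<n} (\<lambda>_. ball (0::complex) b)"
  have DP: "D \<subseteq> P"
  proof
    fix z assume z: "z \<in> D"
    have "z \<in> extensional {..<n}"
      using z openin_subset[OF openD] by (auto simp: Cn_top_def PiE_iff)
    then show "z \<in> P" using b(2)[OF z] by (auto simp: P_def PiE_iff)
  qed
  have P: "P \<in> sets \<mu>" unfolding P_def Cn_lborel_def by (rule sets_PiM_I_finite) auto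
  have "emeasure \<mu> P = (\<Prod>i<n. emeasure lborel (ball (0::complex) b))"
    unfolding P_def Cn_lborel_def by (rule lborel_product.emeasure_PiM) auto
  also have "\<dots> < \<infinity>" using b(1) by (simp add: emeasure_ball ennreal_power less_top[symmetric] power_eq_top_ennreal)
  finally have Pfin: "emeasure \<mu> P < \<infinity>" .
  have "I f \<le> (\<integral>\<^sup>+z. ennreal (M\<^sup>2) * indicator P z \<partial>\<mu>)"
    unfolding I_def
  proof (rule nn_integral_mono)
    fix z
    show "ennreal ((cmod (f z))\<^sup>2) * indicator D z \<le> ennreal (M\<^sup>2) * indicator P z"
    proof (cases "z \<in> D")
      case True
      have "(cmod (f z))\<^sup>2 \<le> M\<^sup>2" using M[OF True] by (rule power_mono) simp
      then show ?thesis using True DP by (auto intro: ennreal_leI)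
    qed simp
  qed
  also have "\<dots> = ennreal (M\<^sup>2) * emeasure \<mu> P" using P by (rule nn_integral_cmult_indicator)
  also have "\<dots> < \<infinity>" using Pfin by (simp add: ennreal_mult_less_top)
  finally show ?thesis using f by (simp add: A2_iff)
qed

theorem bounded_domain_not_positive_constant_hsc:
  assumes n: "n \<ge> 1" and D: "Cn_domain n D" and bdd: "Cn_bounded n D" and c: "c > 0"
  shows "\<not> bergman_constant_hsc n D c"
proof -
  interpret bergman n D using D by unfold_locales (simp add: Cn_domain_def)
  obtain z0 where z0: "z0 \<in> D" using D by (auto simp: Cn_domain_def)
  obtain b where b: "b > 0" "\<And>z i. z \<in> D \<Longrightarrow> i < n \<Longrightarrow> cmod (z i) < b"
    using Cn_bounded_component[OF bdd] by metis
  have pow: "hol (\<lambda>z. (z 0 - q) ^ k) D" for q k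
  proof (induction k)
    case 0
    show ?case by (simp add: hol_const)
  next
    case (Suc k)
    have "hol (\<lambda>z. (z 0 + (- q)) * (z 0 - q) ^ k) D"
      by (intro hol_mult hol_add hol_coord hol_const Suc) (use n in auto)
    then show ?case by simp
  qed
  show ?thesis
  proof (rule no_positive_constant_hsc[OF _ _ _ _ z0 c])
    show "(\<lambda>_. 1) \<in> A2" by (rule bounded_hol_in_A2[OF bdd hol_const, of _ 1]) simp
    show "(\<lambda>z. z i) \<in> A2" if "i < n" for i
      by (rule bounded_hol_in_A2[OF bdd hol_coord[OF that], of b]) (use b that in \<open>auto intro: less_imp_le\<close>)
    show "(\<lambda>z. (z 0 - q) ^ k) \<in> A2" for q k
    proof (rule bounded_hol_in_A2[OF bdd pow, where M = "(b + cmod q) ^ k"])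
      fix z assume "z \<in> D"
      then have "cmod (z 0 - q) \<le> b + cmod q"
        using b(2)[of z 0] n norm_triangle_ineq4[of "z 0" q] by simp
      then show "cmod ((z 0 - q) ^ k) \<le> (b + cmod q) ^ k" unfolding norm_power by (rule power_mono) simp
    qed
  qed (use n in auto)
qed

section \<open>Integration over two complex variables\<close>

lemma measurable_Cn_scale:
  "(\<lambda>z. \<lambda>i\<in>{..<n}. \<omega> i * z i) \<in> measurable (Cn_lborel n) (Cn_lborel n)"
  unfolding Cn_lborel_def
proof (rule measurable_restrict)
  fix i assume i: "i \<in> {..<n}"
  have "(\<lambda>z. z i) \<in> borel_measurable (Pi\<^sub>M {..<n} (\<lambda>_. lborel :: complex measure))"
    using measurable_component_singleton[OF i, of "\<lambda>_. lborel :: complex measure"] by simp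
  then have "(\<lambda>z. \<omega> i * z i) \<in> borel_measurable (Pi\<^sub>M {..<n} (\<lambda>_. lborel :: complex measure))"
    by (intro borel_measurable_times borel_measurable_const)
  then show "(\<lambda>z. \<omega> i * z i) \<in> measurable (Pi\<^sub>M {..<n} (\<lambda>_. lborel)) (lborel :: complex measure)"
    by simp
qed

text \<open>Rotations preserve the measure of boxes, one coordinate at a time.\<close>

lemma distr_Cn_rotate:
  assumes \<omega>: "\<And>i. i < n \<Longrightarrow> cmod (\<omega> i) = 1"
  shows "distr (Cn_lborel n) (Cn_lborel n) (\<lambda>z. \<lambda>i\<in>{..<n}. \<omega> i * z i) = Cn_lborel n"
proof -
  let ?T = "\<lambda>z. \<lambda>i\<in>{..<n}. \<omega> i * z i"
  have "distr (Cn_lborel n) (Cn_lborel n) ?T = Pi\<^sub>M {..<n} (\<lambda>_. lborel)"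
  proof (rule lborel_product.PiM_eqI)
    fix A :: "nat \<Rightarrow> complex set" assume A: "\<And>i. i \<in> {..<n} \<Longrightarrow> A i \<in> sets lborel"
    have m: "(\<lambda>w. \<omega> i * w) -` A i \<in> sets borel" if "i < n" for i
    proof -
      have "A i \<in> sets borel" using A[of i] that by simp
      moreover have "(\<lambda>w. \<omega> i * w) \<in> borel_measurable borel" by measurable
      ultimately have "(\<lambda>w. \<omega> i * w) -` A i \<inter> space borel \<in> sets borel" by (rule measurable_sets[rotated])
      then show ?thesis by simp
    qed
    have pre: "?T -` PiE {..<n} A \<inter> space (Cn_lborel n) = PiE {..<n} (\<lambda>i. (\<lambda>w. \<omega> i * w) -` A i)"
      by (auto simp: Cn_lborel_def space_PiM PiE_iff)
    have "emeasure (distr (Cn_lborel n) (Cn_lborel n) ?T) (PiE {..<n} A)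
        = emeasure (Cn_lborel n) (PiE {..<n} (\<lambda>i. (\<lambda>w. \<omega> i * w) -` A i))"
      unfolding pre[symmetric]
      by (rule emeasure_distr[OF measurable_Cn_scale]) (auto simp: Cn_lborel_def intro!: sets_PiM_I_finite A)
    also have "\<dots> = (\<Prod>i<n. emeasure lborel ((\<lambda>w. \<omega> i * w) -` A i))"
      unfolding Cn_lborel_def by (rule lborel_product.emeasure_PiM) (auto intro: m)
    also have "\<dots> = (\<Prod>i<n. emeasure lborel (A i))"
    proof (rule prod.cong[OF refl])
      fix i assume i: "i \<in> {..<n}"
      have "emeasure lborel ((\<lambda>w. \<omega> i * w) -` A i) = (\<integral>\<^sup>+w. indicator ((\<lambda>w. \<omega> i * w) -` A i) w \<partial>lborel)"
        using m i by simp
      also have "\<dots> = (\<integral>\<^sup>+w. indicator (A i) (\<omega> i * w) \<partial>lborel)"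
        by (intro nn_integral_cong) (simp add: indicator_def)
      also have "\<dots> = (\<integral>\<^sup>+w. indicator (A i) w \<partial>lborel)"
        by (rule nn_integral_rotate) (use A[OF i] \<omega> i in auto)
      also have "\<dots> = emeasure lborel (A i)" using A[OF i] by simp
      finally show "emeasure lborel ((\<lambda>w. \<omega> i * w) -` A i) = emeasure lborel (A i)" .
    qed
    finally show "emeasure (distr (Cn_lborel n) (Cn_lborel n) ?T) (PiE {..<n} A) = (\<Prod>i<n. emeasure lborel (A i))" .
  qed (auto simp: Cn_lborel_def)
  then show ?thesis by (simp add: Cn_lborel_def)
qed

lemma nn_integral_Cn_rotate:
  assumes "\<And>i. i < n \<Longrightarrow> cmod (\<omega> i) = 1" and "F \<in> borel_measurable (Cn_lborel n)"
  shows "(\<integral>\<^sup>+z. F (\<lambda>i\<in>{..<n}. \<omega> i * z i) \<partial>Cn_lborel n) = (\<integral>\<^sup>+z. F z \<partial>Cn_lborel n)"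
proof -
  have "(\<integral>\<^sup>+z. F z \<partial>Cn_lborel n) = (\<integral>\<^sup>+z. F z \<partial>distr (Cn_lborel n) (Cn_lborel n) (\<lambda>z. \<lambda>i\<in>{..<n}. \<omega> i * z i))"
    using distr_Cn_rotate[of n \<omega>] assms(1) by simp
  also have "\<dots> = (\<integral>\<^sup>+z. F (\<lambda>i\<in>{..<n}. \<omega> i * z i) \<partial>Cn_lborel n)"
    using assms(2) by (intro nn_integral_distr measurable_Cn_scale) simp
  finally show ?thesis by simp
qed

lemma lessThan_2: "{..<2::nat} = {0, 1}" by auto

lemma nn_integral_Cn2:
  assumes F[measurable]: "case_prod F \<in> borel_measurable (lborel \<Otimes>\<^sub>M lborel)"
  shows "(\<integral>\<^sup>+z. F (z 0) (z 1) \<partial>Cn_lborel 2) = (\<integral>\<^sup>+a. \<integral>\<^sup>+b. F a b \<partial>lborel \<partial>lborel)"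
proof -
  have "(\<integral>\<^sup>+z. F (z 0) (z 1) \<partial>Cn_lborel 2) = (\<integral>\<^sup>+q. F (fst q) (snd q) \<partial>(lborel \<Otimes>\<^sub>M lborel))"
    unfolding Cn_lborel_def lessThan_2 by (rule lborel_product.product_nn_integral_pair[OF F]) simp
  also have "\<dots> = (\<integral>\<^sup>+a. \<integral>\<^sup>+b. F a b \<partial>lborel \<partial>lborel)"
    using lborel.nn_integral_fst[OF F] by (simp add: case_prod_unfold)
  finally show ?thesis .
qed

lemma AE_Cn2_nonzero: "AE z in Cn_lborel 2. z 1 \<noteq> 0"
proof -
  define N where "N = PiE {..<2} (\<lambda>i::nat. if i = 1 then {0::complex} else UNIV)"
  have "emeasure (Cn_lborel 2) N = (\<Prod>i\<in>{..<2::nat}. emeasure lborel (if i = 1 then {0::complex} else UNIV))"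
    unfolding N_def Cn_lborel_def by (rule lborel_product.emeasure_PiM) auto
  also have "\<dots> = 0" by (simp add: lessThan_2)
  finally have "N \<in> null_sets (Cn_lborel 2)"
    unfolding N_def Cn_lborel_def by (intro null_setsI sets_PiM_I_finite) (auto simp: N_def Cn_lborel_def)
  then show ?thesis
    by (rule AE_I') (auto simp: N_def Cn_lborel_def space_PiM PiE_iff extensional_def)
qed

lemma emeasure_ball_complex: "r \<ge> 0 \<Longrightarrow> emeasure lborel (ball (0::complex) r) = ennreal (pi * r\<^sup>2)"
  and emeasure_cball_complex: "r \<ge> 0 \<Longrightarrow> emeasure lborel (cball (0::complex) r) = ennreal (pi * r\<^sup>2)"
  by (simp_all add: emeasure_ball emeasure_cball eval_unit_ball_vol)

lemma emeasure_annulus: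
  assumes "0 \<le> u" "u \<le> v"
  shows "emeasure lborel {b::complex. u < (cmod b)\<^sup>2 \<and> (cmod b)\<^sup>2 < v} = ennreal (pi * (v - u))"
proof -
  have e: "{b::complex. u < (cmod b)\<^sup>2 \<and> (cmod b)\<^sup>2 < v} = ball 0 (sqrt v) - cball 0 (sqrt u)"
  proof -
    have "u < (cmod b)\<^sup>2 \<longleftrightarrow> sqrt u < cmod b" "(cmod b)\<^sup>2 < v \<longleftrightarrow> cmod b < sqrt v" for b :: complex
      using real_sqrt_less_iff[of u "(cmod b)\<^sup>2"] real_sqrt_less_iff[of "(cmod b)\<^sup>2" v] by simp_all
    then show ?thesis by auto
  qed
  show ?thesis
  proof (cases "u = v")
    case True
    then have "{b::complex. u < (cmod b)\<^sup>2 \<and> (cmod b)\<^sup>2 < v} = {}" by auto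
    then show ?thesis using True by (simp only:) simp
  next
    case False
    then have "sqrt u < sqrt v" using assms by simp
    then have "cball (0::complex) (sqrt u) \<subseteq> ball 0 (sqrt v)"
      by (intro subsetI) (simp only: mem_cball mem_ball)
    then have "emeasure lborel (ball (0::complex) (sqrt v) - cball 0 (sqrt u))
        = emeasure lborel (ball (0::complex) (sqrt v)) - emeasure lborel (cball (0::complex) (sqrt u))"
      by (intro emeasure_Diff) (auto simp: emeasure_cball_complex assms)
    also have "\<dots> = ennreal (pi * v - pi * u)"
      using assms by (subst ennreal_minus[symmetric]) (simp_all add: emeasure_cball_complex emeasure_ball_complex)
    finally show ?thesis unfolding e by (simp add: right_diff_distrib)
  qed
qed

section \<open>An unbounded Reinhardt domain\<close>

text \<open>The domain clings to \<open>\<bar>z 0\<bar> = \<bar>z 1\<bar>\<close>: over \<open>z 0\<close> lies a ring of area comparable to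
  \<open>(1 + \<bar>z 0\<bar>\<^sup>2)\<^sup>-\<^sup>3\<close>, so that a monomial of total degree \<open>k\<close> is square integrable exactly if \<open>k \<le> 1\<close>. It
  is invariant under contractions \<open>z \<mapsto> t z\<close>.\<close>

definition ring_height :: "complex \<Rightarrow> complex \<Rightarrow> real" where
  "ring_height a b = \<bar>(cmod b)\<^sup>2 - (cmod a)\<^sup>2\<bar> * (1 + (cmod a)\<^sup>2) ^ 3"

definition thin_reinhardt :: "(nat \<Rightarrow> complex) set" where
  "thin_reinhardt = {z \<in> PiE {..<2} (\<lambda>_. UNIV). ring_height (z 0) (z 1) < 1}"

lemma ring_height_contract:
  assumes "cmod t \<le> 1"
  shows "ring_height (t * a) (t * b) \<le> ring_height a b"
proof -
  have t: "(cmod t)\<^sup>2 \<le> 1" using assms by (simp add: power_le_one)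
  have "\<bar>(cmod (t * b))\<^sup>2 - (cmod (t * a))\<^sup>2\<bar> = (cmod t)\<^sup>2 * \<bar>(cmod b)\<^sup>2 - (cmod a)\<^sup>2\<bar>"
    by (simp add: norm_mult power_mult_distrib right_diff_distrib[symmetric] abs_mult)
  also have "\<dots> \<le> 1 * \<bar>(cmod b)\<^sup>2 - (cmod a)\<^sup>2\<bar>" using t by (intro mult_right_mono) auto
  finally have 1: "\<bar>(cmod (t * b))\<^sup>2 - (cmod (t * a))\<^sup>2\<bar> \<le> \<bar>(cmod b)\<^sup>2 - (cmod a)\<^sup>2\<bar>" by simp
  have "(cmod (t * a))\<^sup>2 \<le> 1 * (cmod a)\<^sup>2"
    unfolding norm_mult power_mult_distrib using t by (intro mult_right_mono) auto
  then have "(1 + (cmod (t * a))\<^sup>2) ^ 3 \<le> (1 + (cmod a)\<^sup>2) ^ 3" by (intro power_mono) auto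
  with 1 show ?thesis unfolding ring_height_def by (intro mult_mono) auto
qed

lemma ring_height_rotate:
  "cmod s = 1 \<Longrightarrow> cmod t = 1 \<Longrightarrow> ring_height (s * a) (t * b) = ring_height a b"
  by (simp add: ring_height_def norm_mult)

lemma continuous_map_Cn2:
  assumes "continuous_on UNIV \<Phi>"
  shows "continuous_map (Cn_top 2) euclidean (\<lambda>z. \<Phi> (z 0, z 1))"
proof -
  have c: "continuous_map (Cn_top 2) euclidean (\<lambda>z. z i)" if "i < 2" for i
    unfolding Cn_top_def by (rule continuous_map_product_projection) (use that in auto)
  have "continuous_map (Cn_top 2) euclidean (\<lambda>z. (z 0, z 1))"
    using continuous_map_pairedI[OF c[of 0] c[of 1]] by simp
  from continuous_map_compose[OF this, of euclidean \<Phi>] show ?thesis using assms by (simp add: o_def)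
qed

lemma openin_Cn2_less:
  fixes \<Phi> :: "complex \<times> complex \<Rightarrow> real"
  assumes "continuous_on UNIV \<Phi>"
  shows "openin (Cn_top 2) {z \<in> PiE {..<2} (\<lambda>_. UNIV). \<Phi> (z 0, z 1) < 1}"
proof -
  have "openin (Cn_top 2) {z \<in> topspace (Cn_top 2). \<Phi> (z 0, z 1) \<in> {..<1}}"
    by (rule openin_continuous_map_preimage[OF continuous_map_Cn2[OF assms]]) (simp add: open_openin[symmetric])
  then show ?thesis by (simp add: Cn_top_def)
qed

lemma continuous_ring_height: "continuous_on UNIV (\<lambda>q. ring_height (\<phi> q) (\<psi> q))"
  if "continuous_on UNIV \<phi>" "continuous_on UNIV \<psi>"
  unfolding ring_height_def using that by (intro continuous_intros)

lemma open_thin: "openin (Cn_top 2) thin_reinhardt"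
  unfolding thin_reinhardt_def
  using openin_Cn2_less[of "\<lambda>q. ring_height (fst q) (snd q)"] continuous_ring_height[of fst snd]
  by (simp add: continuous_on_fst continuous_on_snd continuous_on_id)

definition cscale :: "complex \<Rightarrow> (nat \<Rightarrow> complex) \<Rightarrow> nat \<Rightarrow> complex" where
  "cscale t z = (\<lambda>i\<in>{..<2}. t * z i)"

lemma cscale_apply: "i < 2 \<Longrightarrow> cscale t z i = t * z i"
  by (simp add: cscale_def)

lemma cscale_apply01 [simp]: "cscale t z 0 = t * z 0" "cscale t z (Suc 0) = t * z (Suc 0)"
  by (simp_all add: cscale_def)

lemma thin_mem: "z \<in> thin_reinhardt \<longleftrightarrow> z \<in> extensional {..<2} \<and> ring_height (z 0) (z 1) < 1"
  by (auto simp: thin_reinhardt_def PiE_iff)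

lemma cscale_ext: "cscale t z \<in> extensional {..<2}" by (simp add: cscale_def)

lemma thin_contract: "z \<in> thin_reinhardt \<Longrightarrow> cmod t \<le> 1 \<Longrightarrow> cscale t z \<in> thin_reinhardt"
  using ring_height_contract[of t "z 0" "z 1"] by (auto simp: thin_mem cscale_ext)

lemma thin_rotate:
  assumes "cmod (\<omega> 0) = 1" "cmod (\<omega> 1) = 1"
  shows "(\<lambda>i\<in>{..<2}. \<omega> i * z i) \<in> thin_reinhardt \<longleftrightarrow> restrict z {..<2} \<in> thin_reinhardt"
  using ring_height_rotate[OF assms, of "z 0" "z 1"] by (auto simp: thin_mem)

text \<open>Star-shaped about the origin, by \<open>thin_contract\<close>.\<close>

lemma thin_connected: "connectedin (Cn_top 2) thin_reinhardt"
proof -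
  have seg: "connectedin (Cn_top 2) ((\<lambda>t. cscale (of_real t) z) ` {0..1})" for z
  proof (rule connectedin_continuous_map_image)
    show "continuous_map euclideanreal (Cn_top 2) (\<lambda>t. cscale (of_real t) z)"
      unfolding Cn_top_def continuous_map_componentwise
      by (auto simp: cscale_def intro!: continuous_intros)
  qed (simp add: convex_connected)
  have "thin_reinhardt = (\<Union>z\<in>thin_reinhardt. (\<lambda>t. cscale (of_real t) z) ` {0..1})"
  proof (intro equalityI subsetI)
    fix z assume z: "z \<in> thin_reinhardt"
    then have "cscale (of_real 1) z = z" by (auto simp: cscale_def thin_mem extensional_def fun_eq_iff)
    then have "z \<in> (\<lambda>t. cscale (of_real t) z) ` {0..1}" by (metis atLeastAtMost_iff imageI order_refl zero_le_one)
    then show "z \<in> (\<Union>z\<in>thin_reinhardt. (\<lambda>t. cscale (of_real t) z) ` {0..1})" using z by blast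
  qed (auto intro!: thin_contract)
  moreover have "connectedin (Cn_top 2) (\<Union>z\<in>thin_reinhardt. (\<lambda>t. cscale (of_real t) z) ` {0..1})"
  proof (rule connectedin_Union)
    have "cscale 0 (\<lambda>_. 0) \<in> (\<lambda>t. cscale (of_real t) z) ` {0..1}" for z
      by (rule image_eqI[of _ _ 0]) (auto simp: cscale_def)
    then show "\<Inter> ((\<lambda>z. (\<lambda>t. cscale (of_real t) z) ` {0..1}) ` thin_reinhardt) \<noteq> {}" by blast
  qed (use seg in auto)
  ultimately show ?thesis by simp
qed

lemma zero_thin: "cscale 0 z \<in> thin_reinhardt"
  by (simp add: thin_mem cscale_ext ring_height_def)

lemma thin_reinhardt_domain: "reinhardt_domain 2 thin_reinhardt"
  unfolding reinhardt_domain_def Cn_domain_def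
proof (intro conjI ballI allI)
  show "thin_reinhardt \<noteq> {}" using zero_thin by blast
  fix z and \<theta> :: "nat \<Rightarrow> real" assume z: "z \<in> thin_reinhardt"
  then have "restrict z {..<2} = z" by (auto simp: thin_mem extensional_restrict)
  then show "(\<lambda>i\<in>{..<2}. cis (\<theta> i) * z i) \<in> thin_reinhardt"
    using z thin_rotate[of "\<lambda>i. cis (\<theta> i)" z] by simp
qed (simp_all add: open_thin thin_connected)

lemma thin_unbounded: "\<not> Cn_bounded 2 thin_reinhardt"
proof
  assume "Cn_bounded 2 thin_reinhardt"
  then obtain b where b: "\<And>z i. z \<in> thin_reinhardt \<Longrightarrow> i < 2 \<Longrightarrow> cmod (z i) < b" "b > 0"
    using Cn_bounded_component by metis
  \<comment> \<open>the diagonal lies in the domain\<close>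
  have "cscale (of_real b) (\<lambda>_. 1) \<in> thin_reinhardt"
    by (simp add: thin_mem cscale_ext ring_height_def)
  from b(1)[OF this, of 0] b(2) show False by simp
qed

text \<open>Square integrability of affine functions: the rings have area at most
  \<open>2 pi (1 + \<bar>a\<bar>\<^sup>2)\<^sup>-\<^sup>3\<close>, and \<open>(1 + \<bar>a\<bar>\<^sup>2)\<^sup>-\<^sup>2\<close> is dominated by a product of two Cauchy densities, which is integrable.\<close>

lemma ring_eq: "ring_height a b < 1 \<longleftrightarrow> \<bar>(cmod b)\<^sup>2 - (cmod a)\<^sup>2\<bar> < 1 / (1 + (cmod a)\<^sup>2) ^ 3"
proof -
  have "(1 + (cmod a)\<^sup>2) ^ 3 > 0" by (intro zero_less_power add_pos_nonneg) auto
  then show ?thesis unfolding ring_height_def by (simp add: pos_less_divide_eq)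
qed

lemma ring_sets: "{b. ring_height a b < 1} \<in> sets lborel"
proof -
  have "open {b. ring_height a b < 1}"
    using continuous_ring_height[of "\<lambda>_. a" "\<lambda>b. b"] by (intro open_Collect_less) (auto intro: continuous_intros)
  then show ?thesis by simp
qed

lemma ring_area_le: "emeasure lborel {b. ring_height a b < 1} \<le> ennreal (2 * pi / (1 + (cmod a)\<^sup>2) ^ 3)"
proof -
  define p d where "p = (cmod a)\<^sup>2" and "d = 1 / (1 + p) ^ 3"
  have p: "p \<ge> 0" by (simp add: p_def)
  have d: "d > 0" unfolding d_def p_def by (intro divide_pos_pos zero_less_power add_pos_nonneg) auto
  show ?thesis
  proof (cases "p < d")
    case True
    have "{b. ring_height a b < 1} \<subseteq> ball 0 (sqrt (p + d))"
      unfolding ring_eq by (auto simp: p_def[symmetric] d_def[symmetric] intro!: real_less_rsqrt)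
    then have "emeasure lborel {b. ring_height a b < 1} \<le> emeasure lborel (ball (0::complex) (sqrt (p + d)))"
      by (rule emeasure_mono) simp
    also have "\<dots> = ennreal (pi * (p + d))" using p d by (simp add: emeasure_ball_complex)
    also have "\<dots> \<le> ennreal (2 * pi * d)" using True by (intro ennreal_leI) (simp add: distrib_left)
    finally show ?thesis by (simp add: d_def p_def)
  next
    case False
    have "{b. ring_height a b < 1} = {b. p - d < (cmod b)\<^sup>2 \<and> (cmod b)\<^sup>2 < p + d}"
      unfolding ring_eq by (auto simp: p_def[symmetric] d_def[symmetric])
    then show ?thesis using False d emeasure_annulus[of "p - d" "p + d"] by (simp add: d_def p_def mult_ac)
  qed
qed

lemma ring_area_eq:
  assumes "cmod a \<ge> 1"
  shows "emeasure lborel {b. ring_height a b < 1} = ennreal (2 * pi / (1 + (cmod a)\<^sup>2) ^ 3)"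
proof -
  define p d where "p = (cmod a)\<^sup>2" and "d = 1 / (1 + p) ^ 3"
  have p: "p \<ge> 1" using assms by (simp add: p_def)
  have d: "d > 0" unfolding d_def p_def by (intro divide_pos_pos zero_less_power add_pos_nonneg) auto
  have "(1 + p) ^ 3 \<ge> 1" using p by (intro one_le_power) simp
  then have d1: "d \<le> 1" unfolding d_def using frac_le[of 1 1 1 "(1 + p) ^ 3"] by simp
  have "{b. ring_height a b < 1} = {b. p - d < (cmod b)\<^sup>2 \<and> (cmod b)\<^sup>2 < p + d}"
    unfolding ring_eq by (auto simp: p_def[symmetric] d_def[symmetric])
  moreover have "0 \<le> p - d" using p d1 by simp
  ultimately show ?thesis using d emeasure_annulus[of "p - d" "p + d"] by (simp add: d_def p_def mult_ac)
qed

lemma ring_measurable: "{q. ring_height (fst q) (snd q) < 1} \<in> sets (lborel \<Otimes>\<^sub>M lborel)"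
proof -
  have "open {q :: complex \<times> complex. ring_height (fst q) (snd q) < 1}"
    by (intro open_Collect_less continuous_ring_height continuous_intros)
  then have "{q :: complex \<times> complex. ring_height (fst q) (snd q) < 1} \<in> sets lborel" by simp
  then show ?thesis unfolding lborel_prod .
qed

lemma nn_integral_inverse_square_finite: "(\<integral>\<^sup>+x. ennreal (inverse (1 + x\<^sup>2)) \<partial>lborel) < \<infinity>"
proof -
  have "integrable lborel (\<lambda>x::real. inverse (1 + x\<^sup>2))"
    using integrable_inverse_1_plus_square by (simp add: set_integrable_def einterval_def)
  then show ?thesis unfolding integrable_iff_bounded by simp
qed

lemma nn_integral_plane_finite: "(\<integral>\<^sup>+a. ennreal (1 / (1 + (cmod a)\<^sup>2)\<^sup>2) \<partial>lborel) < \<infinity>"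
proof -
  have "(\<integral>\<^sup>+a. ennreal (1 / (1 + (cmod a)\<^sup>2)\<^sup>2) \<partial>lborel)
      = (\<integral>\<^sup>+x. \<integral>\<^sup>+y. ennreal (1 / (1 + (cmod (Complex x y))\<^sup>2)\<^sup>2) \<partial>lborel \<partial>lborel)"
    by (rule nn_integral_complex(1)) measurable
  also have "\<dots> \<le> (\<integral>\<^sup>+x. \<integral>\<^sup>+y. ennreal (inverse (1 + x\<^sup>2)) * ennreal (inverse (1 + y\<^sup>2)) \<partial>lborel \<partial>lborel)"
  proof (intro nn_integral_mono)
    fix x y :: real
    have "(1 + x\<^sup>2) * (1 + y\<^sup>2) \<le> (1 + (x\<^sup>2 + y\<^sup>2)) * (1 + (x\<^sup>2 + y\<^sup>2))"
      by (intro mult_mono) auto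
    then have "1 / (1 + (x\<^sup>2 + y\<^sup>2))\<^sup>2 \<le> 1 / ((1 + x\<^sup>2) * (1 + y\<^sup>2))"
      unfolding power2_eq_square[of "1 + (x\<^sup>2 + y\<^sup>2)"]
      by (intro divide_left_mono) (auto intro!: mult_pos_pos add_pos_nonneg)
    then show "ennreal (1 / (1 + (cmod (Complex x y))\<^sup>2)\<^sup>2) \<le> ennreal (inverse (1 + x\<^sup>2)) * ennreal (inverse (1 + y\<^sup>2))"
      by (subst ennreal_mult[symmetric]) (auto simp: cmod_power2 divide_inverse intro!: ennreal_leI)
  qed
  also have "\<dots> = (\<integral>\<^sup>+x. ennreal (inverse (1 + x\<^sup>2)) * (\<integral>\<^sup>+y. ennreal (inverse (1 + y\<^sup>2)) \<partial>lborel) \<partial>lborel)"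
    by (intro nn_integral_cong nn_integral_cmult) measurable
  also have "\<dots> = (\<integral>\<^sup>+x. ennreal (inverse (1 + x\<^sup>2)) \<partial>lborel) * (\<integral>\<^sup>+y. ennreal (inverse (1 + y\<^sup>2)) \<partial>lborel)"
    by (rule nn_integral_multc) measurable
  also have "\<dots> < \<infinity>" using nn_integral_inverse_square_finite by (simp add: ennreal_mult_less_top)
  finally show ?thesis .
qed

interpretation thin: bergman 2 thin_reinhardt
  by unfold_locales (rule open_thin)

lemma affine_square_integrable:
  assumes f: "Cn_holomorphic_on 2 f thin_reinhardt"
    and bd: "\<And>z. z \<in> thin_reinhardt \<Longrightarrow> (cmod (f z))\<^sup>2 \<le> 1 + (cmod (z 0))\<^sup>2"
  shows "f \<in> bergman_space 2 thin_reinhardt"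
proof -
  define F where "F a b = ennreal (1 + (cmod a)\<^sup>2) * indicator {b. ring_height a b < 1} b" for a b
  have Fm: "case_prod F \<in> borel_measurable (lborel \<Otimes>\<^sub>M lborel)"
  proof -
    have "case_prod F = (\<lambda>q. ennreal (1 + (cmod (fst q))\<^sup>2) * indicator {q. ring_height (fst q) (snd q) < 1} q)"
      by (auto simp: F_def fun_eq_iff indicator_def)
    moreover have "(\<lambda>q. ennreal (1 + (cmod (fst q))\<^sup>2) * indicator {q. ring_height (fst q) (snd q) < 1} q)
        \<in> borel_measurable (lborel \<Otimes>\<^sub>M lborel)"
      by (intro borel_measurable_times_ennreal borel_measurable_indicator ring_measurable) measurable
    ultimately show ?thesis by simp
  qed
  have "thin.I f \<le> (\<integral>\<^sup>+z. F (z 0) (z 1) \<partial>Cn_lborel 2)"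
    unfolding thin.I_def
  proof (rule nn_integral_mono)
    fix z
    show "ennreal ((cmod (f z))\<^sup>2) * indicator thin_reinhardt z \<le> F (z 0) (z 1)"
    proof (cases "z \<in> thin_reinhardt")
      case True
      then have "ring_height (z 0) (z 1) < 1" by (simp add: thin_mem)
      moreover have "ennreal ((cmod (f z))\<^sup>2) \<le> ennreal (1 + (cmod (z 0))\<^sup>2)" by (rule ennreal_leI[OF bd[OF True]])
      ultimately show ?thesis using True by (simp add: F_def)
    qed simp
  qed
  also have "\<dots> = (\<integral>\<^sup>+a. \<integral>\<^sup>+b. F a b \<partial>lborel \<partial>lborel)" by (rule nn_integral_Cn2[OF Fm])
  also have "\<dots> \<le> (\<integral>\<^sup>+a. ennreal (2 * pi) * ennreal (1 / (1 + (cmod a)\<^sup>2)\<^sup>2) \<partial>lborel)"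
  proof (rule nn_integral_mono)
    fix a :: complex
    have pos: "1 + (cmod a)\<^sup>2 > 0" by (simp add: add_pos_nonneg)
    have "(\<integral>\<^sup>+b. F a b \<partial>lborel) = ennreal (1 + (cmod a)\<^sup>2) * emeasure lborel {b. ring_height a b < 1}"
      unfolding F_def by (rule nn_integral_cmult_indicator[OF ring_sets])
    also have "\<dots> \<le> ennreal (1 + (cmod a)\<^sup>2) * ennreal (2 * pi / (1 + (cmod a)\<^sup>2) ^ 3)"
      by (intro mult_left_mono ring_area_le) simp
    also have "\<dots> = ennreal (2 * pi) * ennreal (1 / (1 + (cmod a)\<^sup>2)\<^sup>2)"
    proof -
      have "x * (2 * pi / x ^ 3) = 2 * pi * (1 / x\<^sup>2)" if "x > 0" for x :: real
        using that by (simp add: power2_eq_square power3_eq_cube)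
      from this[OF pos] show ?thesis using pos
        by (subst (1 2) ennreal_mult[symmetric]) (auto simp: less_imp_le)
    qed
    finally show "(\<integral>\<^sup>+b. F a b \<partial>lborel) \<le> ennreal (2 * pi) * ennreal (1 / (1 + (cmod a)\<^sup>2)\<^sup>2)" .
  qed
  also have "\<dots> = ennreal (2 * pi) * (\<integral>\<^sup>+a. ennreal (1 / (1 + (cmod a)\<^sup>2)\<^sup>2) \<partial>lborel)"
    by (rule nn_integral_cmult) measurable
  also have "\<dots> < \<infinity>" using nn_integral_plane_finite by (simp add: ennreal_mult_less_top)
  finally show ?thesis using f by (simp add: thin.A2_iff)
qed

lemma one_in_A2: "(\<lambda>_. 1) \<in> bergman_space 2 thin_reinhardt"
  by (rule affine_square_integrable[OF thin.hol_const]) simp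

lemma coord_in_A2:
  assumes i: "i < 2"
  shows "(\<lambda>z. z i) \<in> bergman_space 2 thin_reinhardt"
proof (rule affine_square_integrable[OF thin.hol_coord[OF i]])
  fix z assume "z \<in> thin_reinhardt"
  then have "\<bar>(cmod (z 1))\<^sup>2 - (cmod (z 0))\<^sup>2\<bar> < 1 / (1 + (cmod (z 0))\<^sup>2) ^ 3"
    by (simp add: thin_mem ring_eq)
  also have "\<dots> \<le> 1"
  proof -
    have "(1 + (cmod (z 0))\<^sup>2) ^ 3 \<ge> 1" by (intro one_le_power) simp
    then show ?thesis using frac_le[of 1 1 1 "(1 + (cmod (z 0))\<^sup>2) ^ 3"] by simp
  qed
  finally have "(cmod (z 1))\<^sup>2 \<le> 1 + (cmod (z 0))\<^sup>2" by linarith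
  moreover have "i = 0 \<or> i = 1" using i by auto
  ultimately show "(cmod (z i))\<^sup>2 \<le> 1 + (cmod (z 0))\<^sup>2" by auto
qed

section \<open>Monomials that are not square integrable\<close>

text \<open>Each of the shells \<open>2\<^sup>l\<^sup>+\<^sup>1 \<le> \<bar>a\<bar> < 2\<^sup>l\<^sup>+\<^sup>2\<close> contributes at least the same amount.\<close>

lemma nn_integral_inverse_square_infinite:
  assumes \<kappa>: "\<kappa> > 0"
  shows "(\<integral>\<^sup>+a. ennreal (\<kappa> / (cmod a)\<^sup>2) * indicator {a. 2 \<le> cmod a} a \<partial>lborel) = \<infinity>"
proof -
  define S where "S l = {a::complex. 2 ^ Suc l \<le> cmod a \<and> cmod a < 2 ^ Suc (Suc l)}" for l
  have Sm: "S l \<in> sets lborel" for l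
  proof -
    have "S l = ball 0 (2 ^ Suc (Suc l)) - ball 0 (2 ^ Suc l)" by (auto simp: S_def)
    then show ?thesis by simp
  qed
  have S_area: "emeasure lborel (S l) = ennreal (12 * pi * 4 ^ l)" for l
  proof -
    have e: "S l = ball 0 (2 ^ Suc (Suc l)) - ball 0 (2 ^ Suc l)" by (auto simp: S_def)
    have p: "(2::real) ^ l * 2 ^ l = 4 ^ l" by (simp add: power_mult_distrib[symmetric])
    have "(2::real) ^ Suc l \<le> 2 ^ Suc (Suc l)" by simp
    then have "ball (0::complex) (2 ^ Suc l) \<subseteq> ball 0 (2 ^ Suc (Suc l))" by (rule subset_ball)
    then have "emeasure lborel (S l) = emeasure lborel (ball (0::complex) (2 ^ Suc (Suc l))) - emeasure lborel (ball (0::complex) (2 ^ Suc l))"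
      unfolding e by (intro emeasure_Diff) (auto simp: emeasure_ball_complex)
    also have "\<dots> = ennreal (pi * (2 ^ Suc (Suc l))\<^sup>2 - pi * (2 ^ Suc l)\<^sup>2)"
      by (simp add: emeasure_ball_complex ennreal_minus del: power_Suc)
    also have "pi * (2 ^ Suc (Suc l))\<^sup>2 - pi * (2 ^ Suc l)\<^sup>2 = 12 * pi * 4 ^ l"
      using p by (simp add: power2_eq_square algebra_simps)
    finally show ?thesis .
  qed
  define J where "J = (\<integral>\<^sup>+a. ennreal (\<kappa> / (cmod a)\<^sup>2) * indicator {a. 2 \<le> cmod a} a \<partial>lborel)"
  have low: "ennreal (real N * (3 / 4 * pi * \<kappa>)) \<le> J" for N
  proof -
    have pw: "(\<Sum>l<N. ennreal (\<kappa> / (16 * 4 ^ l)) * indicator (S l) a)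
        \<le> ennreal (\<kappa> / (cmod a)\<^sup>2) * indicator {a. 2 \<le> cmod a} a" for a
    proof (cases "\<exists>l<N. a \<in> S l")
      case False
      then have "(\<Sum>l<N. ennreal (\<kappa> / (16 * 4 ^ l)) * indicator (S l) a) = 0"
        by (intro sum.neutral) auto
      then show ?thesis by simp
    next
      case True
      then obtain l where l: "l < N" "a \<in> S l" by blast
      have uniq: "l' = l" if "a \<in> S l'" for l'
      proof (rule ccontr)
        assume "l' \<noteq> l"
        then consider "l' < l" | "l < l'" by linarith
        then show False
        proof cases
          case 1
          then have "(2::real) ^ Suc (Suc l') \<le> 2 ^ Suc l" by (intro power_increasing) auto
          then show False using that l by (auto simp: S_def)
        next
          case 2
          then have "(2::real) ^ Suc (Suc l) \<le> 2 ^ Suc l'" by (intro power_increasing) auto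
          then show False using that l by (auto simp: S_def)
        qed
      qed
      have "(\<Sum>l'<N. ennreal (\<kappa> / (16 * 4 ^ l')) * indicator (S l') a)
          = (\<Sum>l'<N. if l' = l then ennreal (\<kappa> / (16 * 4 ^ l)) else 0)"
      proof (rule sum.cong[OF refl])
        fix l'
        show "ennreal (\<kappa> / (16 * 4 ^ l')) * indicator (S l') a = (if l' = l then ennreal (\<kappa> / (16 * 4 ^ l)) else 0)"
        proof (cases "l' = l")
          case False
          then have "a \<notin> S l'" using uniq by blast
          then show ?thesis using False by simp
        qed (use l in simp)
      qed
      also have "\<dots> = ennreal (\<kappa> / (16 * 4 ^ l))" using l by simp
      also have "\<dots> \<le> ennreal (\<kappa> / (cmod a)\<^sup>2)"
      proof (rule ennreal_leI)
        have "0 < (2::real) ^ Suc l" by (rule zero_less_power) simp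
        moreover have "2 ^ Suc l \<le> cmod a" and less: "cmod a < 2 ^ Suc (Suc l)" using l(2) unfolding S_def by blast+
        ultimately have "0 < cmod a" by linarith
        have "(cmod a)\<^sup>2 \<le> (2 ^ Suc (Suc l))\<^sup>2" using less by (intro power_mono) (auto simp del: power_Suc)
        also have "(2 ^ Suc (Suc l))\<^sup>2 = (16 * 4 ^ l :: real)"
        proof -
          have "(2::real) ^ l * 2 ^ l = 4 ^ l" by (simp add: power_mult_distrib[symmetric])
          then show ?thesis by (simp add: power2_eq_square)
        qed
        finally show "\<kappa> / (16 * 4 ^ l) \<le> \<kappa> / (cmod a)\<^sup>2"
          using \<kappa> \<open>0 < cmod a\<close> by (intro divide_left_mono) auto
      qed
      also have "\<dots> = ennreal (\<kappa> / (cmod a)\<^sup>2) * indicator {a. 2 \<le> cmod a} a"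
      proof -
        have "1 \<le> (2::real) ^ l" by (rule one_le_power) simp
        moreover have "2 * 2 ^ l \<le> cmod a" using l(2) by (simp add: S_def)
        ultimately have "2 \<le> cmod a" by linarith
        then show ?thesis by simp
      qed
      finally show ?thesis .
    qed
    have "ennreal (real N * (3 / 4 * pi * \<kappa>)) = (\<Sum>l<N. ennreal (\<kappa> / (16 * 4 ^ l)) * emeasure lborel (S l))"
    proof -
      have "ennreal (\<kappa> / (16 * 4 ^ l)) * emeasure lborel (S l) = ennreal (3 / 4 * pi * \<kappa>)" for l
        unfolding S_area using \<kappa> by (simp add: ennreal_mult[symmetric])
      then have "(\<Sum>l<N. ennreal (\<kappa> / (16 * 4 ^ l)) * emeasure lborel (S l)) = of_nat N * ennreal (3 / 4 * pi * \<kappa>)"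
        by (simp only: sum_constant card_lessThan)
      also have "\<dots> = ennreal (real N) * ennreal (3 / 4 * pi * \<kappa>)" by (simp only: ennreal_of_nat_eq_real_of_nat)
      also have "\<dots> = ennreal (real N * (3 / 4 * pi * \<kappa>))" using \<kappa> by (intro ennreal_mult[symmetric]) auto
      finally show ?thesis by simp
    qed
    also have "\<dots> = (\<integral>\<^sup>+a. (\<Sum>l<N. ennreal (\<kappa> / (16 * 4 ^ l)) * indicator (S l) a) \<partial>lborel)"
      using Sm by (subst nn_integral_sum) (auto simp: nn_integral_cmult_indicator)
    also have "\<dots> \<le> J" unfolding J_def by (intro nn_integral_mono pw)
    finally show ?thesis .
  qed
  have "J = \<infinity>"
  proof (rule ccontr)
    assume "J \<noteq> \<infinity>"
    then obtain j where j: "J = ennreal j" "j \<ge> 0" by (cases J) auto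
    obtain N :: nat where N: "j < real N * (3 / 4 * pi * \<kappa>)"
      using reals_Archimedean3[of "3 / 4 * pi * \<kappa>"] \<kappa> by auto
    have "ennreal (real N * (3 / 4 * pi * \<kappa>)) \<le> ennreal j" using low[of N] j by simp
    then show False using N j(2) by (simp add: ennreal_le_iff)
  qed
  then show ?thesis by (simp add: J_def)
qed

text \<open>Far out, \<open>\<bar>z 0\<bar>\<close> and \<open>\<bar>z 1\<bar>\<close> differ by a bounded factor, so the square of the monomial is at least of order
  \<open>\<bar>z 0\<bar>\<^sup>4\<close>, whereas the ring over \<open>z 0\<close> has area of order \<open>\<bar>z 0\<bar>\<^sup>-\<^sup>6\<close>.\<close>

lemma monomial_not_square_integrable:
  assumes c: "c \<noteq> 0" and m: "m \<ge> 2"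
  shows "(\<integral>\<^sup>+z. ennreal ((cmod (indicator thin_reinhardt z * (z 1 ^ m * (c * (z 0 / z 1) ^ j))))\<^sup>2) \<partial>Cn_lborel 2) = \<infinity>"
proof -
  define \<kappa> where "\<kappa> = (cmod c)\<^sup>2 / 4 * (1/2) ^ j"
  have \<kappa>: "\<kappa> > 0" using c by (simp add: \<kappa>_def)
  define F where "F a b = ennreal (\<kappa> * (cmod a) ^ 4) * indicator {q. ring_height (fst q) (snd q) < 1 \<and> 2 \<le> cmod (fst q)} (a, b)" for a b
  have Fm: "case_prod F \<in> borel_measurable (lborel \<Otimes>\<^sub>M lborel)"
  proof -
    have "closed {q :: complex \<times> complex. 2 \<le> cmod (fst q)}"
      by (intro closed_Collect_le continuous_intros)
    then have "{q :: complex \<times> complex. 2 \<le> cmod (fst q)} \<in> sets lborel" by simp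
    then have "{q :: complex \<times> complex. ring_height (fst q) (snd q) < 1} \<inter> {q. 2 \<le> cmod (fst q)} \<in> sets (lborel \<Otimes>\<^sub>M lborel)"
      using ring_measurable unfolding lborel_prod by (intro sets.Int)
    moreover have "{q :: complex \<times> complex. ring_height (fst q) (snd q) < 1} \<inter> {q. 2 \<le> cmod (fst q)}
        = {q. ring_height (fst q) (snd q) < 1 \<and> 2 \<le> cmod (fst q)}" by blast
    ultimately have S: "{q :: complex \<times> complex. ring_height (fst q) (snd q) < 1 \<and> 2 \<le> cmod (fst q)} \<in> sets (lborel \<Otimes>\<^sub>M lborel)"
      by simp
    have "case_prod F = (\<lambda>q. ennreal (\<kappa> * (cmod (fst q)) ^ 4) * indicator {q. ring_height (fst q) (snd q) < 1 \<and> 2 \<le> cmod (fst q)} q)"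
      by (auto simp: F_def fun_eq_iff)
    moreover have "\<dots> \<in> borel_measurable (lborel \<Otimes>\<^sub>M lborel)"
      by (intro borel_measurable_times_ennreal borel_measurable_indicator S) measurable
    ultimately show ?thesis by simp
  qed
  have low: "F (z 0) (z 1) \<le> ennreal ((cmod (indicator thin_reinhardt z * (z 1 ^ m * (c * (z 0 / z 1) ^ j))))\<^sup>2)"
    if "z \<in> space (Cn_lborel 2)" for z
  proof (cases "ring_height (z 0) (z 1) < 1 \<and> 2 \<le> cmod (z 0)")
    case True
    define p q where "p = (cmod (z 0))\<^sup>2" and "q = (cmod (z 1))\<^sup>2"
    have z: "z \<in> thin_reinhardt" using that True by (simp add: thin_mem Cn_lborel_def space_PiM PiE_iff)
    have "2\<^sup>2 \<le> (cmod (z 0))\<^sup>2" using True by (intro power_mono) auto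
    then have p: "p \<ge> 4" by (simp add: p_def)
    have "(1 + p) ^ 3 \<ge> 1" using p by (intro one_le_power) simp
    then have "1 / (1 + p) ^ 3 \<le> 1" using frac_le[of 1 1 1 "(1 + p) ^ 3"] by simp
    moreover have "\<bar>q - p\<bar> < 1 / (1 + p) ^ 3" using True by (simp add: ring_eq p_def q_def)
    ultimately have qp: "q > p - 1" "q < p + 1" by auto
    \<comment> \<open>\<open>q\<close> is within \<open>1\<close> of \<open>p \<ge> 4\<close>\<close>
    have q1: "q \<ge> 1" "q \<ge> p / 2" using qp p by auto
    have "(cmod (z 1 ^ m * (c * (z 0 / z 1) ^ j)))\<^sup>2 = q ^ m * ((cmod c)\<^sup>2 * (p / q) ^ j)"
      by (simp add: p_def q_def norm_mult norm_power norm_divide power_mult_distrib power_divide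
          flip: power_mult) (simp add: mult.commute)
    moreover have "q ^ m \<ge> (p / 2)\<^sup>2"
    proof -
      have "(p / 2)\<^sup>2 \<le> q\<^sup>2" using q1 p by (intro power_mono) auto
      also have "\<dots> \<le> q ^ m" using m q1 by (intro power_increasing) auto
      finally show ?thesis .
    qed
    moreover have "(p / q) ^ j \<ge> (1/2) ^ j"
      using qp p q1 by (intro power_mono) (auto simp: field_simps)
    ultimately have "(cmod (z 1 ^ m * (c * (z 0 / z 1) ^ j)))\<^sup>2 \<ge> (p / 2)\<^sup>2 * ((cmod c)\<^sup>2 * (1/2) ^ j)"
      using q1 by (simp only:) (intro mult_mono, auto)
    moreover have "(p / 2)\<^sup>2 * ((cmod c)\<^sup>2 * (1/2) ^ j) = \<kappa> * (cmod (z 0)) ^ 4"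
      by (simp add: \<kappa>_def p_def power_divide power_mult[symmetric])
    ultimately show ?thesis using True z by (simp add: F_def ennreal_leI)
  qed (simp add: F_def)
  have "\<infinity> = (\<integral>\<^sup>+a. ennreal (\<kappa> * pi / 4 / (cmod a)\<^sup>2) * indicator {a. 2 \<le> cmod a} a \<partial>lborel)"
    by (rule nn_integral_inverse_square_infinite[symmetric]) (use \<kappa> in simp)
  also have "\<dots> \<le> (\<integral>\<^sup>+a. \<integral>\<^sup>+b. F a b \<partial>lborel \<partial>lborel)"
  proof (rule nn_integral_mono)
    fix a :: complex
    show "ennreal (\<kappa> * pi / 4 / (cmod a)\<^sup>2) * indicator {a. 2 \<le> cmod a} a \<le> (\<integral>\<^sup>+b. F a b \<partial>lborel)"
    proof (cases "2 \<le> cmod a")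
      case True
      define p where "p = (cmod a)\<^sup>2"
      have "2\<^sup>2 \<le> (cmod a)\<^sup>2" using True by (intro power_mono) auto
      then have p: "p \<ge> 4" by (simp add: p_def)
      have "(\<integral>\<^sup>+b. F a b \<partial>lborel) = (\<integral>\<^sup>+b. ennreal (\<kappa> * (cmod a) ^ 4) * indicator {b. ring_height a b < 1} b \<partial>lborel)"
        using True by (intro nn_integral_cong) (simp add: F_def indicator_def)
      also have "\<dots> = ennreal (\<kappa> * (cmod a) ^ 4) * emeasure lborel {b. ring_height a b < 1}"
        by (rule nn_integral_cmult_indicator[OF ring_sets])
      also have "emeasure lborel {b. ring_height a b < 1} = ennreal (2 * pi / (1 + (cmod a)\<^sup>2) ^ 3)"
        by (rule ring_area_eq) (use True in simp)
      also have "ennreal (\<kappa> * (cmod a) ^ 4) * ennreal (2 * pi / (1 + (cmod a)\<^sup>2) ^ 3) = ennreal (\<kappa> * p\<^sup>2 * (2 * pi / (1 + p) ^ 3))"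
        using \<kappa> p by (subst ennreal_mult[symmetric]) (auto simp: p_def power_mult[symmetric])
      also have "\<dots> \<ge> ennreal (\<kappa> * pi / 4 / (cmod a)\<^sup>2)"
      proof (rule ennreal_leI)
        have "(1 + p) ^ 3 \<le> (2 * p) ^ 3" using p by (intro power_mono) auto
        then have "2 * pi / (2 * p) ^ 3 \<le> 2 * pi / (1 + p) ^ 3"
          using p by (intro divide_left_mono) auto
        then have "\<kappa> * p\<^sup>2 * (2 * pi / (2 * p) ^ 3) \<le> \<kappa> * p\<^sup>2 * (2 * pi / (1 + p) ^ 3)"
          using \<kappa> by (intro mult_left_mono) auto
        moreover have "\<kappa> * p\<^sup>2 * (2 * pi / (2 * p) ^ 3) = \<kappa> * pi / 4 / (cmod a)\<^sup>2"
          using p unfolding p_def[symmetric] by (simp add: power2_eq_square power3_eq_cube)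
        ultimately show "\<kappa> * pi / 4 / (cmod a)\<^sup>2 \<le> \<kappa> * p\<^sup>2 * (2 * pi / (1 + p) ^ 3)" by simp
      qed
      finally show ?thesis using True by simp
    qed simp
  qed
  also have "\<dots> = (\<integral>\<^sup>+z. F (z 0) (z 1) \<partial>Cn_lborel 2)" by (rule nn_integral_Cn2[OF Fm, symmetric])
  also have "\<dots> \<le> (\<integral>\<^sup>+z. ennreal ((cmod (indicator thin_reinhardt z * (z 1 ^ m * (c * (z 0 / z 1) ^ j))))\<^sup>2) \<partial>Cn_lborel 2)"
    by (rule nn_integral_mono[OF low])
  finally show ?thesis by (simp add: top_unique)
qed

text \<open>The chain rule along a complex line, from the one-variable Taylor estimate.\<close>

lemma diagonal_has_field_derivative:
  assumes fam: "hol_family 2 D {()} (\<lambda>_. f)" and z: "z \<in> D"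
  shows "((\<lambda>h. f (z(1 := z 1 + h, 0 := z 0 + s * h))) has_field_derivative (s * cpd 0 f z + cpd 1 f z)) (at 0)"
proof -
  obtain r M where r: "r > 0" and M: "M \<ge> 0" and zin: "z \<in> polydisc 2 z r"
    and sub: "polydisc 2 z r \<subseteq> D"
    and bd: "\<And>y F. y \<in> polydisc 2 z r \<Longrightarrow> finite F \<Longrightarrow> F \<subseteq> {()} \<Longrightarrow> (\<Sum>j\<in>F. (cmod (f y))\<^sup>2) \<le> M\<^sup>2"
    using hol_familyE[OF fam z] by metis
  have fM: "cmod (f y) \<le> M" if "y \<in> polydisc 2 z r" for y
    using bd[OF that, of "{()}"] M by (simp add: abs_le_square_iff[symmetric])
  define y where "y h = z(1 := z 1 + h)" for h
  define \<rho> where "\<rho> = r / 4 / (1 + cmod s)"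
  have s1: "1 + cmod s > 0" by (simp add: add_pos_nonneg)
  have \<rho>: "\<rho> > 0" "\<rho> \<le> r / 4" "cmod s * \<rho> \<le> r / 4"
    using r s1 by (auto simp: \<rho>_def divide_simps mult_left_le)
  have yin: "y h \<in> polydisc 2 z r" if "cmod h < \<rho>" for h
    unfolding y_def by (rule polydisc_update[OF zin]) (use that \<rho> r in \<open>auto simp: dist_norm\<close>)
  have y0: "y h 0 = z 0" for h by (simp add: y_def)
  have est: "cmod (f ((y h)(0 := z 0 + s * h)) - f (y h) - (s * h) * cpd 0 f (y h)) \<le> 8 * M / r\<^sup>2 * (cmod (s * h))\<^sup>2"
    if h: "cmod h < \<rho>" for h
  proof -
    have "cmod (s * h) \<le> cmod s * \<rho>" unfolding norm_mult using h by (intro mult_left_mono) auto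
    then have sh: "cmod (s * h) \<le> r / 4" using \<rho>(3) by linarith
    have up: "(y h)(0 := w) \<in> polydisc 2 z r" if "w \<in> ball (z 0) r" for w
      by (rule polydisc_update[OF yin[OF h] _ that]) simp
    have hol: "(\<lambda>w. f ((y h)(0 := w))) holomorphic_on ball (z 0) r"
      by (rule hol_family_line[OF fam]) (use up sub in auto)
    have "cmod (f ((y h)(0 := z 0 + s * h)) - f ((y h)(0 := z 0)) - (s * h) * deriv (\<lambda>w. f ((y h)(0 := w))) (z 0))
        \<le> 8 * M / r\<^sup>2 * (cmod (s * h))\<^sup>2"
      by (rule norm_taylor_remainder_le_of_bounded[OF hol r _ sh]) (use up fM in auto)
    moreover have "(y h)(0 := z 0) = y h" using y0[of h] by (metis fun_upd_triv)
    ultimately show ?thesis by (simp add: cpd_def y0)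
  qed
  have small: "\<forall>\<^sub>F h in at (0::complex). cmod h < \<rho>"
    unfolding eventually_at using \<rho>(1) by (intro exI[of _ \<rho>]) (auto simp: dist_norm)
  define Q where "Q h = (f ((y h)(0 := z 0 + s * h)) - f (y h)) / h" for h
  have "((\<lambda>h. Q h - s * cpd 0 f (y h)) \<longlongrightarrow> 0) (at 0)"
  proof (rule Lim_null_comparison)
    have "\<forall>\<^sub>F h in at (0::complex). cmod h < \<rho> \<and> h \<noteq> 0"
      using small eventually_neq_at_within[of 0 0 UNIV] by eventually_elim auto
    then show "\<forall>\<^sub>F h in at 0. cmod (Q h - s * cpd 0 f (y h)) \<le> 8 * M / r\<^sup>2 * (cmod s)\<^sup>2 * cmod h"
    proof eventually_elim
      case (elim h)
      have "h * (Q h - s * cpd 0 f (y h)) = f ((y h)(0 := z 0 + s * h)) - f (y h) - (s * h) * cpd 0 f (y h)"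
        using elim by (simp add: Q_def field_simps)
      then have "cmod h * cmod (Q h - s * cpd 0 f (y h)) \<le> cmod h * (8 * M / r\<^sup>2 * (cmod s)\<^sup>2 * cmod h)"
        using est[of h] elim by (simp add: norm_mult[symmetric]) (simp add: norm_mult power_mult_distrib power2_eq_square mult_ac)
      then show ?case by (rule mult_left_le_imp_le) (use elim in simp)
    qed
    have "((\<lambda>h::complex. 8 * M / r\<^sup>2 * (cmod s)\<^sup>2 * cmod h) \<longlongrightarrow> 8 * M / r\<^sup>2 * (cmod s)\<^sup>2 * cmod 0) (at 0)"
      by (intro tendsto_intros)
    then show "((\<lambda>h::complex. 8 * M / r\<^sup>2 * (cmod s)\<^sup>2 * cmod h) \<longlongrightarrow> 0) (at 0)" by simp
  qed
  moreover have "((\<lambda>h. cpd 0 f (y h)) \<longlongrightarrow> cpd 0 f z) (at 0)"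
  proof -
    have "((\<lambda>w. cpd 0 f (z(1 := w))) has_field_derivative cpd 1 (cpd 0 f) z) (at (z 1))"
      by (rule cpd_has_derivative[OF hol_family_cpd[OF fam]]) (use z in auto)
    then have "isCont (\<lambda>w. cpd 0 f (z(1 := w))) (z 1)" by (rule DERIV_isCont)
    then have "((\<lambda>h. cpd 0 f (z(1 := z 1 + h))) \<longlongrightarrow> cpd 0 f (z(1 := z 1))) (at 0)"
      by (simp add: isCont_iff)
    then show ?thesis by (simp add: y_def)
  qed
  moreover have "((\<lambda>h. (f (y h) - f z) / h) \<longlongrightarrow> cpd 1 f z) (at 0)"
    using cpd_has_derivative[OF fam, of "()" 1 z] z by (simp add: DERIV_def y_def)
  ultimately have "((\<lambda>h. (Q h - s * cpd 0 f (y h)) + s * cpd 0 f (y h) + (f (y h) - f z) / h) \<longlongrightarrow>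
      0 + s * cpd 0 f z + cpd 1 f z) (at 0)"
    by (intro tendsto_add tendsto_mult tendsto_const)
  moreover have "(Q h - s * cpd 0 f (y h)) + s * cpd 0 f (y h) + (f (y h) - f z) / h
      = (f ((y h)(0 := z 0 + s * h)) - f z) / h" for h
    by (simp add: Q_def diff_divide_distrib)
  ultimately show ?thesis by (simp add: DERIV_def y_def)
qed

lemma higher_deriv_line: "(deriv ^^ m) (\<lambda>w. u (y(i := w))) = (\<lambda>w. cpds (replicate m i) u (y(i := w)))"
proof (induction m arbitrary: u)
  case (Suc m)
  have "deriv (\<lambda>w. u (y(i := w))) = (\<lambda>w. cpd i u (y(i := w)))" by (simp add: cpd_update)
  then have "(deriv ^^ Suc m) (\<lambda>w. u (y(i := w))) = (deriv ^^ m) (\<lambda>w. cpd i u (y(i := w)))"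
    by (simp only: funpow_Suc_right o_apply)
  also have "\<dots> = (\<lambda>w. cpds (replicate m i) (cpd i u) (y(i := w)))" by (rule Suc)
  finally show ?case by (simp only: replicate_Suc cpds_simps)
qed simp

section \<open>Square-integrable functions on the domain are affine\<close>

locale thin_function =
  fixes f :: "(nat \<Rightarrow> complex) \<Rightarrow> complex"
  assumes fA2: "f \<in> bergman_space 2 thin_reinhardt"
begin

lemma f_hol: "Cn_holomorphic_on 2 f thin_reinhardt"
  using fA2 by (rule thin.A2_hol)

lemma fam_f: "hol_family 2 thin_reinhardt {()} (\<lambda>_. f)"
  unfolding hol_family_def
proof (intro conjI ballI allI impI)
  show "(\<lambda>w. f (z(i := w))) field_differentiable at (z i)" if "z \<in> thin_reinhardt" "i < 2" for z i
    using f_hol that unfolding Cn_holomorphic_on_def by blast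
  fix p assume "p \<in> thin_reinhardt"
  then obtain r C where r: "r > 0" "C \<ge> 0" "p \<in> polydisc 2 p r" "polydisc 2 p r \<subseteq> thin_reinhardt"
    and ev: "\<And>z f. z \<in> polydisc 2 p r \<Longrightarrow> f \<in> bergman_space 2 thin_reinhardt \<Longrightarrow> (cmod (f z))\<^sup>2 \<le> C\<^sup>2 * thin.Nrm f"
    using thin.point_evaluation by metis
  have "(\<Sum>j\<in>F. (cmod (f z))\<^sup>2) \<le> (C * sqrt (thin.Nrm f))\<^sup>2"
    if "z \<in> polydisc 2 p r" "finite F" "F \<subseteq> {()}" for z F
  proof -
    have "(cmod (f z))\<^sup>2 \<le> (C * sqrt (thin.Nrm f))\<^sup>2"
      using ev[OF that(1) fA2] thin.ip_self(3)[OF fA2] by (simp add: power_mult_distrib)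
    moreover have "F = {} \<or> F = {()}" using that by blast
    ultimately show ?thesis by auto
  qed
  moreover have "C * sqrt (thin.Nrm f) \<ge> 0" using r(2) thin.ip_self(3)[OF fA2] by simp
  ultimately show "\<exists>r>0. \<exists>M\<ge>0. p \<in> polydisc 2 p r \<and> polydisc 2 p r \<subseteq> thin_reinhardt \<and>
      (\<forall>z\<in>polydisc 2 p r. \<forall>F. finite F \<longrightarrow> F \<subseteq> {()} \<longrightarrow> (\<Sum>j\<in>F. (cmod (f z))\<^sup>2) \<le> M\<^sup>2)"
    using r by blast
qed

text \<open>In the coordinates \<open>w = z 1\<close>, \<open>s = z 0 / z 1\<close> the slices over fixed \<open>s\<close> are discs about \<open>w = 0\<close>,
  and every \<open>s\<close> occurs.\<close>

definition blow_down :: "(nat \<Rightarrow> complex) \<Rightarrow> nat \<Rightarrow> complex" where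
  "blow_down y = (\<lambda>i\<in>{..<2}. if i = 0 then y 1 * y 0 else y 0)"

definition slice_domain :: "(nat \<Rightarrow> complex) set" where
  "slice_domain = {y \<in> PiE {..<2} (\<lambda>_. UNIV). ring_height (y 1 * y 0) (y 0) < 1}"

definition "slice_fun y = f (blow_down y)"

lemma blow_down_01 [simp]: "blow_down y 0 = y 1 * y 0" "blow_down y (Suc 0) = y 0"
  by (simp_all add: blow_down_def)

lemma blow_down_mem: "y \<in> slice_domain \<Longrightarrow> blow_down y \<in> thin_reinhardt"
proof -
  have "blow_down y \<in> extensional {..<2}" by (simp add: blow_down_def)
  then show "y \<in> slice_domain \<Longrightarrow> blow_down y \<in> thin_reinhardt" by (simp add: slice_domain_def thin_mem)
qed

lemma fun2_eqI: "y \<in> extensional {..<2} \<Longrightarrow> y' \<in> extensional {..<2} \<Longrightarrow> y 0 = y' 0 \<Longrightarrow> y 1 = y' 1 \<Longrightarrow> y = y'"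
  for y y' :: "nat \<Rightarrow> complex"
  by (rule extensionalityI[of _ "{..<2}"]) (auto simp: lessThan_2)

lemma open_slice: "openin (Cn_top 2) slice_domain"
  unfolding slice_domain_def
  using openin_Cn2_less[of "\<lambda>q. ring_height (snd q * fst q) (fst q)"] continuous_ring_height[of "\<lambda>q. snd q * fst q" fst]
  by (simp add: continuous_on_fst continuous_on_snd continuous_on_id continuous_on_mult)

lemma fam_slice: "hol_family 2 slice_domain {()} (\<lambda>_. slice_fun)"
proof -
  have contT: "continuous_map (subtopology (Cn_top 2) slice_domain) (subtopology (Cn_top 2) thin_reinhardt) blow_down"
  proof (rule continuous_map_into_subtopology)
    have "continuous_map (Cn_top 2) (product_topology (\<lambda>_. euclidean) {..<2}) blow_down"
      unfolding continuous_map_componentwise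
    proof (intro conjI ballI)
      show "blow_down ` topspace (Cn_top 2) \<subseteq> extensional {..<2}" by (auto simp: blow_down_def)
      fix k :: nat assume "k \<in> {..<2}"
      then consider "k = 0" | "k = 1" by fastforce
      then show "continuous_map (Cn_top 2) euclidean (\<lambda>x. blow_down x k)"
      proof cases
        case 1
        then show ?thesis using continuous_map_Cn2[of "\<lambda>q. snd q * fst q"]
          by (simp add: continuous_on_fst continuous_on_snd continuous_on_id continuous_on_mult)
      next
        case 2
        then show ?thesis using continuous_map_Cn2[of fst]
          by (simp add: continuous_on_fst continuous_on_id)
      qed
    qed
    then have "continuous_map (Cn_top 2) (Cn_top 2) blow_down" by (simp only: Cn_top_def[symmetric])
    then show "continuous_map (subtopology (Cn_top 2) slice_domain) (Cn_top 2) blow_down"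
      by (rule continuous_map_from_subtopology)
  qed (use blow_down_mem in auto)
  have "continuous_map (subtopology (Cn_top 2) thin_reinhardt) euclidean f"
    using f_hol by (simp add: Cn_holomorphic_on_def)
  from continuous_map_compose[OF contT this]
  have cont: "continuous_map (subtopology (Cn_top 2) slice_domain) euclidean slice_fun"
    by (simp add: o_def slice_fun_def[abs_def])
  show ?thesis
    unfolding hol_family_def
  proof (intro conjI ballI allI impI)
    fix y :: "nat \<Rightarrow> complex" and i :: nat
    assume y: "y \<in> slice_domain" and "i < 2"
    then consider "i = 0" | "i = 1" by fastforce
    then show "(\<lambda>w. slice_fun (y(i := w))) field_differentiable at (y i)"
    proof cases
      case 1
      define z where "z = blow_down y"
      have z: "z \<in> thin_reinhardt" unfolding z_def by (rule blow_down_mem[OF y])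
      have e: "slice_fun (y(0 := w)) = f (z(1 := z 1 + (w - y 0), 0 := z 0 + y 1 * (w - y 0)))" for w
        unfolding slice_fun_def
        by (intro arg_cong[where f = f] fun2_eqI) (auto simp: z_def algebra_simps, auto simp: blow_down_def extensional_def)
      have "((\<lambda>h. f (z(1 := z 1 + h, 0 := z 0 + y 1 * h))) has_field_derivative (y 1 * cpd 0 f z + cpd 1 f z)) (at (y 0 - y 0))"
        using diagonal_has_field_derivative[OF fam_f z] by simp
      then have "((\<lambda>w. f (z(1 := z 1 + (w - y 0), 0 := z 0 + y 1 * (w - y 0)))) has_field_derivative
          (y 1 * cpd 0 f z + cpd 1 f z) * (1 - 0)) (at (y 0))"
        by (rule DERIV_chain2) (intro derivative_intros)
      then show ?thesis unfolding 1 e field_differentiable_def by blast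
    next
      case 2
      define z where "z = blow_down y"
      have z: "z \<in> thin_reinhardt" unfolding z_def by (rule blow_down_mem[OF y])
      have e: "slice_fun (y(1 := s)) = f (z(0 := s * y 0))" for s
        unfolding slice_fun_def
        by (intro arg_cong[where f = f] fun2_eqI) (auto simp: z_def, auto simp: blow_down_def extensional_def)
      have "((\<lambda>w. f (z(0 := w))) has_field_derivative cpd 0 f z) (at (y 1 * y 0))"
        using cpd_has_derivative[OF fam_f, of "()" 0 z] z by (simp add: z_def)
      then have "((\<lambda>s. f (z(0 := s * y 0))) has_field_derivative cpd 0 f z * (1 * y 0)) (at (y 1))"
        by (rule DERIV_chain2) (auto intro!: derivative_eq_intros)
      then show ?thesis unfolding 2 e field_differentiable_def by blast
    qed
  next
    fix p assume p: "p \<in> slice_domain"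
    have sub: "slice_domain \<subseteq> topspace (Cn_top 2)" using open_slice openin_subset by blast
    have "openin (subtopology (Cn_top 2) slice_domain)
        {y \<in> topspace (subtopology (Cn_top 2) slice_domain). slice_fun y \<in> ball 0 (cmod (slice_fun p) + 1)}"
      by (rule openin_continuous_map_preimage[OF cont]) (simp add: open_openin[symmetric])
    then have "openin (Cn_top 2) {y \<in> slice_domain. slice_fun y \<in> ball 0 (cmod (slice_fun p) + 1)}"
      using open_slice sub by (simp add: openin_open_subtopology inf_absorb2)
    then have "cn_open 2 {y \<in> slice_domain. slice_fun y \<in> ball 0 (cmod (slice_fun p) + 1)}"
      by (rule openin_Cn_imp_cn_open)
    moreover have "p \<in> {y \<in> slice_domain. slice_fun y \<in> ball 0 (cmod (slice_fun p) + 1)}" using p by simp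
    ultimately obtain r where r: "r > 0" "p \<in> polydisc 2 p r"
      "polydisc 2 p r \<subseteq> {y \<in> slice_domain. slice_fun y \<in> ball 0 (cmod (slice_fun p) + 1)}"
      unfolding cn_open_def by blast
    have "(\<Sum>j\<in>F. (cmod (slice_fun z))\<^sup>2) \<le> (cmod (slice_fun p) + 1)\<^sup>2"
      if "z \<in> polydisc 2 p r" "finite F" "F \<subseteq> {()}" for z and F :: "unit set"
    proof -
      have "cmod (slice_fun z) \<le> cmod (slice_fun p) + 1" using r(3) that(1) by auto
      then have "(cmod (slice_fun z))\<^sup>2 \<le> (cmod (slice_fun p) + 1)\<^sup>2" by (rule power_mono) simp
      moreover have "F = {} \<or> F = {()}" using that by blast
      ultimately show ?thesis by auto
    qed
    moreover have "polydisc 2 p r \<subseteq> slice_domain" using r(3) by blast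
    moreover have "0 \<le> cmod (slice_fun p) + 1" by simp
    ultimately show "\<exists>r>0. \<exists>M\<ge>0. p \<in> polydisc 2 p r \<and> polydisc 2 p r \<subseteq> slice_domain \<and>
      (\<forall>z\<in>polydisc 2 p r. \<forall>F. finite F \<longrightarrow> F \<subseteq> {()} \<longrightarrow> (\<Sum>j\<in>F. (cmod (slice_fun z))\<^sup>2) \<le> M\<^sup>2)"
      using r(1,2) by blast
  qed
qed

definition "pt s w = (\<lambda>i\<in>{..<2::nat}. if i = 0 then w else (s :: complex))"

lemma pt_01 [simp]: "pt s w 0 = w" "pt s w (Suc 0) = s"
  by (simp_all add: pt_def)

lemma pt_upd: "(pt s w)(0 := w') = pt s w'" "(pt s w)(Suc 0 := s') = pt s' w"
  by (auto simp: pt_def fun_eq_iff)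

lemma pt_mem: "pt s w \<in> slice_domain \<longleftrightarrow> ring_height (s * w) w < 1"
  by (simp add: slice_domain_def) (simp add: pt_def)

lemma pt_shrink: "pt s w \<in> slice_domain \<Longrightarrow> cmod t \<le> 1 \<Longrightarrow> pt s (t * w) \<in> slice_domain"
  using ring_height_contract[of t "s * w" w] by (simp add: pt_mem mult_ac)

lemma blow_down_pt: "z \<in> thin_reinhardt \<Longrightarrow> z 1 \<noteq> 0 \<Longrightarrow> blow_down (pt (z 0 / z 1) (t * z 1)) = cscale t z"
  by (rule fun2_eqI) (auto simp: cscale_def, auto simp: blow_down_def)

text \<open>Up to the factor \<open>m!\<close>, the coefficient of \<open>w\<^sup>m\<close> on the line of slope \<open>s\<close>. It is an entire function of \<open>s\<close>,
  because every line through the origin meets the domain in a disc about the origin.\<close>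

definition "line_coeff m s = (deriv ^^ m) (\<lambda>w. slice_fun (pt s w)) 0"

lemma line_coeff_eq: "line_coeff m s = cpds (replicate m 0) slice_fun ((pt 0 0)(1 := s))"
proof -
  have "(deriv ^^ m) (\<lambda>w. slice_fun ((pt s 0)(0 := w))) = (\<lambda>w. cpds (replicate m 0) slice_fun ((pt s 0)(0 := w)))"
    by (rule higher_deriv_line)
  then show ?thesis unfolding line_coeff_def by (simp add: pt_upd)
qed

lemma line_coeff_entire: "line_coeff m holomorphic_on UNIV"
proof -
  have "(\<lambda>s. cpds (replicate m 0) slice_fun ((pt 0 0)(1 := s))) holomorphic_on UNIV"
    by (rule hol_family_line[OF hol_family_cpds[OF fam_slice]])
       (auto simp: pt_upd pt_mem ring_height_def)
  then show ?thesis by (simp add: line_coeff_eq[abs_def, symmetric] line_coeff_eq fun_eq_iff cong: holomorphic_cong)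
qed

text \<open>The domain is open and contains \<open>z\<close>, so the line through the origin and \<open>z\<close> stays inside slightly
  beyond \<open>z\<close>, and the Taylor expansion in \<open>t\<close> is valid up to \<open>t = 1\<close>.\<close>

lemma slice_holomorphic:
  assumes z: "z \<in> thin_reinhardt" and z1: "z 1 \<noteq> 0"
  obtains R where "R > 1" "(\<lambda>t. slice_fun (pt (z 0 / z 1) (z 1 * t))) holomorphic_on ball 0 R"
    "\<And>m. (deriv ^^ m) (\<lambda>t. slice_fun (pt (z 0 / z 1) (z 1 * t))) 0 = z 1 ^ m * line_coeff m (z 0 / z 1)"
proof -
  define s where "s = z 0 / z 1"
  have mem: "pt s (z 1) \<in> slice_domain" using z z1 by (simp add: pt_mem s_def thin_mem)
  have "\<forall>\<^sub>F w in nhds (pt s (z 1) 0). (pt s (z 1))(0 := w) \<in> slice_domain"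
    by (rule cn_open_line[OF openin_Cn_imp_cn_open[OF open_slice] mem]) simp
  then obtain e where e: "e > 0" "\<And>w. dist w (z 1) < e \<Longrightarrow> pt s w \<in> slice_domain"
    unfolding eventually_nhds_metric by (auto simp: pt_upd)
  define R where "R = 1 + e / (2 * cmod (z 1))"
  have R: "R > 1" using e(1) z1 by (simp add: R_def)
  have memR: "pt s (of_real R * z 1) \<in> slice_domain"
  proof (rule e(2))
    have "of_real R * z 1 - z 1 = of_real (e / (2 * cmod (z 1))) * z 1" by (simp add: R_def algebra_simps)
    then have "dist (of_real R * z 1) (z 1) = cmod (of_real (e / (2 * cmod (z 1))) * z 1)" by (simp only: dist_norm)
    also have "\<dots> = e / 2" using e(1) z1 by (simp add: norm_mult norm_divide)
    finally show "dist (of_real R * z 1) (z 1) < e" using e(1) by simp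
  qed
  have memt: "pt s (z 1 * t) \<in> slice_domain" if "t \<in> ball 0 R" for t
  proof -
    have "cmod (t / of_real R) \<le> 1" using that R by (simp add: norm_divide divide_le_eq_1)
    from pt_shrink[OF memR this] show ?thesis using R by (simp add: mult_ac)
  qed
  define W where "W = (\<lambda>t. z 1 * t) ` ball 0 R"
  have W: "W = ball 0 (cmod (z 1) * R)"
  proof (intro equalityI subsetI)
    fix w :: complex assume "w \<in> ball 0 (cmod (z 1) * R)"
    then show "w \<in> W" unfolding W_def using z1
      by (intro image_eqI[of _ _ "w / z 1"]) (auto simp: norm_divide divide_less_eq mult.commute)
  qed (use z1 in \<open>auto simp: W_def norm_mult\<close>)
  have hol: "(\<lambda>w. slice_fun (pt s w)) holomorphic_on W"
  proof -
    have "(\<lambda>w. slice_fun ((pt s 0)(0 := w))) holomorphic_on W"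
      by (rule hol_family_line[OF fam_slice]) (use memt in \<open>auto simp: W_def pt_upd\<close>)
    then show ?thesis by (simp add: pt_upd)
  qed
  have comp: "(\<lambda>t. slice_fun (pt s (z 1 * t))) holomorphic_on ball 0 R"
  proof (rule holomorphic_on_compose_gen[of "\<lambda>t. z 1 * t" _ "\<lambda>w. slice_fun (pt s w)" W, unfolded o_def])
    show "(\<lambda>t. z 1 * t) ` ball 0 R \<subseteq> W" by (simp add: W_def)
  qed (auto intro!: holomorphic_intros hol)
  have "(deriv ^^ m) (\<lambda>t. slice_fun (pt s (z 1 * t))) 0 = z 1 ^ m * (deriv ^^ m) (\<lambda>w. slice_fun (pt s w)) (z 1 * 0)" for m
    by (rule higher_deriv_compose_linear[OF hol open_ball[of 0 R]]) (use R W z1 in \<open>auto simp: W_def[symmetric] norm_mult\<close>)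
  then show ?thesis using that[OF R, unfolded s_def[symmetric], OF comp] by (simp add: line_coeff_def s_def)
qed

lemma slice_fun_scale:
  "z \<in> thin_reinhardt \<Longrightarrow> z 1 \<noteq> 0 \<Longrightarrow> slice_fun (pt (z 0 / z 1) (z 1 * t)) = f (cscale t z)"
  using blow_down_pt[of z t] by (simp add: slice_fun_def mult.commute)

text \<open>Discrete Fourier averages over the diagonal rotations \<open>z \<mapsto> \<omega> z\<close> isolate the part of \<open>f\<close> that is
  homogeneous of degree \<open>m\<close>, without increasing the norm.\<close>

lemma homogeneous_part_square_integrable:
  "(\<integral>\<^sup>+z. ennreal ((cmod (indicator thin_reinhardt z * (z 1 ^ m * line_coeff m (z 0 / z 1) / fact m)))\<^sup>2) \<partial>Cn_lborel 2) < \<infinity>"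
proof -
  have h: "(\<lambda>z. indicator thin_reinhardt z * f z) \<in> borel_measurable (Cn_lborel 2)"
    by (rule thin.hol_meas[OF f_hol])
  have "(\<integral>\<^sup>+z. ennreal ((cmod (indicator thin_reinhardt z * (z 1 ^ m * line_coeff m (z 0 / z 1) / fact m)))\<^sup>2) \<partial>Cn_lborel 2)
      \<le> (\<integral>\<^sup>+z. ennreal ((cmod (indicator thin_reinhardt z * f z))\<^sup>2) \<partial>Cn_lborel 2)"
  proof (rule nn_integral_average_limit_le[OF h, where \<tau> = "\<lambda>N k. cscale (root1 N k)" and wt = "\<lambda>N k. cnj (root1 N k ^ m)"])
    show "cscale (root1 N k) \<in> measurable (Cn_lborel 2) (Cn_lborel 2)" for N k
      unfolding cscale_def[abs_def] by (rule measurable_Cn_scale)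
    show "(\<integral>\<^sup>+z. ennreal ((cmod (indicator thin_reinhardt (cscale (root1 N k) z) * f (cscale (root1 N k) z)))\<^sup>2) \<partial>Cn_lborel 2)
        = (\<integral>\<^sup>+z. ennreal ((cmod (indicator thin_reinhardt z * f z))\<^sup>2) \<partial>Cn_lborel 2)" for N k
      unfolding cscale_def
      by (rule nn_integral_Cn_rotate[where F = "\<lambda>z. ennreal ((cmod (indicator thin_reinhardt z * f z))\<^sup>2)"])
         (use h in auto)
    show "cmod (cnj (root1 N k ^ m)) \<le> 1" for N k by (simp add: norm_power)
    show "AE z in Cn_lborel 2. (\<lambda>N. (\<Sum>k<N. cnj (root1 N k ^ m) * (indicator thin_reinhardt (cscale (root1 N k) z) * f (cscale (root1 N k) z))) / of_nat N)
        \<longlonglongrightarrow> indicator thin_reinhardt z * (z 1 ^ m * line_coeff m (z 0 / z 1) / fact m)"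
      using AE_Cn2_nonzero AE_space
    proof eventually_elim
      case (elim z)
      have zr: "restrict z {..<2} = z" using elim(2) by (auto simp: Cn_lborel_def space_PiM PiE_iff extensional_restrict)
      have mem: "cscale (root1 N k) z \<in> thin_reinhardt \<longleftrightarrow> z \<in> thin_reinhardt" for N k
        using thin_rotate[of "\<lambda>_. root1 N k" z] zr by (simp add: cscale_def)
      show ?case
      proof (cases "z \<in> thin_reinhardt")
        case True
        obtain R where R: "R > 1" "(\<lambda>t. slice_fun (pt (z 0 / z 1) (z 1 * t))) holomorphic_on ball 0 R"
          and d: "\<And>m. (deriv ^^ m) (\<lambda>t. slice_fun (pt (z 0 / z 1) (z 1 * t))) 0 = z 1 ^ m * line_coeff m (z 0 / z 1)"
          using slice_holomorphic[OF True elim(1)] by metis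
        from dft_tendsto_taylor_coeff[OF R(2,1), of m] show ?thesis
          unfolding d using True mem by (simp add: slice_fun_scale[OF True elim(1), simplified])
      qed (simp add: mem)
    qed
  qed
  also have "\<dots> = thin.I f" by (simp add: thin.I_eq)
  also have "\<dots> < \<infinity>" using fA2 thin.A2_iff by blast
  finally show ?thesis .
qed

text \<open>Rotating the first coordinate only isolates, in the same way, the monomials of the homogeneous part; the
  one belonging to a nonzero coefficient would be square integrable.\<close>

lemma line_coeff_derivs_zero:
  assumes m: "m \<ge> 2"
  shows "(deriv ^^ j) (line_coeff m) 0 = 0"
proof (rule ccontr)
  assume nz: "(deriv ^^ j) (line_coeff m) 0 \<noteq> 0"
  define c where "c = (deriv ^^ j) (line_coeff m) 0 / fact j / fact m"
  have c: "c \<noteq> 0" using nz by (simp add: c_def)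
  define h where "h z = indicator thin_reinhardt z * (z 1 ^ m * line_coeff m (z 0 / z 1) / fact m)" for z
  have z_meas[measurable]: "(\<lambda>z. z i) \<in> borel_measurable (Cn_lborel 2)" if "i < 2" for i :: nat
    unfolding Cn_lborel_def using measurable_component_singleton[of i "{..<2}" "\<lambda>_. lborel"] that by simp
  have hm: "h \<in> borel_measurable (Cn_lborel 2)"
  proof -
    have [measurable]: "line_coeff m \<in> borel_measurable borel"
      by (intro borel_measurable_continuous_onI holomorphic_on_imp_continuous_on line_coeff_entire)
    have [measurable]: "(\<lambda>z. z 0) \<in> borel_measurable (Cn_lborel 2)" "(\<lambda>z. z 1) \<in> borel_measurable (Cn_lborel 2)"
      by (rule z_meas, simp)+
    have [measurable]: "thin_reinhardt \<in> sets (Cn_lborel 2)" by (rule thin.D_sets)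
    show ?thesis unfolding h_def[abs_def] by measurable
  qed
  define rot where "rot N k z = (\<lambda>i\<in>{..<2}. (if i = 0 then root1 N k else 1) * z i)" for N k and z :: "nat \<Rightarrow> complex"
  have "(\<integral>\<^sup>+z. ennreal ((cmod (indicator thin_reinhardt z * (z 1 ^ m * (c * (z 0 / z 1) ^ j))))\<^sup>2) \<partial>Cn_lborel 2)
      \<le> (\<integral>\<^sup>+z. ennreal ((cmod (h z))\<^sup>2) \<partial>Cn_lborel 2)"
  proof (rule nn_integral_average_limit_le[OF hm, where \<tau> = rot and wt = "\<lambda>N k. cnj (root1 N k ^ j)"])
    show "rot N k \<in> measurable (Cn_lborel 2) (Cn_lborel 2)" for N k
      unfolding rot_def[abs_def] by (rule measurable_Cn_scale)
    show "(\<integral>\<^sup>+z. ennreal ((cmod (h (rot N k z)))\<^sup>2) \<partial>Cn_lborel 2) = (\<integral>\<^sup>+z. ennreal ((cmod (h z))\<^sup>2) \<partial>Cn_lborel 2)" for N k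
      unfolding rot_def
      by (rule nn_integral_Cn_rotate[where F = "\<lambda>z. ennreal ((cmod (h z))\<^sup>2)"]) (use hm in auto)
    show "cmod (cnj (root1 N k ^ j)) \<le> 1" for N k by (simp add: norm_power)
    show "AE z in Cn_lborel 2. (\<lambda>N. (\<Sum>k<N. cnj (root1 N k ^ j) * h (rot N k z)) / of_nat N)
        \<longlonglongrightarrow> indicator thin_reinhardt z * (z 1 ^ m * (c * (z 0 / z 1) ^ j))"
      using AE_Cn2_nonzero AE_space
    proof eventually_elim
      case (elim z)
      have zr: "restrict z {..<2} = z" using elim(2) by (auto simp: Cn_lborel_def space_PiM PiE_iff extensional_restrict)
      have mem: "rot N k z \<in> thin_reinhardt \<longleftrightarrow> z \<in> thin_reinhardt" for N k
        using thin_rotate[of "\<lambda>i. if i = 0 then root1 N k else 1" z] zr by (simp add: rot_def)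
      have r01: "rot N k z 0 = root1 N k * z 0" "rot N k z 1 = z 1" for N k by (simp_all add: rot_def)
      define s where "s = z 0 / z 1"
      have "(\<lambda>t. line_coeff m (s * t)) holomorphic_on ball 0 2"
        using holomorphic_on_compose_gen[of "\<lambda>t. s * t" "ball 0 2" "line_coeff m" UNIV] line_coeff_entire
        by (auto simp: o_def intro!: holomorphic_intros)
      from dft_tendsto_taylor_coeff[OF this, of j]
      have "(\<lambda>N. (\<Sum>k<N. cnj (root1 N k ^ j) * line_coeff m (s * root1 N k)) / of_nat N)
          \<longlonglongrightarrow> (deriv ^^ j) (\<lambda>t. line_coeff m (s * t)) 0 / fact j" by simp
      also have "(deriv ^^ j) (\<lambda>t. line_coeff m (s * t)) 0 = s ^ j * (deriv ^^ j) (line_coeff m) (s * 0)"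
        by (rule higher_deriv_compose_linear[OF line_coeff_entire open_UNIV open_UNIV]) auto
      finally have "(\<lambda>N. (indicator thin_reinhardt z * z 1 ^ m / fact m) *
            ((\<Sum>k<N. cnj (root1 N k ^ j) * line_coeff m (s * root1 N k)) / of_nat N))
          \<longlonglongrightarrow> (indicator thin_reinhardt z * z 1 ^ m / fact m) * (s ^ j * (deriv ^^ j) (line_coeff m) (s * 0) / fact j)"
        by (intro tendsto_mult tendsto_const)
      moreover have "(indicator thin_reinhardt z * z 1 ^ m / fact m) *
            ((\<Sum>k<N. cnj (root1 N k ^ j) * line_coeff m (s * root1 N k)) / of_nat N)
          = (\<Sum>k<N. cnj (root1 N k ^ j) * h (rot N k z)) / of_nat N" for N
      proof -
        have "h (rot N k z) = (indicator thin_reinhardt z * z 1 ^ m / fact m) * line_coeff m (s * root1 N k)" for k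
          unfolding h_def r01 by (simp add: indicator_def mem s_def mult_ac)
        then show ?thesis by (simp add: sum_distrib_left mult_ac)
      qed
      moreover have "(indicator thin_reinhardt z * z 1 ^ m / fact m) * (s ^ j * (deriv ^^ j) (line_coeff m) (s * 0) / fact j)
          = indicator thin_reinhardt z * (z 1 ^ m * (c * (z 0 / z 1) ^ j))"
        by (simp add: c_def s_def mult_ac)
      ultimately show ?case by simp
    qed
  qed
  also have "\<dots> < \<infinity>" unfolding h_def by (rule homogeneous_part_square_integrable)
  finally show False unfolding monomial_not_square_integrable[OF c m] by simp
qed

lemma line_coeff_zero:
  assumes "m \<ge> 2"
  shows "line_coeff m s = 0"
proof -
  have "line_coeff m holomorphic_on ball 0 (cmod s + 1)" by (rule holomorphic_on_subset[OF line_coeff_entire]) simp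
  from holomorphic_power_series[OF this, of s]
  have "(\<lambda>j. (deriv ^^ j) (line_coeff m) 0 / fact j * (s - 0) ^ j) sums line_coeff m s" by simp
  then have "(\<lambda>j. 0) sums line_coeff m s" by (simp add: line_coeff_derivs_zero[OF assms])
  from sums_unique2[OF this sums_zero] show ?thesis .
qed

text \<open>The Taylor series on the line through \<open>z\<close> has no terms of degree \<open>m \<ge> 2\<close>.\<close>

lemma affine_on_lines_aux:
  assumes z: "z \<in> thin_reinhardt" and z1: "z 1 \<noteq> 0" and t: "cmod t \<le> 1"
  shows "f (cscale t z) = (1 - t) * f (cscale 0 z) + t * f z"
proof -
  obtain R where R: "R > 1" "(\<lambda>t. slice_fun (pt (z 0 / z 1) (z 1 * t))) holomorphic_on ball 0 R"
    and d: "\<And>m. (deriv ^^ m) (\<lambda>t. slice_fun (pt (z 0 / z 1) (z 1 * t))) 0 = z 1 ^ m * line_coeff m (z 0 / z 1)"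
    using slice_holomorphic[OF z z1] by metis
  define a b where "a = line_coeff 0 (z 0 / z 1)" and "b = z 1 * line_coeff 1 (z 0 / z 1)"
  have lin: "f (cscale t z) = a + b * t" if "cmod t \<le> 1" for t
  proof -
    have "(\<lambda>m. (deriv ^^ m) (\<lambda>t. slice_fun (pt (z 0 / z 1) (z 1 * t))) 0 / fact m * (t - 0) ^ m) sums
        slice_fun (pt (z 0 / z 1) (z 1 * t))"
      by (rule holomorphic_power_series[OF R(2)]) (use that R(1) in auto)
    then have "(\<lambda>m. z 1 ^ m * line_coeff m (z 0 / z 1) / fact m * t ^ m) sums slice_fun (pt (z 0 / z 1) (z 1 * t))"
      by (simp only: d diff_zero)
    then have s: "(\<lambda>m. z 1 ^ m * line_coeff m (z 0 / z 1) / fact m * t ^ m) sums f (cscale t z)"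
      by (simp only: slice_fun_scale[OF z z1])
    have "(\<lambda>m. z 1 ^ m * line_coeff m (z 0 / z 1) / fact m * t ^ m) sums
        (\<Sum>m<2. z 1 ^ m * line_coeff m (z 0 / z 1) / fact m * t ^ m)"
      by (rule sums_finite) (use line_coeff_zero in auto)
    from sums_unique2[OF s this] show ?thesis by (simp add: a_def b_def numeral_2_eq_2)
  qed
  have "cscale 1 z = z" using z by (auto simp: cscale_def thin_mem extensional_def fun_eq_iff)
  then have "f z = a + b" using lin[of 1] by simp
  moreover have "f (cscale 0 z) = a" using lin[of 0] by simp
  ultimately show ?thesis using lin[OF t] by (simp add: algebra_simps)
qed

lemma cscale_upd: "i < 2 \<Longrightarrow> cscale t (z(i := w)) = (cscale t z)(i := t * w)"
  by (auto simp: cscale_def fun_eq_iff)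

lemma cn_open_thin: "cn_open 2 thin_reinhardt"
  using openin_Cn_imp_cn_open[OF open_thin] .

lemma cscale0_eq: "cscale 0 z = cscale 0 z'" by (auto simp: cscale_def)

lemma line_tendsto:
  assumes "z \<in> thin_reinhardt" "i < 2"
  shows "((\<lambda>w. f (z(i := w))) \<longlongrightarrow> f z) (at (z i))"
proof -
  have "isCont (\<lambda>w. f (z(i := w))) (z i)"
    by (rule DERIV_isCont[OF cpd_has_derivative[OF fam_f]]) (use assms in auto)
  then show ?thesis by (simp add: isCont_def)
qed

text \<open>The remaining case \<open>z 1 = 0\<close> follows by continuity.\<close>

lemma affine_on_lines:
  assumes z: "z \<in> thin_reinhardt" and t: "cmod t \<le> 1"
  shows "f (cscale t z) = (1 - t) * f (cscale 0 z) + t * f z"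
proof (cases "z 1 = 0")
  case False
  then show ?thesis using affine_on_lines_aux z t by blast
next
  case True
  have tz: "cscale t z \<in> thin_reinhardt" by (rule thin_contract[OF z t])
  have L: "((\<lambda>w. f (cscale t (z(1 := w)))) \<longlongrightarrow> f (cscale t z)) (at 0)"
  proof -
    have "isCont (\<lambda>w. f ((cscale t z)(1 := w))) (cscale t z 1)"
      by (rule DERIV_isCont[OF cpd_has_derivative[OF fam_f]]) (use tz in auto)
    then have c: "isCont (\<lambda>w. f ((cscale t z)(1 := w))) (t * 0)" using True by simp
    have "isCont (\<lambda>w. f ((cscale t z)(1 := t * w))) 0"
      by (rule isCont_o2[where f = "\<lambda>w. t * w" and g = "\<lambda>w. f ((cscale t z)(1 := w))", OF _ c]) (intro continuous_intros)
    then have "((\<lambda>w. f ((cscale t z)(1 := t * w))) \<longlongrightarrow> f ((cscale t z)(1 := t * 0))) (at 0)"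
      by (simp add: isCont_def)
    moreover have "(cscale t z)(1 := t * 0) = cscale t z" using True by (auto simp: fun_eq_iff)
    ultimately show ?thesis by (simp add: cscale_upd)
  qed
  have Rr: "((\<lambda>w. (1 - t) * f (cscale 0 z) + t * f (z(1 := w))) \<longlongrightarrow> (1 - t) * f (cscale 0 z) + t * f z) (at 0)"
    using line_tendsto[OF z, of 1] True by (intro tendsto_intros) auto
  have "\<forall>\<^sub>F w in nhds (z 1). z(1 := w) \<in> thin_reinhardt"
    by (rule cn_open_line[OF cn_open_thin z]) simp
  then have "\<forall>\<^sub>F w in at 0. z(1 := w) \<in> thin_reinhardt"
    using True by (simp add: eventually_nhds_conv_at)
  moreover have "\<forall>\<^sub>F w in at (0::complex). w \<noteq> 0" by (rule eventually_neq_at_within)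
  ultimately have "\<forall>\<^sub>F w in at 0. f (cscale t (z(1 := w))) = (1 - t) * f (cscale 0 z) + t * f (z(1 := w))"
  proof eventually_elim
    case (elim w)
    then show ?case using affine_on_lines_aux[of "z(1 := w)" t] t cscale0_eq[of z "z(1 := w)"] by simp
  qed
  from tendsto_cong[THEN iffD1, OF this L]
  show ?thesis using Rr by (rule tendsto_unique[rotated]) simp
qed

lemma scaled_line_derivative:
  assumes fam: "hol_family 2 thin_reinhardt {()} (\<lambda>_. u)"
    and z: "z \<in> thin_reinhardt" and t: "cmod t \<le> 1" and i: "i < 2"
  shows "((\<lambda>w. u (cscale t (z(i := w)))) has_field_derivative t * cpd i u (cscale t z)) (at (z i))"
proof -
  have "((\<lambda>w. u ((cscale t z)(i := w))) has_field_derivative cpd i u (cscale t z)) (at (t * z i))"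
    using cpd_has_derivative[OF fam, of "()" i "cscale t z"] thin_contract[OF z t] i by (simp add: cscale_apply)
  then have "((\<lambda>w. u ((cscale t z)(i := t * w))) has_field_derivative cpd i u (cscale t z) * (t * 1)) (at (z i))"
    by (rule DERIV_chain2) (intro DERIV_cmult DERIV_ident)
  then show ?thesis using i by (simp add: cscale_upd mult.commute)
qed

text \<open>Differentiating the identity \<open>f (t z) = (1 - t) f 0 + t f z\<close> in \<open>z\<close> and dividing by \<open>t\<close>.\<close>

lemma cpd_scale_invariant:
  assumes z: "z \<in> thin_reinhardt" and t: "cmod t \<le> 1" "t \<noteq> 0" and i: "i < 2"
  shows "cpd i f (cscale t z) = cpd i f z"
proof -
  have L: "((\<lambda>w. f (cscale t (z(i := w)))) has_field_derivative t * cpd i f (cscale t z)) (at (z i))"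
    by (rule scaled_line_derivative[OF fam_f z t(1) i])
  have Rr: "((\<lambda>w. (1 - t) * f (cscale 0 z) + t * f (z(i := w))) has_field_derivative 0 + t * cpd i f z) (at (z i))"
    by (intro DERIV_add DERIV_const DERIV_cmult cpd_has_derivative[OF fam_f]) (use z i in auto)
  have "\<forall>\<^sub>F w in nhds (z i). f (cscale t (z(i := w))) = (1 - t) * f (cscale 0 z) + t * f (z(i := w))"
    using cn_open_line[OF cn_open_thin z i]
    by eventually_elim (use affine_on_lines t cscale0_eq in metis)
  then have "deriv (\<lambda>w. f (cscale t (z(i := w)))) (z i) = deriv (\<lambda>w. (1 - t) * f (cscale 0 z) + t * f (z(i := w))) (z i)"
    by (rule deriv_cong_ev) simp
  then have "t * cpd i f (cscale t z) = 0 + t * cpd i f z"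
    unfolding DERIV_imp_deriv[OF L] DERIV_imp_deriv[OF Rr] .
  then show ?thesis using t(2) by simp
qed

text \<open>By \<open>cpd_scale_invariant\<close> the second derivatives satisfy \<open>u z = t u (t z)\<close>; they are bounded near the
  origin, so \<open>t \<rightarrow> 0\<close> gives \<open>u z = 0\<close>.\<close>

lemma second_cpd_zero:
  assumes z: "z \<in> thin_reinhardt" and i: "i < 2" and k: "k < 2"
  shows "cpd k (cpd i f) z = 0"
proof -
  have fam1: "hol_family 2 thin_reinhardt {()} (\<lambda>_. cpd i f)" by (rule hol_family_cpd[OF fam_f i])
  have fam2: "hol_family 2 thin_reinhardt {()} (\<lambda>_. cpd k (cpd i f))" by (rule hol_family_cpd[OF fam1 k])
  have inv: "cpd k (cpd i f) z = t * cpd k (cpd i f) (cscale t z)" if t: "cmod t \<le> 1" "t \<noteq> 0" for t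
  proof -
    have L: "((\<lambda>w. cpd i f (cscale t (z(k := w)))) has_field_derivative t * cpd k (cpd i f) (cscale t z)) (at (z k))"
      by (rule scaled_line_derivative[OF fam1 z t(1) k])
    have "\<forall>\<^sub>F w in nhds (z k). cpd i f (z(k := w)) = cpd i f (cscale t (z(k := w)))"
      using cn_open_line[OF cn_open_thin z k]
      by eventually_elim (use cpd_scale_invariant[OF _ t i] in simp)
    then have "deriv (\<lambda>w. cpd i f (z(k := w))) (z k) = deriv (\<lambda>w. cpd i f (cscale t (z(k := w)))) (z k)"
      by (rule deriv_cong_ev) simp
    then show ?thesis unfolding cpd_def[of k "cpd i f" z] DERIV_imp_deriv[OF L] .
  qed
  obtain r M where r: "r > 0" "M \<ge> 0" "cscale 0 z \<in> polydisc 2 (cscale 0 z) r"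
    and bd: "\<And>y F. y \<in> polydisc 2 (cscale 0 z) r \<Longrightarrow> finite F \<Longrightarrow> F \<subseteq> {()} \<Longrightarrow> (\<Sum>j\<in>F. (cmod (cpd k (cpd i f) y))\<^sup>2) \<le> M\<^sup>2"
    using hol_familyE[OF fam2 zero_thin] by metis
  have bM: "cmod (cpd k (cpd i f) y) \<le> M" if "y \<in> polydisc 2 (cscale 0 z) r" for y
    using bd[OF that, of "{()}"] r(2) by (simp add: abs_le_square_iff[symmetric])
  have ev: "\<forall>\<^sub>F t in at_right (0::real). cmod (cpd k (cpd i f) z) \<le> t * M"
  proof -
    define d where "d = min 1 (r / (cmod (z 0) + cmod (z 1) + 1))"
    have pos: "cmod (z 0) + cmod (z 1) + 1 > 0" by (simp add: add_nonneg_pos)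
    have d: "d > 0" using r(1) pos by (simp add: d_def)
    have "\<forall>\<^sub>F t in at_right (0::real). t \<in> {0<..<d}" by (rule eventually_at_right_real[OF d])
    then show ?thesis
    proof eventually_elim
      case (elim t)
      have tr: "t * (cmod (z 0) + cmod (z 1) + 1) < r"
      proof -
        have "t < r / (cmod (z 0) + cmod (z 1) + 1)" using elim by (simp add: d_def)
        then show ?thesis using pos by (simp add: pos_less_divide_eq)
      qed
      have "t * cmod (z j) < r" if "j < 2" for j
      proof -
        have "cmod (z j) \<le> cmod (z 0) + cmod (z 1) + 1" using that by (cases "j = 0") (auto simp: less_2_cases_iff)
        then have "t * cmod (z j) \<le> t * (cmod (z 0) + cmod (z 1) + 1)" using elim by (intro mult_left_mono) auto
        with tr show ?thesis by linarith
      qed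
      then have "cscale (of_real t) z \<in> polydisc 2 (cscale 0 z) r"
        using elim by (auto simp: polydisc_def PiE_iff cscale_ext) (auto simp: cscale_def dist_norm norm_mult)
      then have "cmod (cpd k (cpd i f) (cscale (of_real t) z)) \<le> M" by (rule bM)
      moreover have "cpd k (cpd i f) z = of_real t * cpd k (cpd i f) (cscale (of_real t) z)"
        by (rule inv) (use elim in \<open>auto simp: d_def\<close>)
      ultimately show ?case using elim by (simp add: norm_mult mult_left_mono)
    qed
  qed
  have "((\<lambda>t. t * M) \<longlongrightarrow> 0 * M) (at_right (0::real))" by (intro tendsto_intros)
  then have "cmod (cpd k (cpd i f) z) \<le> 0 * M"
    by (rule tendsto_lowerbound[OF _ ev]) simp
  then show ?thesis by simp
qed

end

section \<open>The Fubini-Study metric as a Bergman metric\<close>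

theorem thin_reinhardt_fubini_study:
  "bergman_metric_well_defined 2 thin_reinhardt" "bergman_constant_hsc 2 thin_reinhardt 2"
proof -
  interpret onb: bergman_onb 2 thin_reinhardt thin.B0 by (rule thin.B0)
  interpret km: kernel_metric 2 thin_reinhardt thin.B0 "\<lambda>f. f"
    by (rule thin.kernel_metric_B0[OF one_in_A2 coord_in_A2])
  show "bergman_metric_well_defined 2 thin_reinhardt" by (rule km.well_defined)
  show "bergman_constant_hsc 2 thin_reinhardt 2"
  proof (rule km.constant_hsc_2_of_affine)
    fix f i k z assume f: "f \<in> thin.B0" and ik: "i < (2::nat)" "k < (2::nat)" and z: "z \<in> thin_reinhardt"
    interpret thin_function f by unfold_locales (rule onb.BA[OF f])
    show "cpd k (cpd i f) z = 0" by (rule second_cpd_zero[OF z ik])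
  qed
qed

theorem corollary1p2:
  "(\<forall>(n::nat) (\<Omega>::(nat \<Rightarrow> complex) set).
      n \<ge> 1 \<and> Cn_domain n \<Omega> \<and> Cn_bounded n \<Omega> \<longrightarrow>
      \<not> (\<exists>c>0. bergman_constant_hsc n \<Omega> c))
   \<and>
   (\<exists>(m::nat) (D::(nat \<Rightarrow> complex) set).
      m \<ge> 1 \<and> reinhardt_domain m D \<and> \<not> Cn_bounded m D \<and>
      bergman_metric_well_defined m D \<and>
      (\<exists>c>0. bergman_constant_hsc m D c))"
proof (intro conjI)
  show "\<forall>(n::nat) (\<Omega>::(nat \<Rightarrow> complex) set).
      n \<ge> 1 \<and> Cn_domain n \<Omega> \<and> Cn_bounded n \<Omega> \<longrightarrow>
      \<not> (\<exists>c>0. bergman_constant_hsc n \<Omega> c)"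
    using bounded_domain_not_positive_constant_hsc by blast
  have "\<exists>c>0. bergman_constant_hsc 2 thin_reinhardt c"
    using thin_reinhardt_fubini_study(2) by (intro exI[of _ 2]) simp
  then show "\<exists>(m::nat) (D::(nat \<Rightarrow> complex) set).
      m \<ge> 1 \<and> reinhardt_domain m D \<and> \<not> Cn_bounded m D \<and>
      bergman_metric_well_defined m D \<and>
      (\<exists>c>0. bergman_constant_hsc m D c)"
    using thin_reinhardt_domain thin_unbounded thin_reinhardt_fubini_study(1)
    by (intro exI[of _ 2] exI[of _ thin_reinhardt]) simp
qed

end
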